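(* Let $A$ be a $C^*$-algebra. Then each of the spaces $\overline{S}_{\mathbb C}(A)$, $\overline{\mathcal U}_{b\mathbb C}(A)$, and $\mathcal U_{0\mathbb C}(A)$ is a $C^*$-algebra (i.e. a $C^*$-subalgebra of $A^{**}$). Moreover, $\mathcal U_{\mathbb C}(A)$ is a $\mathcal U_{0\mathbb C}(A)$-$\mathcal U_{0\mathbb C}(A)$-bimodule, i.e. $xu\in\mathcal U_{\mathbb C}(A)$ and $ux\in\mathcal U_{\mathbb C}(A)$ whenever $x\in\mathcal U_{0\mathbb C}(A)$ and $u\in\mathcal U_{\mathbb C}(A)$, the products being taken in $A^{**}$.
   Context: $A^{**}$ is the enveloping von Neumann algebra (bidual) of the $C^*$-algebra $A$. For $R\subset A^{**}$, $R_{\mathrm{sa}}=\{x\in R: x^*=x\}$; $(R_{\mathrm{sa}})^m$ is the set of limits in $A^{**}$ ($\sigma$-weak, equivalently strong) of bounded increasing nets from $R_{\mathrm{sa}}$; the superscript ${}^-$ denotes norm closure. An element $h\in A^{**}_{\mathrm{sa}}$ is strongly lower semicontinuous if $h\in((A_{\mathrm{sa}})^m)^-$, and $k$ is strongly upper semicontinuous if $-k$ is strongly lower semicontinuous. $\overline{S}(A)$ is the norm closed real vector space generated by $((A_{\mathrm{sa}})^m)^-$. $\mathcal U(A)$ (the universally measurable elements) is the set of $x\in A^{**}_{\mathrm{sa}}$ such that for every $\epsilon>0$ and every state $\varphi$ of $A$ (extended normally to $A^{**}$) there are a strongly lower semicontinuous $h$ and a strongly upper semicontinuous $k$ with $k\le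 x\le h$ and $\varphi(h-k)<\epsilon$. $\mathcal U_b(A)$ is the set of $x\in\mathcal U(A)$ for which there is a constant $\gamma$, depending only on $x$, such that $h$ and $k$ above can always be chosen with $\|h\|,\|k\|\le\gamma$. $\overline{\mathcal U}_b(A)$ is the norm closure of $\mathcal U_b(A)$. $\mathcal U_0(A)$ is the monotone sequential closure of $\mathcal U_b(A)$: the smallest subset of $A^{**}_{\mathrm{sa}}$ containing $\mathcal U_b(A)$ and closed under limits of bounded monotone (increasing or decreasing) sequences. For $R\subset A^{**}_{\mathrm{sa}}$, $R_{\mathbb C}=R+iR$; thus $\overline{S}_{\mathbb C}(A)=\overline{S}(A)+i\overline{S}(A)$, $\overline{\mathcal U}_{b\mathbb C}(A)=\overline{\mathcal U}_b(A)+i\,\overline{\mathcal U}_b(A)$, $\mathcal U_{0\mathbb C}(A)=\mathcal U_0(A)+i\,\mathcal U_0(A)$, $\mathcal U_{\mathbb C}(A)=\mathcal U(A)+i\,\mathcal U(A)$. *)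

theory Defs
  imports "HOL-Analysis.Analysis"
begin

section \<open>Complex normed spaces and their Banach duals\<close>

class complex_normed_vector = real_normed_vector +
  fixes scaleC :: "complex \<Rightarrow> 'a \<Rightarrow> 'a" (infixr "*\<^sub>C" 75)
  assumes scaleC_of_real: "complex_of_real r *\<^sub>C x = r *\<^sub>R x"
    and scaleC_add_right: "c *\<^sub>C (x + y) = c *\<^sub>C x + c *\<^sub>C y"
    and scaleC_add_left: "(c + d) *\<^sub>C x = c *\<^sub>C x + d *\<^sub>C x"
    and scaleC_scaleC: "c *\<^sub>C d *\<^sub>C x = (c * d) *\<^sub>C x"
    and norm_scaleC: "norm (c *\<^sub>C x) = cmod c * norm x"

typedef (overloaded) 'a cdual =
  "{f :: 'a::complex_normed_vector \<Rightarrow> complex.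
      bounded_linear f \<and> (\<forall>c x. f (c *\<^sub>C x) = c * f x)}"
  morphisms cdual_apply Abs_cdual
  by (rule exI[of _ "\<lambda>_. 0"]) simp

notation cdual_apply (infixl "\<cdot>" 80)

setup_lifting type_definition_cdual

lemma cdual_eqI: "(\<And>x. f \<cdot> x = g \<cdot> x) \<Longrightarrow> f = g"
  by transfer auto

instantiation cdual :: (complex_normed_vector) complex_normed_vector
begin

lift_definition norm_cdual :: "'a cdual \<Rightarrow> real" is onorm .

lift_definition minus_cdual :: "'a cdual \<Rightarrow> 'a cdual \<Rightarrow> 'a cdual"
  is "\<lambda>f g x. f x - g x"
  by (auto intro: bounded_linear_sub simp: algebra_simps)

definition dist_cdual :: "'a cdual \<Rightarrow> 'a cdual \<Rightarrow> real"
  where "dist_cdual f g = norm (f - g)"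

definition [code del]:
  "(uniformity :: ('a cdual \<times> 'a cdual) filter) =
     (INF e\<in>{0 <..}. principal {(x, y). dist x y < e})"

definition open_cdual :: "'a cdual set \<Rightarrow> bool"
  where [code del]: "open_cdual S = (\<forall>x\<in>S. \<forall>\<^sub>F (x', y) in uniformity. x' = x \<longrightarrow> y \<in> S)"

lift_definition uminus_cdual :: "'a cdual \<Rightarrow> 'a cdual" is "\<lambda>f x. - f x"
  by (auto intro: bounded_linear_minus)

lift_definition zero_cdual :: "'a cdual" is "\<lambda>x. 0"
  by auto

lift_definition plus_cdual :: "'a cdual \<Rightarrow> 'a cdual \<Rightarrow> 'a cdual"
  is "\<lambda>f g x. f x + g x"
  by (auto intro: bounded_linear_add simp: algebra_simps)

lift_definition scaleR_cdual :: "real \<Rightarrow> 'a cdual \<Rightarrow> 'a cdual" is "\<lambda>r f x. r *\<^sub>R f x"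
  by (auto intro: bounded_linear_compose[OF bounded_linear_scaleR_right] simp: algebra_simps)

lift_definition scaleC_cdual :: "complex \<Rightarrow> 'a cdual \<Rightarrow> 'a cdual" is "\<lambda>c f x. c * f x"
  by (auto intro: bounded_linear_compose[OF bounded_linear_mult_right] simp: algebra_simps)

definition sgn_cdual :: "'a cdual \<Rightarrow> 'a cdual"
  where "sgn_cdual f = scaleR (inverse (norm f)) f"

instance
proof
  fix c d :: complex and r :: real and f g :: "'a cdual"
  show "complex_of_real r *\<^sub>C f = r *\<^sub>R f"
    by (transfer, simp add: scaleR_conv_of_real)
  show "c *\<^sub>C (f + g) = c *\<^sub>C f + c *\<^sub>C g" "(c + d) *\<^sub>C f = c *\<^sub>C f + d *\<^sub>C f"
    "c *\<^sub>C d *\<^sub>C f = (c * d) *\<^sub>C f"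
    by (transfer, force simp: algebra_simps)+
  have le: "norm (c *\<^sub>C f) \<le> cmod c * norm f" for c and f :: "'a cdual"
  proof (transfer, rule onorm_bound)
    fix c :: complex and f :: "'a \<Rightarrow> complex" and x :: 'a
    assume "bounded_linear f \<and> (\<forall>c x. f (c *\<^sub>C x) = c * f x)"
    then have f: "bounded_linear f" ..
    show "0 \<le> cmod c * onorm f"
      using onorm_pos_le[OF f] by simp
    show "cmod (c * f x) \<le> cmod c * onorm f * norm x"
      using onorm[OF f, of x] by (simp add: norm_mult mult.assoc mult_left_mono)
  qed
  show "norm (c *\<^sub>C f) = cmod c * norm f"
  proof (cases "c = 0")
    case True
    have "0 *\<^sub>C f = 0" "norm (0 :: 'a cdual) = 0"
      by (transfer, simp add: onorm_zero)+
    with True show ?thesis by simp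
  next
    case False
    have "inverse c *\<^sub>C c *\<^sub>C f = f"
      using False by (transfer, simp add: mult.assoc[symmetric])
    then have "norm f \<le> cmod (inverse c) * norm (c *\<^sub>C f)"
      using le[of "inverse c" "c *\<^sub>C f"] by simp
    then have "cmod c * norm f \<le> norm (c *\<^sub>C f)"
      using False by (simp add: norm_inverse norm_divide field_simps)
    with le[of c f] show ?thesis by simp
  qed
qed (unfold dist_cdual_def open_cdual_def sgn_cdual_def uniformity_cdual_def,
  (rule refl | (transfer, force simp: onorm_triangle onorm_scaleR onorm_eq_0 algebra_simps))+)

end

lemma bounded_linear_cdual_apply: "bounded_linear ((\<cdot>) f)"
  by transfer auto

lemma cdual_apply_scaleC: "f \<cdot> (c *\<^sub>C x) = c * (f \<cdot> x)"
  by transfer auto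

lemma norm_cdual_apply: "cmod (f \<cdot> x) \<le> norm f * norm x"
  by transfer (auto intro: onorm)

lemma norm_cdual_bound: "0 \<le> b \<Longrightarrow> (\<And>x. cmod (f \<cdot> x) \<le> b * norm x) \<Longrightarrow> norm f \<le> b"
  by transfer (auto intro: onorm_bound)

lemma cdual_apply_add: "f \<cdot> (x + y) = f \<cdot> x + f \<cdot> y"
  by (rule bounded_linear.linear[OF bounded_linear_cdual_apply, THEN linear_add])

lemma cdual_apply_scaleR: "f \<cdot> (r *\<^sub>R x) = r *\<^sub>R (f \<cdot> x)"
  by (rule bounded_linear.linear[OF bounded_linear_cdual_apply, THEN linear_scale])

lemma cdual_add_apply: "(f + g) \<cdot> x = f \<cdot> x + g \<cdot> x"
  by transfer simp

lemma cdual_diff_apply: "(f - g) \<cdot> x = f \<cdot> x - g \<cdot> x"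
  by transfer simp

lemma cdual_scaleR_apply: "(r *\<^sub>R f) \<cdot> x = r *\<^sub>R (f \<cdot> x)"
  by transfer simp

lemma cdual_scaleC_apply: "(c *\<^sub>C f) \<cdot> x = c * (f \<cdot> x)"
  by transfer simp

lemmas cdual_simps = cdual_apply_add cdual_apply_scaleR cdual_apply_scaleC
  cdual_add_apply cdual_scaleR_apply cdual_scaleC_apply

lemma cdualI:
  assumes "\<And>x y. f (x + y) = f x + f y" "\<And>r x. f (r *\<^sub>R x) = r *\<^sub>R f x"
    "\<And>c x. f (c *\<^sub>C x) = c * f x" "\<And>x. cmod (f x) \<le> K * norm x"
  shows "bounded_linear f \<and> (\<forall>c x. f (c *\<^sub>C x) = c * f x)"
  using assms by (auto intro!: bounded_linear_intro[where K=K] simp: mult.commute)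

instance cdual :: (complex_normed_vector) banach
proof
  fix X :: "nat \<Rightarrow> 'a cdual"
  assume "Cauchy X"
  let ?B = "\<lambda>f :: 'a cdual. Blinfun (cdual_apply f)"
  have B: "blinfun_apply (?B f) = cdual_apply f" for f :: "'a cdual"
    by (simp add: bounded_linear_Blinfun_apply bounded_linear_cdual_apply)
  have norm_B: "norm (?B f - ?B g) = norm (f - g)" for f g :: "'a cdual"
    by (simp add: norm_blinfun.rep_eq minus_blinfun.rep_eq B norm_cdual.rep_eq minus_cdual.rep_eq)
  have "Cauchy (\<lambda>n. ?B (X n))"
    using \<open>Cauchy X\<close> by (simp add: Cauchy_def dist_norm norm_B)
  then obtain L where L: "(\<lambda>n. ?B (X n)) \<longlonglongrightarrow> L"
    by (auto simp: Cauchy_convergent_iff convergent_def)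
  have Lx: "(\<lambda>n. X n \<cdot> x) \<longlonglongrightarrow> blinfun_apply L x" for x
    using blinfun.tendsto[OF L tendsto_const, of x] by (simp add: B)
  have "blinfun_apply L (c *\<^sub>C x) = c * blinfun_apply L x" for c x
    using LIMSEQ_unique[OF Lx[of "c *\<^sub>C x"]] tendsto_mult[OF tendsto_const Lx, of c x]
    by (simp add: cdual_apply_scaleC)
  then have "cdual_apply (Abs_cdual (blinfun_apply L)) = blinfun_apply L"
    by (intro Abs_cdual_inverse) (auto intro: blinfun.bounded_linear_right)
  then have BL: "?B (Abs_cdual (blinfun_apply L)) = L"
    by (simp add: blinfun_apply_inverse)
  have "X \<longlonglongrightarrow> Abs_cdual (blinfun_apply L)"
    using L norm_B[of _ "Abs_cdual (blinfun_apply L)"] unfolding BL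
    by (simp add: LIMSEQ_def dist_norm)
  then show "convergent X"
    by (auto simp: convergent_def)
qed


section \<open>C*-algebras\<close>

text \<open>No unit is assumed.\<close>

class cstar_algebra = complex_normed_vector + real_normed_algebra + complete_space +
  fixes adj :: "'a \<Rightarrow> 'a"
  assumes mult_scaleC_left: "(c *\<^sub>C x) * y = c *\<^sub>C (x * y)"
    and mult_scaleC_right: "x * (c *\<^sub>C y) = c *\<^sub>C (x * y)"
    and adj_add: "adj (x + y) = adj x + adj y"
    and adj_scaleC: "adj (c *\<^sub>C x) = cnj c *\<^sub>C adj x"
    and adj_mult: "adj (x * y) = adj y * adj x"
    and adj_adj: "adj (adj x) = x"
    and cstar_identity: "norm (adj x * x) = (norm x)\<^sup>2"

lemma norm_adj: "norm (adj x) = norm (x :: 'a::cstar_algebra)"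
proof -
  have *: "norm y \<le> norm (adj y)" for y :: 'a
  proof (cases "y = 0")
    case False
    have "norm y * norm y \<le> norm (adj y) * norm y"
      using norm_mult_ineq[of "adj y" y] by (simp add: cstar_identity power2_eq_square)
    with False show ?thesis by simp
  qed simp
  from *[of x] *[of "adj x"] show ?thesis by (simp add: adj_adj)
qed

lemma adj_scaleR: "adj (r *\<^sub>R x) = r *\<^sub>R adj (x :: 'a::cstar_algebra)"
  using adj_scaleC[of "complex_of_real r" x] by (simp add: scaleC_of_real)


section \<open>The bidual with the Arens product\<close>

text \<open>
  The enveloping von Neumann algebra of \<open>A\<close> is realised as the Banach space bidual with its
  Arens product (Sherman--Takeda). It carries the bidual norm; its \<open>\<sigma>\<close>-weak topology
  is the weak* topology, that is pointwise convergence on the dual of \<open>A\<close>; and the normal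
  extension of a functional \<open>\<phi>\<close> of \<open>A\<close> to the bidual is \<open>x \<mapsto> x \<cdot> \<phi>\<close>.
\<close>

type_synonym 'a bidual = "'a cdual cdual"

lift_definition embed :: "'a::complex_normed_vector \<Rightarrow> 'a bidual" is "\<lambda>a \<phi>. \<phi> \<cdot> a"
  by (rule cdualI[where K="norm a" for a])
    (auto simp: cdual_simps mult.commute intro: order_trans[OF norm_cdual_apply])

text \<open>\<open>(\<phi> a)(b) = \<phi>(a b)\<close>, then \<open>(F \<phi>)(a) = F(\<phi> a)\<close>, then \<open>(F G)(\<phi>) = F(G \<phi>)\<close>.\<close>

lift_definition arens1 :: "'a::cstar_algebra cdual \<Rightarrow> 'a \<Rightarrow> 'a cdual"
  is "\<lambda>\<phi> a b. \<phi> \<cdot> (a * b)"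
proof (rule cdualI)
  fix \<phi> :: "'a cdual" and a b :: 'a
  have "cmod (\<phi> \<cdot> (a * b)) \<le> norm \<phi> * norm (a * b)"
    by (rule norm_cdual_apply)
  also have "\<dots> \<le> norm \<phi> * (norm a * norm b)"
    by (intro mult_left_mono norm_mult_ineq norm_ge_zero)
  finally show "cmod (\<phi> \<cdot> (a * b)) \<le> (norm \<phi> * norm a) * norm b"
    by (simp add: mult.assoc)
qed (auto simp: cdual_simps distrib_left mult_scaleC_right)

lemma norm_arens1: "norm (arens1 \<phi> a) \<le> norm \<phi> * norm (a :: 'a::cstar_algebra)"
proof (rule norm_cdual_bound)
  fix b :: 'a
  have "cmod (\<phi> \<cdot> (a * b)) \<le> norm \<phi> * norm (a * b)"
    by (rule norm_cdual_apply)
  also have "\<dots> \<le> norm \<phi> * (norm a * norm b)"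
    by (intro mult_left_mono norm_mult_ineq norm_ge_zero)
  finally show "cmod (arens1 \<phi> a \<cdot> b) \<le> norm \<phi> * norm a * norm b"
    by (simp add: arens1.rep_eq mult.assoc)
qed simp

lemma arens1_linear:
  fixes a b :: "'a::cstar_algebra"
  shows "arens1 \<phi> (a + b) = arens1 \<phi> a + arens1 \<phi> b"
    "arens1 \<phi> (r *\<^sub>R a) = r *\<^sub>R arens1 \<phi> a"
    "arens1 \<phi> (c *\<^sub>C a) = c *\<^sub>C arens1 \<phi> a"
    "arens1 (\<phi> + \<psi>) a = arens1 \<phi> a + arens1 \<psi> a"
    "arens1 (r *\<^sub>R \<phi>) a = r *\<^sub>R arens1 \<phi> a"
    "arens1 (c *\<^sub>C \<phi>) a = c *\<^sub>C arens1 \<phi> a"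
  by (rule cdual_eqI; simp add: arens1.rep_eq cdual_simps distrib_right mult_scaleC_left)+

lift_definition arens2 :: "'a::cstar_algebra bidual \<Rightarrow> 'a cdual \<Rightarrow> 'a cdual"
  is "\<lambda>F \<phi> a. F \<cdot> arens1 \<phi> a"
proof (rule cdualI)
  fix F :: "'a bidual" and \<phi> :: "'a cdual" and a :: 'a
  have "cmod (F \<cdot> arens1 \<phi> a) \<le> norm F * norm (arens1 \<phi> a)"
    by (rule norm_cdual_apply)
  also have "\<dots> \<le> norm F * (norm \<phi> * norm a)"
    by (intro mult_left_mono norm_arens1 norm_ge_zero)
  finally show "cmod (F \<cdot> arens1 \<phi> a) \<le> (norm F * norm \<phi>) * norm a"
    by (simp add: mult.assoc)
qed (auto simp: cdual_simps arens1_linear)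

lemma norm_arens2: "norm (arens2 F \<phi>) \<le> norm F * norm (\<phi> :: 'a::cstar_algebra cdual)"
proof (rule norm_cdual_bound)
  fix a :: 'a
  have "cmod (F \<cdot> arens1 \<phi> a) \<le> norm F * norm (arens1 \<phi> a)"
    by (rule norm_cdual_apply)
  also have "\<dots> \<le> norm F * (norm \<phi> * norm a)"
    by (intro mult_left_mono norm_arens1 norm_ge_zero)
  finally show "cmod (arens2 F \<phi> \<cdot> a) \<le> norm F * norm \<phi> * norm a"
    by (simp add: arens2.rep_eq mult.assoc)
qed simp

lemma arens2_linear:
  fixes \<phi> \<psi> :: "'a::cstar_algebra cdual"
  shows "arens2 F (\<phi> + \<psi>) = arens2 F \<phi> + arens2 F \<psi>"
    "arens2 F (r *\<^sub>R \<phi>) = r *\<^sub>R arens2 F \<phi>"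
    "arens2 F (c *\<^sub>C \<phi>) = c *\<^sub>C arens2 F \<phi>"
    "arens2 (F + G) \<phi> = arens2 F \<phi> + arens2 G \<phi>"
    "arens2 (r *\<^sub>R F) \<phi> = r *\<^sub>R arens2 F \<phi>"
    "arens2 (c *\<^sub>C F) \<phi> = c *\<^sub>C arens2 F \<phi>"
  by (rule cdual_eqI; simp add: arens2.rep_eq cdual_simps arens1_linear)+

lift_definition bidual_mult :: "'a::cstar_algebra bidual \<Rightarrow> 'a bidual \<Rightarrow> 'a bidual"
    (infixl "\<odot>" 70)
  is "\<lambda>F G \<phi>. F \<cdot> arens2 G \<phi>"
proof (rule cdualI)
  fix F G :: "'a bidual" and \<phi> :: "'a cdual"
  have "cmod (F \<cdot> arens2 G \<phi>) \<le> norm F * norm (arens2 G \<phi>)"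
    by (rule norm_cdual_apply)
  also have "\<dots> \<le> norm F * (norm G * norm \<phi>)"
    by (intro mult_left_mono norm_arens2 norm_ge_zero)
  finally show "cmod (F \<cdot> arens2 G \<phi>) \<le> (norm F * norm G) * norm \<phi>"
    by (simp add: mult.assoc)
qed (auto simp: cdual_simps arens2_linear)

lift_definition cdual_adj :: "'a::cstar_algebra cdual \<Rightarrow> 'a cdual"
  is "\<lambda>\<phi> a. cnj (\<phi> \<cdot> adj a)"
  by (rule cdualI, goal_cases)
    (auto simp: cdual_simps adj_add adj_scaleR adj_scaleC
      intro: order_trans[OF norm_cdual_apply] simp: norm_adj)

lemma cdual_adj_linear:
  fixes \<phi> \<psi> :: "'a::cstar_algebra cdual"
  shows "cdual_adj (\<phi> + \<psi>) = cdual_adj \<phi> + cdual_adj \<psi>"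
    "cdual_adj (r *\<^sub>R \<phi>) = r *\<^sub>R cdual_adj \<phi>"
    "cdual_adj (c *\<^sub>C \<phi>) = cnj c *\<^sub>C cdual_adj \<phi>"
  by (rule cdual_eqI; simp add: cdual_adj.rep_eq cdual_simps)+

lemma norm_cdual_adj: "norm (cdual_adj \<phi>) \<le> norm (\<phi> :: 'a::cstar_algebra cdual)"
  by (rule norm_cdual_bound)
    (auto simp: cdual_adj.rep_eq norm_adj intro: order_trans[OF norm_cdual_apply])

lift_definition bidual_adj :: "'a::cstar_algebra bidual \<Rightarrow> 'a bidual"
  is "\<lambda>F \<phi>. cnj (F \<cdot> cdual_adj \<phi>)"
proof (rule cdualI)
  fix F :: "'a bidual" and \<phi> :: "'a cdual"
  have "cmod (cnj (F \<cdot> cdual_adj \<phi>)) \<le> norm F * norm (cdual_adj \<phi>)"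
    by (simp add: norm_cdual_apply)
  also have "\<dots> \<le> norm F * norm \<phi>"
    by (intro mult_left_mono norm_cdual_adj norm_ge_zero)
  finally show "cmod (cnj (F \<cdot> cdual_adj \<phi>)) \<le> norm F * norm \<phi>" .
qed (auto simp: cdual_simps cdual_adj_linear)

lemma embed_mult: "embed (a * b) = embed a \<odot> embed (b :: 'a::cstar_algebra)"
  by (rule cdual_eqI) (simp add: embed.rep_eq bidual_mult.rep_eq arens2.rep_eq arens1.rep_eq)

lemma embed_adj: "embed (adj a) = bidual_adj (embed (a :: 'a::cstar_algebra))"
  by (rule cdual_eqI) (simp add: embed.rep_eq bidual_adj.rep_eq cdual_adj.rep_eq)

lemma bidual_mult_assoc: "F \<odot> G \<odot> H = F \<odot> (G \<odot> (H :: 'a::cstar_algebra bidual))"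
proof -
  have 1: "arens1 (arens1 \<phi> a) b = arens1 \<phi> (a * b)" for \<phi> and a b :: 'a
    by (rule cdual_eqI) (simp add: arens1.rep_eq mult.assoc)
  have 2: "arens1 (arens2 H \<phi>) a = arens2 H (arens1 \<phi> a)" for \<phi> a
    by (rule cdual_eqI) (simp add: arens1.rep_eq arens2.rep_eq 1)
  have 3: "arens2 (G \<odot> H) \<phi> = arens2 G (arens2 H \<phi>)" for \<phi>
    by (rule cdual_eqI) (simp add: arens2.rep_eq bidual_mult.rep_eq 2)
  show ?thesis
    by (rule cdual_eqI) (simp add: bidual_mult.rep_eq 3)
qed

lemma bidual_mult_bilinear:
  fixes F G H :: "'a::cstar_algebra bidual"
  shows "(F + G) \<odot> H = F \<odot> H + G \<odot> H" "H \<odot> (F + G) = H \<odot> F + H \<odot> G"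
    "(c *\<^sub>C F) \<odot> G = c *\<^sub>C (F \<odot> G)" "F \<odot> (c *\<^sub>C G) = c *\<^sub>C (F \<odot> G)"
  by (rule cdual_eqI; simp add: bidual_mult.rep_eq cdual_simps arens2_linear)+

lemma norm_bidual_mult: "norm (F \<odot> G) \<le> norm F * norm (G :: 'a::cstar_algebra bidual)"
proof (rule norm_cdual_bound)
  fix \<phi> :: "'a cdual"
  have "cmod (F \<cdot> arens2 G \<phi>) \<le> norm F * norm (arens2 G \<phi>)"
    by (rule norm_cdual_apply)
  also have "\<dots> \<le> norm F * (norm G * norm \<phi>)"
    by (intro mult_left_mono norm_arens2 norm_ge_zero)
  finally show "cmod ((F \<odot> G) \<cdot> \<phi>) \<le> norm F * norm G * norm \<phi>"
    by (simp add: bidual_mult.rep_eq mult.assoc)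
qed simp

lemma bidual_adj_linear:
  fixes F G :: "'a::cstar_algebra bidual"
  shows "bidual_adj (F + G) = bidual_adj F + bidual_adj G"
    "bidual_adj (c *\<^sub>C F) = cnj c *\<^sub>C bidual_adj F"
  by (rule cdual_eqI; simp add: bidual_adj.rep_eq cdual_simps)+

lemma bidual_adj_adj: "bidual_adj (bidual_adj F) = (F :: 'a::cstar_algebra bidual)"
proof -
  have "cdual_adj (cdual_adj \<phi>) = \<phi>" for \<phi> :: "'a cdual"
    by (rule cdual_eqI) (simp add: cdual_adj.rep_eq adj_adj)
  then show ?thesis
    by (intro cdual_eqI) (simp add: bidual_adj.rep_eq)
qed

definition bidual_le :: "'a::cstar_algebra bidual \<Rightarrow> 'a bidual \<Rightarrow> bool" (infix "\<preceq>" 50)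
  where "x \<preceq> y \<longleftrightarrow> (\<exists>w. y - x = bidual_adj w \<odot> w)"

definition self_adjoint_part :: "'a::cstar_algebra bidual set \<Rightarrow> 'a bidual set"
  where "self_adjoint_part R = {x \<in> R. bidual_adj x = x}"

text \<open>
  The C*-axioms that hold throughout the bidual for elementary reasons
  (\<open>bidual_mult_assoc\<close>, \<open>bidual_mult_bilinear\<close>, \<open>norm_bidual_mult\<close>, \<open>bidual_adj_linear\<close>,
  \<open>bidual_adj_adj\<close>, completeness) are inherited by a norm closed *-subalgebra. The two remaining
  ones rest on Arens regularity and the Sherman--Takeda theorem, and are required explicitly.
\<close>

definition complex_subspace :: "'a::complex_normed_vector set \<Rightarrow> bool"
  where "complex_subspace S \<longleftrightarrow>
    0 \<in> S \<and> (\<forall>x\<in>S. \<forall>y\<in>S. x + y \<in> S) \<and> (\<forall>c. \<forall>x\<in>S. c *\<^sub>C x \<in> S)"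

definition cstar_subalgebra :: "'a::cstar_algebra bidual set \<Rightarrow> bool"
  where "cstar_subalgebra S \<longleftrightarrow>
    complex_subspace S \<and> closed S \<and>
    (\<forall>x\<in>S. \<forall>y\<in>S. x \<odot> y \<in> S) \<and> (\<forall>x\<in>S. bidual_adj x \<in> S) \<and>
    (\<forall>x\<in>S. \<forall>y\<in>S. bidual_adj (x \<odot> y) = bidual_adj y \<odot> bidual_adj x) \<and>
    (\<forall>x\<in>S. norm (bidual_adj x \<odot> x) = (norm x)\<^sup>2)"

definition bimodule_over :: "'a::cstar_algebra bidual set \<Rightarrow> 'a bidual set \<Rightarrow> bool"
  where "bimodule_over S M \<longleftrightarrow>
    complex_subspace M \<and> (\<forall>x\<in>S. \<forall>u\<in>M. x \<odot> u \<in> M \<and> u \<odot> x \<in> M)"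


section \<open>Semicontinuity and universal measurability\<close>

text \<open>
  The index set of the net \<open>f\<close> is a directed preordered set \<open>I\<close> of elements of the bidual. This
  covers all nets: an increasing net may be indexed by its own range without
  changing its limit.
\<close>

definition increasing_net_limits :: "'a::cstar_algebra bidual set \<Rightarrow> 'a bidual set"
  where "increasing_net_limits R = {x. \<exists>(I :: 'a bidual set) le (f :: 'a bidual \<Rightarrow> 'a bidual).
    I \<noteq> {} \<and>
    (\<forall>i\<in>I. le i i) \<and>
    (\<forall>i\<in>I. \<forall>j\<in>I. \<forall>k\<in>I. le i j \<longrightarrow> le j k \<longrightarrow> le i k) \<and>
    (\<forall>i\<in>I. \<forall>j\<in>I. \<exists>k\<in>I. le i k \<and> le j k) \<and>
    (\<forall>i\<in>I. f i \<in> R) \<and>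
    bounded (f ` I) \<and>
    (\<forall>i\<in>I. \<forall>j\<in>I. le i j \<longrightarrow> f i \<preceq> f j) \<and>
    (\<forall>\<phi>. \<forall>\<epsilon>>0. \<exists>i\<in>I. \<forall>j\<in>I. le i j \<longrightarrow> cmod (f j \<cdot> \<phi> - x \<cdot> \<phi>) < \<epsilon>)}"

definition A_sa_m_closure :: "'a::cstar_algebra bidual set"
  where "A_sa_m_closure = closure (increasing_net_limits (self_adjoint_part (range embed)))"

definition strongly_lsc :: "'a::cstar_algebra bidual \<Rightarrow> bool"
  where "strongly_lsc h \<longleftrightarrow> bidual_adj h = h \<and> h \<in> A_sa_m_closure"

definition strongly_usc :: "'a::cstar_algebra bidual \<Rightarrow> bool"
  where "strongly_usc k \<longleftrightarrow> strongly_lsc (- k)"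

definition S_bar :: "'a::cstar_algebra bidual set"
  where "S_bar = closure (span A_sa_m_closure)"

definition is_state :: "'a::cstar_algebra cdual \<Rightarrow> bool"
  where "is_state \<phi> \<longleftrightarrow> (\<forall>a. \<phi> \<cdot> (adj a * a) \<in> \<real>\<^sub>\<ge>\<^sub>0) \<and> norm \<phi> = 1"

text \<open>\<open>(h - k) \<cdot> \<phi>\<close> is real because \<open>h\<close> and \<open>k\<close> are self-adjoint and \<open>\<phi>\<close> is positive.\<close>

definition U_meas :: "'a::cstar_algebra bidual set"
  where "U_meas = {x. bidual_adj x = x \<and>
    (\<forall>\<epsilon>>0. \<forall>\<phi>. is_state \<phi> \<longrightarrow>
      (\<exists>h k. strongly_lsc h \<and> strongly_usc k \<and> k \<preceq> x \<and> x \<preceq> h \<and> Re ((h - k) \<cdot> \<phi>) < \<epsilon>))}"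

definition U_b :: "'a::cstar_algebra bidual set"
  where "U_b = {x \<in> U_meas. \<exists>\<gamma>. \<forall>\<epsilon>>0. \<forall>\<phi>. is_state \<phi> \<longrightarrow>
      (\<exists>h k. strongly_lsc h \<and> strongly_usc k \<and> k \<preceq> x \<and> x \<preceq> h \<and> Re ((h - k) \<cdot> \<phi>) < \<epsilon> \<and>
        norm h \<le> \<gamma> \<and> norm k \<le> \<gamma>)}"

definition U_b_bar :: "'a::cstar_algebra bidual set"
  where "U_b_bar = closure U_b"

definition monotone_seq_closed :: "'a::cstar_algebra bidual set \<Rightarrow> bool"
  where "monotone_seq_closed S \<longleftrightarrow>
    (\<forall>f x. (\<forall>n::nat. f n \<in> S) \<and> bounded (range f) \<and>
      ((\<forall>n. f n \<preceq> f (Suc n)) \<or> (\<forall>n. f (Suc n) \<preceq> f n)) \<and>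
      (\<forall>\<phi>. (\<lambda>n. f n \<cdot> \<phi>) \<longlonglongrightarrow> x \<cdot> \<phi>) \<longrightarrow> x \<in> S)"

definition U_0 :: "'a::cstar_algebra bidual set"
  where "U_0 = \<Inter>{S. U_b \<subseteq> S \<and> S \<subseteq> self_adjoint_part UNIV \<and> monotone_seq_closed S}"

definition complexify :: "'a::complex_normed_vector set \<Rightarrow> 'a set"
  where "complexify R = {x + \<i> *\<^sub>C y | x y. x \<in> R \<and> y \<in> R}"

end

theory Submission
  imports Defs
begin

text \<open>
  Positive functionals dominating a given functional (Hahn--Banach) yield Arens regularity of \<open>A\<close>
  and the C*-identity in the bidual; with a weak* cluster point of an approximate unit as identity,
  the bidual becomes a unital C*-algebra.

  For self-adjoint \<open>x, y\<close> put \<open>z = x + iy\<close> and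
  \<open>E\<^sub>t(x, y) = x + y - t z (1 + t(x + y))\<^sup>-\<^sup>1 z\<^sup>*\<close>. Completing a square shows that \<open>E\<^sub>t(x, y)\<close> is the
  minimum (\<open>t > 0\<close>) or maximum (\<open>t < 0\<close>) over \<open>v\<close> of a quadratic form that is increasing in \<open>x\<close> and
  \<open>y\<close>. Hence \<open>E\<^sub>t\<close> is jointly increasing and normal, it preserves semicontinuity and one-sided
  approximability, and \<open>(x + y - E\<^sub>t(x, y))/t\<close> tends to \<open>z z\<^sup>*\<close> as \<open>t \<rightarrow> 0\<close>. A closed real space of
  self-adjoint elements containing all such \<open>z z\<^sup>*\<close> complexifies to a C*-algebra by polarization.
  For the monotone sequential closure one works with \<open>E\<^sub>t\<close> for all small \<open>t\<close>, equivalently with all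
  \<open>z (x + y)\<^sup>n z\<^sup>*\<close>, a condition stable under monotone limits in each variable.

  The universally measurable elements are closed under monotone limits, and for them \<open>- z z\<^sup>*\<close> is still
  approximable from above. Differentiating \<open>z\<^sub>0 z\<^sub>0\<^sup>* - (z\<^sub>0 + s u)(z\<^sub>0 + s u)\<^sup>*\<close> at \<open>s = 0\<close>, where
  \<open>z\<^sub>0 z\<^sub>0\<^sup>*\<close> is universally measurable, gives the bimodule property.
\<close>

section \<open>Positivity in unital C*-algebras\<close>

\<comment> \<open>Closure under squares would yield only the Jordan product. The missing commutator
  sits in z z^* = x^2 + y^2 - i (x y - y x), which is why \<open>opE\<close> has two variables; at y
  = 0 it is the familiar operator monotone x (1 + t x)^-1.

  The sign of t decides what can be proved. \<open>opE t x y\<close> needs 1 + t (x + y) bounded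
  below by a positive constant. For t > 0 this survives when x and y are replaced by larger
  approximants of any size; for t < 0 a norm bound on the approximants is called for. Since -
  \<open>opE t x y\<close> is \<open>opE (- t) (- x) (- y)\<close>, two-sided approximation is at
  hand under the uniform bound of \<open>UbM\<close>, while in \<open>Um\<close> only - z z^* is
  reached, from above. This asymmetry shapes the bimodule statement.

  The other obstacle is that the algebra may lack a unit: 1 is then only a supremum of its elements,
  so scalar shifts of nets have to be replaced by elements of an approximate unit. No Hilbert space
  is built: GNS seminorms with approximate Riesz vectors do its work.\<close>
subclass (in cstar_algebra) banach ..

class ucstar = cstar_algebra + monoid_mult

definition sa :: "'a::cstar_algebra \<Rightarrow> bool"
  where "sa x \<longleftrightarrow> adj x = x"

text \<open>Says that the spectrum lies in [0, 2t] without mentioning spectra. In this form the cone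
  is visibly stable under sums and scaling; that it contains every \<open>adj w * w\<close> is the
  hard part.\<close>

definition pos :: "'a::ucstar \<Rightarrow> bool"
  where "pos x \<longleftrightarrow> sa x \<and> (\<exists>t\<ge>0. norm (t *\<^sub>R 1 - x) \<le> t)"

lemma adj_0 [simp]: "adj (0 :: 'a::cstar_algebra) = 0"
  by (metis adj_add add_cancel_right_right)

lemma adj_minus: "adj (- x) = - adj (x :: 'a::cstar_algebra)"
  by (metis adj_0 adj_add add.right_inverse minus_unique)

lemma adj_diff: "adj (x - y) = adj x - adj (y :: 'a::cstar_algebra)"
  by (metis adj_add adj_minus diff_conv_add_uminus)

lemma adj_1 [simp]: "adj (1 :: 'a::ucstar) = 1"
  by (metis adj_mult adj_adj mult_1_left mult_1_right)

lemma adj_power: "adj (x ^ n) = adj (x :: 'a::ucstar) ^ n"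
  by (induction n) (auto simp: adj_mult power_commutes)

lemmas adj_simps = adj_add adj_diff adj_minus adj_mult adj_adj adj_scaleR adj_scaleC

lemma bounded_linear_adj: "bounded_linear (adj :: 'a::cstar_algebra \<Rightarrow> 'a)"
  by (rule bounded_linear_intro[where K=1]) (auto simp: adj_simps norm_adj)

lemmas tendsto_adj = bounded_linear.tendsto[OF bounded_linear_adj]

lemma norm_square: "sa x \<Longrightarrow> norm (x * x) = (norm (x :: 'a::cstar_algebra))\<^sup>2"
  using cstar_identity[of x] by (simp add: sa_def)

lemma norm_one_le: "norm (1 :: 'a::ucstar) \<le> 1"
proof -
  have "norm (1::'a) = (norm (1::'a))\<^sup>2"
    using cstar_identity[of "1::'a"] by simp
  then have "norm (1::'a) * (1 - norm (1::'a)) = 0"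
    by (simp add: algebra_simps power2_eq_square)
  then show ?thesis by auto
qed

lemma norm_scaleR_one: "norm (t *\<^sub>R (1::'a::ucstar)) \<le> \<bar>t\<bar>"
  using mult_left_mono[OF norm_one_le, of "\<bar>t\<bar>"] by simp

lemma sa_simps [simp]:
  "sa (0::'a::cstar_algebra)" "sa (1::'b::ucstar)"
  by (simp_all add: sa_def)

lemma sa_intros [intro]:
  fixes x y :: "'a::cstar_algebra" and z :: "'b::ucstar"
  shows "sa x \<Longrightarrow> sa y \<Longrightarrow> sa (x + y)" "sa x \<Longrightarrow> sa y \<Longrightarrow> sa (x - y)" "sa x \<Longrightarrow> sa (- x)"
    "sa x \<Longrightarrow> sa (r *\<^sub>R x)" "sa z \<Longrightarrow> sa (z ^ n)" "sa (adj w * w)" "sa (w * adj w)"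
  by (auto simp: sa_def adj_simps adj_power)

lemma sa_mult: "sa x \<Longrightarrow> sa y \<Longrightarrow> x * y = y * x \<Longrightarrow> sa (x * (y :: 'a::cstar_algebra))"
  by (simp add: sa_def adj_simps)

lemma sa_conj: "sa x \<Longrightarrow> sa (adj y * x * (y :: 'a::cstar_algebra))"
  by (simp add: sa_def adj_simps mult.assoc)

lemma scaleC_simps:
  fixes x :: "'a::complex_normed_vector"
  shows "1 *\<^sub>C x = x" "0 *\<^sub>C x = 0" "(- c) *\<^sub>C x = - (c *\<^sub>C x)" "c *\<^sub>C (- x) = - (c *\<^sub>C x)"
    "c *\<^sub>C (x - y) = c *\<^sub>C x - c *\<^sub>C y" "(c - d) *\<^sub>C x = c *\<^sub>C x - d *\<^sub>C x" "c *\<^sub>C 0 = (0 :: 'a)"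
proof -
  show 1: "1 *\<^sub>C x = x" for x :: 'a using scaleC_of_real[of 1 x] by simp
  show 2: "0 *\<^sub>C x = 0" for x :: 'a using scaleC_of_real[of 0 x] by simp
  show 3: "(- c) *\<^sub>C x = - (c *\<^sub>C x)" for x :: 'a and c
    using scaleC_add_left[of "-c" c x] by (simp add: 2 eq_neg_iff_add_eq_0)
  show 0: "c *\<^sub>C 0 = (0 :: 'a)" for c using scaleC_add_right[of c 0 "0::'a"] by simp
  show 4: "c *\<^sub>C (- x) = - (c *\<^sub>C x)" for x :: 'a and c
    using scaleC_add_right[of c "-x" x] by (simp add: 0 eq_neg_iff_add_eq_0)
  show "c *\<^sub>C (x - y) = c *\<^sub>C x - c *\<^sub>C y"
    using scaleC_add_right[of c x "-y"] 4[of c y] by simp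
  show "(c - d) *\<^sub>C x = c *\<^sub>C x - d *\<^sub>C x"
    using scaleC_add_left[of c "-d" x] 3[of d x] by simp
qed

lemma scaleC_scaleR:
  fixes x :: "'a::complex_normed_vector"
  shows "c *\<^sub>C (r *\<^sub>R x) = r *\<^sub>R (c *\<^sub>C x)"
  by (metis scaleC_of_real scaleC_scaleC mult.commute)

lemma bounded_linear_scaleC: "bounded_linear ((*\<^sub>C) c :: 'a::complex_normed_vector \<Rightarrow> 'a)"
  by (rule bounded_linear_intro[where K="cmod c"])
    (simp_all add: scaleC_add_right scaleC_scaleR norm_scaleC mult.commute)

lemma ii_mult:
  fixes x y :: "'a::cstar_algebra"
  shows "(\<i> *\<^sub>C x) * y = \<i> *\<^sub>C (x * y)" "x * (\<i> *\<^sub>C y) = \<i> *\<^sub>C (x * y)"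
    "\<i> *\<^sub>C \<i> *\<^sub>C x = - x" "adj (\<i> *\<^sub>C x) = - (\<i> *\<^sub>C adj x)"
  by (simp_all add: mult_scaleC_left mult_scaleC_right scaleC_scaleC adj_scaleC scaleC_simps)

text \<open>The square root of \<open>1 - g\<close> is \<open>1 - y\<close>, where \<open>y\<close> is the fixed point of
  \<open>y \<mapsto> (g + y\<^sup>2)/2\<close>; the iteration is dominated by the scalar one for \<open>g = 1\<close>.\<close>

lemma sqrt_one_minus:
  fixes g :: "'a::ucstar"
  assumes g: "sa g" "norm g \<le> 1"
  obtains s where "sa s" "s * s = 1 - g" "norm (1 - s) \<le> 1"
    "\<And>y. y * g = g * y \<Longrightarrow> y * s = s * y"
proof -
  define Y where "Y = rec_nat (0::'a) (\<lambda>n y. (1/2) *\<^sub>R (g + y * y))"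
  define R where "R = rec_nat (0::real) (\<lambda>n y. (1/2) * (1 + y * y))"
  have Y: "Y 0 = 0" "Y (Suc n) = (1/2) *\<^sub>R (g + Y n * Y n)" for n by (auto simp: Y_def)
  have R: "R 0 = 0" "R (Suc n) = (1/2) * (1 + R n * R n)" for n by (auto simp: R_def)
  have R01: "0 \<le> R n \<and> R n \<le> 1" for n
  proof (induction n)
    case (Suc n)
    then have "R n * R n \<le> 1" by (simp add: mult_le_one)
    with Suc show ?case by (simp add: R)
  qed (simp add: R)
  have comm: "y * g = g * y \<Longrightarrow> y * Y n = Y n * y" for y n
  proof (induction n)
    case (Suc n)
    then have "y * (Y n * Y n) = (Y n * Y n) * y" by (metis mult.assoc)
    with Suc show ?case by (simp add: Y algebra_simps)
  qed (simp add: Y)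
  have YY: "Y m * Y n = Y n * Y m" for m n
    using comm[of g m] comm[of "Y m" n] by simp
  have YR: "norm (Y n) \<le> R n" for n
  proof (induction n)
    case (Suc n)
    have "norm (g + Y n * Y n) \<le> 1 + R n * R n"
      by (rule order_trans[OF norm_triangle_ineq add_mono[OF g(2) order_trans[OF norm_mult_ineq]]])
        (intro mult_mono Suc norm_ge_zero, use R01 in auto)
    then show ?case by (simp add: Y R)
  qed (simp add: Y R)
  have dYR: "norm (Y (Suc n) - Y n) \<le> R (Suc n) - R n" for n
  proof (induction n)
    case 0
    show ?case using g(2) by (simp add: Y R)
  next
    case (Suc n)
    have "Y (Suc (Suc n)) - Y (Suc n) = (1/2) *\<^sub>R ((Y (Suc n) - Y n) * (Y (Suc n) + Y n))"
      using YY[of n "Suc n"] by (simp only: Y(2)[of "Suc n"] Y(2)[of n])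
        (simp add: Y(2)[of n, symmetric] algebra_simps)
    also have "norm \<dots> \<le> (1/2) * ((R (Suc n) - R n) * (R (Suc n) + R n))"
      unfolding norm_scaleR
      by (simp, rule order_trans[OF norm_mult_ineq], intro mult_mono Suc)
        (use YR[of n] YR[of "Suc n"] norm_triangle_ineq[of "Y (Suc n)" "Y n"]
          order_trans[OF norm_ge_zero Suc] in auto)
    also have "\<dots> = R (Suc (Suc n)) - R (Suc n)"
      by (simp only: R(2)[of "Suc n"] R(2)[of n]) (simp add: R(2)[of n, symmetric] algebra_simps)
    finally show ?case .
  qed
  have Rinc: "R n \<le> R (Suc n)" for n
    using dYR[of n] norm_ge_zero[of "Y (Suc n) - Y n"] by linarith
  have dYR2: "norm (Y (n + k) - Y n) \<le> R (n + k) - R n" for n k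
  proof (induction k)
    case (Suc k)
    show ?case
      using Suc dYR[of "n + k"] norm_triangle_ineq[of "Y (n + Suc k) - Y (n + k)" "Y (n + k) - Y n"]
      by simp
  qed simp
  have "convergent R"
    by (rule Bseq_mono_convergent) (use R01 Rinc in \<open>auto simp: Bseq_def incseq_SucI incseqD
        intro!: exI[of _ 1]\<close>)
  then have "Cauchy R" by (rule convergent_Cauchy)
  have "Cauchy Y"
  proof (rule CauchyI)
    fix e :: real assume "0 < e"
    then obtain N where N: "\<forall>m\<ge>N. \<forall>n\<ge>N. norm (R m - R n) < e"
      using CauchyD[OF \<open>Cauchy R\<close>] by blast
    have *: "norm (Y m - Y n) < e" if "m \<ge> n" "n \<ge> N" for m n
      using dYR2[of n "m - n"] N[rule_format, of m n] that by auto
    show "\<exists>M. \<forall>m\<ge>M. \<forall>n\<ge>M. norm (Y m - Y n) < e"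
      by (rule exI[of _ N]) (metis * linear norm_minus_commute)
  qed
  then obtain y where y: "Y \<longlonglongrightarrow> y" by (auto simp: Cauchy_convergent_iff convergent_def)
  have "(\<lambda>n. Y (Suc n)) \<longlonglongrightarrow> (1/2) *\<^sub>R (g + y * y)"
    unfolding Y(2) by (intro tendsto_intros y)
  with LIMSEQ_Suc[OF y] have yeq: "y = (1/2) *\<^sub>R (g + y * y)" by (rule LIMSEQ_unique)
  have ny: "norm y \<le> 1"
    by (rule LIMSEQ_le_const2[OF tendsto_norm[OF y]]) (meson YR R01 order_trans)
  have "sa (Y n)" for n
  proof (induction n)
    case (Suc n)
    then show ?case unfolding Y by (intro sa_intros g sa_mult) auto
  qed (simp add: Y)
  then have "sa y"
    using LIMSEQ_unique[OF tendsto_adj[OF y]] y by (simp add: sa_def)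
  have 2: "z * (1 - y) = (1 - y) * z" if "z * g = g * z" for z
  proof -
    have "z * y = y * z"
    using that LIMSEQ_unique[OF tendsto_mult[OF tendsto_const y, of z]] tendsto_mult[OF y tendsto_const, of z]
      comm[of z] by simp
    then show ?thesis by (simp add: left_diff_distrib right_diff_distrib)
  qed
  have 3: "(1 - y) * (1 - y) = 1 - g"
  proof -
    have "2 *\<^sub>R y = g + y * y" by (subst yeq) simp
    then show ?thesis by (simp add: algebra_simps scaleR_2)
  qed
  show thesis
    by (rule that[OF _ 3 _ 2]) (use \<open>sa y\<close> ny in auto)
qed

text \<open>With s a root of 1 - u^2 commuting with u, the element u + i s is unitary. Its imaginary
  part s has norm at most 1, hence so has s^2.\<close>

lemma norm_one_minus_square:
  fixes u :: "'a::ucstar"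
  assumes u: "sa u" "norm u \<le> 1"
  shows "norm (1 - u * u) \<le> 1"
proof -
  have "sa (u * u)" "norm (u * u) \<le> 1"
    using u by (auto simp: sa_mult norm_square power_le_one)
  then obtain s where s: "sa s" "s * s = 1 - u * u" "\<And>y. y * (u * u) = (u * u) * y \<Longrightarrow> y * s = s * y"
    using sqrt_one_minus by metis
  have us: "u * s = s * u" using s(3)[of u] by (simp add: mult.assoc)
  let ?v = "u + \<i> *\<^sub>C s"
  have "adj ?v * ?v = 1"
    using u(1) s(1,2) us by (simp add: sa_def adj_simps ii_mult algebra_simps scaleC_simps)
  then have "norm ?v \<le> 1"
    using cstar_identity[of ?v] norm_one_le by (metis power2_nonneg_ge_1_iff[of "norm ?v"] abs_norm_cancel
      abs_le_square_iff power_one abs_one)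
  have "2 *\<^sub>R (\<i> *\<^sub>C s) = ?v - adj ?v"
    using u(1) s(1) by (simp add: sa_def adj_simps ii_mult scaleR_2 scaleC_simps)
  then have "2 * norm (\<i> *\<^sub>C s) \<le> norm ?v + norm (adj ?v)"
    by (metis norm_scaleR abs_numeral norm_triangle_ineq4)
  then have "norm s \<le> 1" using \<open>norm ?v \<le> 1\<close> by (simp add: norm_adj norm_scaleC)
  then show ?thesis
    using norm_square[OF s(1)] by (simp add: s(2) power_le_one)
qed

lemma norm_minus_square:
  fixes u :: "'a::ucstar"
  assumes u: "sa u" "(norm u)\<^sup>2 \<le> t"
  shows "norm (t *\<^sub>R 1 - u * u) \<le> t"
proof (cases "t = 0")
  case False
  then have t: "t > 0" using u(2) zero_le_power2[of "norm u"] by linarith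
  define v where "v = (1 / sqrt t) *\<^sub>R u"
  have "sa v" using u unfolding v_def by auto
  moreover have "norm v \<le> 1" using t u(2) by (simp add: v_def real_le_rsqrt)
  ultimately have "norm (1 - v * v) \<le> 1" by (rule norm_one_minus_square)
  moreover have "t *\<^sub>R 1 - u * u = t *\<^sub>R (1 - v * v)"
    using t by (simp add: v_def algebra_simps)
  ultimately show ?thesis using t by simp
qed (use u in auto)

lemma pos_sa: "pos x \<Longrightarrow> sa x" by (simp add: pos_def)

lemma pos_square: "sa u \<Longrightarrow> pos (u * (u :: 'a::ucstar))"
  unfolding pos_def using norm_minus_square[of u "(norm u)\<^sup>2"]
  by (auto simp: sa_mult intro!: exI[of _ "(norm u)\<^sup>2"])

text \<open>The commutation clause stands in for functional calculus: roots of commuting positive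
  elements commute with each other.\<close>

lemma pos_sqrt_ex:
  fixes x :: "'a::ucstar"
  assumes "pos x"
  shows "\<exists>w. sa w \<and> w * w = x \<and> pos w \<and> (\<forall>y. y * x = x * y \<longrightarrow> y * w = w * y)"
proof -
  obtain t where t: "t \<ge> 0" "norm (t *\<^sub>R 1 - x) \<le> t" and x: "sa x"
    using assms by (auto simp: pos_def)
  show ?thesis
  proof (cases "t = 0")
    case True
    then have "x = 0" using t by simp
    moreover have "pos (0::'a)" unfolding pos_def by (auto intro!: exI[of _ 0])
    ultimately show ?thesis by (intro exI[of _ 0]) auto
  next
    case False
    with t have t: "t > 0" "norm (t *\<^sub>R 1 - x) \<le> t" by auto
    define g where "g = (1/t) *\<^sub>R (t *\<^sub>R 1 - x)"
    have "sa g" unfolding g_def by (intro sa_intros x sa_simps)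
    have "norm g \<le> 1" using t by (auto simp: g_def)
    obtain s where s: "sa s" "s * s = 1 - g" "norm (1 - s) \<le> 1"
      "\<And>y. y * g = g * y \<Longrightarrow> y * s = s * y"
      using sqrt_one_minus[OF \<open>sa g\<close> \<open>norm g \<le> 1\<close>] by blast
    define w where "w = sqrt t *\<^sub>R s"
    have 1: "w * w = x" using t by (simp add: w_def s(2) g_def algebra_simps)
    have 2: "sa w" unfolding w_def by (intro sa_intros s)
    have "sqrt t *\<^sub>R 1 - w = sqrt t *\<^sub>R (1 - s)" by (simp add: w_def algebra_simps)
    then have "norm (sqrt t *\<^sub>R 1 - w) \<le> sqrt t"
      using s(3) t by simp
    with 2 t have 3: "pos w" unfolding pos_def by (auto intro!: exI[of _ "sqrt t"])
    have 4: "y * w = w * y" if y: "y * x = x * y" for y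
    proof -
      have "y * g = g * y" using y by (simp add: g_def left_diff_distrib right_diff_distrib)
      from s(4)[OF this] show ?thesis by (simp add: w_def)
    qed
    from 1 2 3 4 show ?thesis by blast
  qed
qed

text \<open>Every t above the norm can serve as the witness in \<open>pos\<close>. A common t for a
  bounded sequence is what makes the cone closed in \<open>pos_lim\<close>.\<close>

lemma pos_norm_le:
  fixes x :: "'a::ucstar"
  assumes "pos x" "norm x \<le> t"
  shows "norm (t *\<^sub>R 1 - x) \<le> t"
proof -
  obtain w where "sa w" "w * w = x" using pos_sqrt_ex[OF assms(1)] by blast
  with norm_minus_square[of w t] norm_square[of w] assms(2) show ?thesis by simp
qed

lemma pos_0 [simp]: "pos 0" using pos_square[of 0] by simp

lemma pos_1 [simp]: "pos (1::'a::ucstar)" using pos_square[of "1::'a"] by simp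

lemma pos_add:
  fixes x y :: "'a::ucstar"
  assumes "pos x" "pos y" shows "pos (x + y)"
proof -
  obtain s t where *: "s \<ge> 0" "norm (s *\<^sub>R 1 - x) \<le> s" "t \<ge> 0" "norm (t *\<^sub>R 1 - y) \<le> t"
    using assms by (auto simp: pos_def)
  have "norm ((s + t) *\<^sub>R 1 - (x + y)) \<le> s + t"
    using norm_triangle_ineq[of "s *\<^sub>R 1 - x" "t *\<^sub>R 1 - y"] * by (simp add: algebra_simps)
  with * assms show ?thesis unfolding pos_def by (auto intro!: exI[of _ "s+t"])
qed

lemma pos_scaleR:
  fixes x :: "'a::ucstar"
  assumes "pos x" "r \<ge> 0" shows "pos (r *\<^sub>R x)"
proof -
  obtain s where *: "s \<ge> 0" "norm (s *\<^sub>R 1 - x) \<le> s"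
    using assms by (auto simp: pos_def)
  have "(r * s) *\<^sub>R 1 - r *\<^sub>R x = r *\<^sub>R (s *\<^sub>R 1 - x)" by (simp add: algebra_simps)
  then have "norm ((r * s) *\<^sub>R 1 - r *\<^sub>R x) \<le> r * s"
    using * assms by (simp add: mult_left_mono)
  with * assms show ?thesis unfolding pos_def by (auto intro!: exI[of _ "r * s"])
qed

lemma pos_scaleR_one: "r \<ge> 0 \<Longrightarrow> pos (r *\<^sub>R (1::'a::ucstar))"
  by (simp add: pos_scaleR)

lemma pos_sum: "(\<And>i. i \<in> I \<Longrightarrow> pos (f i)) \<Longrightarrow> pos (sum f I)"
  by (induction I rule: infinite_finite_induct) (auto intro: pos_add)

lemma pos_lim:
  fixes f :: "nat \<Rightarrow> 'a::ucstar"
  assumes f: "\<And>n. pos (f n)" "f \<longlonglongrightarrow> x"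
  shows "pos x"
proof -
  have "bounded (range f)" using convergent_imp_bounded f(2) by blast
  then obtain t where t: "\<And>n. norm (f n) \<le> t" by (auto simp: bounded_iff)
  then have "t \<ge> 0" using norm_ge_zero order_trans by blast
  have "norm (t *\<^sub>R 1 - f n) \<le> t" for n by (intro pos_norm_le f t)
  moreover have "(\<lambda>n. norm (t *\<^sub>R 1 - f n)) \<longlonglongrightarrow> norm (t *\<^sub>R 1 - x)" by (intro tendsto_intros f)
  ultimately have "norm (t *\<^sub>R 1 - x) \<le> t" using LIMSEQ_le_const2 by blast
  moreover have "sa x"
    using LIMSEQ_unique[OF tendsto_adj[OF f(2)], of x] f(2) pos_sa[OF f(1)] by (simp add: sa_def)
  ultimately show ?thesis using \<open>t \<ge> 0\<close> unfolding pos_def by blast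
qed

lemma pos_eps:
  fixes x :: "'a::ucstar"
  assumes "\<And>e. e > 0 \<Longrightarrow> pos (x + e *\<^sub>R 1)"
  shows "pos x"
proof (rule pos_lim)
  show "pos (x + (1 / real (Suc n)) *\<^sub>R 1)" for n by (rule assms) simp
  have "(\<lambda>n. x + (1 / real (Suc n)) *\<^sub>R 1) \<longlonglongrightarrow> x + 0 *\<^sub>R 1"
    by (intro tendsto_intros) (use LIMSEQ_inverse_real_of_nat in \<open>simp add: inverse_eq_divide\<close>)
  then show "(\<lambda>n. x + (1 / real (Suc n)) *\<^sub>R 1) \<longlonglongrightarrow> x" by simp
qed

lemma pos_mult:
  fixes x y :: "'a::ucstar"
  assumes "pos x" "pos y" "x * y = y * x"
  shows "pos (x * y)"
proof -
  obtain w where w: "sa w" "w * w = x" "pos w" "\<And>y. y * x = x * y \<Longrightarrow> y * w = w * y"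
    using pos_sqrt_ex[OF assms(1)] by blast
  obtain v where v: "sa v" "v * v = y" "pos v" "\<And>z. z * y = y * z \<Longrightarrow> z * v = v * z"
    using pos_sqrt_ex[OF assms(2)] by blast
  have "w * v = v * w" using assms(3) w(4)[of y] v(4)[of w] by simp
  then have "x * y = (w * v) * (w * v)" unfolding w(2)[symmetric] v(2)[symmetric] by (metis mult.assoc)
  with \<open>w * v = v * w\<close> show ?thesis using pos_square[OF sa_mult[OF w(1) v(1)]] by simp
qed

lemma pos_power: "pos x \<Longrightarrow> pos (x ^ n)"
  by (induction n) (auto intro!: pos_mult simp: power_commutes)

lemma pos_norm_minus:
  fixes x :: "'a::ucstar"
  assumes "sa x" "norm x \<le> t" shows "pos (t *\<^sub>R 1 - x)" "pos (t *\<^sub>R 1 + x)"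
proof -
  have t: "t \<ge> 0" using norm_ge_zero[of x] assms(2) by linarith
  have "norm (t *\<^sub>R 1 - (t *\<^sub>R 1 - x)) \<le> t" "norm (t *\<^sub>R 1 - (t *\<^sub>R 1 + x)) \<le> t"
    using assms by auto
  with t show "pos (t *\<^sub>R 1 - x)" "pos (t *\<^sub>R 1 + x)"
    unfolding pos_def using assms(1) by (blast intro: sa_intros sa_simps)+
qed

text \<open>With c^2 = (1 - u) (1 + u) = 1 - u^2 and c commuting with u, the element u + i c is
  unitary and u is its real part.\<close>

lemma norm_le_of_pos1:
  fixes u :: "'a::ucstar"
  assumes "pos (1 - u)" "pos (1 + u)" shows "norm u \<le> 1"
proof -
  have "sa u" using pos_sa[OF assms(2)] by (simp add: sa_def adj_simps)
  have "pos ((1 - u) * (1 + u))" by (intro pos_mult assms) (simp add: algebra_simps)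
  from pos_sqrt_ex[OF this] obtain c where c: "sa c" "c * c = (1 - u) * (1 + u)"
    "\<And>y. y * ((1 - u) * (1 + u)) = ((1 - u) * (1 + u)) * y \<Longrightarrow> y * c = c * y"
    by blast
  have uc: "u * c = c * u" by (rule c(3)) (simp add: algebra_simps)
  let ?v = "u + \<i> *\<^sub>C c"
  have "adj ?v * ?v = 1"
    using \<open>sa u\<close> c(1,2) uc by (simp add: sa_def adj_simps ii_mult algebra_simps scaleC_simps)
  then have "norm ?v \<le> 1"
    using cstar_identity[of ?v] norm_one_le by (metis abs_norm_cancel
      abs_le_square_iff power_one abs_one)
  have "2 *\<^sub>R u = ?v + adj ?v"
    using \<open>sa u\<close> c(1) by (simp add: sa_def adj_simps ii_mult scaleR_2 scaleC_simps)
  then have "2 * norm u \<le> norm ?v + norm (adj ?v)"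
    by (metis norm_scaleR abs_numeral norm_triangle_ineq)
  with \<open>norm ?v \<le> 1\<close> show ?thesis by (simp add: norm_adj)
qed

text \<open>Rescaling by t + e instead of t reduces to the case t = 1 and also covers t = 0.\<close>

lemma norm_le_of_pos:
  fixes u :: "'a::ucstar"
  assumes "pos (t *\<^sub>R 1 - u)" "pos (t *\<^sub>R 1 + u)" "t \<ge> 0" shows "norm u \<le> t"
proof (rule field_le_epsilon)
  fix e :: real assume e: "e > 0"
  let ?r = "t + e" and ?u = "(1 / (t + e)) *\<^sub>R u"
  have "pos ((1 / ?r) *\<^sub>R (t *\<^sub>R 1 - u + e *\<^sub>R 1))" "pos ((1 / ?r) *\<^sub>R (t *\<^sub>R 1 + u + e *\<^sub>R 1))"
    using assms e by (auto intro!: pos_scaleR pos_add pos_scaleR_one)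
  moreover have "(1 / ?r) *\<^sub>R (t *\<^sub>R 1 - u + e *\<^sub>R 1) = 1 - ?u" "(1 / ?r) *\<^sub>R (t *\<^sub>R 1 + u + e *\<^sub>R 1) = 1 + ?u"
    using e assms(3) by (simp_all add: algebra_simps flip: scaleR_add_left add_divide_distrib)
  ultimately have "norm ?u \<le> 1" using norm_le_of_pos1[of ?u] by simp
  then show "norm u \<le> t + e" using e assms(3) by (simp add: divide_simps)
qed

section \<open>Positivity of \<open>adj x * x\<close>\<close>

lemma one_minus_power:
  fixes h :: "'a::ucstar"
  shows "1 - (1 - h) ^ m = h * (\<Sum>j<m. (1 - h) ^ j)"
  by (induction m) (auto simp: algebra_simps)

lemma power_comm: "x * y = y * x \<Longrightarrow> x * y ^ n = y ^ n * (x :: 'a::monoid_mult)"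
  by (induction n) (auto simp: mult.assoc[symmetric], metis mult.assoc)

text \<open>Positivity of h is not assumed, since h will be \<open>adj x * x\<close> before its
  positivity is known. The first element is a sum of terms h^2 (1 - h)^j. The second is (1 - h)^m
  plus a quantity that grows by (m + 1) h^2 (1 - h)^m from m to m + 1.\<close>

lemma pos_power_bounds:
  fixes h :: "'a::ucstar"
  assumes h: "sa h" "norm h \<le> 1"
  shows "pos (h - h * (1 - h) ^ m)" and "pos (1 - real m *\<^sub>R (h * (1 - h) ^ m))"
proof -
  have c: "pos (1 - h)" using pos_norm_minus(1)[OF h] by simp
  have hc: "(h * h) * (1 - h) ^ j = (1 - h) ^ j * (h * h)" for j
    by (rule power_comm) (simp add: algebra_simps)
  have p: "pos ((h * h) * (1 - h) ^ j)" for j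
    by (intro pos_mult pos_square pos_power h c hc)
  have "h - h * (1 - h) ^ m = h * (1 - (1 - h) ^ m)" by (simp add: algebra_simps)
  also have "\<dots> = (\<Sum>j<m. (h * h) * (1 - h) ^ j)"
    unfolding one_minus_power by (simp add: sum_distrib_left mult.assoc)
  finally show "pos (h - h * (1 - h) ^ m)" by (simp add: pos_sum p)
  have "pos (1 - (1 - h) ^ m - real m *\<^sub>R (h * (1 - h) ^ m))"
  proof (induction m)
    case (Suc m)
    have hm: "(1 - h) ^ m * h = h * (1 - h) ^ m" 
      using power_comm[of h "1 - h" m] by (simp add: algebra_simps)
    have "1 - (1 - h) ^ Suc m - real (Suc m) *\<^sub>R (h * (1 - h) ^ Suc m)
       = (1 - (1 - h) ^ m - real m *\<^sub>R (h * (1 - h) ^ m)) + real (Suc m) *\<^sub>R ((h * h) * (1 - h) ^ m)"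
      by (simp add: algebra_simps hm)
    then show ?case using pos_add[OF Suc pos_scaleR[OF p[of m]], of "real (Suc m)"] by (simp only:)
  qed simp
  with pos_power[OF c, of m] have "pos ((1 - (1 - h) ^ m - real m *\<^sub>R (h * (1 - h) ^ m)) + (1 - h) ^ m)"
    by (rule pos_add[rotated])
  then show "pos (1 - real m *\<^sub>R (h * (1 - h) ^ m))" by simp
qed

text \<open>Twice the sum is u^2 + v^2 with u = y + adj y and v = i (y - adj y), both
  self-adjoint.\<close>

lemma pos_adj_add:
  fixes y :: "'a::ucstar"
  shows "pos (adj y * y + y * adj y)"
proof -
  define u where "u = y + adj y"
  define v where "v = \<i> *\<^sub>C (y - adj y)"
  have "sa u" "sa v" by (simp_all add: u_def v_def sa_def adj_simps ii_mult scaleC_simps)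
  then have "pos ((1/2) *\<^sub>R (u * u + v * v))" by (intro pos_scaleR pos_add pos_square) auto
  moreover have "u * u + v * v = 2 *\<^sub>R (adj y * y + y * adj y)"
    by (simp add: u_def v_def ii_mult algebra_simps scaleR_2 scaleC_simps)
  ultimately show ?thesis by simp
qed

text \<open>With \<open>h = x\<^sup>*x\<close>, \<open>k = x x\<^sup>*\<close>, \<open>y = x(1-h)\<^sup>n\<close> and \<open>m = 2n\<close> one has
  \<open>h(1-h)\<^sup>m + k(1-k)\<^sup>m = y\<^sup>*y + y y\<^sup>* \<ge> 0\<close>, while \<open>k(1-k)\<^sup>m \<le> 1/m\<close> and \<open>h \<ge> h(1-h)\<^sup>m\<close>.\<close>

lemma pos_adj_mult_1:
  fixes x :: "'a::ucstar"
  assumes "norm x \<le> 1" shows "pos (adj x * x)"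
proof (rule pos_eps)
  fix e :: real assume e: "e > 0"
  define h where "h = adj x * x"
  define k where "k = x * adj x"
  obtain n :: nat where n: "n > 0" "1 / real n < e"
    using e nat_approx_posE by (metis zero_less_Suc)
  define m where "m = n + n"
  define y where "y = x * (1 - h) ^ n"
  have "sa h" "sa k" by (auto simp: h_def k_def)
  have nhk: "norm h \<le> 1" "norm k \<le> 1"
    using assms cstar_identity[of x] cstar_identity[of "adj x"]
    by (auto simp: h_def k_def adj_adj norm_adj power_le_one)
  have ac: "adj ((1 - h) ^ n) = (1 - h) ^ n"
    using \<open>sa h\<close> by (simp add: adj_power adj_simps sa_def)
  have xc: "x * (1 - h) ^ j = (1 - k) ^ j * x" for j
  proof (induction j)
    case (Suc j)
    have "x * (1 - h) ^ Suc j = (x * (1 - h)) * (1 - h) ^ j" by (simp add: mult.assoc)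
    also have "\<dots> = (1 - k) * (x * (1 - h) ^ j)"
      by (simp add: h_def k_def algebra_simps)
    also have "\<dots> = (1 - k) ^ Suc j * x" by (simp add: Suc mult.assoc)
    finally show ?case .
  qed simp
  have hc: "(1 - h) ^ j * h = h * (1 - h) ^ j" for j
    using power_comm[of h "1 - h" j] by (simp add: algebra_simps)
  have kc: "(1 - k) ^ j * k = k * (1 - k) ^ j" for j
    using power_comm[of k "1 - k" j] by (simp add: algebra_simps)
  have "adj y * y = (1 - h) ^ n * h * (1 - h) ^ n"
    unfolding y_def adj_mult ac by (simp add: h_def mult.assoc)
  also have "\<dots> = h * (1 - h) ^ m" by (simp add: hc m_def power_add mult.assoc)
  finally have 1: "adj y * y = h * (1 - h) ^ m" .
  have "y * adj y = x * (1 - h) ^ m * adj x"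
    unfolding y_def adj_mult ac by (simp add: m_def power_add mult.assoc)
  also have "\<dots> = k * (1 - k) ^ m" by (simp add: xc k_def mult.assoc kc[unfolded k_def mult.assoc])
  finally have 2: "y * adj y = k * (1 - k) ^ m" .
  have p1: "pos (h - h * (1 - h) ^ m)" by (rule pos_power_bounds) fact+
  have p2: "pos ((1/real m) *\<^sub>R (1 - real m *\<^sub>R (k * (1 - k) ^ m)))"
    by (rule pos_scaleR[OF pos_power_bounds(2)]) (use \<open>sa k\<close> nhk in auto)
  have p3: "pos ((e - 1 / real m) *\<^sub>R (1::'a))"
    using n by (intro pos_scaleR_one) (auto simp: m_def field_simps)
  have m: "m > 0" using n by (simp add: m_def)
  have "h + e *\<^sub>R 1 = (h - h * (1 - h) ^ m) + (adj y * y + y * adj y)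
      + (1/real m) *\<^sub>R (1 - real m *\<^sub>R (k * (1 - k) ^ m)) + (e - 1 / real m) *\<^sub>R 1"
    unfolding 1 2 using m by (simp add: algebra_simps)
  then show "pos (adj x * x + e *\<^sub>R 1)"
    unfolding h_def[symmetric] by (metis pos_add p1 p2 p3 pos_adj_add)
qed

lemma pos_adj_mult:
  fixes x :: "'a::ucstar"
  shows "pos (adj x * x)"
proof (cases "x = 0")
  case False
  have "pos (adj ((1 / norm x) *\<^sub>R x) * ((1 / norm x) *\<^sub>R x))"
    by (rule pos_adj_mult_1) (use False in auto)
  then have "pos (((norm x)\<^sup>2) *\<^sub>R (adj ((1 / norm x) *\<^sub>R x) * ((1 / norm x) *\<^sub>R x)))"
    by (rule pos_scaleR) auto
  then show ?thesis using False by (simp add: adj_simps power2_eq_square)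
qed simp

text \<open>Identifies the cone with the one behind \<open>bidual_le\<close>, whose witnesses have
  this form.\<close>

lemma pos_iff: "pos x \<longleftrightarrow> (\<exists>w. x = adj w * (w :: 'a::ucstar))"
  by (metis pos_adj_mult pos_sqrt_ex sa_def)

lemma pos_conj:
  fixes x :: "'a::ucstar"
  assumes "pos x" shows "pos (adj y * x * y)"
proof -
  obtain w where "x = adj w * w" using assms pos_iff by blast
  then have "adj y * x * y = adj (w * y) * (w * y)" by (simp add: adj_simps mult.assoc)
  then show ?thesis by (simp add: pos_adj_mult)
qed

lemma pos_conj_sa: "pos x \<Longrightarrow> sa y \<Longrightarrow> pos (y * x * (y::'a::ucstar))"
  by (metis pos_conj sa_def)

lemma pos_diff_trans:
  fixes x y z :: "'a::ucstar"
  assumes "pos (y - x)" "pos (z - y)" shows "pos (z - x)"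
  using pos_add[OF assms] by simp

lemma norm_mono:
  fixes x y :: "'a::ucstar"
  assumes "pos x" "pos (y - x)" shows "norm x \<le> norm y"
proof -
  have "pos y" using pos_add[OF assms] by simp
  then have "pos (norm y *\<^sub>R 1 - y)" by (intro pos_norm_minus pos_sa) auto
  then have 1: "pos (norm y *\<^sub>R 1 - x)" using pos_diff_trans[OF assms(2)] by blast
  have 2: "pos (norm y *\<^sub>R 1 + x)" by (intro pos_add pos_scaleR_one assms) auto
  show ?thesis by (rule norm_le_of_pos[OF 1 2]) simp
qed

text \<open>From 0 \<le> x - a \<le> b - a. It bounds the part of an increasing net between one of
  its members and its limit.\<close>

lemma norm_between:
  fixes x a b :: "'a::ucstar"
  assumes "pos (x - a)" "pos (b - x)" shows "norm x \<le> norm b + 2 * norm a"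
proof -
  have "norm (x - a) \<le> norm (b - a)" using assms by (intro norm_mono) auto
  then show ?thesis using norm_triangle_ineq[of "x - a" a] norm_triangle_ineq4[of b a] by simp
qed

lemma pos_square_le:
  fixes x :: "'a::ucstar"
  assumes "pos x" "norm x \<le> C" shows "pos (C *\<^sub>R x - x * x)"
proof -
  have "pos (x * (C *\<^sub>R 1 - x))"
    by (intro pos_mult assms pos_norm_minus(1) pos_sa) (simp add: algebra_simps)
  then show ?thesis by (simp add: algebra_simps)
qed

subsection \<open>Inverses\<close>

text \<open>T = K (1 - g) with norm g \<le> (K - c)/K < 1, so a right and a left inverse are fixed
  points of contractions. The norm bound comes from S (T - c) S \<ge> 0, that is c S^2 \<le>
  S.\<close>

lemma pos_inverse_ex:
  fixes T :: "'a::ucstar"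
  assumes T: "pos (T - c *\<^sub>R 1)" "c > 0"
  shows "\<exists>S. T * S = 1 \<and> S * T = 1 \<and> pos S \<and> norm S \<le> 1 / c"
proof -
  have saT: "sa T" using pos_sa[OF T(1)] by (simp add: sa_def adj_simps)
  define K where "K = norm T + c"
  have K: "K > 0" "K \<ge> c" using T(2) by (auto simp: K_def intro: add_nonneg_pos)
  define g where "g = (1/K) *\<^sub>R (K *\<^sub>R 1 - T)"
  have "pos (K *\<^sub>R 1 - T)" using pos_norm_minus(1)[OF saT, of K] T by (simp add: K_def)
  then have "norm (K *\<^sub>R 1 - T) \<le> norm ((K - c) *\<^sub>R (1::'a))"
    by (rule norm_mono) (use T in \<open>simp add: algebra_simps\<close>)
  also have "\<dots> \<le> K - c" using norm_scaleR_one[of "K - c", where 'a='a] K by simp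
  finally have ng: "norm g \<le> (K - c) / K" using K by (simp add: g_def divide_right_mono)
  have TK: "T = K *\<^sub>R (1 - g)" using K by (simp add: g_def algebra_simps)
  have r: "0 \<le> (K - c) / K" "(K - c) / K < 1" using K T(2) by auto
  have contr: "dist (f x) (f y) \<le> (K - c) / K * dist x y"
    if "\<And>x y. f x - f y = g * (x - y) \<or> f x - f y = (x - y) * g" for f and x y :: 'a
  proof -
    have "norm (f x - f y) \<le> norm g * norm (x - y)"
      using that[of x y] norm_mult_ineq[of g "x - y"] norm_mult_ineq[of "x - y" g] by (auto simp: mult.commute)
    also have "\<dots> \<le> (K - c) / K * norm (x - y)" by (intro mult_right_mono ng) auto
    finally show ?thesis by (simp add: dist_norm)
  qed
  have "\<exists>!S. (1/K) *\<^sub>R 1 + g * S = S"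
    by (rule banach_fix_type[OF r]) (intro allI contr disjI1, simp add: right_diff_distrib)
  then obtain S where S: "(1/K) *\<^sub>R 1 + g * S = S" by blast
  have "\<exists>!S. (1/K) *\<^sub>R 1 + S * g = S"
    by (rule banach_fix_type[OF r]) (intro allI contr disjI2, simp add: left_diff_distrib)
  then obtain S' where S': "(1/K) *\<^sub>R 1 + S' * g = S'" by blast
  have "(1 - g) * S = (1/K) *\<^sub>R 1" using S by (simp add: algebra_simps)
  then have TS: "T * S = 1" using K by (simp add: TK)
  have "S' * (1 - g) = (1/K) *\<^sub>R 1" using S' by (simp add: algebra_simps)
  then have ST: "S' * T = 1" using K by (simp add: TK)
  have SS: "S' = S" using ST TS by (metis mult.assoc mult_1_left mult_1_right)
  have "adj S * T = 1" using arg_cong[OF TS, of adj] saT by (simp add: adj_simps sa_def)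
  then have "sa S" using TS by (metis mult.assoc mult_1_left mult_1_right sa_def)
  have "pos (c *\<^sub>R 1)" using T by (simp add: pos_scaleR_one)
  then have "pos T" using pos_add[OF T(1), of "c *\<^sub>R 1"] by simp
  then have "pos (S * T * S)" using \<open>sa S\<close> by (rule pos_conj_sa)
  then have pS: "pos S" by (simp add: mult.assoc TS)
  have "pos (S * (T - c *\<^sub>R 1) * S)" by (rule pos_conj_sa[OF T(1) \<open>sa S\<close>])
  then have "pos (S - c *\<^sub>R (S * S))" by (simp add: algebra_simps TS)
  moreover have "pos (c *\<^sub>R (S * S))" using T \<open>sa S\<close> by (simp add: pos_scaleR pos_square)
  ultimately have "norm (c *\<^sub>R (S * S)) \<le> norm S" using norm_mono by blast
  then have "c * (norm S * norm S) \<le> norm S" using norm_square[OF \<open>sa S\<close>] T(2) by (simp add: power2_eq_square)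
  then have "norm S \<le> 1 / c"
  proof (cases "norm S = 0")
    case False
    with \<open>c * (norm S * norm S) \<le> norm S\<close> have "c * norm S \<le> 1" 
      by (intro mult_right_le_imp_le[of "c * norm S" "norm S" 1]) (simp_all add: mult.assoc)
    then show ?thesis using T(2) by (simp add: field_simps)
  qed (use T in auto)
  with TS ST SS pS show ?thesis by blast
qed

definition minv :: "'a::ucstar \<Rightarrow> 'a"
  where "minv T = (THE S. T * S = 1 \<and> S * T = 1)"

lemma minv_eq: "T * S = 1 \<Longrightarrow> S * T = 1 \<Longrightarrow> minv T = (S :: 'a::ucstar)"
  unfolding minv_def by (rule the_equality) (auto, metis mult.assoc mult_1_left mult_1_right)

lemma minv:
  fixes T :: "'a::ucstar"
  assumes "pos (T - c *\<^sub>R 1)" "c > 0"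
  shows "T * minv T = 1" "minv T * T = 1" "pos (minv T)" "norm (minv T) \<le> 1 / c"
  using pos_inverse_ex[OF assms] minv_eq by metis+

lemma minv_comm:
  fixes T :: "'a::ucstar"
  assumes "pos (T - c *\<^sub>R 1)" "c > 0" "x * T = T * x"
  shows "x * minv T = minv T * x"
  using minv(1,2)[OF assms(1,2)] assms(3) by (metis mult.assoc mult_1_left mult_1_right)

text \<open>With D = T - S the difference is
  \<open>minv T * D * minv T + minv T * D * minv S * D * minv T\<close>, a sum of two positive
  terms.\<close>

lemma minv_antimono:
  fixes S T :: "'a::ucstar"
  assumes "pos (S - c *\<^sub>R 1)" "c > 0" "pos (T - S)"
  shows "pos (minv S - minv T)"
proof -
  have T: "pos (T - c *\<^sub>R 1)" using pos_diff_trans[OF assms(1,3)] .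
  define D where "D = T - S"
  let ?T = "minv T" and ?S = "minv S"
  have sa: "sa D" "sa ?T" using assms(3) minv(3)[OF T] assms(2) by (auto simp: D_def pos_sa)
  have p1: "pos (?T * D * ?T)" by (intro pos_conj_sa sa) (simp add: D_def assms)
  have "pos (adj (D * ?T) * ?S * (D * ?T))" by (intro pos_conj minv(3)[OF assms(1,2)])
  then have p2: "pos (?T * D * ?S * D * ?T)" using sa by (simp add: sa_def adj_simps mult.assoc)
  have "?T * D * ?T + ?T * D * ?S * D * ?T = ?T * D * (?S * S + ?S * D) * ?T"
    using minv(2)[OF assms(1,2)] by (simp add: algebra_simps)
  also have "?S * S + ?S * D = ?S * T" by (simp add: D_def algebra_simps)
  also have "?T * D * (?S * T) * ?T = ?T * D * ?S"
    using minv(1)[OF T assms(2)] by (simp add: mult.assoc)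
  also have "\<dots> = ?S - ?T"
    using minv(2)[OF T assms(2)] minv(1)[OF assms(1,2)] by (simp add: D_def algebra_simps mult.assoc[symmetric])
  finally show ?thesis using pos_add[OF p1 p2] by simp
qed

subsection \<open>Absolute value\<close>

text \<open>With d = e^2 and S = (f^2 + d)^-1 one has f = f^3 S + r, where r = d f S. The first term
  is a product of commuting positive elements, and r^2 \<le> d gives norm r \<le> e.\<close>

lemma pos_of_cube:
  fixes f :: "'a::ucstar"
  assumes f: "sa f" "pos (f * f * f)"
  shows "pos f"
proof (rule pos_eps)
  fix e :: real assume e: "e > 0"
  define d where "d = e\<^sup>2"
  have d: "d > 0" using e by (simp add: d_def)
  define T where "T = f * f + d *\<^sub>R 1"
  have T: "pos (T - d *\<^sub>R 1)" by (simp add: T_def pos_square f)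
  define S where "S = minv T"
  have S: "T * S = 1" "S * T = 1" "pos S" using minv[OF T d] by (auto simp: S_def)
  have fS: "f * S = S * f" unfolding S_def by (rule minv_comm[OF T d]) (simp add: T_def algebra_simps)
  have fS2: "f * (S * z) = S * (f * z)" for z by (metis fS mult.assoc)
  have 1: "pos (f * f * f * S)"
    by (intro pos_mult f S) (simp add: mult.assoc fS fS2)
  have saS: "sa S" using S pos_sa by blast
  define r where "r = d *\<^sub>R (f * S)"
  have sar: "sa r" unfolding r_def by (intro sa_intros sa_mult f saS fS)
  have "f - f * f * f * S = f * (T * S) - f * f * f * S" by (simp add: S)
  also have "\<dots> = r" by (simp add: T_def r_def algebra_simps)
  finally have fr: "f = f * f * f * S + r" by (simp only: diff_eq_eq add.commute)
  have ffS: "f * f * S = S * (f * f)" by (simp add: mult.assoc fS fS2)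
  have p1: "pos ((f * f) * (f * f) * S * S + (d * d) *\<^sub>R (S * S) + d *\<^sub>R (f * f * (S * S)))"
  proof (intro pos_add pos_scaleR pos_square saS)
    have "f * f * (f * f) * S * S = (f * f * S) * (f * f * S)" by (simp add: mult.assoc fS fS2)
    moreover have "sa (f * f * S)" by (intro sa_mult saS ffS f refl)
    ultimately show "pos (f * f * (f * f) * S * S)" by (simp add: pos_square)
    have "f * f * (S * S) = (f * S) * (f * S)" by (simp add: mult.assoc fS fS2)
    then show "pos (f * f * (S * S))" by (simp add: pos_square sa_mult f saS fS)
  qed (use d in auto)
  \<comment> \<open>T^2 = f^4 + 2 d f^2 + d^2, so removing one of the two copies of d f^2 S^2 from
    T^2 S^2 = 1 leaves positive terms.\<close>
  have "1 = (T * T) * (S * S)" by (metis S(1) mult.assoc mult_1_right)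
  then have "1 - d *\<^sub>R ((f * S) * (f * S)) = (T * T) * (S * S) - d *\<^sub>R (f * f * (S * S))"
    by (simp add: mult.assoc fS fS2)
  also have "\<dots> = (f * f) * (f * f) * S * S + (d * d) *\<^sub>R (S * S) + d *\<^sub>R (f * f * (S * S))"
    by (simp add: T_def algebra_simps)
  finally have p2: "pos (1 - d *\<^sub>R ((f * S) * (f * S)))" using p1 by simp
  have "pos (d *\<^sub>R (1 - d *\<^sub>R ((f * S) * (f * S))))" using p2 d by (intro pos_scaleR) auto
  then have "pos (d *\<^sub>R 1 - r * r)" by (simp add: r_def algebra_simps)
  then have "norm (r * r) \<le> norm (d *\<^sub>R (1::'a))" by (intro norm_mono pos_square sar)
  also have "\<dots> \<le> d" using norm_scaleR_one[of d, where 'a='a] d by simp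
  finally have "norm r \<le> e" using norm_square[OF sar] e by (simp add: d_def power2_le_iff_abs_le)
  then have "pos (e *\<^sub>R 1 + r)" by (rule pos_norm_minus(2)[OF sar])
  then have "pos (f * f * f * S + (e *\<^sub>R 1 + r))" by (rule pos_add[OF 1])
  then show "pos (f + e *\<^sub>R 1)" by (subst fr) (simp add: add_ac)
qed

text \<open>The sum f = r + d is twice the positive part of d. From f (r - d) = 0 follow f^2 = 2 f r
  and f^3 = 2 f r f \<ge> 0, and \<open>pos_of_cube\<close> applies.\<close>

lemma abs_ex:
  fixes d :: "'a::ucstar"
  assumes d: "sa d"
  obtains r where "pos r" "r * r = d * d" "pos (r + d)" "r * d = d * r"
proof -
  obtain r where r: "sa r" "r * r = d * d" "pos r" "\<And>y. y * (d * d) = (d * d) * y \<Longrightarrow> y * r = r * y"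
    using pos_sqrt_ex[OF pos_square[OF d]] by blast
  have rd: "d * r = r * d" by (rule r(4)) (simp add: mult.assoc)
  define f where "f = r + d"
  have "sa f" unfolding f_def by (intro sa_intros r(1) d)
  have "f * f * f = 2 *\<^sub>R (f * r * f)"
  proof -
    have "f * (r - d) = 0" by (simp add: f_def algebra_simps r(2) rd)
    then have "f * d = f * r" by (simp add: algebra_simps)
    then have "f * f = 2 *\<^sub>R (f * r)" by (subst (2) f_def) (simp add: algebra_simps scaleR_2)
    then show ?thesis by simp
  qed
  then have "pos (f * f * f)" using pos_conj_sa[OF r(3) \<open>sa f\<close>] by (simp add: pos_scaleR)
  then have "pos f" by (rule pos_of_cube[OF \<open>sa f\<close>])
  then have "pos (r + d)" by (simp add: f_def)
  from that[OF r(3,2) this rd[symmetric]] show thesis .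
qed

section \<open>Unitization\<close>

datatype 'a uni = Uni (el: 'a) (sc: complex)

lemma scaleR_scaleC: "(r *\<^sub>R c) *\<^sub>C x = r *\<^sub>R (c *\<^sub>C (x :: 'a::complex_normed_vector))"
  by (metis scaleC_of_real scaleC_scaleC scaleR_conv_of_real)

definition uact :: "'a::cstar_algebra uni \<Rightarrow> 'a \<Rightarrow> 'a"
  where "uact X b = el X * b + sc X *\<^sub>C b"

definition opn :: "'a::cstar_algebra uni \<Rightarrow> real"
  where "opn X = onorm (uact X)"

lemma bounded_linear_uact: "bounded_linear (uact X)"
proof (rule bounded_linear_intro[where K = "norm (el X) + cmod (sc X)"])
  fix b
  have "norm (uact X b) \<le> norm (el X * b) + norm (sc X *\<^sub>C b)"
    unfolding uact_def by (rule norm_triangle_ineq)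
  also have "\<dots> \<le> norm (el X) * norm b + cmod (sc X) * norm b"
    by (intro add_mono norm_mult_ineq) (simp add: norm_scaleC)
  finally show "norm (uact X b) \<le> norm b * (norm (el X) + cmod (sc X))"
    by (simp add: algebra_simps)
qed (simp_all add: uact_def algebra_simps scaleC_add_right scaleC_scaleR)

lemma opn: "norm (uact X b) \<le> opn X * norm b"
  unfolding opn_def by (rule onorm[OF bounded_linear_uact])

lemma opn_bound: "0 \<le> c \<Longrightarrow> (\<And>b. norm (uact X b) \<le> c * norm b) \<Longrightarrow> opn X \<le> c"
  unfolding opn_def by (rule onorm_bound)

lemma opn_ge0: "0 \<le> opn X"
  unfolding opn_def by (rule onorm_pos_le[OF bounded_linear_uact])

lemma norm_le_of_mult_bound:
  fixes x :: "'a::cstar_algebra"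
  assumes "\<And>b. norm (x * b) \<le> c * norm b" "c \<ge> 0" shows "norm x \<le> c"
proof (cases "x = 0")
  case False
  have "norm (x * adj x) = norm x * norm x"
    using cstar_identity[of "adj x"] by (simp add: adj_adj norm_adj power2_eq_square)
  then show ?thesis using assms(1)[of "adj x"] False by (simp add: norm_adj)
qed (use assms in auto)

lemma opn_Uni_0: "opn (Uni x 0) = norm x"
proof (rule antisym)
  show "opn (Uni x 0) \<le> norm x"
    by (rule opn_bound) (auto simp: uact_def scaleC_simps norm_mult_ineq)
  show "norm x \<le> opn (Uni x 0)"
    by (rule norm_le_of_mult_bound)
      (use opn[of "Uni x 0"] opn_ge0 in \<open>simp_all add: uact_def scaleC_simps\<close>)
qed

lemma opn_Uni_0_le: "opn (Uni 0 c) \<le> cmod c"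
  by (rule opn_bound) (auto simp: uact_def norm_scaleC)

instantiation uni :: (cstar_algebra) real_normed_vector
begin

definition zero_uni :: "'a uni" where "0 = Uni 0 0"
definition plus_uni :: "'a uni \<Rightarrow> 'a uni \<Rightarrow> 'a uni"
  where "X + Y = Uni (el X + el Y) (sc X + sc Y)"
definition minus_uni :: "'a uni \<Rightarrow> 'a uni \<Rightarrow> 'a uni"
  where "X - Y = Uni (el X - el Y) (sc X - sc Y)"
definition uminus_uni :: "'a uni \<Rightarrow> 'a uni"
  where "- X = Uni (- el X) (- sc X)"
definition scaleR_uni :: "real \<Rightarrow> 'a uni \<Rightarrow> 'a uni"
  where "r *\<^sub>R X = Uni (r *\<^sub>R el X) (r *\<^sub>R sc X)"
text \<open>The operator norm of left multiplication alone is only a seminorm when the algebra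
  already has a unit e, because \<open>Uni e (- 1)\<close> then acts as zero. The maximum with the
  modulus of the scalar part repairs this and keeps the C*-identity.\<close>

definition norm_uni :: "'a uni \<Rightarrow> real"
  where "norm X = max (opn X) (cmod (sc X))"
definition sgn_uni :: "'a uni \<Rightarrow> 'a uni"
  where "sgn_uni X = scaleR (inverse (norm X)) X"
definition dist_uni :: "'a uni \<Rightarrow> 'a uni \<Rightarrow> real"
  where "dist_uni X Y = norm (X - Y)"
definition [code del]:
  "(uniformity :: ('a uni \<times> 'a uni) filter) = (INF e\<in>{0 <..}. principal {(x, y). dist x y < e})"
definition open_uni :: "'a uni set \<Rightarrow> bool"
  where [code del]: "open_uni S = (\<forall>x\<in>S. \<forall>\<^sub>F (x', y) in uniformity. x' = x \<longrightarrow> y \<in> S)"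

lemma uni_sel1 [simp]:
  fixes X Y :: "'a uni"
  shows "el (0 :: 'a uni) = 0" "sc (0 :: 'a uni) = 0"
    "el (X + Y) = el X + el Y" "sc (X + Y) = sc X + sc Y"
    "el (X - Y) = el X - el Y" "sc (X - Y) = sc X - sc Y"
    "el (- X) = - el X" "sc (- X) = - sc X"
    "el (r *\<^sub>R X) = r *\<^sub>R el X" "sc (r *\<^sub>R X) = r *\<^sub>R sc X"
  by (simp_all add: zero_uni_def plus_uni_def minus_uni_def uminus_uni_def scaleR_uni_def)

lemma uact_add: "uact (X + Y) b = uact X b + uact Y (b :: 'a)"
  by (simp add: uact_def scaleC_add_left distrib_right)

lemma uact_scaleR: "uact (r *\<^sub>R X) b = r *\<^sub>R uact X (b :: 'a)"
  by (simp only: uact_def uni_sel1 scaleR_scaleC scaleR_add_right mult_scaleR_left)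

lemma opn_add: "opn (X + Y) \<le> opn X + opn (Y :: 'a uni)"
  by (rule opn_bound) (auto simp: uact_add opn_ge0 add_nonneg_nonneg distrib_right
      intro!: order_trans[OF norm_triangle_ineq] add_mono opn)

lemma opn_scaleR: "opn (r *\<^sub>R X) = \<bar>r\<bar> * opn (X :: 'a uni)"
proof -
  have "uact (r *\<^sub>R X) = (\<lambda>b. r *\<^sub>R uact X b)" by (rule ext) (rule uact_scaleR)
  then show ?thesis unfolding opn_def by (simp add: onorm_scaleR[OF bounded_linear_uact])
qed

lemma norm_sc_le: "cmod (sc X) \<le> norm (X :: 'a uni)"
  by (simp add: norm_uni_def)

lemma norm_el_le: "norm (el X) \<le> 2 * norm (X :: 'a uni)"
proof -
  have "opn (Uni (el X) 0) \<le> opn X + opn (Uni 0 (- sc X) :: 'a uni)"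
    using opn_add[of X "Uni 0 (- sc X)"] by (simp add: plus_uni_def)
  then show ?thesis using opn_Uni_0_le[of "- sc X", where 'a='a] by (auto simp: opn_Uni_0 norm_uni_def)
qed

lemma norm_uni_le: "norm X \<le> norm (el X) + cmod (sc X)" for X :: "'a uni"
proof -
  have "X = Uni (el X) 0 + Uni 0 (sc X)" by (intro uni.expand) simp
  then have "opn X \<le> opn (Uni (el X) 0) + opn (Uni 0 (sc X) :: 'a uni)" using opn_add by metis
  then show ?thesis using opn_Uni_0_le[of "sc X", where 'a='a] by (auto simp: opn_Uni_0 norm_uni_def)
qed

instance
proof
  fix X Y Z :: "'a uni" and r s :: real
  show "dist X Y = norm (X - Y)" by (rule dist_uni_def)
  show "sgn X = inverse (norm X) *\<^sub>R X" by (rule sgn_uni_def)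
  show "(uniformity :: ('a uni \<times> 'a uni) filter) = (INF e\<in>{0 <..}. principal {(x, y). dist x y < e})"
    by (rule uniformity_uni_def)
  show "open U = (\<forall>x\<in>U. \<forall>\<^sub>F (x', y) in uniformity. x' = x \<longrightarrow> y \<in> U)" for U :: "'a uni set"
    by (rule open_uni_def)
  show "(norm X = 0) = (X = 0)"
  proof
    assume "norm X = 0"
    with norm_el_le[of X] norm_sc_le[of X] show "X = 0" by (intro uni.expand) simp
  next
    assume "X = 0"
    then show "norm X = 0" using opn_Uni_0[of "0::'a"] by (simp add: norm_uni_def zero_uni_def)
  qed
  show "norm (X + Y) \<le> norm X + norm Y"
    using opn_add[of X Y] norm_triangle_ineq[of "sc X" "sc Y"] by (auto simp: norm_uni_def)
  show "norm (r *\<^sub>R X) = \<bar>r\<bar> * norm X"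
    by (simp add: norm_uni_def opn_scaleR max_mult_distrib_left)
  show "X + Y + Z = X + (Y + Z)" "X + Y = Y + X" "0 + X = X" "- X + X = 0" "X - Y = X + - Y"
    "r *\<^sub>R (X + Y) = r *\<^sub>R X + r *\<^sub>R Y" "(r + s) *\<^sub>R X = r *\<^sub>R X + s *\<^sub>R X"
    "r *\<^sub>R s *\<^sub>R X = (r * s) *\<^sub>R X" "1 *\<^sub>R X = X"
    by (rule uni.expand; simp add: algebra_simps)+
qed

end

instance uni :: (cstar_algebra) complete_space
proof
  fix X :: "nat \<Rightarrow> 'a uni"
  assume X: "Cauchy X"
  have *: "Cauchy (\<lambda>n. f (X n))"
    if "\<And>x y. norm (f x - f y) \<le> 2 * norm (x - y)" for f :: "'a uni \<Rightarrow> 'b::real_normed_vector"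
  proof (rule CauchyI)
    fix e :: real assume "e > 0"
    then obtain M where M: "\<forall>m\<ge>M. \<forall>n\<ge>M. norm (X m - X n) < e / 2"
      using CauchyD[OF X, of "e/2"] by auto
    have "norm (f (X m) - f (X n)) < e" if "m \<ge> M" "n \<ge> M" for m n
      using \<open>\<And>x y. norm (f x - f y) \<le> 2 * norm (x - y)\<close>[of "X m" "X n"] M that by fastforce
    then show "\<exists>M. \<forall>m\<ge>M. \<forall>n\<ge>M. norm (f (X m) - f (X n)) < e" by blast
  qed
  have "norm (el x - el y) \<le> 2 * norm (x - y)" for x y :: "'a uni"
    using norm_el_le[of "x - y"] by simp
  then have "Cauchy (\<lambda>n. el (X n))" by (rule *)
  then obtain a where a: "(\<lambda>n. el (X n)) \<longlonglongrightarrow> a" by (auto simp: Cauchy_convergent_iff convergent_def)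
  have "norm (sc x - sc y) \<le> 2 * norm (x - y)" for x y :: "'a uni"
    by (rule order_trans[of _ "norm (x - y)"]) (use norm_sc_le[of "x - y"] in auto)
  then have "Cauchy (\<lambda>n. sc (X n))" by (rule *)
  then obtain t where t: "(\<lambda>n. sc (X n)) \<longlonglongrightarrow> t" by (auto simp: Cauchy_convergent_iff convergent_def)
  have "(\<lambda>n. norm (el (X n) - a) + cmod (sc (X n) - t)) \<longlonglongrightarrow> 0"
    using tendsto_add[OF tendsto_norm[OF tendsto_diff[OF a tendsto_const[of a]]]
      tendsto_norm[OF tendsto_diff[OF t tendsto_const[of t]]]] by simp
  moreover have "\<forall>\<^sub>F n in sequentially. norm (X n - Uni a t) \<le> norm (el (X n) - a) + cmod (sc (X n) - t)"
    using norm_uni_le[of "X _ - Uni a t"] by (intro always_eventually) simp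
  ultimately have "(\<lambda>n. X n - Uni a t) \<longlonglongrightarrow> 0"
    by (rule Lim_null_comparison[rotated])
  then show "convergent X" by (auto simp: convergent_def LIM_zero_iff intro!: exI[of _ "Uni a t"])
qed

instantiation uni :: (cstar_algebra) complex_normed_vector
begin

definition scaleC_uni :: "complex \<Rightarrow> 'a uni \<Rightarrow> 'a uni"
  where "c *\<^sub>C X = Uni (c *\<^sub>C el X) (c * sc X)"

lemma uni_sel2 [simp]: "el (c *\<^sub>C X) = c *\<^sub>C el X" "sc (c *\<^sub>C X) = c * sc (X :: 'a uni)"
  by (simp_all add: scaleC_uni_def)

lemma uact_scaleC: "uact (c *\<^sub>C X) b = c *\<^sub>C uact X (b :: 'a)"
  by (simp only: uact_def uni_sel2 scaleC_add_right scaleC_scaleC mult_scaleC_left)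

lemma opn_scaleC: "opn (c *\<^sub>C X) = cmod c * opn (X :: 'a uni)"
proof -
  have le: "opn (c *\<^sub>C X) \<le> cmod c * opn X" for c and X :: "'a uni"
    by (rule opn_bound) (auto simp: uact_scaleC norm_scaleC opn_ge0 mult.assoc intro: mult_left_mono opn)
  show ?thesis
  proof (cases "c = 0")
    case True
    then show ?thesis using le[of 0 X] opn_ge0[of "0 *\<^sub>C X"] by simp
  next
    case False
    then have "inverse c *\<^sub>C c *\<^sub>C X = X"
      by (intro uni.expand) (simp add: scaleC_scaleC scaleC_simps)
    with le[of "inverse c" "c *\<^sub>C X"] have "opn X \<le> inverse (cmod c) * opn (c *\<^sub>C X)"
      by (simp add: norm_inverse)
    then have "cmod c * opn X \<le> opn (c *\<^sub>C X)" using False by (simp add: field_simps)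
    with le[of c X] show ?thesis by simp
  qed
qed

instance
proof
  fix X Y :: "'a uni" and c d :: complex and r :: real
  show "norm (c *\<^sub>C X) = cmod c * norm X"
    by (simp add: norm_uni_def opn_scaleC norm_mult max_mult_distrib_left)
  show "complex_of_real r *\<^sub>C X = r *\<^sub>R X"
    by (intro uni.expand) (simp add: scaleC_of_real scaleR_conv_of_real)
  show "c *\<^sub>C (X + Y) = c *\<^sub>C X + c *\<^sub>C Y" "(c + d) *\<^sub>C X = c *\<^sub>C X + d *\<^sub>C X"
    "c *\<^sub>C d *\<^sub>C X = (c * d) *\<^sub>C X"
    by (rule uni.expand; simp add: algebra_simps scaleC_add_left scaleC_add_right scaleC_scaleC)+
qed

end

instantiation uni :: (cstar_algebra) ucstar
begin

definition one_uni :: "'a uni" where "1 = Uni 0 1"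
definition times_uni :: "'a uni \<Rightarrow> 'a uni \<Rightarrow> 'a uni"
  where "X * Y = Uni (el X * el Y + sc X *\<^sub>C el Y + sc Y *\<^sub>C el X) (sc X * sc Y)"
definition adj_uni :: "'a uni \<Rightarrow> 'a uni"
  where "adj X = Uni (adj (el X)) (cnj (sc X))"

lemma uni_sel3 [simp]:
  fixes X Y :: "'a uni"
  shows "el (1 :: 'a uni) = 0" "sc (1 :: 'a uni) = 1"
    "el (X * Y) = el X * el Y + sc X *\<^sub>C el Y + sc Y *\<^sub>C el X" "sc (X * Y) = sc X * sc Y"
    "el (adj X) = adj (el X)" "sc (adj X) = cnj (sc X)"
  by (simp_all add: one_uni_def times_uni_def adj_uni_def)

lemma uact_mult: "uact (X * Y) b = uact X (uact Y (b :: 'a))"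
  by (simp add: uact_def scaleC_add_right distrib_right distrib_left scaleC_scaleC mult.assoc
      mult_scaleC_left mult_scaleC_right add_ac mult.commute[of "sc X" "sc Y"])

lemma opn_mult: "opn (X * Y) \<le> opn X * opn (Y :: 'a uni)"
proof (rule opn_bound)
  fix b
  have "norm (uact (X * Y) b) \<le> opn X * norm (uact Y b)" by (simp add: uact_mult opn)
  also have "\<dots> \<le> opn X * (opn Y * norm b)" by (intro mult_left_mono opn opn_ge0)
  finally show "norm (uact (X * Y) b) \<le> opn X * opn Y * norm b" by (simp add: mult.assoc)
qed (simp add: opn_ge0)

text \<open>For b in the algebra, the C*-identity turns the squared norm of X b into the norm of
  (adj b) ((adj X) X b), and the second factor is bounded by the operator norm of (adj X) X.\<close>

lemma opn_square: "(opn X)\<^sup>2 \<le> opn (adj X * (X :: 'a uni))"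
proof -
  let ?c = "sqrt (opn (adj X * X))"
  have "opn X \<le> ?c"
  proof (rule opn_bound)
    fix b :: 'a
    have "(norm (uact X b))\<^sup>2 = norm (adj (uact X b) * uact X b)" by (simp add: cstar_identity)
    also have "adj (uact X b) * uact X b = adj b * uact (adj X * X) b"
      by (simp add: uact_def adj_simps algebra_simps mult_scaleC_left mult_scaleC_right
          scaleC_add_right scaleC_scaleC scaleC_add_left)
    also have "norm \<dots> \<le> norm (adj b) * norm (uact (adj X * X) b)" by (rule norm_mult_ineq)
    also have "\<dots> \<le> norm b * (opn (adj X * X) * norm b)"
      by (simp only: norm_adj) (intro mult_left_mono opn norm_ge_zero)
    also have "\<dots> = (?c * norm b)\<^sup>2" by (simp add: power_mult_distrib opn_ge0 power2_eq_square)
    finally show "norm (uact X b) \<le> ?c * norm b"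
      by (rule power2_le_imp_le) (simp add: opn_ge0)
  qed (simp add: opn_ge0)
  then have "(opn X)\<^sup>2 \<le> ?c\<^sup>2" by (intro power_mono opn_ge0)
  then show ?thesis by (simp add: opn_ge0)
qed

lemma opn_adj_mult: "opn (adj X * X) = (opn (X :: 'a uni))\<^sup>2"
proof -
  have le: "opn Y \<le> opn (adj Y)" for Y :: "'a uni"
  proof (cases "opn Y = 0")
    case False
    have "opn Y * opn Y \<le> opn (adj Y) * opn Y"
      using opn_square[of Y] opn_mult[of "adj Y" Y] by (simp add: power2_eq_square)
    then show ?thesis using False opn_ge0[of Y] by simp
  qed (simp add: opn_ge0)
  have "adj (adj X) = X" by (intro uni.expand) (simp add: adj_adj)
  then have "opn (adj X) = opn X" using le[of X] le[of "adj X"] by simp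
  then show ?thesis using opn_square[of X] opn_mult[of "adj X" X] by (simp add: power2_eq_square)
qed

instance
proof
  fix X Y Z :: "'a uni" and c d :: complex and r s :: real
  show "norm (X * Y) \<le> norm X * norm Y"
    using order_trans[OF opn_mult[of X Y] mult_mono[of "opn X" "norm X" "opn Y" "norm Y"]]
      mult_mono[of "cmod (sc X)" "norm X" "cmod (sc Y)" "norm Y"] opn_ge0[of X] opn_ge0[of Y]
    by (simp add: norm_uni_def norm_mult max.coboundedI1 le_max_iff_disj)
  show "norm (adj X * X) = (norm X)\<^sup>2"
    by (simp add: norm_uni_def opn_adj_mult norm_mult power2_eq_square[of "cmod _", symmetric])
      (auto simp: max_def opn_ge0 power_mono_iff)
  show "X * Y * Z = X * (Y * Z)" "(X + Y) * Z = X * Z + Y * Z" "X * (Y + Z) = X * Y + X * Z"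
    "r *\<^sub>R X * Y = r *\<^sub>R (X * Y)" "X * r *\<^sub>R Y = r *\<^sub>R (X * Y)" "1 * X = X" "X * 1 = X"
    "(c *\<^sub>C X) * Y = c *\<^sub>C (X * Y)" "X * (c *\<^sub>C Y) = c *\<^sub>C (X * Y)"
    by (rule uni.expand; simp add: algebra_simps scaleC_add_left scaleC_add_right scaleC_scaleC
      scaleC_simps mult_scaleC_left mult_scaleC_right scaleC_scaleR scaleR_scaleC)+
  show "adj (X + Y) = adj X + adj Y" "adj (c *\<^sub>C X) = cnj c *\<^sub>C adj X"
    "adj (X * Y) = adj Y * adj X" "adj (adj X) = X"
    by (rule uni.expand; simp add: adj_simps add_ac)+
qed

end

section \<open>Positive elements and an approximate unit inside the algebra\<close>

definition posA :: "'a::cstar_algebra \<Rightarrow> bool"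
  where "posA a \<longleftrightarrow> pos (Uni a 0)"

lemma Uni_add: "Uni (a + b) 0 = Uni a 0 + Uni (b::'a::cstar_algebra) 0"
  and Uni_diff: "Uni (a - b) 0 = Uni a 0 - Uni b 0"
  and Uni_mult: "Uni (a * b) 0 = Uni a 0 * Uni b 0"
  and Uni_scaleR: "Uni (r *\<^sub>R a) 0 = r *\<^sub>R Uni a 0"
  and Uni_adj: "Uni (adj a) 0 = adj (Uni a 0)"
  by (intro uni.expand, simp add: scaleC_simps)+

lemmas Uni_simps = Uni_add Uni_diff Uni_mult Uni_scaleR Uni_adj

lemma norm_Uni: "norm (Uni a 0) = norm (a::'a::cstar_algebra)"
  by (simp add: norm_uni_def opn_Uni_0)

lemma Uni_el: "sc X = 0 \<Longrightarrow> Uni (el X) 0 = X"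
  by (intro uni.expand) simp

lemma sa_Uni: "sa (Uni a 0) \<longleftrightarrow> sa (a::'a::cstar_algebra)"
  by (auto simp: sa_def adj_uni_def)

lemma posA_adj_mult: "posA (adj a * (a::'a::cstar_algebra))"
  by (simp add: posA_def Uni_simps pos_adj_mult)

lemma posA_add: "posA a \<Longrightarrow> posA b \<Longrightarrow> posA (a + (b::'a::cstar_algebra))"
  by (simp add: posA_def Uni_simps pos_add)

lemma posA_scaleR: "posA a \<Longrightarrow> r \<ge> 0 \<Longrightarrow> posA (r *\<^sub>R (a::'a::cstar_algebra))"
  by (simp add: posA_def Uni_simps pos_scaleR)

lemma posA_norm_mono: "posA a \<Longrightarrow> posA (b - a) \<Longrightarrow> norm a \<le> norm (b::'a::cstar_algebra)"
  unfolding posA_def by (metis norm_mono norm_Uni Uni_diff)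

text \<open>The root is taken in the unitization. Its scalar part squares to 0, so it belongs to the
  algebra.\<close>

lemma posA_root:
  assumes "posA a" obtains w where "a = adj w * (w :: 'a::cstar_algebra)"
proof -
  obtain W where W: "sa W" "W * W = Uni a 0" using assms pos_sqrt_ex unfolding posA_def by blast
  then have "sc W * sc W = 0" by (metis uni_sel3(4) uni.sel(2))
  then have "W = Uni (el W) 0" by (simp add: Uni_el)
  with W have "Uni a 0 = Uni (adj (el W) * el W) 0" by (metis Uni_simps(3,5) sa_def)
  then show thesis using that by simp
qed

lemma abs_exA:
  fixes d :: "'a::cstar_algebra"
  assumes "sa d"
  obtains r where "posA r" "r * r = d * d" "posA (r + d)" "r * d = d * r"
proof -
  have "sa (Uni d 0)" using assms by (simp add: sa_Uni)
  then obtain R where R: "pos R" "R * R = Uni d 0 * Uni d 0" "pos (R + Uni d 0)" "R * Uni d 0 = Uni d 0 * R"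
    by (rule abs_ex)
  have "sc R * sc R = 0" using arg_cong[OF R(2), of sc] by simp
  then have "Uni (el R) 0 = R" by (simp add: Uni_el)
  then show thesis
    using that[of "el R"] R unfolding posA_def
    by (metis Uni_simps(1,3) uni.inject)
qed

text \<open>The approximate unit \<open>a(1+a)\<^sup>-\<^sup>1\<close>, indexed by the positive elements \<open>a\<close>.\<close>

definition apx :: "'a::cstar_algebra \<Rightarrow> 'a"
  where "apx a = el (1 - minv (1 + Uni a 0))"

lemma apx_minv:
  fixes a :: "'a::cstar_algebra"
  assumes "posA a"
  defines "S \<equiv> minv (1 + Uni a 0)"
  shows "Uni (apx a) 0 = 1 - S" "(1 + Uni a 0) * S = 1" "S * (1 + Uni a 0) = 1" "pos S" "norm S \<le> 1"
proof -
  have "pos (1 + Uni a 0 - 1 *\<^sub>R 1)" using assms by (simp add: posA_def)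
  note * = minv[OF this, folded S_def]
  show "(1 + Uni a 0) * S = 1" "S * (1 + Uni a 0) = 1" "pos S" "norm S \<le> 1" using * by auto
  have "sc S = 1" using arg_cong[OF *(1), of sc] by simp
  then show "Uni (apx a) 0 = 1 - S"
    unfolding apx_def S_def[symmetric] by (intro Uni_el) simp
qed

lemma apx_pos:
  fixes a :: "'a::cstar_algebra"
  assumes "posA a"
  shows "posA (apx a)" "norm (apx a) \<le> 1" "pos (1 - Uni (apx a) 0)"
proof -
  let ?S = "minv (1 + Uni a 0)"
  note S = apx_minv[OF assms]
  have 1: "pos (1 - ?S)" using pos_norm_minus(1)[OF pos_sa[OF S(4)] S(5)] by simp
  then show "posA (apx a)" by (simp add: posA_def S(1))
  show 2: "pos (1 - Uni (apx a) 0)" using S(1,4) by simp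
  have "norm (1 - ?S) \<le> norm (1 :: 'a uni)" by (rule norm_mono[OF 1]) (use S in simp)
  then show "norm (apx a) \<le> 1" using S(1) norm_one_le[where 'a="'a uni"] by (metis norm_Uni order_trans)
qed

lemma apx_mono:
  fixes a b :: "'a::cstar_algebra"
  assumes "posA a" "posA b" "posA (b - a)"
  shows "posA (apx b - apx a)"
proof -
  have "pos (1 + Uni a 0 - 1 *\<^sub>R 1)" using assms by (simp add: posA_def)
  then have "pos (minv (1 + Uni a 0) - minv (1 + Uni b 0))"
    by (rule minv_antimono) (use assms in \<open>simp_all add: posA_def Uni_simps\<close>)
  then show ?thesis
    unfolding posA_def Uni_diff apx_minv(1)[OF assms(1)] apx_minv(1)[OF assms(2)] by simp
qed

text \<open>Let X = \<open>Uni b 0\<close>, S = (1 + a)^-1 and a \<ge> a0 = n (adj b) b. The squared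
  norm is that of X S^2 (adj X), which is dominated by X S (adj X) and then by X (1 + a0)^-1 (adj
  X). The last equals (1 + n k)^-1 k with k = X (adj X), of norm at most 1/n.\<close>

lemma apx_unit:
  fixes b :: "'a::cstar_algebra"
  assumes "e > 0"
  shows "\<exists>a0. posA a0 \<and> (\<forall>a. posA a \<longrightarrow> posA (a - a0) \<longrightarrow> norm (b * apx a - b) < e)"
proof -
  obtain n :: nat where n: "n > 0" "1 / real n < e\<^sup>2"
    using assms nat_approx_posE[of "e\<^sup>2"] by (metis zero_less_Suc zero_less_power)
  define a0 where "a0 = real n *\<^sub>R (adj b * b)"
  have p0: "posA a0" unfolding a0_def by (intro posA_scaleR posA_adj_mult) simp
  define X where "X = Uni b 0"
  define k where "k = X * adj X"
  define T where "T = minv (1 + real n *\<^sub>R k)"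
  have "pos k" using pos_adj_mult[of "adj X"] by (simp add: k_def adj_adj)
  then have kT: "pos (1 + real n *\<^sub>R k - 1 *\<^sub>R 1)" by (simp add: pos_scaleR)
  note T = minv[OF kT, folded T_def, simplified]
  have "norm (b * apx a - b) < e" if a: "posA a" "posA (a - a0)" for a
  proof -
    let ?S = "minv (1 + Uni a 0)" and ?U = "minv (1 + Uni a0 0)"
    note S = apx_minv[OF a(1)] and S0 = apx_minv[OF p0]
    have saS: "adj ?S = ?S" using pos_sa[OF S(4)] by (simp add: sa_def)
    have "Uni (b - b * apx a) 0 = X * ?S"
      by (simp add: Uni_simps S(1) X_def right_diff_distrib)
    then have "(norm (b - b * apx a))\<^sup>2 = (norm (adj (X * ?S)))\<^sup>2" by (metis norm_Uni norm_adj)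
    also have "\<dots> = norm (X * (?S * ?S) * adj X)"
      using cstar_identity[of "adj (X * ?S)"] by (simp add: adj_adj adj_mult saS mult.assoc)
    also have "\<dots> \<le> norm (X * ?S * adj X)"
    proof (rule norm_mono)
      have "pos (adj (adj X) * (?S * ?S) * adj X)"
        by (intro pos_conj pos_square pos_sa S)
      then show "pos (X * (?S * ?S) * adj X)" by (simp add: adj_adj)
      have "pos (1 *\<^sub>R ?S - ?S * ?S)" by (rule pos_square_le[OF S(4,5)])
      then have "pos (adj (adj X) * (?S - ?S * ?S) * adj X)" by (intro pos_conj) simp
      then show "pos (X * ?S * adj X - X * (?S * ?S) * adj X)"
        by (simp add: adj_adj left_diff_distrib right_diff_distrib)
    qed
    also have "\<dots> \<le> norm (X * ?U * adj X)"
    proof (rule norm_mono)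
      have "pos (adj (adj X) * ?S * adj X)" by (intro pos_conj S)
      then show "pos (X * ?S * adj X)" by (simp add: adj_adj)
      have "pos (1 + Uni a0 0 - 1 *\<^sub>R 1)" using p0 by (simp add: posA_def)
      then have "pos (?U - ?S)"
        by (rule minv_antimono) (use a in \<open>simp_all add: posA_def Uni_simps\<close>)
      then have "pos (adj (adj X) * (?U - ?S) * adj X)" by (intro pos_conj)
      then show "pos (X * ?U * adj X - X * ?S * adj X)"
        by (simp add: adj_adj left_diff_distrib right_diff_distrib)
    qed
    also have "X * ?U = T * X"
    proof -
      have "X * (1 + Uni a0 0) = (1 + real n *\<^sub>R k) * X"
        by (simp add: a0_def Uni_simps X_def k_def distrib_left distrib_right mult.assoc)
      then have "T * (X * (1 + Uni a0 0)) * ?U = T * ((1 + real n *\<^sub>R k) * X) * ?U" by simp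
      then have "T * X * ((1 + Uni a0 0) * ?U) = (T * (1 + real n *\<^sub>R k)) * X * ?U"
        by (simp only: mult.assoc)
      then show ?thesis using S0(2) T(2) by simp
    qed
    also have "T * X * adj X = T * k" by (simp add: k_def mult.assoc)
    also have "T * k = (1 / real n) *\<^sub>R (1 - T)"
    proof -
      have "T + real n *\<^sub>R (T * k) = 1" using T(2) by (simp add: distrib_left)
      then have "1 - T = real n *\<^sub>R (T * k)" by (simp add: algebra_simps)
      then show ?thesis using n by simp
    qed
    also have "norm ((1 / real n) *\<^sub>R (1 - T)) \<le> 1 / real n"
    proof -
      have "norm (1 - T) \<le> norm (1 :: 'a uni)"
        by (rule norm_mono) (use pos_norm_minus(1)[OF pos_sa[OF T(3)], of 1] T in auto)
      then have "norm (1 - T) \<le> 1" using norm_one_le order_trans by blast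
      then show ?thesis using n by (simp add: divide_right_mono)
    qed
    also have "1 / real n < e\<^sup>2" by (rule n)
    finally have "norm (b - b * apx a) < e" using assms by (simp add: power_less_imp_less_base)
    then show ?thesis by (simp add: norm_minus_commute)
  qed
  with p0 show ?thesis by blast
qed

text \<open>The element equals s t/(s + t) times \<open>adj (a - b) * (a - b)\<close>. This
  convexity of a \<mapsto> (adj a) a is what makes the functional in
  \<open>dominating_positive_functional\<close> subadditive.\<close>

lemma posA_convex:
  fixes a b :: "'a::cstar_algebra"
  assumes "s > 0" "t > 0"
  shows "posA (s *\<^sub>R (adj a * a) + t *\<^sub>R (adj b * b)
    - (1 / (s + t)) *\<^sub>R (adj (s *\<^sub>R a + t *\<^sub>R b) * (s *\<^sub>R a + t *\<^sub>R b)))"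
proof -
  have "s *\<^sub>R x + t *\<^sub>R y - (1 / (s + t)) *\<^sub>R ((s * s) *\<^sub>R x + (s * t) *\<^sub>R z + (t * t) *\<^sub>R y)
    = (s * t / (s + t)) *\<^sub>R (x - z + y)" for x y z :: 'a
  proof -
    define c where "c = 1 / (s + t)"
    have "c * (s + t) = 1" using assms by (simp add: c_def)
    then have "c * s * s + c * s * t = s" "c * s * t + c * t * t = t"
      by (metis distrib_left mult.assoc mult.commute mult_1)+
    then have "s *\<^sub>R x = (c * s * s) *\<^sub>R x + (c * s * t) *\<^sub>R x"
      "t *\<^sub>R y = (c * s * t) *\<^sub>R y + (c * t * t) *\<^sub>R y"
      by (metis scaleR_add_left)+
    moreover have "s * t / (s + t) = c * s * t" by (simp add: c_def)
    ultimately show ?thesis unfolding c_def[symmetric] by (simp add: algebra_simps)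
  qed
  from this[of "adj a * a" "adj b * b" "adj a * b + adj b * a"]
  have "s *\<^sub>R (adj a * a) + t *\<^sub>R (adj b * b)
    - (1 / (s + t)) *\<^sub>R (adj (s *\<^sub>R a + t *\<^sub>R b) * (s *\<^sub>R a + t *\<^sub>R b))
    = (s * t / (s + t)) *\<^sub>R (adj (a - b) * (a - b))"
    by (simp add: adj_simps algebra_simps)
  then show ?thesis using assms by (simp add: posA_scaleR posA_adj_mult)
qed

section \<open>Hahn--Banach and domination by positive functionals\<close>

definition sublin :: "('v::real_vector \<Rightarrow> real) \<Rightarrow> bool"
  where "sublin p \<longleftrightarrow> (\<forall>x y. p (x + y) \<le> p x + p y) \<and> (\<forall>r x. r > 0 \<longrightarrow> p (r *\<^sub>R x) \<le> r * p x) \<and> p 0 = 0"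

lemma sublin_minus: "sublin p \<Longrightarrow> - p (- x) \<le> p x"
  unfolding sublin_def by (metis add.right_inverse minus_le_iff neg_le_iff_le le_minus_iff add_increasing
      diff_le_eq diff_0)

lemma sublin_scale:
  assumes "sublin p" "r \<ge> 0" shows "p (r *\<^sub>R x) = r * p x"
proof (cases "r = 0")
  case False
  with assms have r: "r > 0" by simp
  have "p (inverse r *\<^sub>R (r *\<^sub>R x)) \<le> inverse r * p (r *\<^sub>R x)"
    using assms r unfolding sublin_def by (metis positive_imp_inverse_positive)
  then have "r * p x \<le> p (r *\<^sub>R x)" using r by (simp add: field_simps)
  moreover have "p (r *\<^sub>R x) \<le> r * p x" using assms r unfolding sublin_def by blast
  ultimately show ?thesis by simp
qed (use assms in \<open>simp add: sublin_def\<close>)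

text \<open>Serves three infima: over shifts along a vector, over a chain in Zorn's lemma, and over
  the triples that yield positive domination. \<open>B\<close> is a common lower bound, so that the
  infima are finite.\<close>

lemma sublin_INF:
  fixes F :: "'i \<Rightarrow> 'v::real_vector \<Rightarrow> real"
  assumes "I \<noteq> {}" and bdd: "\<And>i x. i \<in> I \<Longrightarrow> B x \<le> F i x"
    and add: "\<And>i j x y. i \<in> I \<Longrightarrow> j \<in> I \<Longrightarrow> \<exists>k\<in>I. F k (x + y) \<le> F i x + F j y"
    and scale: "\<And>i r x. i \<in> I \<Longrightarrow> r > 0 \<Longrightarrow> \<exists>k\<in>I. F k (r *\<^sub>R x) \<le> r * F i x"
    and zero: "B 0 = 0" "\<And>e. e > 0 \<Longrightarrow> \<exists>i\<in>I. F i 0 \<le> e"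
  shows "sublin (\<lambda>x. INF i\<in>I. F i x)"
proof -
  have bb: "bdd_below ((\<lambda>i. F i x) ` I)" for x using bdd by (intro bdd_belowI2[where m = "B x"])
  have low: "i \<in> I \<Longrightarrow> (INF i\<in>I. F i x) \<le> F i x" for i x by (rule cINF_lower[OF bb])
  show ?thesis
    unfolding sublin_def
  proof (intro conjI allI impI)
    fix x y
    have "(INF i\<in>I. F i (x + y)) - F j y \<le> (INF i\<in>I. F i x)" if j: "j \<in> I" for j
    proof (rule cINF_greatest[OF \<open>I \<noteq> {}\<close>])
      fix i assume "i \<in> I"
      then obtain k where "k \<in> I" "F k (x + y) \<le> F i x + F j y" using add[OF _ j] by blast
      with low[of k "x + y"] show "(INF i\<in>I. F i (x + y)) - F j y \<le> F i x" by linarith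
    qed
    then have "(INF i\<in>I. F i (x + y)) - (INF i\<in>I. F i x) \<le> (INF i\<in>I. F i y)"
      by (intro cINF_greatest[OF \<open>I \<noteq> {}\<close>]) (metis add.commute diff_le_eq le_diff_eq)
    then show "(INF i\<in>I. F i (x + y)) \<le> (INF i\<in>I. F i x) + (INF i\<in>I. F i y)" by simp
  next
    fix r :: real and x assume r: "r > 0"
    have "(INF i\<in>I. F i (r *\<^sub>R x)) / r \<le> (INF i\<in>I. F i x)"
    proof (rule cINF_greatest[OF \<open>I \<noteq> {}\<close>])
      fix i assume "i \<in> I"
      then obtain k where "k \<in> I" "F k (r *\<^sub>R x) \<le> r * F i x" using scale[OF _ r] by blast
      with low[of k "r *\<^sub>R x"] have "(INF i\<in>I. F i (r *\<^sub>R x)) \<le> r * F i x" by linarith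
      with r show "(INF i\<in>I. F i (r *\<^sub>R x)) / r \<le> F i x" by (simp add: field_simps)
    qed
    with r show "(INF i\<in>I. F i (r *\<^sub>R x)) \<le> r * (INF i\<in>I. F i x)" by (simp add: field_simps)
  next
    have "0 \<le> (INF i\<in>I. F i 0)"
      using bdd[of _ 0] zero(1) by (intro cINF_greatest[OF \<open>I \<noteq> {}\<close>]) simp
    moreover have "(INF i\<in>I. F i 0) \<le> 0 + e" if e: "e > 0" for e
    proof -
      obtain i where "i \<in> I" "F i 0 \<le> e" using zero(2)[OF e] by blast
      with low[of i 0] show ?thesis by linarith
    qed
    then have "(INF i\<in>I. F i 0) \<le> 0" by (rule field_le_epsilon)
    ultimately show "(INF i\<in>I. F i 0) = 0" by simp
  qed
qed

text \<open>Takes q' x = inf {q (x + t y) - t q y | t \<ge> 0}; the values t = 0 and t = 1 give the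
  two inequalities. For a minimal q this forces q (- y) \<le> - q y.\<close>

lemma sublin_shift:
  assumes q: "sublin q"
  obtains q' where "sublin q'" "\<And>x. q' x \<le> q x" "q' (- y) \<le> - q y"
proof -
  have sub: "q (a + b) \<le> q a + q b" for a b using q by (simp add: sublin_def)
  have low: "- q (- x) \<le> q (x + t *\<^sub>R y) - t * q y" if "t \<ge> 0" for x t
    using sub[of "x + t *\<^sub>R y" "- x"] sublin_scale[OF q that, of y] by simp
  define q' where "q' x = (INF t\<in>{0..}. q (x + t *\<^sub>R y) - t * q y)" for x
  have "sublin (\<lambda>x. INF t\<in>{0..}. q (x + t *\<^sub>R y) - t * q y)"
  proof (rule sublin_INF[where B = "\<lambda>x. - q (- x)"])
    fix s t :: real and x z assume st: "s \<in> {0..}" "t \<in> {0..}"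
    show "\<exists>k\<in>{0..}. q (x + z + k *\<^sub>R y) - k * q y \<le> q (x + s *\<^sub>R y) - s * q y + (q (z + t *\<^sub>R y) - t * q y)"
      using st sub[of "x + s *\<^sub>R y" "z + t *\<^sub>R y"]
      by (intro bexI[of _ "s + t"]) (auto simp: algebra_simps)
  next
    fix s r :: real and x assume "s \<in> {0..}" "r > 0"
    then show "\<exists>k\<in>{0..}. q (r *\<^sub>R x + k *\<^sub>R y) - k * q y \<le> r * (q (x + s *\<^sub>R y) - s * q y)"
      using sublin_scale[OF q, of r "x + s *\<^sub>R y"]
      by (intro bexI[of _ "r * s"]) (auto simp: algebra_simps)
  qed (use low q in \<open>auto simp: sublin_def intro!: bexI[of _ 0]\<close>)
  moreover have "q' x \<le> q (x + t *\<^sub>R y) - t * q y" if "t \<ge> 0" for x t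
    unfolding q'_def using low[of _ x] that
    by (intro cINF_lower bdd_belowI2[where m = "- q (- x)"]) auto
  from this[of 0] this[of 1 "- y"] have "q' x \<le> q x" "q' (- y) \<le> - q y" for x
    using q by (simp_all add: sublin_def)
  ultimately show thesis using that[of q'] unfolding q'_def[abs_def] by blast
qed

text \<open>Zorn's lemma runs over all sublinear functionals below p instead of partially defined
  linear ones: a minimal one is odd by \<open>sublin_shift\<close>, hence linear.\<close>

theorem hahn_banach:
  assumes p: "sublin p"
  obtains f where "linear f" "\<And>x. f x \<le> p x"
proof -
  define A where "A = {q. sublin q \<and> (\<forall>x. q x \<le> p x)}"
  define P where "P = (\<lambda>f g :: 'a \<Rightarrow> real. \<forall>x. g x \<le> f x)"
  have "\<exists>m\<in>A. \<forall>a\<in>A. P m a \<longrightarrow> a = m"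
  proof (rule predicate_Zorn)
    show "partial_order_on A (relation_of P A)"
      by (rule partial_order_on_relation_ofI) (auto simp: P_def fun_eq_iff intro: order_trans antisym)
    fix C assume "C \<in> Chains (relation_of P A)"
    then have CA: "C \<subseteq> A" and ch: "\<And>f g. f \<in> C \<Longrightarrow> g \<in> C \<Longrightarrow> P f g \<or> P g f"
      by (auto simp: Chains_def relation_of_def)
    show "\<exists>u\<in>A. \<forall>a\<in>C. P a u"
    proof (cases "C = {}")
      case True
      then show ?thesis using p by (intro bexI[of _ p]) (auto simp: A_def)
    next
      case False
      have low: "- p (- x) \<le> q x" if "q \<in> C" for q x
      proof -
        have "sublin q" "q (- x) \<le> p (- x)" using CA that by (auto simp: A_def)
        with sublin_minus[of q x] show ?thesis by linarith
      qed
      have C1: "q (x + y) \<le> q x + q y" "r > 0 \<Longrightarrow> q (r *\<^sub>R x) \<le> r * q x" "q 0 = 0" "q x \<le> p x"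
        if "q \<in> C" for q x y r
        using CA that by (auto simp: A_def sublin_def)
      have "sublin (\<lambda>x. INF q\<in>C. q x)"
      proof (rule sublin_INF[where B = "\<lambda>x. - p (- x)"])
        fix f g x y assume fg: "f \<in> C" "g \<in> C"
        from ch[OF this] show "\<exists>k\<in>C. k (x + y) \<le> f x + g y"
          unfolding P_def using C1(1)[of f x y] C1(1)[of g x y] fg by (smt (verit, best))
      next
        fix q r x assume "q \<in> C" "(r::real) > 0"
        then show "\<exists>k\<in>C. k (r *\<^sub>R x) \<le> r * q x" using C1(2) by blast
      next
        fix e :: real assume "e > 0"
        with False C1(3) show "\<exists>q\<in>C. q 0 \<le> e" by (metis all_not_in_conv less_imp_le)
      qed (use False low p in \<open>auto simp: sublin_def\<close>)
      moreover have le: "(INF q\<in>C. q x) \<le> q x" if "q \<in> C" for q x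
        by (rule cINF_lower[OF bdd_belowI2 that]) (rule low)
      moreover have "(INF q\<in>C. q x) \<le> p x" for x using le C1(4) False by (meson all_not_in_conv order_trans)
      ultimately show ?thesis
        by (intro bexI[of _ "\<lambda>x. INF q\<in>C. q x"]) (auto simp: A_def P_def)
    qed
  qed
  then obtain m where m: "m \<in> A" "\<And>a. a \<in> A \<Longrightarrow> P m a \<Longrightarrow> a = m" by blast
  then have sm: "sublin m" "\<And>x. m x \<le> p x" by (auto simp: A_def)
  have neg: "m (- y) = - m y" for y
  proof -
    obtain q where q: "sublin q" "\<And>x. q x \<le> m x" "q (- y) \<le> - m y" using sublin_shift[OF sm(1), of y] by blast
    then have "q \<in> A" unfolding A_def using sm(2) order_trans by blast
    then have "q = m" using m(2) q(2) unfolding P_def by blast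
    with q(3) sublin_minus[OF sm(1), of "y"] show ?thesis by simp
  qed
  have sub: "m (x + y) \<le> m x + m y" for x y using sm by (simp add: sublin_def)
  have add: "m (x + y) = m x + m y" for x y
    using sub[of x y] sub[of "-x" "-y"] neg[of x] neg[of y] neg[of "x + y"] by simp
  have "m (r *\<^sub>R x) = r * m x" for r x
    using sublin_scale[OF sm(1), of "\<bar>r\<bar>" x] neg[of "\<bar>r\<bar> *\<^sub>R x"] by (cases "r \<ge> 0") auto
  then have "linear m" by (intro linearI) (auto simp: add)
  then show thesis using that sm(2) by blast
qed

lemma phase_ex: obtains c where "cmod c = 1" "c * z = cmod z"
proof (cases "z = 0")
  case False
  have "cnj z * z = of_real (cmod z) * of_real (cmod z)"
    using complex_norm_square[of z] by (simp add: power2_eq_square mult.commute)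
  then have "cnj z / cmod z * z = cmod z" using False by simp
  then show ?thesis using False by (intro that[of "cnj z / cmod z"]) (auto simp: norm_divide)
qed (use that[of 1] in auto)

lemma cdual_of_real_functional:
  fixes f :: "'a::complex_normed_vector \<Rightarrow> real"
  assumes f: "linear f" "\<And>x. f x \<le> norm x"
  obtains \<psi> where "norm \<psi> \<le> 1" "\<And>x. \<psi> \<cdot> x = Complex (f x) (- f (\<i> *\<^sub>C x))"
proof -
  let ?g = "\<lambda>x. Complex (f x) (- f (\<i> *\<^sub>C x))"
  have add: "?g (x + y) = ?g x + ?g y" for x y
    by (simp add: complex_eq_iff linear_add[OF f(1)] scaleC_add_right)
  have sR: "?g (r *\<^sub>R x) = r *\<^sub>R ?g x" for r x
    by (simp add: complex_eq_iff linear_scale[OF f(1)] scaleC_scaleR)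
  have sC: "?g (c *\<^sub>C x) = c * ?g x" for c x
  proof -
    have "\<i> *\<^sub>C \<i> *\<^sub>C x = - x" by (simp add: scaleC_scaleC scaleC_simps)
    then have ii: "?g (\<i> *\<^sub>C x) = \<i> * ?g x" by (simp add: complex_eq_iff linear_neg[OF f(1)])
    have "c *\<^sub>C x = Re c *\<^sub>R x + Im c *\<^sub>R (\<i> *\<^sub>C x)"
      by (subst complex_eq[of c]) (simp add: scaleC_add_left scaleC_of_real[symmetric] scaleC_scaleC mult.commute)
    then have "?g (c *\<^sub>C x) = Re c *\<^sub>R ?g x + Im c *\<^sub>R (\<i> * ?g x)"
      by (simp only: add sR ii)
    then show ?thesis by (simp add: complex_eq_iff algebra_simps)
  qed
  have bd: "cmod (?g x) \<le> 1 * norm x" for x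
  proof (cases "?g x = 0")
    case False
    obtain c where c: "cmod c = 1" "c * ?g x = cmod (?g x)" by (rule phase_ex)
    then have "?g (c *\<^sub>C x) = cmod (?g x)" using c(2) by (simp only: sC)
    then have "cmod (?g x) = f (c *\<^sub>C x)" by (simp add: complex_eq_iff)
    also have "\<dots> \<le> norm x" using f(2)[of "c *\<^sub>C x"] by (simp add: norm_scaleC c(1))
    finally show ?thesis by simp
  qed simp
  have *: "cdual_apply (Abs_cdual ?g) = ?g"
    by (intro Abs_cdual_inverse CollectI cdualI[of ?g 1]) (fact add sR sC bd)+
  show thesis
  proof (rule that[of "Abs_cdual ?g"])
    show "norm (Abs_cdual ?g) \<le> 1" by (rule norm_cdual_bound) (use bd in \<open>auto simp: *\<close>)
  qed (simp add: *)
qed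

text \<open>Shifting the norm along \<open>a\<close> first forces every linear functional below the
  result to take the value norm a at \<open>a\<close>.\<close>

lemma norming_functional:
  fixes a :: "'a::complex_normed_vector"
  obtains \<psi> where "norm \<psi> \<le> 1" "Re (\<psi> \<cdot> a) = norm a"
proof -
  have "sublin (norm :: 'a \<Rightarrow> real)" by (auto simp: sublin_def norm_triangle_ineq)
  from sublin_shift[OF this, of a]
  obtain q where q: "sublin q" "\<And>x. q x \<le> norm x" "q (- a) \<le> - norm a" by blast
  obtain f where f: "linear f" "\<And>x. f x \<le> q x" using hahn_banach[OF q(1)] by blast
  obtain \<psi> where \<psi>: "norm \<psi> \<le> 1" "\<And>x. \<psi> \<cdot> x = Complex (f x) (- f (\<i> *\<^sub>C x))"
    using cdual_of_real_functional[OF f(1)] f(2) q(2) order_trans by metis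
  have "norm a \<le> f a" using f(2)[of "- a"] q(3) linear_neg[OF f(1)] by simp
  moreover have "f a \<le> norm a" using f(2) q(2) order_trans by blast
  ultimately show thesis using \<psi> that by simp
qed

lemma norm_embed: "norm (embed a) = norm (a :: 'a::complex_normed_vector)"
proof (rule antisym)
  show "norm (embed a) \<le> norm a"
    by (rule norm_cdual_bound) (auto simp: embed.rep_eq mult.commute intro: order_trans[OF norm_cdual_apply])
  obtain \<psi> where \<psi>: "norm \<psi> \<le> 1" "Re (\<psi> \<cdot> a) = norm a" by (rule norming_functional)
  have "norm a \<le> cmod (embed a \<cdot> \<psi>)" using \<psi>(2) complex_Re_le_cmod[of "\<psi> \<cdot> a"] by (simp add: embed.rep_eq)
  also have "\<dots> \<le> norm (embed a) * norm \<psi>" by (rule norm_cdual_apply)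
  also have "\<dots> \<le> norm (embed a)" using \<psi> by (simp add: mult_left_le)
  finally show "norm a \<le> norm (embed a)" .
qed

definition posf :: "'a::cstar_algebra cdual \<Rightarrow> bool"
  where "posf \<phi> \<longleftrightarrow> (\<forall>a. \<phi> \<cdot> (adj a * a) \<in> \<real>\<^sub>\<ge>\<^sub>0)"

text \<open>Hahn--Banach for the sublinear functional
  \<open>q(x) = inf {\<parallel>Re x + c\<parallel> - s (2 Re \<psi>(a) - 1) | s > 0, c \<ge> s a\<^sup>*a}\<close>; since
  \<open>2 Re \<psi>(a) - 1 \<le> \<bar>\<psi>(a)\<bar>\<^sup>2 \<le> \<parallel>a\<parallel>\<^sup>2\<close>, it is bounded below by \<open>- \<parallel>x\<parallel>\<close>.\<close>

theorem dominating_positive_functional: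
  fixes \<psi> :: "'a::cstar_algebra cdual"
  assumes \<psi>: "norm \<psi> \<le> 1"
  obtains \<phi> where "posf \<phi>" "norm \<phi> \<le> 1" "\<And>a. (cmod (\<psi> \<cdot> a))\<^sup>2 \<le> Re (\<phi> \<cdot> (adj a * a))"
proof -
  define re :: "'a \<Rightarrow> 'a" where "re x = (1/2) *\<^sub>R (x + adj x)" for x
  have re_add: "re (x + y) = re x + re y" and re_scale: "re (r *\<^sub>R x) = r *\<^sub>R re x" for x y r
    by (simp_all add: re_def adj_simps algebra_simps)
  have re_norm: "norm (re x) \<le> norm x" for x
    using norm_triangle_ineq[of x "adj x"] by (simp add: re_def norm_adj)
  define I where "I = {(c :: 'a, s :: real, a :: 'a). s > 0 \<and> posA (c - s *\<^sub>R (adj a * a))}"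
  define F where "F = (\<lambda>(c, s, a) x. norm (re x + c) - s * (2 * Re (\<psi> \<cdot> a) - 1))"
  have low: "- norm x \<le> F i x" if iI: "i \<in> I" for i x
  proof -
    obtain c s a where i: "i = (c, s, a)" "s > 0" "posA (c - s *\<^sub>R (adj a * a))"
      using iI by (auto simp: I_def)
    have "\<bar>Re (\<psi> \<cdot> a)\<bar> \<le> norm a"
      using norm_cdual_apply[of \<psi> a] mult_right_mono[OF \<psi>, of "norm a"] abs_Re_le_cmod[of "\<psi> \<cdot> a"] by simp
    then have "(Re (\<psi> \<cdot> a))\<^sup>2 \<le> (norm a)\<^sup>2" by (metis abs_le_square_iff abs_norm_cancel)
    moreover have "0 \<le> (Re (\<psi> \<cdot> a) - 1)\<^sup>2" by simp
    ultimately have "2 * Re (\<psi> \<cdot> a) - 1 \<le> (norm a)\<^sup>2" by (simp add: power2_diff)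
    then have "s * (2 * Re (\<psi> \<cdot> a) - 1) \<le> norm (s *\<^sub>R (adj a * a))"
      using i(2) by (simp add: cstar_identity mult_left_mono)
    also have "\<dots> \<le> norm c" using i by (intro posA_norm_mono posA_scaleR posA_adj_mult) auto
    also have "norm c \<le> norm (re x + c) + norm x"
      using norm_triangle_ineq4[of "re x + c" "re x"] re_norm[of x] by simp
    finally show ?thesis by (simp add: i F_def)
  qed
  have "sublin (\<lambda>x. INF i\<in>I. F i x)"
  proof (rule sublin_INF[where B = "\<lambda>x. - norm x"])
    show "I \<noteq> {}" by (auto simp: I_def intro!: exI[of _ 0] exI[of _ 1] simp: posA_def simp flip: zero_uni_def)
    fix i j x y assume "i \<in> I" "j \<in> I"
    then obtain c s a d t b where i: "i = (c, s, a)" "s > 0" "posA (c - s *\<^sub>R (adj a * a))"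
      and j: "j = (d, t, b)" "t > 0" "posA (d - t *\<^sub>R (adj b * b))" by (auto simp: I_def)
    define m where "m = (1 / (s + t)) *\<^sub>R (s *\<^sub>R a + t *\<^sub>R b)"
    have "(s + t) *\<^sub>R (adj m * m) = (1 / (s + t)) *\<^sub>R (adj (s *\<^sub>R a + t *\<^sub>R b) * (s *\<^sub>R a + t *\<^sub>R b))"
      using i j by (simp add: m_def adj_scaleR)
    moreover have "posA (c - s *\<^sub>R (adj a * a) + (d - t *\<^sub>R (adj b * b)) + (s *\<^sub>R (adj a * a) + t *\<^sub>R (adj b * b)
      - (1 / (s + t)) *\<^sub>R (adj (s *\<^sub>R a + t *\<^sub>R b) * (s *\<^sub>R a + t *\<^sub>R b))))"
      using i j by (intro posA_add posA_convex)
    ultimately have "posA (c + d - (s + t) *\<^sub>R (adj m * m))" by (simp add: algebra_simps)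
    then have k: "(c + d, s + t, m) \<in> I" using i j by (simp add: I_def)
    have "(s + t) * Re (\<psi> \<cdot> m) = s * Re (\<psi> \<cdot> a) + t * Re (\<psi> \<cdot> b)"
      using i j by (simp add: m_def cdual_simps)
    then have "F (c + d, s + t, m) (x + y) \<le> F i x + F j y"
    proof -
      have "re (x + y) + (c + d) = (re x + c) + (re y + d)" by (simp add: re_add)
      then have "norm (re (x + y) + (c + d)) \<le> norm (re x + c) + norm (re y + d)"
        by (simp only: norm_triangle_ineq)
      moreover have "(s + t) * (2 * Re (\<psi> \<cdot> m) - 1)
        = s * (2 * Re (\<psi> \<cdot> a) - 1) + t * (2 * Re (\<psi> \<cdot> b) - 1)"
        using \<open>(s + t) * Re (\<psi> \<cdot> m) = _\<close> by (simp add: algebra_simps)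
      ultimately show ?thesis unfolding i j F_def by simp
    qed
    with k show "\<exists>k\<in>I. F k (x + y) \<le> F i x + F j y" by blast
  next
    fix i r x assume "i \<in> I" and r: "(r::real) > 0"
    then obtain c s a where i: "i = (c, s, a)" "s > 0" "posA (c - s *\<^sub>R (adj a * a))" by (auto simp: I_def)
    have "(r *\<^sub>R c, r * s, a) \<in> I" using posA_scaleR[OF i(3), of r] i r by (simp add: I_def algebra_simps)
    moreover have "F (r *\<^sub>R c, r * s, a) (r *\<^sub>R x) \<le> r * F i x"
    proof -
      have "norm (re (r *\<^sub>R x) + r *\<^sub>R c) = r * norm (re x + c)"
        using r by (simp only: re_scale scaleR_add_right[symmetric] norm_scaleR abs_of_pos)
      then show ?thesis by (simp add: i F_def algebra_simps)
    qed
    ultimately show "\<exists>k\<in>I. F k (r *\<^sub>R x) \<le> r * F i x" by blast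
  next
    fix e :: real assume "e > 0"
    then have "(0, e, 0) \<in> I" "F (0, e, 0) 0 = e"
      by (auto simp: I_def F_def re_def posA_def linear_0[OF bounded_linear.linear[OF bounded_linear_cdual_apply]]
        simp flip: zero_uni_def)
    then show "\<exists>i\<in>I. F i 0 \<le> e" by force
  qed (use low in auto)
  then obtain f where f: "linear f" "\<And>x. f x \<le> (INF i\<in>I. F i x)" using hahn_banach by blast
  have fF: "f x \<le> F i x" if "i \<in> I" for i x
    using f(2)[of x] cINF_lower[OF bdd_belowI2[where m = "- norm x"] that, of "\<lambda>i. F i x"] low by fastforce
  have I0: "(adj b * b, e, 0) \<in> I" if "e > 0" for b e using that posA_adj_mult[of b] by (simp add: I_def)
  have \<psi>0: "\<psi> \<cdot> 0 = 0" by (rule linear_0[OF bounded_linear.linear[OF bounded_linear_cdual_apply]])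
  \<comment> \<open>The triple with last entry 0 and weight e costs only e beyond the norm term, and
    e is arbitrary.\<close>
  have f_le: "f x \<le> norm (re x + adj b * b)" for x b
    by (rule field_le_epsilon) (use fF[OF I0] in \<open>fastforce simp: F_def \<psi>0\<close>)
  have "f x \<le> norm x" for x using f_le[of x 0] re_norm[of x] by simp
  then obtain \<phi> where \<phi>: "norm \<phi> \<le> 1" "\<And>x. \<phi> \<cdot> x = Complex (f x) (- f (\<i> *\<^sub>C x))"
    using cdual_of_real_functional[OF f(1)] by metis
  have re_sa: "re x = x" if "adj x = x" for x
    unfolding re_def that by (simp flip: scaleR_2)
  \<comment> \<open>At x = - (adj b) b the norm term vanishes.\<close>
  have "f (adj b * b) \<ge> 0" for b
    using f_le[of "- (adj b * b)" b] linear_neg[OF f(1)] by (simp add: re_sa adj_simps)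
  \<comment> \<open>The real part of i (adj b) b is 0, so \<open>f\<close> vanishes there and the
    functional \<open>\<phi>\<close> is real on \<open>adj b * b\<close>.\<close>
  moreover have "f (\<i> *\<^sub>C (adj b * b)) = 0" for b
    using f_le[of "\<i> *\<^sub>C (adj b * b)" 0] f_le[of "- (\<i> *\<^sub>C (adj b * b))" 0] linear_neg[OF f(1)]
    by (simp add: re_def adj_simps ii_mult scaleC_simps)
  ultimately have "posf \<phi>" by (simp add: posf_def \<phi>(2) complex_nonneg_Reals_iff)
  moreover have "(cmod (\<psi> \<cdot> a))\<^sup>2 \<le> Re (\<phi> \<cdot> (adj a * a))" for a
  proof -
    define P where "P = Re (\<phi> \<cdot> (adj a * a))"
    define w where "w = cmod (\<psi> \<cdot> a)"
    have P: "P \<ge> 0" using \<open>posf \<phi>\<close> by (auto simp: posf_def P_def complex_nonneg_Reals_iff)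
    \<comment> \<open>The triple with weight 1 has norm term 0 at x = - (adj b) b.\<close>
    have 1: "2 * Re (\<psi> \<cdot> b) - 1 \<le> Re (\<phi> \<cdot> (adj b * b))" for b
    proof -
      have "(adj b * b, 1, b) \<in> I" by (simp add: I_def posA_def flip: zero_uni_def)
      from fF[OF this, of "- (adj b * b)"] show ?thesis
        by (simp add: F_def re_sa adj_simps linear_neg[OF f(1)] \<phi>(2))
    qed
    \<comment> \<open>Scaling \<open>a\<close> by t and a phase gives an inequality for every real
      t; the choice t = w/P yields w^2 \<le> P.\<close>
    have 2: "2 * t * w - 1 \<le> t\<^sup>2 * P" for t
    proof -
      obtain c where c: "cmod c = 1" "c * (\<psi> \<cdot> a) = w" unfolding w_def by (rule phase_ex)
      have "cnj c * c = 1" using c(1) by (metis complex_norm_square mult.commute of_real_1 power_one)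
      then have "cnj (t * c) * (t * c) = complex_of_real (t\<^sup>2)"
        by (simp add: power2_eq_square mult_ac)
      then have "\<phi> \<cdot> (adj ((t * c) *\<^sub>C a) * ((t * c) *\<^sub>C a)) = t\<^sup>2 * (\<phi> \<cdot> (adj a * a))"
        by (simp only: adj_scaleC mult_scaleC_left mult_scaleC_right scaleC_scaleC cdual_apply_scaleC)
          (simp add: mult_ac)
      moreover have "Re (\<psi> \<cdot> ((t * c) *\<^sub>C a)) = t * w"
        by (simp add: cdual_apply_scaleC mult.assoc c(2))
      ultimately show ?thesis using 1[of "(t * c) *\<^sub>C a"] by (simp add: P_def)
    qed
    show "w\<^sup>2 \<le> P"
    proof (cases "P = 0")
      case True
      have "w = 0"
      proof (rule ccontr)
        assume "w \<noteq> 0"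
        with 2[of "1 / w"] True show False by simp
      qed
      then show ?thesis using P by simp
    next
      case False
      with P 2[of "w / P"] have "2 * w\<^sup>2 / P - 1 \<le> w\<^sup>2 / P"
        by (simp add: power2_eq_square)
      then show ?thesis using False P by (simp add: field_simps)
    qed
  qed
  ultimately show thesis using that \<phi>(1) by blast
qed

section \<open>Arens regularity and the C*-identity in the bidual\<close>

lemma quadratic_nonneg:
  fixes P Q w :: real
  assumes "\<And>t. 0 \<le> P - 2 * t * w + t\<^sup>2 * Q" "Q \<ge> 0"
  shows "w\<^sup>2 \<le> P * Q"
proof (cases "Q = 0")
  case True
  have "w = 0"
  proof (rule ccontr)
    assume "w \<noteq> 0"
    with assms(1)[of "(P + 1) / (2 * w)"] True show False by simp
  qed
  then show ?thesis by (simp add: True)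
next
  case False
  with assms(2) assms(1)[of "w / Q"] have "0 \<le> P - w\<^sup>2 / Q"
    by (simp add: power2_eq_square)
  then show ?thesis using False assms(2) by (simp add: field_simps)
qed

lemma le_add_eps:
  fixes x y K :: real
  assumes "\<And>e. e > 0 \<Longrightarrow> x \<le> y + e * K" "K \<ge> 0" shows "x \<le> y"
proof (rule field_le_epsilon)
  fix e :: real assume "e > 0"
  then have "x \<le> y + e / (K + 1) * K" using assms(2) by (intro assms(1)) simp
  also have "e / (K + 1) * K \<le> e" using assms(2) \<open>e > 0\<close> by (simp add: field_simps)
  finally show "x \<le> y + e" by simp
qed

lemma norm_tri3:
  fixes x :: "'a::real_normed_vector"
  shows "norm (x - w) \<le> norm (x - y) + norm (y - z) + norm (w - z)"
  using dist_triangle[of x w z] dist_triangle[of x z y] by (simp add: dist_norm norm_minus_commute)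

lemma cdual_apply_diff: "f \<cdot> (x - y) = f \<cdot> x - f \<cdot> y"
  by (rule linear_diff[OF bounded_linear.linear[OF bounded_linear_cdual_apply]])

lemma cdual_apply_0 [simp]: "f \<cdot> 0 = 0"
  by (rule linear_0[OF bounded_linear.linear[OF bounded_linear_cdual_apply]])

text \<open>The GNS seminorm of a positive functional, with inner product
  \<open>\<phi> \<cdot> (adj b * a)\<close>. The space is neither divided by its null vectors nor
  completed, so Riesz vectors exist only approximately.\<close>

definition N :: "'a::cstar_algebra cdual \<Rightarrow> 'a \<Rightarrow> real"
  where "N \<phi> a = sqrt (Re (\<phi> \<cdot> (adj a * a)))"

lemma posf_nonneg:
  assumes "posf \<phi>"
  shows "Re (\<phi> \<cdot> (adj a * a)) \<ge> 0" "Im (\<phi> \<cdot> (adj a * a)) = 0"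
  using assms by (auto simp: posf_def complex_nonneg_Reals_iff)

lemma N_nonneg: "posf \<phi> \<Longrightarrow> N \<phi> a \<ge> 0"
  by (simp add: N_def posf_nonneg)

lemma N_square: "posf \<phi> \<Longrightarrow> \<phi> \<cdot> (adj a * a) = complex_of_real ((N \<phi> a)\<^sup>2)"
  by (simp add: N_def posf_nonneg complex_eq_iff)

lemma posf_herm:
  assumes "posf \<phi>" shows "\<phi> \<cdot> (adj b * a) = cnj (\<phi> \<cdot> (adj a * b))"
proof -
  have "Im (\<phi> \<cdot> (adj a * b) + \<phi> \<cdot> (adj b * a)) = 0"
    using posf_nonneg(2)[OF assms, of "a + b"] posf_nonneg(2)[OF assms, of a] posf_nonneg(2)[OF assms, of b]
    by (simp add: adj_simps algebra_simps cdual_apply_add)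
  moreover have "Im (\<i> * (\<phi> \<cdot> (adj a * b)) - \<i> * (\<phi> \<cdot> (adj b * a))) = 0"
    using posf_nonneg(2)[OF assms, of "a + \<i> *\<^sub>C b"] posf_nonneg(2)[OF assms, of a] posf_nonneg(2)[OF assms, of b]
    by (simp add: adj_simps algebra_simps cdual_apply_add ii_mult cdual_apply_diff cdual_apply_scaleC scaleC_simps)
  ultimately show ?thesis by (simp add: complex_eq_iff)
qed

lemma posf_expand:
  assumes "posf \<phi>"
  shows "Re (\<phi> \<cdot> (adj (b + c *\<^sub>C a) * (b + c *\<^sub>C a)))
    = Re (\<phi> \<cdot> (adj b * b)) + 2 * Re (c * (\<phi> \<cdot> (adj b * a))) + (cmod c)\<^sup>2 * Re (\<phi> \<cdot> (adj a * a))"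
proof -
  have "\<phi> \<cdot> (adj (b + c *\<^sub>C a) * (b + c *\<^sub>C a)) = \<phi> \<cdot> (adj b * b) + c * (\<phi> \<cdot> (adj b * a))
    + cnj c * (\<phi> \<cdot> (adj a * b)) + (cnj c * c) * (\<phi> \<cdot> (adj a * a))"
    by (simp add: adj_simps algebra_simps cdual_apply_add mult_scaleC_left mult_scaleC_right cdual_apply_scaleC)
  also have "cnj c * (\<phi> \<cdot> (adj a * b)) = cnj (c * (\<phi> \<cdot> (adj b * a)))" by (simp add: posf_herm[OF assms, of b a])
  also have "cnj c * c = complex_of_real ((cmod c)\<^sup>2)" by (metis complex_norm_square mult.commute)
  finally show ?thesis by simp
qed

lemma posf_CS:
  assumes "posf \<phi>" shows "cmod (\<phi> \<cdot> (adj b * a)) \<le> N \<phi> b * N \<phi> a"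
proof -
  obtain c where c: "cmod c = 1" "c * (\<phi> \<cdot> (adj b * a)) = cmod (\<phi> \<cdot> (adj b * a))" by (rule phase_ex)
  define w where "w = cmod (\<phi> \<cdot> (adj b * a))"
  have "w\<^sup>2 \<le> Re (\<phi> \<cdot> (adj b * b)) * Re (\<phi> \<cdot> (adj a * a))"
  proof (rule quadratic_nonneg)
    fix t :: real
    have "0 \<le> Re (\<phi> \<cdot> (adj (b + (- t * c) *\<^sub>C a) * (b + (- t * c) *\<^sub>C a)))"
      by (rule posf_nonneg[OF assms])
    also have "\<dots> = Re (\<phi> \<cdot> (adj b * b)) - 2 * t * w + t\<^sup>2 * Re (\<phi> \<cdot> (adj a * a))"
      unfolding posf_expand[OF assms] using c by (simp add: norm_mult mult.assoc w_def)
    finally show "0 \<le> Re (\<phi> \<cdot> (adj b * b)) - 2 * t * w + t\<^sup>2 * Re (\<phi> \<cdot> (adj a * a))" .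
  qed (rule posf_nonneg[OF assms])
  then have "w\<^sup>2 \<le> (N \<phi> b * N \<phi> a)\<^sup>2"
    by (simp add: N_def power_mult_distrib posf_nonneg[OF assms])
  then show ?thesis unfolding w_def
    by (rule power2_le_imp_le) (simp add: N_nonneg assms)
qed

lemma posf_posA:
  assumes "posf \<phi>" "posA x" shows "Re (\<phi> \<cdot> x) \<ge> 0"
  using assms posA_root[OF assms(2)] posf_nonneg by metis

lemma N_le_norm:
  assumes "posf \<phi>" shows "N \<phi> a \<le> sqrt (norm \<phi>) * norm a"
proof -
  have "Re (\<phi> \<cdot> (adj a * a)) \<le> norm \<phi> * norm (adj a * a)"
    using norm_cdual_apply[of \<phi> "adj a * a"] complex_Re_le_cmod order_trans by blast
  then have "N \<phi> a \<le> sqrt (norm \<phi> * (norm a)\<^sup>2)" by (simp add: N_def cstar_identity)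
  then show ?thesis by (simp add: real_sqrt_mult)
qed

text \<open>In the unitization (norm a)^2 - (adj a) a is positive, and conjugating it by b keeps it
  so.\<close>

lemma N_mult_le:
  assumes "posf \<phi>" shows "N \<phi> (a * b) \<le> norm a * N \<phi> b"
proof -
  let ?a = "Uni a 0" and ?b = "Uni b 0"
  have "pos ((norm a)\<^sup>2 *\<^sub>R 1 - adj ?a * ?a)"
    by (rule pos_norm_minus(1)) (auto simp: cstar_identity norm_Uni)
  then have "pos (adj ?b * ((norm a)\<^sup>2 *\<^sub>R 1 - adj ?a * ?a) * ?b)" by (rule pos_conj)
  also have "adj ?b * ((norm a)\<^sup>2 *\<^sub>R 1 - adj ?a * ?a) * ?b
    = Uni ((norm a)\<^sup>2 *\<^sub>R (adj b * b) - adj (a * b) * (a * b)) 0"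
    by (simp add: Uni_simps algebra_simps adj_mult)
  finally have "0 \<le> Re (\<phi> \<cdot> ((norm a)\<^sup>2 *\<^sub>R (adj b * b) - adj (a * b) * (a * b)))"
    by (intro posf_posA assms) (simp add: posA_def)
  then have "Re (\<phi> \<cdot> (adj (a * b) * (a * b))) \<le> (norm a)\<^sup>2 * Re (\<phi> \<cdot> (adj b * b))"
    by (simp add: cdual_apply_diff cdual_apply_scaleR)
  then have "N \<phi> (a * b) \<le> sqrt ((norm a)\<^sup>2 * Re (\<phi> \<cdot> (adj b * b)))" by (simp add: N_def)
  then show ?thesis by (simp add: N_def real_sqrt_mult)
qed

text \<open>Riesz representation for the pre-Hilbert space of \<open>\<phi>\<close>: the representing vector is an
  approximate minimiser of \<open>\<phi>(b\<^sup>*b) - 2 Re \<xi>(b)\<close>.\<close>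

lemma riesz_approx:
  assumes \<phi>: "posf \<phi>" and \<xi>: "\<And>a. cmod (\<xi> \<cdot> a) \<le> C * N \<phi> a" and e: "e > 0"
  obtains b where "\<And>a. cmod (\<xi> \<cdot> a - \<phi> \<cdot> (adj b * a)) \<le> e * N \<phi> a"
proof -
  define J where "J b = Re (\<phi> \<cdot> (adj b * b)) - 2 * Re (\<xi> \<cdot> b)" for b
  have "- (C\<^sup>2) \<le> J b" for b
  proof -
    have "2 * Re (\<xi> \<cdot> b) \<le> 2 * (C * N \<phi> b)" using \<xi>[of b] complex_Re_le_cmod[of "\<xi> \<cdot> b"] by linarith
    moreover have "0 \<le> (N \<phi> b - C)\<^sup>2" by simp
    ultimately show ?thesis by (simp add: J_def N_square[OF \<phi>] power2_diff algebra_simps)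
  qed
  then have bdd: "bdd_below (range J)" by (intro bdd_belowI2)
  \<comment> \<open>The quadratic polynomial t \<mapsto> J (b + t c a) stays above J b - e^2; its
    discriminant is the required bound.\<close>
  obtain b where b: "J b < (INF b. J b) + e\<^sup>2"
    using cInf_lessD[of "range J" "(INF b. J b) + e\<^sup>2"] e by auto
  have "cmod (\<xi> \<cdot> a - \<phi> \<cdot> (adj b * a)) \<le> e * N \<phi> a" for a
  proof -
    define w where "w = cmod (\<xi> \<cdot> a - \<phi> \<cdot> (adj b * a))"
    obtain c where c: "cmod c = 1" "c * (\<xi> \<cdot> a - \<phi> \<cdot> (adj b * a)) = w" unfolding w_def by (rule phase_ex)
    have "w\<^sup>2 \<le> e\<^sup>2 * Re (\<phi> \<cdot> (adj a * a))"
    proof (rule quadratic_nonneg)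
      fix t :: real
      have 1: "J b - e\<^sup>2 \<le> J (b + (t * c) *\<^sub>C a)"
        using b cINF_lower[OF bdd, of "b + (t * c) *\<^sub>C a"] by simp
      have 2: "2 * Re (t * c * (\<phi> \<cdot> (adj b * a))) - 2 * Re (t * c * (\<xi> \<cdot> a)) = - 2 * t * w"
      proof -
        have "t * c * (\<phi> \<cdot> (adj b * a)) - t * c * (\<xi> \<cdot> a) = - (t * (c * (\<xi> \<cdot> a - \<phi> \<cdot> (adj b * a))))"
          by (simp add: algebra_simps)
        also have "\<dots> = complex_of_real (- t * w)" by (simp add: c(2))
        finally have "Re (t * c * (\<phi> \<cdot> (adj b * a)) - t * c * (\<xi> \<cdot> a)) = - t * w" by (metis Re_complex_of_real)
        then show ?thesis by (simp only: minus_complex.sel)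
      qed
      have 3: "(cmod (t * c))\<^sup>2 = t\<^sup>2" using c by (simp add: norm_mult)
      have "J (b + (t * c) *\<^sub>C a) = J b - 2 * t * w + t\<^sup>2 * Re (\<phi> \<cdot> (adj a * a))"
        using 2 unfolding J_def posf_expand[OF \<phi>] 3 by (simp add: cdual_apply_add cdual_apply_scaleC)
      with 1 show "0 \<le> e\<^sup>2 - 2 * t * w + t\<^sup>2 * Re (\<phi> \<cdot> (adj a * a))" by simp
    qed (rule posf_nonneg[OF \<phi>])
    then have "w\<^sup>2 \<le> (e * N \<phi> a)\<^sup>2" by (simp add: power_mult_distrib N_def posf_nonneg[OF \<phi>])
    then show ?thesis unfolding w_def by (rule power2_le_imp_le) (use e in \<open>simp add: N_nonneg \<phi>\<close>)
  qed
  then show thesis using that by blast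
qed

lemma arens2_embed: "arens2 (embed c) \<psi> \<cdot> a = \<psi> \<cdot> (a * c)"
  by (simp add: arens2.rep_eq embed.rep_eq arens1.rep_eq)

text \<open>Strong density of the algebra in the bidual, tested at the cyclic vector of \<open>\<phi>\<close>.\<close>

lemma strong_approx:
  assumes \<phi>: "posf \<phi>" and e: "e > 0"
  shows "\<exists>c. (\<forall>\<xi> C. C \<ge> 0 \<longrightarrow> (\<forall>a. cmod (\<xi> \<cdot> a) \<le> C * N \<phi> a) \<longrightarrow> cmod (F \<cdot> \<xi> - \<xi> \<cdot> c) \<le> e * C)
    \<and> (\<forall>a. cmod (cdual_adj (arens2 F \<phi>) \<cdot> a - \<phi> \<cdot> (adj c * a)) \<le> e * N \<phi> a)
    \<and> N \<phi> c \<le> norm F * sqrt (norm \<phi>) + e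
    \<and> (\<forall>a. cmod (cdual_adj (arens2 F \<phi>) \<cdot> a) \<le> (norm F * sqrt (norm \<phi>)) * N \<phi> a)"
proof -
  \<comment> \<open>\<open>X\<close> is the functional that the vector of F in the GNS space would
    represent. Its approximate Riesz vector \<open>c\<close> is an element of the algebra imitating
    F at that vector.\<close>
  define X where "X = cdual_adj (arens2 F \<phi>)"
  have X: "X \<cdot> a = cnj (F \<cdot> arens1 \<phi> (adj a))" for a
    by (simp add: X_def cdual_adj.rep_eq arens2.rep_eq)
  define s where "s = sqrt (norm \<phi>)"
  have s: "s \<ge> 0" by (simp add: s_def)
  note Nn = N_nonneg[OF \<phi>]
  have 1: "norm (arens1 \<phi> (adj a)) \<le> s * N \<phi> a" for a
  proof (rule norm_cdual_bound)
    fix b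
    have "cmod (\<phi> \<cdot> (adj a * b)) \<le> N \<phi> a * N \<phi> b" by (rule posf_CS[OF \<phi>])
    also have "\<dots> \<le> N \<phi> a * (s * norm b)"
      unfolding s_def by (intro mult_left_mono N_le_norm \<phi> Nn)
    finally show "cmod (arens1 \<phi> (adj a) \<cdot> b) \<le> s * N \<phi> a * norm b"
      by (simp add: arens1.rep_eq mult_ac)
  qed (simp add: s Nn)
  have Xb: "cmod (X \<cdot> a) \<le> (norm F * s) * N \<phi> a" for a
  proof -
    have "cmod (X \<cdot> a) \<le> norm F * norm (arens1 \<phi> (adj a))" by (simp add: X norm_cdual_apply)
    also have "\<dots> \<le> norm F * (s * N \<phi> a)" by (intro mult_left_mono 1 norm_ge_zero)
    finally show ?thesis by (simp add: mult.assoc)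
  qed
  obtain c where c: "\<And>a. cmod (X \<cdot> a - \<phi> \<cdot> (adj c * a)) \<le> e * N \<phi> a"
    using riesz_approx[OF \<phi> Xb e] by blast
  have Nbound: "N \<phi> b \<le> C + e'" if "\<And>a. cmod (\<xi> \<cdot> a) \<le> C * N \<phi> a"
    "\<And>a. cmod (\<xi> \<cdot> a - \<phi> \<cdot> (adj b * a)) \<le> e' * N \<phi> a" "C + e' \<ge> 0" for \<xi> b C e'
  proof (cases "N \<phi> b = 0")
    case False
    have "(N \<phi> b)\<^sup>2 = cmod (\<phi> \<cdot> (adj b * b))" by (simp add: N_square[OF \<phi>] norm_power Nn)
    also have "\<dots> \<le> cmod (\<xi> \<cdot> b) + cmod (\<xi> \<cdot> b - \<phi> \<cdot> (adj b * b))"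
      using norm_triangle_ineq4[of "\<xi> \<cdot> b" "\<xi> \<cdot> b - \<phi> \<cdot> (adj b * b)"] by simp
    also have "\<dots> \<le> (C + e') * N \<phi> b" using that(1)[of b] that(2)[of b] by (simp add: distrib_right)
    finally show ?thesis using False Nn[of b] by (simp add: power2_eq_square)
  qed (use that in simp)
  have main: "cmod (F \<cdot> \<xi> - \<xi> \<cdot> c) \<le> e * C" if C: "C \<ge> 0" and \<xi>: "\<And>a. cmod (\<xi> \<cdot> a) \<le> C * N \<phi> a" for \<xi> C
  proof (rule le_add_eps)
    fix d :: real assume d: "d > 0"
    \<comment> \<open>Writing \<open>\<xi>\<close> approximately as
      \<open>\<phi> \<cdot> (adj b * a)\<close> turns the comparison of F with c on
      \<open>\<xi>\<close> into the estimate of \<open>X\<close> at b that chose c.\<close>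
    obtain b where b: "\<And>a. cmod (\<xi> \<cdot> a - \<phi> \<cdot> (adj b * a)) \<le> d * N \<phi> a"
      using riesz_approx[OF \<phi> \<xi> d] by blast
    have "norm (\<xi> - arens1 \<phi> (adj b)) \<le> d * s"
    proof (rule norm_cdual_bound)
      fix a
      have "cmod ((\<xi> - arens1 \<phi> (adj b)) \<cdot> a) \<le> d * N \<phi> a"
        using b[of a] by (simp add: cdual_diff_apply arens1.rep_eq)
      also have "\<dots> \<le> d * (s * norm a)"
        unfolding s_def by (intro mult_left_mono N_le_norm \<phi>) (use d in simp)
      finally show "cmod ((\<xi> - arens1 \<phi> (adj b)) \<cdot> a) \<le> d * s * norm a" by (simp add: mult.assoc)
    qed (use d s in simp)
    then have "cmod (F \<cdot> (\<xi> - arens1 \<phi> (adj b))) \<le> norm F * (d * s)"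
      using norm_cdual_apply[of F "\<xi> - arens1 \<phi> (adj b)"] mult_left_mono[of _ "d * s" "norm F"]
      by (meson norm_ge_zero order_trans)
    then have i: "cmod (F \<cdot> \<xi> - F \<cdot> arens1 \<phi> (adj b)) \<le> norm F * (d * s)"
      by (simp add: cdual_apply_diff)
    have "F \<cdot> arens1 \<phi> (adj b) - \<phi> \<cdot> (adj b * c) = cnj (X \<cdot> b - \<phi> \<cdot> (adj c * b))"
      by (simp add: X posf_herm[OF \<phi>, of b c])
    then have "cmod (F \<cdot> arens1 \<phi> (adj b) - \<phi> \<cdot> (adj b * c)) = cmod (X \<cdot> b - \<phi> \<cdot> (adj c * b))"
      by (simp only: complex_mod_cnj)
    also have "\<dots> \<le> e * N \<phi> b" by (rule c)
    also have "\<dots> \<le> e * (C + d)" using Nbound[OF \<xi> b] C d e by (intro mult_left_mono) auto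
    finally have ii: "cmod (F \<cdot> arens1 \<phi> (adj b) - \<phi> \<cdot> (adj b * c)) \<le> e * (C + d)" .
    have iii: "cmod (\<xi> \<cdot> c - \<phi> \<cdot> (adj b * c)) \<le> d * N \<phi> c" by (rule b)
    have "cmod (F \<cdot> \<xi> - \<xi> \<cdot> c) \<le> norm F * (d * s) + e * (C + d) + d * N \<phi> c"
      using norm_tri3[of "F \<cdot> \<xi>" "\<xi> \<cdot> c" "F \<cdot> arens1 \<phi> (adj b)" "\<phi> \<cdot> (adj b * c)"] i ii iii by linarith
    then show "cmod (F \<cdot> \<xi> - \<xi> \<cdot> c) \<le> e * C + d * (norm F * s + e + N \<phi> c)"
      by (simp add: algebra_simps)
  qed (use e s Nn in simp)
  have "N \<phi> c \<le> norm F * s + e" by (rule Nbound[OF Xb c]) (use e s in simp)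
  with main c Xb show ?thesis unfolding X_def s_def by (intro exI[of _ c] conjI allI impI) auto
qed

text \<open>\<open>N\<close> is homogeneous of degree 1/2 in the functional, whence the square in
  the bound on \<open>norm \<phi>\<close>.\<close>

lemma dominating_ex:
  fixes \<psi> :: "'a::cstar_algebra cdual"
  obtains \<phi> where "posf \<phi>" "norm \<phi> \<le> (norm \<psi>)\<^sup>2" "\<And>a. cmod (\<psi> \<cdot> a) \<le> N \<phi> a"
proof (cases "\<psi> = 0")
  case True
  have "(0 :: 'a cdual) \<cdot> a = 0" for a by transfer simp
  with True show ?thesis by (intro that[of 0]) (auto simp: posf_def N_def)
next
  case False
  define r where "r = norm \<psi>"
  have r: "r > 0" using False by (simp add: r_def)
  obtain \<phi> where \<phi>: "posf \<phi>" "norm \<phi> \<le> 1" "\<And>a. (cmod (((1/r) *\<^sub>R \<psi>) \<cdot> a))\<^sup>2 \<le> Re (\<phi> \<cdot> (adj a * a))"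
    using dominating_positive_functional[of "(1/r) *\<^sub>R \<psi>"] r by (auto simp: r_def)
  show ?thesis
  proof (rule that[of "r\<^sup>2 *\<^sub>R \<phi>"])
    show "posf (r\<^sup>2 *\<^sub>R \<phi>)" using \<phi>(1) by (auto simp: posf_def cdual_scaleR_apply complex_nonneg_Reals_iff)
    show "norm (r\<^sup>2 *\<^sub>R \<phi>) \<le> (norm \<psi>)\<^sup>2" using \<phi>(2) mult_left_mono[of "norm \<phi>" 1 "r\<^sup>2"] by (simp add: r_def)
    fix a
    have "(cmod (\<psi> \<cdot> a) / r)\<^sup>2 \<le> Re (\<phi> \<cdot> (adj a * a))"
      using \<phi>(3)[of a] r by (simp add: cdual_scaleR_apply)
    then have "(cmod (\<psi> \<cdot> a))\<^sup>2 \<le> r\<^sup>2 * Re (\<phi> \<cdot> (adj a * a))" using r by (simp add: power_divide field_simps)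
    then show "cmod (\<psi> \<cdot> a) \<le> N (r\<^sup>2 *\<^sub>R \<phi>) a"
      by (simp add: N_def cdual_scaleR_apply real_le_rsqrt)
  qed
qed

text \<open>Builds the product in the other order: \<open>G \<cdot> rarens \<psi> F\<close> is the
  second Arens product of F and G evaluated at \<open>\<psi>\<close>.\<close>

lift_definition rarens :: "'a::cstar_algebra cdual \<Rightarrow> 'a bidual \<Rightarrow> 'a cdual"
  is "\<lambda>\<psi> F a. F \<cdot> arens2 (embed a) \<psi>"
proof (rule cdualI)
  fix \<psi> :: "'a cdual" and F :: "'a bidual" and a b :: 'a and r :: real and c :: complex
  have "embed (a + b) = embed a + embed b" "embed (r *\<^sub>R a) = r *\<^sub>R embed a" "embed (c *\<^sub>C a) = c *\<^sub>C embed a"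
    by (rule cdual_eqI, simp add: embed.rep_eq cdual_simps)+
  then show "F \<cdot> arens2 (embed (a + b)) \<psi> = F \<cdot> arens2 (embed a) \<psi> + F \<cdot> arens2 (embed b) \<psi>"
    "F \<cdot> arens2 (embed (r *\<^sub>R a)) \<psi> = r *\<^sub>R (F \<cdot> arens2 (embed a) \<psi>)"
    "F \<cdot> arens2 (embed (c *\<^sub>C a)) \<psi> = c * (F \<cdot> arens2 (embed a) \<psi>)"
    by (simp_all add: arens2_linear cdual_simps)
  have "cmod (F \<cdot> arens2 (embed a) \<psi>) \<le> norm F * norm (arens2 (embed a) \<psi>)" by (rule norm_cdual_apply)
  also have "\<dots> \<le> norm F * (norm a * norm \<psi>)"
    using norm_arens2[of "embed a" \<psi>] by (intro mult_left_mono) (simp_all add: norm_embed)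
  finally show "cmod (F \<cdot> arens2 (embed a) \<psi>) \<le> (norm F * norm \<psi>) * norm a" by (simp add: mult_ac)
qed

text \<open>Both sides agree when G is \<open>embed c\<close>. If \<open>\<phi>\<close> dominates
  \<open>\<psi>\<close>, then \<open>rarens \<psi> F\<close> and all functionals
  \<open>arens1 \<psi> a\<close> are bounded in the seminorm \<open>N \<phi>\<close>, the latter
  with constant norm a. One \<open>c\<close> from \<open>strong_approx\<close> therefore imitates G
  on all of them at once.\<close>

theorem arens_regular: "(F \<odot> G) \<cdot> \<psi> = G \<cdot> rarens \<psi> (F :: 'a::cstar_algebra bidual)"
proof -
  obtain \<phi> where \<phi>: "posf \<phi>" "\<And>a. cmod (\<psi> \<cdot> a) \<le> N \<phi> a" using dominating_ex[of \<psi>] by blast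
  have "cmod ((F \<odot> G) \<cdot> \<psi> - G \<cdot> rarens \<psi> F) \<le> 0"
  proof (rule le_add_eps)
    fix e :: real assume e: "e > 0"
    obtain c where c: "\<And>\<xi> C. C \<ge> 0 \<Longrightarrow> \<forall>a. cmod (\<xi> \<cdot> a) \<le> C * N \<phi> a \<Longrightarrow> cmod (G \<cdot> \<xi> - \<xi> \<cdot> c) \<le> e * C"
      using strong_approx[OF \<phi>(1) e, of G] by auto
    have "norm (arens2 G \<psi> - arens2 (embed c) \<psi>) \<le> e"
    proof (rule norm_cdual_bound)
      fix a
      have "cmod (arens1 \<psi> a \<cdot> b) \<le> norm a * N \<phi> b" for b
        using \<phi>(2)[of "a * b"] N_mult_le[OF \<phi>(1), of a b] by (simp add: arens1.rep_eq)
      then have "cmod (G \<cdot> arens1 \<psi> a - arens1 \<psi> a \<cdot> c) \<le> e * norm a" by (intro c allI) auto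
      then show "cmod ((arens2 G \<psi> - arens2 (embed c) \<psi>) \<cdot> a) \<le> e * norm a"
        by (simp add: cdual_diff_apply arens2_embed arens2.rep_eq[of G] arens1.rep_eq)
    qed (use e in simp)
    then have "cmod (F \<cdot> (arens2 G \<psi> - arens2 (embed c) \<psi>)) \<le> norm F * e"
      by (meson norm_cdual_apply norm_ge_zero order_trans mult_left_mono)
    then have 1: "cmod ((F \<odot> G) \<cdot> \<psi> - F \<cdot> arens2 (embed c) \<psi>) \<le> norm F * e"
      by (simp add: bidual_mult.rep_eq cdual_apply_diff)
    have "cmod (rarens \<psi> F \<cdot> a) \<le> norm F * N \<phi> a" for a
    proof -
      have "norm (arens2 (embed a) \<psi>) \<le> N \<phi> a"
      proof (rule norm_cdual_bound)
        fix b
        show "cmod (arens2 (embed a) \<psi> \<cdot> b) \<le> N \<phi> a * norm b"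
          using \<phi>(2)[of "b * a"] N_mult_le[OF \<phi>(1), of b a] by (simp add: arens2_embed mult.commute)
      qed (rule N_nonneg[OF \<phi>(1)])
      then show ?thesis unfolding rarens.rep_eq
        by (meson norm_cdual_apply norm_ge_zero order_trans mult_left_mono)
    qed
    then have "cmod (G \<cdot> rarens \<psi> F - rarens \<psi> F \<cdot> c) \<le> e * norm F" by (intro c allI) auto
    then have 2: "cmod (F \<cdot> arens2 (embed c) \<psi> - G \<cdot> rarens \<psi> F) \<le> e * norm F"
      by (simp add: rarens.rep_eq norm_minus_commute)
    show "cmod ((F \<odot> G) \<cdot> \<psi> - G \<cdot> rarens \<psi> F) \<le> 0 + e * (2 * norm F)"
      using 1 2 norm_triangle_ineq[of "(F \<odot> G) \<cdot> \<psi> - F \<cdot> arens2 (embed c) \<psi>"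
          "F \<cdot> arens2 (embed c) \<psi> - G \<cdot> rarens \<psi> F"] by (simp add: algebra_simps)
  qed simp
  then show ?thesis by simp
qed

text \<open>The involution interchanges the two Arens products, so this is Arens regularity in
  another form.\<close>

lemma bidual_adj_mult: "bidual_adj (F \<odot> G) = bidual_adj G \<odot> bidual_adj (F :: 'a::cstar_algebra bidual)"
proof (rule cdual_eqI)
  fix \<psi> :: "'a cdual"
  have "cdual_adj (arens2 (embed (adj a)) \<psi>) = arens1 (cdual_adj \<psi>) a" for a
    by (rule cdual_eqI) (simp add: cdual_adj.rep_eq arens2_embed arens1.rep_eq adj_mult)
  then have "cdual_adj (rarens \<psi> (bidual_adj G)) = arens2 G (cdual_adj \<psi>)"
    by (intro cdual_eqI) (simp add: cdual_adj.rep_eq rarens.rep_eq bidual_adj.rep_eq arens2.rep_eq)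
  then show "bidual_adj (F \<odot> G) \<cdot> \<psi> = (bidual_adj G \<odot> bidual_adj F) \<cdot> \<psi>"
    unfolding arens_regular[of "bidual_adj G"] by (simp add: bidual_adj.rep_eq bidual_mult.rep_eq)
qed

text \<open>Elements c n of the algebra that imitate F at \<open>\<phi>\<close> have
  \<open>\<phi> \<cdot> (adj (c n) * c n)\<close> converging to the value in question. Positivity
  and the domination of \<open>\<psi>\<close> both pass to the limit.\<close>

theorem bidual_adj_mult_posf:
  assumes \<phi>: "posf \<phi>"
  shows "(bidual_adj F \<odot> F) \<cdot> \<phi> \<in> \<real>\<^sub>\<ge>\<^sub>0"
    and "(\<And>a. cmod (\<psi> \<cdot> a) \<le> N \<phi> a) \<Longrightarrow> (cmod (F \<cdot> \<psi>))\<^sup>2 \<le> Re ((bidual_adj F \<odot> F) \<cdot> \<phi>)"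
proof -
  define X where "X = cdual_adj (arens2 F \<phi>)"
  define K where "K = norm F * sqrt (norm \<phi>)"
  have K: "K \<ge> 0" by (simp add: K_def)
  have FF: "(bidual_adj F \<odot> F) \<cdot> \<phi> = cnj (F \<cdot> X)"
    by (simp add: bidual_mult.rep_eq bidual_adj.rep_eq X_def)
  define e where "e n = 1 / real (Suc n)" for n
  have e: "e n > 0" "e \<longlonglongrightarrow> 0" for n
    unfolding e_def using LIMSEQ_inverse_real_of_nat by (auto simp: inverse_eq_divide)
  have "\<exists>c. (\<forall>\<xi> C. C \<ge> 0 \<longrightarrow> (\<forall>a. cmod (\<xi> \<cdot> a) \<le> C * N \<phi> a) \<longrightarrow> cmod (F \<cdot> \<xi> - \<xi> \<cdot> c) \<le> e n * C)
    \<and> (\<forall>a. cmod (X \<cdot> a - \<phi> \<cdot> (adj c * a)) \<le> e n * N \<phi> a) \<and> N \<phi> c \<le> K + e n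
    \<and> (\<forall>a. cmod (X \<cdot> a) \<le> K * N \<phi> a)" for n
    unfolding X_def K_def by (rule strong_approx[OF \<phi> e(1)])
  then obtain c where c: "\<And>n \<xi> C. C \<ge> 0 \<Longrightarrow> \<forall>a. cmod (\<xi> \<cdot> a) \<le> C * N \<phi> a \<Longrightarrow> cmod (F \<cdot> \<xi> - \<xi> \<cdot> c n) \<le> e n * C"
    "\<And>n a. cmod (X \<cdot> a - \<phi> \<cdot> (adj (c n) * a)) \<le> e n * N \<phi> a" "\<And>n. N \<phi> (c n) \<le> K + e n"
    "\<And>a. cmod (X \<cdot> a) \<le> K * N \<phi> a"
    by metis
  have "cmod (F \<cdot> X - \<phi> \<cdot> (adj (c n) * c n)) \<le> e n * K + e n * (K + e n)" for n
  proof -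
    have "cmod (F \<cdot> X - X \<cdot> c n) \<le> e n * K" using c(1)[OF K] c(4) by blast
    moreover have "cmod (X \<cdot> c n - \<phi> \<cdot> (adj (c n) * c n)) \<le> e n * (K + e n)"
      using c(2)[of "c n" n] mult_left_mono[OF c(3)[of n], of "e n"] e(1)[of n] by linarith
    ultimately show ?thesis
      using norm_triangle_ineq[of "F \<cdot> X - X \<cdot> c n" "X \<cdot> c n - \<phi> \<cdot> (adj (c n) * c n)"] by simp
  qed
  moreover have "(\<lambda>n. e n * K + e n * (K + e n)) \<longlonglongrightarrow> 0 * K + 0 * (K + 0)"
    by (intro tendsto_intros e)
  then have "(\<lambda>n. e n * K + e n * (K + e n)) \<longlonglongrightarrow> 0" by simp
  ultimately have "(\<lambda>n. F \<cdot> X - \<phi> \<cdot> (adj (c n) * c n)) \<longlonglongrightarrow> 0"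
    by (rule Lim_null_comparison[OF always_eventually, OF allI])
  from tendsto_diff[OF tendsto_const[of "F \<cdot> X"] this]
  have lim: "(\<lambda>n. \<phi> \<cdot> (adj (c n) * c n)) \<longlonglongrightarrow> F \<cdot> X" by simp
  have "F \<cdot> X \<in> \<real>\<^sub>\<ge>\<^sub>0"
    by (rule Lim_in_closed_set[OF closed_nonneg_Reals_complex _ _ lim])
      (use \<phi> in \<open>auto simp: posf_def\<close>)
  then show 1: "(bidual_adj F \<odot> F) \<cdot> \<phi> \<in> \<real>\<^sub>\<ge>\<^sub>0" by (auto simp: FF complex_nonneg_Reals_iff)
  assume \<psi>: "\<And>a. cmod (\<psi> \<cdot> a) \<le> N \<phi> a"
  have "(\<lambda>n. Re (\<phi> \<cdot> (adj (c n) * c n))) \<longlonglongrightarrow> Re (F \<cdot> X)" by (intro tendsto_Re lim)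
  then have lim2: "(\<lambda>n. N \<phi> (c n) + e n) \<longlonglongrightarrow> sqrt (Re (F \<cdot> X)) + 0"
    unfolding N_def by (intro tendsto_add tendsto_real_sqrt e(2))
  have bnd: "cmod (F \<cdot> \<psi>) \<le> N \<phi> (c n) + e n" for n
  proof -
    have "cmod (F \<cdot> \<psi> - \<psi> \<cdot> c n) \<le> e n * 1" by (rule c(1)) (use \<psi> in auto)
    then show ?thesis
      using \<psi>[of "c n"] norm_triangle_ineq2[of "F \<cdot> \<psi>" "\<psi> \<cdot> c n"] by linarith
  qed
  have "cmod (F \<cdot> \<psi>) \<le> sqrt (Re (F \<cdot> X)) + 0"
    by (rule LIMSEQ_le_const[OF lim2]) (use bnd in blast)
  then have "(cmod (F \<cdot> \<psi>))\<^sup>2 \<le> (sqrt (Re (F \<cdot> X)))\<^sup>2" by (intro power_mono) auto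
  with 1 show "(cmod (F \<cdot> \<psi>))\<^sup>2 \<le> Re ((bidual_adj F \<odot> F) \<cdot> \<phi>)"
    by (simp add: FF complex_nonneg_Reals_iff)
qed

text \<open>The nontrivial inequality tests F on \<open>\<psi>\<close> and dominates
  \<open>\<psi>\<close> by a positive \<open>\<phi>\<close> of norm at most (norm \<psi>)^2: the
  squared modulus of F at \<open>\<psi>\<close> is at most the value of
  \<open>bidual_adj F \<odot> F\<close> at \<open>\<phi>\<close>.\<close>

theorem bidual_cstar_identity: "norm (bidual_adj F \<odot> F) = (norm (F :: 'a::cstar_algebra bidual))\<^sup>2"
proof -
  have ge: "(norm F)\<^sup>2 \<le> norm (bidual_adj F \<odot> F)" for F :: "'a bidual"
  proof -
    let ?P = "bidual_adj F \<odot> F"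
    have "norm F \<le> sqrt (norm ?P)"
    proof (rule norm_cdual_bound)
      fix \<psi> :: "'a cdual"
      obtain \<phi> where \<phi>: "posf \<phi>" "norm \<phi> \<le> (norm \<psi>)\<^sup>2" "\<And>a. cmod (\<psi> \<cdot> a) \<le> N \<phi> a"
        by (rule dominating_ex[of \<psi>]) blast
      have "(cmod (F \<cdot> \<psi>))\<^sup>2 \<le> Re (?P \<cdot> \<phi>)" by (rule bidual_adj_mult_posf(2)[OF \<phi>(1,3)])
      also have "\<dots> \<le> norm ?P * norm \<phi>" using norm_cdual_apply complex_Re_le_cmod order_trans by blast
      also have "\<dots> \<le> norm ?P * (norm \<psi>)\<^sup>2" by (intro mult_left_mono \<phi>) simp
      also have "\<dots> = (sqrt (norm ?P) * norm \<psi>)\<^sup>2" by (simp add: power_mult_distrib)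
      finally show "cmod (F \<cdot> \<psi>) \<le> sqrt (norm ?P) * norm \<psi>" by (rule power2_le_imp_le) simp
    qed simp
    then have "(norm F)\<^sup>2 \<le> (sqrt (norm ?P))\<^sup>2" by (intro power_mono) auto
    then show ?thesis by simp
  qed
  have le: "norm G \<le> norm (bidual_adj G)" for G :: "'a bidual"
  proof (cases "norm G = 0")
    case False
    have "norm G * norm G \<le> norm (bidual_adj G) * norm G"
      using ge[of G] norm_bidual_mult[of "bidual_adj G" G] by (simp add: power2_eq_square)
    then show ?thesis using False by simp
  qed auto
  have "norm (bidual_adj F) = norm F" using le[of F] le[of "bidual_adj F"] by (simp add: bidual_adj_adj)
  then show ?thesis using ge[of F] norm_bidual_mult[of "bidual_adj F" F] by (simp add: power2_eq_square)
qed

section \<open>Weak* compactness and the enveloping von Neumann algebra\<close>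

text \<open>Tychonoff's theorem on a product of discs, cut down to the closed set of linear maps.
  The cluster point is recorded through one vector at a time, the form in which it is
  applied.\<close>

lemma banach_alaoglu:
  fixes F :: "'x::complex_normed_vector cdual filter"
  assumes F: "F \<noteq> bot" "eventually (\<lambda>f. norm f \<le> K) F" and K: "K \<ge> 0"
  obtains x where "norm x \<le> K" "\<And>v e. e > 0 \<Longrightarrow> frequently (\<lambda>f. cmod (f \<cdot> v - x \<cdot> v) < e) F"
proof -
  define B where "B = PiE UNIV (\<lambda>v::'x. cball (0::complex) (K * norm v))"
  define L where "L = {g :: 'x \<Rightarrow> complex. (\<forall>x y. g (x + y) = g x + g y) \<and> (\<forall>r x. g (r *\<^sub>R x) = r *\<^sub>R g x)
    \<and> (\<forall>c x. g (c *\<^sub>C x) = c * g x)}"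
  have "compactin (product_topology (\<lambda>i::'x. euclidean) UNIV) B"
    unfolding B_def compactin_PiE by simp
  then have "compact B" by (simp add: euclidean_product_topology)
  moreover have "closed L"
    unfolding L_def
    by (intro closed_Collect_conj closed_Collect_all closed_Collect_eq continuous_intros
        continuous_on_product_coordinates)
  ultimately have comp: "compact (B \<inter> L)" by (rule compact_Int_closed)
  have mem: "cdual_apply f \<in> B \<inter> L" if "norm f \<le> K" for f :: "'x cdual"
    using order_trans[OF norm_cdual_apply mult_right_mono[OF that norm_ge_zero]]
    by (auto simp: B_def L_def cdual_simps)
  let ?G = "filtermap cdual_apply F"
  have "?G \<noteq> bot" using F(1) by (simp add: filtermap_bot_iff)
  moreover have "eventually (\<lambda>x. x \<in> B \<inter> L) ?G"
    unfolding eventually_filtermap using F(2) by eventually_elim (rule mem)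
  ultimately obtain g where g: "g \<in> B \<inter> L" "inf (nhds g) ?G \<noteq> bot"
    using comp unfolding compact_filter by blast
  have "cdual_apply (Abs_cdual g) = g"
    by (intro Abs_cdual_inverse CollectI cdualI[of g K]) (use g(1) in \<open>auto simp: B_def L_def\<close>)
  moreover have "norm (Abs_cdual g) \<le> K"
    by (rule norm_cdual_bound) (use g(1) K calculation in \<open>auto simp: B_def\<close>)
  moreover have "frequently (\<lambda>f. cmod (f \<cdot> v - g v) < e) F" if "e > 0" for v e
  proof (rule ccontr)
    assume "\<not> ?thesis"
    then have "eventually (\<lambda>h. \<not> cmod (h v - g v) < e) ?G"
      by (simp add: frequently_def eventually_filtermap)
    moreover have "eventually (\<lambda>h. cmod (h v - g v) < e) (nhds g)"
    proof (rule eventually_nhds[THEN iffD2], intro exI conjI)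
      show "open {h. cmod (h v - g v) < e}"
        by (intro open_Collect_less continuous_intros continuous_on_product_coordinates)
    qed (use that in auto)
    ultimately have "eventually (\<lambda>h. False) (inf (nhds g) ?G)"
      unfolding eventually_inf by blast
    with g(2) show False by (simp add: eventually_False)
  qed
  ultimately show thesis using that[of "Abs_cdual g"] by simp
qed

section \<open>Filters of tails and the unit of the bidual\<close>

definition net_filter :: "'i set \<Rightarrow> ('i \<Rightarrow> 'i \<Rightarrow> bool) \<Rightarrow> ('i \<Rightarrow> 'b) \<Rightarrow> 'b filter"
  where "net_filter I le f = (INF i\<in>I. principal (f ` {j\<in>I. le i j}))"

definition directed :: "'i set \<Rightarrow> ('i \<Rightarrow> 'i \<Rightarrow> bool) \<Rightarrow> bool"
  where "directed I le \<longleftrightarrow> I \<noteq> {} \<and> (\<forall>i\<in>I. le i i) \<and> (\<forall>i\<in>I. \<forall>j\<in>I. \<forall>k\<in>I. le i j \<longrightarrow> le j k \<longrightarrow> le i k)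
    \<and> (\<forall>i\<in>I. \<forall>j\<in>I. \<exists>k\<in>I. le i k \<and> le j k)"

lemma eventually_net_filter:
  assumes "directed I le"
  shows "eventually P (net_filter I le f) \<longleftrightarrow> (\<exists>i\<in>I. \<forall>j\<in>I. le i j \<longrightarrow> P (f j))"
proof -
  have "eventually P (net_filter I le f) \<longleftrightarrow> (\<exists>i\<in>I. eventually P (principal (f ` {j\<in>I. le i j})))"
    unfolding net_filter_def
  proof (rule eventually_INF_base)
    show "I \<noteq> {}" using assms by (simp add: directed_def)
    fix i j assume ij: "i \<in> I" "j \<in> I"
    then obtain k where k: "k \<in> I" "le i k" "le j k" using assms unfolding directed_def by blast
    have "f ` {l\<in>I. le k l} \<subseteq> f ` {l\<in>I. le i l} \<inter> f ` {l\<in>I. le j l}"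
      using assms ij k unfolding directed_def by blast
    with k show "\<exists>k\<in>I. principal (f ` {l\<in>I. le k l}) \<le> inf (principal (f ` {l\<in>I. le i l})) (principal (f ` {l\<in>I. le j l}))"
      by (intro bexI[of _ k]) auto
  qed
  then show ?thesis by (auto simp: eventually_principal)
qed

lemma net_filter_not_bot:
  assumes "directed I le" shows "net_filter I le f \<noteq> bot"
proof
  assume "net_filter I le f = bot"
  then have "eventually (\<lambda>x. False) (net_filter I le f)" by simp
  then obtain i where "i \<in> I" "\<forall>j\<in>I. le i j \<longrightarrow> False"
    using eventually_net_filter[OF assms, of "\<lambda>x. False" f] by blast
  moreover have "\<forall>i\<in>I. le i i" using assms unfolding directed_def by blast
  ultimately show False by blast
qed

lemma frequently_net_filter:
  assumes "directed I le"
  shows "frequently P (net_filter I le f) \<longleftrightarrow> (\<forall>i\<in>I. \<exists>j\<in>I. le i j \<and> P (f j))"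
  unfolding frequently_def eventually_net_filter[OF assms] by auto

lemma directed_posA: "directed {a::'a::cstar_algebra. posA a} (\<lambda>a b. posA (b - a))"
  unfolding directed_def
proof (intro conjI ballI impI)
  have "posA (0 :: 'a)" by (simp add: posA_def flip: zero_uni_def)
  then show "{a::'a. posA a} \<noteq> {}" by blast
  show "posA (a - a)" for a :: 'a using \<open>posA (0 :: 'a)\<close> by simp
  show "posA (c - a)" if "posA (b - a)" "posA (c - b)" for a b c :: 'a
    using posA_add[OF that] by simp
  show "\<exists>c\<in>{a. posA a}. posA (c - a) \<and> posA (c - b)" if "a \<in> {a. posA a}" "b \<in> {a. posA a}" for a b :: 'a
    using that by (intro bexI[of _ "a + b"]) (auto simp: posA_add)
qed

text \<open>The unit is a weak* cluster point u of the approximate unit: since b (apx a) tends to b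
  in norm, \<open>arens2 u\<close> fixes every functional.\<close>

lemma bidual_right_unit:
  "\<exists>u. \<forall>F :: 'a::cstar_algebra bidual. F \<odot> u = F"
proof -
  let ?I = "{a::'a. posA a}" and ?le = "\<lambda>a b :: 'a. posA (b - a)"
  let ?F = "net_filter ?I ?le (\<lambda>a. embed (apx a))"
  have ev: "eventually (\<lambda>f. norm f \<le> 1) ?F"
    unfolding eventually_net_filter[OF directed_posA]
  proof (rule bexI[of _ 0])
    show "0 \<in> ?I" by (simp add: posA_def flip: zero_uni_def)
  qed (simp add: norm_embed apx_pos(2))
  obtain u :: "'a bidual" where u: "\<And>v e. e > 0 \<Longrightarrow> frequently (\<lambda>f. cmod (f \<cdot> v - u \<cdot> v) < e) ?F"
    by (rule banach_alaoglu[OF net_filter_not_bot[OF directed_posA] ev zero_le_one]) blast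
  have "arens2 u \<psi> = \<psi>" for \<psi>
  proof (rule cdual_eqI)
    fix b
    have "cmod (\<psi> \<cdot> b - u \<cdot> arens1 \<psi> b) \<le> 0"
    proof (rule le_add_eps)
      fix e :: real assume e: "e > 0"
      obtain a0 where a0: "posA a0" "\<And>a. posA a \<Longrightarrow> posA (a - a0) \<Longrightarrow> norm (b * apx a - b) < e"
        using apx_unit[OF e, of b] by blast
      obtain a where a: "posA a" "posA (a - a0)" "cmod (embed (apx a) \<cdot> arens1 \<psi> b - u \<cdot> arens1 \<psi> b) < e"
        using u[OF e, of "arens1 \<psi> b"] a0(1) unfolding frequently_net_filter[OF directed_posA] by blast
      have "cmod (\<psi> \<cdot> (b * apx a - b)) \<le> norm \<psi> * norm (b * apx a - b)" by (rule norm_cdual_apply)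
      also have "\<dots> \<le> norm \<psi> * e" using a0(2)[OF a(1,2)] by (intro mult_left_mono) auto
      finally have "cmod (\<psi> \<cdot> (b * apx a) - \<psi> \<cdot> b) \<le> norm \<psi> * e" by (simp add: cdual_apply_diff)
      moreover have "cmod (\<psi> \<cdot> (b * apx a) - u \<cdot> arens1 \<psi> b) < e"
        using a(3) by (simp add: embed.rep_eq arens1.rep_eq)
      ultimately show "cmod (\<psi> \<cdot> b - u \<cdot> arens1 \<psi> b) \<le> 0 + e * (norm \<psi> + 1)"
        using norm_triangle_ineq4[of "\<psi> \<cdot> (b * apx a) - u \<cdot> arens1 \<psi> b" "\<psi> \<cdot> (b * apx a) - \<psi> \<cdot> b"]
        by (simp add: algebra_simps)
    qed simp
    then show "arens2 u \<psi> \<cdot> b = \<psi> \<cdot> b" by (simp add: arens2.rep_eq)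
  qed
  then have "F \<odot> u = F" for F by (intro cdual_eqI) (simp add: bidual_mult.rep_eq)
  then show ?thesis by blast
qed

definition bidual_one :: "'a::cstar_algebra bidual"
  where "bidual_one = (SOME u. \<forall>F. F \<odot> u = F)"

text \<open>The adjoint of a right unit is a left unit, and a left unit coincides with a right
  unit.\<close>

lemma bidual_one: "F \<odot> bidual_one = F" "bidual_one \<odot> F = (F :: 'a::cstar_algebra bidual)"
proof -
  have r: "F \<odot> bidual_one = F" for F :: "'a bidual"
    unfolding bidual_one_def by (rule someI_ex[OF bidual_right_unit, THEN spec])
  then show "F \<odot> bidual_one = F" .
  have l: "bidual_adj bidual_one \<odot> F = F" for F :: "'a bidual"
    using bidual_adj_mult[of "bidual_adj F" bidual_one] by (simp add: r bidual_adj_adj)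
  have "bidual_adj bidual_one = (bidual_one :: 'a bidual)"
    using l[of bidual_one] r[of "bidual_adj bidual_one"] by simp
  with l[of F] show "bidual_one \<odot> F = F" by simp
qed

text \<open>A copy of the bidual, so that the Arens product can be the multiplication of a C*-algebra.\<close>

typedef (overloaded) 'a vN = "UNIV :: 'a::cstar_algebra bidual set"
  morphisms rep Abs_vN by simp

lemma bidual_mult_scaleR:
  fixes F G :: "'a::cstar_algebra bidual"
  shows "(r *\<^sub>R F) \<odot> G = r *\<^sub>R (F \<odot> G)" "F \<odot> (r *\<^sub>R G) = r *\<^sub>R (F \<odot> G)"
  using bidual_mult_bilinear(3,4)[where c = "complex_of_real r"] by (simp_all add: scaleC_of_real)

setup_lifting type_definition_vN

instantiation vN :: (cstar_algebra) real_normed_vector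
begin

lift_definition norm_vN :: "'a vN \<Rightarrow> real" is norm .
lift_definition minus_vN :: "'a vN \<Rightarrow> 'a vN \<Rightarrow> 'a vN" is minus .
lift_definition uminus_vN :: "'a vN \<Rightarrow> 'a vN" is uminus .
lift_definition zero_vN :: "'a vN" is 0 .
lift_definition plus_vN :: "'a vN \<Rightarrow> 'a vN \<Rightarrow> 'a vN" is plus .
lift_definition scaleR_vN :: "real \<Rightarrow> 'a vN \<Rightarrow> 'a vN" is scaleR .
definition dist_vN :: "'a vN \<Rightarrow> 'a vN \<Rightarrow> real" where "dist_vN f g = norm (f - g)"
definition sgn_vN :: "'a vN \<Rightarrow> 'a vN" where "sgn_vN f = scaleR (inverse (norm f)) f"
definition [code del]:
  "(uniformity :: ('a vN \<times> 'a vN) filter) = (INF e\<in>{0 <..}. principal {(x, y). dist x y < e})"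
definition open_vN :: "'a vN set \<Rightarrow> bool"
  where [code del]: "open_vN S = (\<forall>x\<in>S. \<forall>\<^sub>F (x', y) in uniformity. x' = x \<longrightarrow> y \<in> S)"

instance
  by standard (unfold dist_vN_def open_vN_def sgn_vN_def uniformity_vN_def,
    (rule refl | (transfer, force simp: algebra_simps norm_triangle_ineq))+)

end

instantiation vN :: (cstar_algebra) ucstar
begin

lift_definition scaleC_vN :: "complex \<Rightarrow> 'a vN \<Rightarrow> 'a vN" is scaleC .
lift_definition times_vN :: "'a vN \<Rightarrow> 'a vN \<Rightarrow> 'a vN" is bidual_mult .
lift_definition one_vN :: "'a vN" is bidual_one .
lift_definition adj_vN :: "'a vN \<Rightarrow> 'a vN" is bidual_adj .

instance
proof
  fix X :: "nat \<Rightarrow> 'a vN"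
  assume X: "Cauchy X"
  have d: "norm (rep x - rep y) = norm (x - y)" for x y :: "'a vN" by transfer simp
  have "Cauchy (\<lambda>n. rep (X n))" using X by (simp add: Cauchy_def dist_norm d)
  then obtain l where "(\<lambda>n. rep (X n)) \<longlonglongrightarrow> l" by (auto simp: Cauchy_convergent_iff convergent_def)
  then have "X \<longlonglongrightarrow> Abs_vN l"
    by (simp add: LIMSEQ_def dist_norm d[symmetric] Abs_vN_inverse)
  then show "convergent X" by (auto simp: convergent_def)
next
  fix x y z :: "'a vN" and c d :: complex and r :: real
  show "r *\<^sub>R x * y = r *\<^sub>R (x * y)" "x * r *\<^sub>R y = r *\<^sub>R (x * y)" by (transfer, simp add: bidual_mult_scaleR)+
  show "complex_of_real r *\<^sub>C x = r *\<^sub>R x" by transfer (rule scaleC_of_real)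
  show "c *\<^sub>C (x + y) = c *\<^sub>C x + c *\<^sub>C y" by transfer (rule scaleC_add_right)
  show "(c + d) *\<^sub>C x = c *\<^sub>C x + d *\<^sub>C x" by transfer (rule scaleC_add_left)
  show "c *\<^sub>C d *\<^sub>C x = (c * d) *\<^sub>C x" by transfer (rule scaleC_scaleC)
  show "norm (c *\<^sub>C x) = cmod c * norm x" by transfer (rule norm_scaleC)
  show "x * y * z = x * (y * z)" by transfer (rule bidual_mult_assoc)
  show "(x + y) * z = x * z + y * z" "x * (y + z) = x * y + x * z"
    "(c *\<^sub>C x) * y = c *\<^sub>C (x * y)" "x * (c *\<^sub>C y) = c *\<^sub>C (x * y)"
    by (transfer, simp add: bidual_mult_bilinear)+
  show "norm (x * y) \<le> norm x * norm y" by transfer (rule norm_bidual_mult)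
  show "1 * x = x" "x * 1 = x" by (transfer, simp add: bidual_one)+
  show "adj (x + y) = adj x + adj y" "adj (c *\<^sub>C x) = cnj c *\<^sub>C adj x"
    by (transfer, simp add: bidual_adj_linear)+
  show "adj (x * y) = adj y * adj x" by transfer (rule bidual_adj_mult)
  show "adj (adj x) = x" by transfer (rule bidual_adj_adj)
  show "norm (adj x * x) = (norm x)\<^sup>2" by transfer (rule bidual_cstar_identity)
qed

end

section \<open>Normal positive functionals\<close>

lift_definition emb :: "'a::cstar_algebra \<Rightarrow> 'a vN" is embed .

lift_definition evf :: "'a::cstar_algebra cdual \<Rightarrow> 'a vN cdual" is "\<lambda>\<phi> x. rep x \<cdot> \<phi>"
proof (rule cdualI)
  fix \<phi> :: "'a cdual" and x y :: "'a vN" and r c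
  show "rep (x + y) \<cdot> \<phi> = rep x \<cdot> \<phi> + rep y \<cdot> \<phi>" by transfer (rule cdual_add_apply)
  show "rep (r *\<^sub>R x) \<cdot> \<phi> = r *\<^sub>R (rep x \<cdot> \<phi>)" by transfer (rule cdual_scaleR_apply)
  show "rep (c *\<^sub>C x) \<cdot> \<phi> = c * (rep x \<cdot> \<phi>)" by transfer (rule cdual_scaleC_apply)
  show "cmod (rep x \<cdot> \<phi>) \<le> norm \<phi> * norm x"
    using norm_cdual_apply[of "rep x" \<phi>] by (simp add: norm_vN.rep_eq mult.commute)
qed

lemma norm_evf: "cmod (evf \<phi> \<cdot> x) \<le> norm x * norm \<phi>"
  unfolding evf.rep_eq norm_vN.rep_eq by (rule norm_cdual_apply)

lemma evf_emb: "evf \<phi> \<cdot> emb a = \<phi> \<cdot> a"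
  by (simp add: evf.rep_eq emb.rep_eq embed.rep_eq)

lemma evf_mult: "evf \<phi> \<cdot> (x * y) = evf (arens2 (rep y) \<phi>) \<cdot> x"
  by (simp add: evf.rep_eq times_vN.rep_eq bidual_mult.rep_eq)

lemma vN_eqI: "(\<And>\<phi>. evf \<phi> \<cdot> x = evf \<phi> \<cdot> y) \<Longrightarrow> x = y"
  by (rule rep_inject[THEN iffD1], rule cdual_eqI) (simp add: evf.rep_eq)

lemma emb_simps:
  fixes a b :: "'a::cstar_algebra"
  shows "emb (a + b) = emb a + emb b" "emb (a - b) = emb a - emb b" "emb (a * b) = emb a * emb b"
  "emb (adj a) = adj (emb a)" "emb (r *\<^sub>R a) = r *\<^sub>R emb a" "emb (- a) = - emb a" "emb (0 :: 'a) = 0"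
proof -
  have 1: "emb (a + b) = emb a + emb b" for a b :: 'a
    by transfer (rule cdual_eqI, simp add: embed.rep_eq cdual_simps)
  have 2: "emb (r *\<^sub>R a) = r *\<^sub>R emb a" for r and a :: 'a
    by transfer (rule cdual_eqI, simp add: embed.rep_eq cdual_simps)
  have 3: "emb (- a) = - emb a" for a :: 'a using 2[of "-1" a] by simp
  show "emb (a + b) = emb a + emb b" "emb (r *\<^sub>R a) = r *\<^sub>R emb a" "emb (- a) = - emb a"
    by (rule 1 2 3)+
  show "emb (a - b) = emb a - emb b" using 1[of a "-b"] 3[of b] by simp
  show "emb (a * b) = emb a * emb b" by transfer (rule embed_mult)
  show "emb (adj a) = adj (emb a)" by transfer (rule embed_adj)
  show "emb (0 :: 'a) = 0" using 2[of 0 0] by simp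
qed

lemma norm_emb: "norm (emb a) = norm a"
  by transfer (rule norm_embed)

lemma sa_emb: "sa (emb a) \<longleftrightarrow> sa a"
proof -
  have "emb (adj a) = emb a \<longleftrightarrow> emb (adj a - a) = 0" by (simp add: emb_simps)
  also have "\<dots> \<longleftrightarrow> adj a = a" by (metis norm_emb norm_eq_zero right_minus_eq)
  finally show ?thesis by (simp add: sa_def emb_simps)
qed

lemma closed_range_emb: "closed (range (emb :: 'a::cstar_algebra \<Rightarrow> 'a vN))"
proof (rule complete_imp_closed, rule completeI)
  fix f :: "nat \<Rightarrow> 'a vN" assume f: "\<forall>n. f n \<in> range emb" "Cauchy f"
  define g where "g n = inv emb (f n)" for n
  have g: "f n = emb (g n)" for n using f(1) by (simp add: g_def f_inv_into_f)
  have d: "norm (emb x - emb y) = norm (x - y)" for x y :: 'a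
    by (simp add: norm_emb flip: emb_simps)
  have "Cauchy g" using f(2) by (simp add: Cauchy_def dist_norm g d)
  then obtain l where "g \<longlonglongrightarrow> l" by (auto simp: Cauchy_convergent_iff convergent_def)
  then have "f \<longlonglongrightarrow> emb l" by (simp add: LIMSEQ_def dist_norm g d)
  then show "\<exists>l\<in>range emb. f \<longlonglongrightarrow> l" by blast
qed

lemma pos_emb:
  assumes "posA a" shows "pos (emb a)"
proof -
  obtain w where "a = adj w * w" using assms by (rule posA_root)
  then show ?thesis by (simp add: emb_simps pos_adj_mult)
qed

definition NF :: "'a::cstar_algebra vN cdual set"
  where "NF = evf ` {\<phi>. posf \<phi>}"

lemma evf_NF: "posf \<phi> \<Longrightarrow> evf \<phi> \<in> NF"
  by (simp add: NF_def)

lemma NF_posf: "f \<in> NF \<Longrightarrow> posf f"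
proof -
  assume "f \<in> NF"
  then obtain \<phi> where \<phi>: "f = evf \<phi>" "posf \<phi>" by (auto simp: NF_def)
  show "posf f"
    unfolding posf_def \<phi>(1) evf.rep_eq times_vN.rep_eq adj_vN.rep_eq
    using bidual_adj_mult_posf(1)[OF \<phi>(2)] by blast
qed

lemma posf_pos:
  fixes x :: "'b::ucstar"
  assumes "posf f" "pos x" shows "Re (f \<cdot> x) \<ge> 0" "Im (f \<cdot> x) = 0"
proof -
  obtain w where "x = adj w * w" using assms(2) pos_iff by blast
  then show "Re (f \<cdot> x) \<ge> 0" "Im (f \<cdot> x) = 0" using posf_nonneg[OF assms(1)] by auto
qed

lemma posf_mono:
  fixes x :: "'b::ucstar"
  assumes "posf f" "pos (y - x)" shows "Re (f \<cdot> x) \<le> Re (f \<cdot> y)"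
  using posf_pos(1)[OF assms] by (simp add: cdual_apply_diff)

lemma posf_adj:
  fixes x :: "'b::ucstar"
  assumes "posf f" shows "f \<cdot> adj x = cnj (f \<cdot> x)"
  using posf_herm[OF assms, of x 1] by simp

text \<open>Normality of the conjugated functional is Arens regularity: \<open>rarens\<close>
  supplies the functional on the algebra whose normal extension it is.\<close>

lemma NF_conj:
  assumes "f \<in> NF" obtains g where "g \<in> NF" "\<And>x. g \<cdot> x = f \<cdot> (adj y * x * y)"
proof -
  obtain \<phi> where \<phi>: "f = evf \<phi>" "posf \<phi>" using assms by (auto simp: NF_def)
  define \<omega> where "\<omega> = rarens (arens2 (rep y) \<phi>) (rep (adj y))"
  have *: "evf \<omega> \<cdot> x = f \<cdot> (adj y * x * y)" for x
    unfolding \<phi>(1) evf_mult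
    by (simp add: evf.rep_eq times_vN.rep_eq \<omega>_def bidual_mult.rep_eq flip: arens_regular)
  have "\<omega> \<cdot> (adj a * a) \<in> \<real>\<^sub>\<ge>\<^sub>0" for a
  proof -
    have "\<omega> \<cdot> (adj a * a) = f \<cdot> (adj (emb a * y) * (emb a * y))"
      unfolding evf_emb[of \<omega>, symmetric] * by (simp add: emb_simps adj_simps mult.assoc)
    then show ?thesis using NF_posf[OF assms] by (simp add: posf_def)
  qed
  then have "posf \<omega>" by (simp add: posf_def)
  with * show thesis using that evf_NF by blast
qed

lemma NF_dom:
  obtains \<phi> where "posf \<phi>" "norm \<phi> \<le> (norm \<psi>)\<^sup>2" "\<And>x. (cmod (evf \<psi> \<cdot> x))\<^sup>2 \<le> Re (evf \<phi> \<cdot> (adj x * x))"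
proof -
  obtain \<phi> where \<phi>: "posf \<phi>" "norm \<phi> \<le> (norm \<psi>)\<^sup>2" "\<And>a. cmod (\<psi> \<cdot> a) \<le> N \<phi> a" by (rule dominating_ex[of \<psi>]) blast
  show thesis
    by (rule that[OF \<phi>(1,2)], unfold evf.rep_eq times_vN.rep_eq adj_vN.rep_eq)
      (rule bidual_adj_mult_posf(2)[OF \<phi>(1,3)])
qed

text \<open>Cauchy-Schwarz against the unit of the bidual bounds the squared modulus of
  \<open>\<phi> \<cdot> a\<close> by \<phi>(1) (norm \<phi>) (norm a)^2.\<close>

lemma norm_posf:
  assumes "posf \<phi>" shows "Re (evf \<phi> \<cdot> 1) = norm \<phi>"
proof (rule antisym)
  have f: "posf (evf \<phi>)" using NF_posf evf_NF assms by blast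
  have "Re (evf \<phi> \<cdot> 1) \<le> cmod (evf \<phi> \<cdot> 1)" by (rule complex_Re_le_cmod)
  also have "\<dots> \<le> norm (1::'a vN) * norm \<phi>" by (rule norm_evf)
  also have "\<dots> \<le> norm \<phi>" using mult_right_mono[OF norm_one_le, of "norm \<phi>"] by simp
  finally show "Re (evf \<phi> \<cdot> 1) \<le> norm \<phi>" .
  have 1: "0 \<le> Re (evf \<phi> \<cdot> 1)" by (rule posf_pos[OF f]) simp
  have "norm \<phi> \<le> sqrt (Re (evf \<phi> \<cdot> 1) * norm \<phi>)"
  proof (rule norm_cdual_bound)
    fix a
    have "cmod (\<phi> \<cdot> a) \<le> N (evf \<phi>) 1 * N (evf \<phi>) (emb a)"
      using posf_CS[OF f, of 1 "emb a"] by (simp add: evf_emb)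
    also have "N (evf \<phi>) (emb a) = N \<phi> a" by (simp add: N_def evf_emb flip: emb_simps)
    also have "N (evf \<phi>) 1 * N \<phi> a \<le> N (evf \<phi>) 1 * (sqrt (norm \<phi>) * norm a)"
      by (intro mult_left_mono N_le_norm N_nonneg f assms)
    also have "\<dots> = sqrt (Re (evf \<phi> \<cdot> 1) * norm \<phi>) * norm a" by (simp add: N_def real_sqrt_mult)
    finally show "cmod (\<phi> \<cdot> a) \<le> sqrt (Re (evf \<phi> \<cdot> 1) * norm \<phi>) * norm a" .
  qed (use 1 in simp)
  then have "(norm \<phi>)\<^sup>2 \<le> Re (evf \<phi> \<cdot> 1) * norm \<phi>"
    using 1 by (metis mult_nonneg_nonneg norm_ge_zero power_mono real_sqrt_pow2)
  then show "norm \<phi> \<le> Re (evf \<phi> \<cdot> 1)"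
    using 1 by (cases "norm \<phi> = 0") (auto simp: power2_eq_square)
qed

lemma posf_square_le:
  fixes x :: "'b::ucstar"
  assumes "posf f" "pos x" "norm x \<le> C" shows "Re (f \<cdot> (x * x)) \<le> C * Re (f \<cdot> x)"
  using posf_pos(1)[OF assms(1) pos_square_le[OF assms(2,3)]] by (simp add: cdual_apply_diff cdual_apply_scaleR)

text \<open>Let G = 1 - x/norm x, which is positive. If \<open>\<phi>\<close> dominates
  \<open>\<psi>\<close>, the squared modulus of \<psi>(G) is at most \<phi>(G^2) \<le> norm G
  \<phi>(G), and \<phi>(x) \<ge> 0 gives \<phi>(G) \<le> norm \<phi>. Hence (norm G)^2 \<le> norm G,
  and norm G \<le> 1 is positivity of x.\<close>

theorem pos_of_NF:
  fixes x :: "'a::cstar_algebra vN"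
  assumes x: "sa x" "\<And>f. f \<in> NF \<Longrightarrow> Re (f \<cdot> x) \<ge> 0"
  shows "pos x"
proof (cases "x = 0")
  case False
  define F where "F = (1 / norm x) *\<^sub>R x"
  define G where "G = 1 - F"
  have F: "sa F" "norm F = 1" using x(1) False by (auto simp: F_def)
  have "pos G" using pos_norm_minus(1)[OF F(1), of 1] F(2) by (simp add: G_def)
  have "norm (rep G) \<le> sqrt (norm G)"
  proof (rule norm_cdual_bound)
    fix \<psi> :: "'a cdual"
    obtain \<phi> where \<phi>: "posf \<phi>" "norm \<phi> \<le> (norm \<psi>)\<^sup>2" "\<And>x. (cmod (evf \<psi> \<cdot> x))\<^sup>2 \<le> Re (evf \<phi> \<cdot> (adj x * x))"
      by (rule NF_dom[of \<psi>]) blast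
    have f: "posf (evf \<phi>)" "evf \<phi> \<in> NF" using NF_posf evf_NF \<phi>(1) by blast+
    have "(cmod (evf \<psi> \<cdot> G))\<^sup>2 \<le> Re (evf \<phi> \<cdot> (G * G))"
      using \<phi>(3)[of G] pos_sa[OF \<open>pos G\<close>] by (simp add: sa_def)
    also have "\<dots> \<le> norm G * Re (evf \<phi> \<cdot> G)" by (rule posf_square_le[OF f(1) \<open>pos G\<close>]) simp
    also have "Re (evf \<phi> \<cdot> F) \<ge> 0" using x(2)[OF f(2)] by (simp add: F_def cdual_apply_scaleR)
    then have "Re (evf \<phi> \<cdot> G) \<le> (norm \<psi>)\<^sup>2"
      using \<phi>(2) norm_posf[OF \<phi>(1)] by (simp add: G_def cdual_apply_diff)
    then have "norm G * Re (evf \<phi> \<cdot> G) \<le> norm G * (norm \<psi>)\<^sup>2" by (rule mult_left_mono) simp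
    also have "\<dots> = (sqrt (norm G) * norm \<psi>)\<^sup>2" by (simp add: power_mult_distrib)
    finally show "cmod (rep G \<cdot> \<psi>) \<le> sqrt (norm G) * norm \<psi>"
      unfolding evf.rep_eq by (rule power2_le_imp_le) simp
  qed simp
  then have "norm G \<le> sqrt (norm G)" by (simp add: norm_vN.rep_eq)
  then have "(norm G)\<^sup>2 \<le> norm G" by (metis norm_ge_zero power_mono real_sqrt_pow2)
  then have "norm G \<le> 1" by (cases "norm G = 0") (auto simp: power2_eq_square)
  then have "pos F" unfolding pos_def using F(1) by (auto simp: G_def intro!: exI[of _ 1])
  then have "pos (norm x *\<^sub>R F)" by (rule pos_scaleR) simp
  then show ?thesis using False by (simp add: F_def)
qed simp

subsection \<open>Suprema of bounded directed sets\<close>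

definition le :: "'b::ucstar \<Rightarrow> 'b \<Rightarrow> bool"
  where "le x y \<longleftrightarrow> pos (y - x)"

lemma le_refl [simp]: "le x x" by (simp add: le_def)

lemma le_trans: "le x y \<Longrightarrow> le y z \<Longrightarrow> le x z"
  unfolding le_def using pos_diff_trans by blast

lemma le_add: "le x y \<Longrightarrow> le z w \<Longrightarrow> le (x + z) (y + w)"
  unfolding le_def using pos_add[of "y - x" "w - z"] by (simp add: algebra_simps)

lemma le_scaleR: "le x y \<Longrightarrow> r \<ge> 0 \<Longrightarrow> le (r *\<^sub>R x) (r *\<^sub>R y)"
  unfolding le_def using pos_scaleR[of "y - x" r] by (simp add: algebra_simps)

lemma le_minus: "le (- x) (- y) \<longleftrightarrow> le y x"
  by (simp add: le_def)

text \<open>One member of D per functional and error is demanded. For bounded directed D this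
  amounts to convergence on the whole dual, by \<open>is_sup_tendsto\<close>.\<close>

definition is_sup :: "'a::cstar_algebra vN set \<Rightarrow> 'a vN \<Rightarrow> bool"
  where "is_sup D x \<longleftrightarrow> (\<forall>d\<in>D. le d x) \<and> (\<forall>f\<in>NF. \<forall>e>0. \<exists>d\<in>D. Re (f \<cdot> (x - d)) < e)"

lemma directedI:
  fixes D :: "'b::ucstar set"
  assumes "D \<noteq> {}" "\<And>x y. x \<in> D \<Longrightarrow> y \<in> D \<Longrightarrow> \<exists>z\<in>D. le x z \<and> le y z"
  shows "directed D le"
  unfolding directed_def
proof (intro conjI ballI impI)
  show "le x z" if "le x y" "le y z" for x y z :: 'b using that by (rule le_trans)
qed (use assms in auto)

lemma directedD: "directed D le \<Longrightarrow> x \<in> D \<Longrightarrow> y \<in> D \<Longrightarrow> \<exists>z\<in>D. le x z \<and> le y z"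
  unfolding directed_def by blast

lemma directed_tail:
  fixes D :: "'b::ucstar set"
  assumes "directed D le" "d0 \<in> D" shows "directed {d\<in>D. le d0 d} le"
proof (rule directedI)
  show "{d\<in>D. le d0 d} \<noteq> {}" using assms(2) le_refl by blast
  fix x y assume "x \<in> {d\<in>D. le d0 d}" "y \<in> {d\<in>D. le d0 d}"
  then show "\<exists>z\<in>{d\<in>D. le d0 d}. le x z \<and> le y z"
    using directedD[OF assms(1), of x y] le_trans by blast
qed

text \<open>A weak* cluster point is replaced by its self-adjoint part, which takes the same real
  values on positive functionals.\<close>

lemma sup_exists:
  fixes D :: "'a::cstar_algebra vN set"
  assumes D: "directed D le" "\<And>d. d \<in> D \<Longrightarrow> sa d" "\<And>d. d \<in> D \<Longrightarrow> norm d \<le> K"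
  obtains x where "sa x" "is_sup D x"
proof -
  obtain d0 where d0: "d0 \<in> D" using D(1) by (auto simp: directed_def)
  let ?F = "net_filter D le rep"
  have K: "K \<ge> 0" using D(3)[OF d0] norm_ge_zero order_trans by blast
  have ev: "eventually (\<lambda>f. norm f \<le> K) ?F"
    unfolding eventually_net_filter[OF D(1)] using d0 D(3) by (auto simp: norm_vN.rep_eq)
  obtain u where u: "\<And>v e. e > 0 \<Longrightarrow> frequently (\<lambda>f. cmod (f \<cdot> v - u \<cdot> v) < e) ?F"
    by (rule banach_alaoglu[OF net_filter_not_bot[OF D(1)] ev K]) blast
  define y where "y = Abs_vN u"
  have y: "rep y = u" by (simp add: y_def Abs_vN_inverse)
  define x where "x = (1/2) *\<^sub>R (y + adj y)"
  have "sa x" by (simp add: x_def sa_def adj_simps add.commute)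
  have ux: "\<exists>d'\<in>D. le d d' \<and> \<bar>Re (f \<cdot> d') - Re (f \<cdot> x)\<bar> < e" if d: "d \<in> D" and e: "e > 0" and f: "f \<in> NF" for d e f
  proof -
    obtain \<phi> where \<phi>: "f = evf \<phi>" "posf \<phi>" using f by (auto simp: NF_def)
    obtain d' where d': "d' \<in> D" "le d d'" "cmod (rep d' \<cdot> \<phi> - u \<cdot> \<phi>) < e"
      using u[OF e, of \<phi>] d unfolding frequently_net_filter[OF D(1)] by blast
    have "Re (f \<cdot> x) = Re (f \<cdot> y)"
      unfolding x_def using posf_adj[OF NF_posf[OF f], of y] by (simp add: cdual_apply_add cdual_apply_scaleR)
    then have "\<bar>Re (f \<cdot> d') - Re (f \<cdot> x)\<bar> = \<bar>Re (rep d' \<cdot> \<phi> - u \<cdot> \<phi>)\<bar>"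
      by (simp add: \<phi> evf.rep_eq y)
    also have "\<dots> < e" using d'(3) abs_Re_le_cmod order_le_less_trans by blast
    finally show ?thesis using d' by blast
  qed
  have "le d x" if d: "d \<in> D" for d
    unfolding le_def
  proof (rule pos_of_NF)
    show "sa (x - d)" using \<open>sa x\<close> D(2)[OF d] by blast
    fix f :: "'a vN cdual" assume f: "f \<in> NF"
    have "Re (f \<cdot> d) \<le> Re (f \<cdot> x)"
    proof (rule field_le_epsilon)
      fix e :: real assume "e > 0"
      then obtain d' where "d' \<in> D" "le d d'" "\<bar>Re (f \<cdot> d') - Re (f \<cdot> x)\<bar> < e" using ux[OF d _ f] by blast
      then show "Re (f \<cdot> d) \<le> Re (f \<cdot> x) + e"
        using posf_mono[OF NF_posf[OF f], of d' d] unfolding le_def by fastforce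
    qed
    then show "0 \<le> Re (f \<cdot> (x - d))" by (simp add: cdual_apply_diff)
  qed
  moreover have "\<exists>d\<in>D. Re (f \<cdot> (x - d)) < e" if f: "f \<in> NF" and e: "e > 0" for f e
  proof -
    obtain d where "d \<in> D" "\<bar>Re (f \<cdot> d) - Re (f \<cdot> x)\<bar> < e" using ux[OF d0 e f] by blast
    then show ?thesis by (intro bexI[of _ d]) (auto simp: cdual_apply_diff)
  qed
  ultimately show thesis using that[OF \<open>sa x\<close>] unfolding is_sup_def by blast
qed

lemma is_sup_sa: "is_sup D x \<Longrightarrow> d \<in> D \<Longrightarrow> sa d \<Longrightarrow> sa x"
  using sa_intros(1)[of "x - d" d] pos_sa[of "x - d"] by (simp add: is_sup_def le_def)

lemma is_sup_le:
  fixes D :: "'a::cstar_algebra vN set"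
  assumes "is_sup D x" "\<And>d. d \<in> D \<Longrightarrow> le d y" "sa x" "sa y" shows "le x y"
  unfolding le_def
proof (rule pos_of_NF)
  fix f :: "'a vN cdual" assume f: "f \<in> NF"
  have "Re (f \<cdot> x) \<le> Re (f \<cdot> y)"
  proof (rule field_le_epsilon)
    fix e :: real assume "e > 0"
    then obtain d where "d \<in> D" "Re (f \<cdot> (x - d)) < e" using assms(1) f unfolding is_sup_def by blast
    then show "Re (f \<cdot> x) \<le> Re (f \<cdot> y) + e"
      using posf_mono[OF NF_posf[OF f], of y d] assms(2)[of d] by (simp add: le_def cdual_apply_diff)
  qed
  then show "0 \<le> Re (f \<cdot> (y - x))" by (simp add: cdual_apply_diff)
qed (use assms in auto)

lemma is_sup_tail:
  assumes "directed D le" "is_sup D x" "d0 \<in> D" shows "is_sup {d\<in>D. le d0 d} x"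
  unfolding is_sup_def
proof (intro conjI ballI allI impI)
  fix f :: "'a vN cdual" and e :: real assume f: "f \<in> NF" "e > 0"
  then obtain d where d: "d \<in> D" "Re (f \<cdot> (x - d)) < e" using assms(2) unfolding is_sup_def by blast
  obtain d' where d': "d' \<in> D" "le d d'" "le d0 d'" using directedD[OF assms(1) d(1) assms(3)] by blast
  have "Re (f \<cdot> (x - d')) < e"
    using d(2) posf_mono[OF NF_posf[OF f(1)], of d' d] d'(2) by (simp add: le_def cdual_apply_diff)
  with d' show "\<exists>d\<in>{d\<in>D. le d0 d}. Re (f \<cdot> (x - d)) < e" by blast
qed (use assms(2) in \<open>auto simp: is_sup_def\<close>)

lemma le_small:
  assumes "f \<in> NF" "le d d'" "Re (f \<cdot> (x - d)) < e" shows "Re (f \<cdot> (x - d')) < e"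
  using assms(3) posf_mono[OF NF_posf[OF assms(1)], of d' d] assms(2) by (simp add: le_def cdual_apply_diff)

text \<open>Positive functionals control the others: the squared modulus of \<psi>(x - d') is at
  most \<phi>((x - d')^2) \<le> C \<phi>(x - d'), where C bounds the norms of x - d'.\<close>

lemma is_sup_tendsto:
  assumes D: "directed D le" "is_sup D x" "\<And>d. d \<in> D \<Longrightarrow> norm d \<le> K" and e: "e > 0"
  shows "\<exists>d\<in>D. \<forall>d'\<in>D. le d d' \<longrightarrow> cmod (evf \<psi> \<cdot> (d' - x)) < e"
proof -
  obtain \<phi> where \<phi>: "posf \<phi>" "\<And>x. (cmod (evf \<psi> \<cdot> x))\<^sup>2 \<le> Re (evf \<phi> \<cdot> (adj x * x))"
    by (rule NF_dom[of \<psi>]) blast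
  have f: "evf \<phi> \<in> NF" "posf (evf \<phi>)" using \<phi>(1) NF_posf evf_NF by blast+
  define C where "C = norm x + \<bar>K\<bar> + 1"
  have C: "C > 0" by (simp add: C_def add_nonneg_pos)
  obtain d where d: "d \<in> D" "Re (evf \<phi> \<cdot> (x - d)) < e\<^sup>2 / C"
    using D(2) f(1) e C unfolding is_sup_def by (meson divide_pos_pos zero_less_power)
  have "cmod (evf \<psi> \<cdot> (d' - x)) < e" if d': "d' \<in> D" "le d d'" for d'
  proof -
    have p: "pos (x - d')" using D(2) d'(1) by (simp add: is_sup_def le_def)
    have "norm (x - d') \<le> C" using norm_triangle_ineq4[of x d'] D(3)[OF d'(1)] by (simp add: C_def)
    have "(cmod (evf \<psi> \<cdot> (x - d')))\<^sup>2 \<le> Re (evf \<phi> \<cdot> ((x - d') * (x - d')))"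
      using \<phi>(2)[of "x - d'"] pos_sa[OF p] by (simp add: sa_def)
    also have "\<dots> \<le> C * Re (evf \<phi> \<cdot> (x - d'))" by (rule posf_square_le) fact+
    also have "\<dots> < e\<^sup>2" using le_small[OF f(1) d'(2) d(2)] C by (simp add: field_simps)
    finally have "cmod (evf \<psi> \<cdot> (x - d')) < e" using e by (simp add: power_less_imp_less_base)
    then show ?thesis by (simp add: cdual_apply_diff norm_minus_commute)
  qed
  with d(1) show ?thesis by blast
qed

text \<open>Dini's theorem on the weak* compact quasi-state space.\<close>

lemma dini:
  fixes D :: "'a::cstar_algebra vN set"
  assumes D: "directed D le" "\<And>d. d \<in> D \<Longrightarrow> sa d" "D \<subseteq> range emb"
    and ex: "\<And>\<phi>. posf \<phi> \<Longrightarrow> norm \<phi> \<le> 1 \<Longrightarrow> \<exists>d\<in>D. Re (evf \<phi> \<cdot> d) > - \<gamma>"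
  shows "\<exists>d\<in>D. pos (d + \<gamma> *\<^sub>R 1)"
proof (rule ccontr)
  assume con: "\<not> ?thesis"
  have "\<exists>\<phi>. posf \<phi> \<and> norm \<phi> \<le> 1 \<and> Re (evf \<phi> \<cdot> d) \<le> - \<gamma>" if d: "d \<in> D" for d
  proof -
    have "sa (d + \<gamma> *\<^sub>R 1)" using D(2)[OF d] by (intro sa_intros sa_simps)
    then obtain f where "f \<in> NF" "Re (f \<cdot> (d + \<gamma> *\<^sub>R 1)) < 0" using con d pos_of_NF by fastforce
    then obtain \<phi> where \<phi>: "posf \<phi>" "Re (evf \<phi> \<cdot> (d + \<gamma> *\<^sub>R 1)) < 0" by (auto simp: NF_def)
    have "\<phi> \<noteq> 0"
    proof
      assume "\<phi> = 0"
      then have "cmod (evf \<phi> \<cdot> (d + \<gamma> *\<^sub>R 1)) \<le> 0" using norm_evf[of \<phi> "d + \<gamma> *\<^sub>R 1"] by simp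
      with \<phi>(2) show False by simp
    qed
    then have n: "norm \<phi> > 0" by simp
    define \<omega> where "\<omega> = (1 / norm \<phi>) *\<^sub>R \<phi>"
    have "posf \<omega>" using \<phi>(1) by (auto simp: posf_def \<omega>_def cdual_scaleR_apply complex_nonneg_Reals_iff)
    moreover have "norm \<omega> = 1" using n by (simp add: \<omega>_def)
    moreover have "evf \<omega> \<cdot> z = (1 / norm \<phi>) *\<^sub>R (evf \<phi> \<cdot> z)" for z
      by (simp add: \<omega>_def evf.rep_eq cdual_apply_scaleR)
    then have "Re (evf \<omega> \<cdot> (d + \<gamma> *\<^sub>R 1)) < 0" using \<phi>(2) n by (simp add: divide_neg_pos)
    then have "Re (evf \<omega> \<cdot> d) < - \<gamma>"
      using norm_posf[OF \<open>posf \<omega>\<close>] \<open>norm \<omega> = 1\<close> by (simp add: cdual_apply_add cdual_apply_scaleR)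
    ultimately show ?thesis by (intro exI[of _ \<omega>]) simp
  qed
  \<comment> \<open>If the claim fails, every d has a normalised positive functional as a witness. A
    cluster point of the witnesses will contradict \<open>ex\<close>.\<close>
  then obtain q where q: "\<And>d. d \<in> D \<Longrightarrow> posf (q d)" "\<And>d. d \<in> D \<Longrightarrow> norm (q d) \<le> 1"
    "\<And>d. d \<in> D \<Longrightarrow> Re (evf (q d) \<cdot> d) \<le> - \<gamma>" by metis
  let ?F = "net_filter D le q"
  obtain d0 where d0: "d0 \<in> D" using D(1) by (auto simp: directed_def)
  have ev: "eventually (\<lambda>f. norm f \<le> 1) ?F"
    unfolding eventually_net_filter[OF D(1)] using d0 q(2) by auto
  obtain \<phi> where \<phi>: "norm \<phi> \<le> 1" "\<And>v e. e > 0 \<Longrightarrow> frequently (\<lambda>f. cmod (f \<cdot> v - \<phi> \<cdot> v) < e) ?F"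
    by (rule banach_alaoglu[OF net_filter_not_bot[OF D(1)] ev zero_le_one]) blast
  have fr: "\<exists>d'\<in>D. le d d' \<and> cmod (q d' \<cdot> v - \<phi> \<cdot> v) < e" if "d \<in> D" "e > 0" for d v e
    using \<phi>(2)[OF that(2), of v] that(1) unfolding frequently_net_filter[OF D(1)] by blast
  have "posf \<phi>"
    unfolding posf_def
  proof
    fix a
    have 1: "0 - Re (\<phi> \<cdot> (adj a * a)) \<le> e" "\<bar>Im (\<phi> \<cdot> (adj a * a))\<bar> \<le> e" if e: "e > 0" for e
    proof -
      obtain d where d: "d \<in> D" "cmod (q d \<cdot> (adj a * a) - \<phi> \<cdot> (adj a * a)) < e" using fr[OF d0 e] by blast
      show "0 - Re (\<phi> \<cdot> (adj a * a)) \<le> e" "\<bar>Im (\<phi> \<cdot> (adj a * a))\<bar> \<le> e"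
        using posf_nonneg[OF q(1)[OF d(1)], of a] abs_Re_le_cmod[of "q d \<cdot> (adj a * a) - \<phi> \<cdot> (adj a * a)"]
          abs_Im_le_cmod[of "q d \<cdot> (adj a * a) - \<phi> \<cdot> (adj a * a)"] d(2) by auto
    qed
    have "0 - Re (\<phi> \<cdot> (adj a * a)) \<le> 0" by (rule field_le_epsilon) (use 1(1) in simp)
    moreover have "\<bar>Im (\<phi> \<cdot> (adj a * a))\<bar> \<le> 0" by (rule field_le_epsilon) (use 1(2) in simp)
    ultimately show "\<phi> \<cdot> (adj a * a) \<in> \<real>\<^sub>\<ge>\<^sub>0" by (simp add: complex_nonneg_Reals_iff)
  qed
  then obtain d where d: "d \<in> D" "Re (evf \<phi> \<cdot> d) > - \<gamma>" using ex \<phi>(1) by blast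
  \<comment> \<open>This is where D must consist of elements of the algebra: d is evaluation at a
    vector, so its values follow the weak* cluster point.\<close>
  obtain a where a: "d = emb a" using D(3) d(1) by blast
  define e where "e = Re (evf \<phi> \<cdot> d) + \<gamma>"
  have "e > 0" using d(2) by (simp add: e_def)
  then obtain d' where d': "d' \<in> D" "le d d'" "cmod (q d' \<cdot> a - \<phi> \<cdot> a) < e" using fr[OF d(1)] by blast
  have "Re (evf (q d') \<cdot> d) \<le> Re (evf (q d') \<cdot> d')"
    using d'(2) unfolding le_def by (intro posf_mono NF_posf evf_NF q d')
  also have "\<dots> \<le> - \<gamma>" by (rule q(3)[OF d'(1)])
  finally have "Re (q d' \<cdot> a) \<le> - \<gamma>" by (simp add: a evf_emb)
  moreover have "e = Re (\<phi> \<cdot> a) + \<gamma>" by (simp add: e_def a evf_emb)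
  moreover have "\<bar>Re (q d' \<cdot> a) - Re (\<phi> \<cdot> a)\<bar> < e"
    using abs_Re_le_cmod[of "q d' \<cdot> a - \<phi> \<cdot> a"] d'(3) by simp
  ultimately show False by linarith
qed

subsection \<open>The approximate unit\<close>

definition Lam :: "'a::cstar_algebra vN set"
  where "Lam = (\<lambda>a. emb (apx a)) ` {a. posA a}"

lemma Lam_props:
  assumes "e \<in> Lam"
  shows "sa e" "pos e" "norm e \<le> 1" "le e 1" "e \<in> range emb"
proof -
  obtain a where a: "e = emb (apx a)" "posA a" using assms by (auto simp: Lam_def)
  show "pos e" using a apx_pos(1) pos_emb by blast
  then show 1: "sa e" by (rule pos_sa)
  show 2: "norm e \<le> 1" using a apx_pos(2) by (simp add: norm_emb)
  show "le e 1" using pos_norm_minus(1)[OF 1 2] by (simp add: le_def)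
  show "e \<in> range emb" by (simp add: a)
qed

lemma Lam_directed: "directed (Lam :: 'a::cstar_algebra vN set) le"
proof (rule directedI)
  show "(Lam :: 'a vN set) \<noteq> {}" using directed_posA[where 'a='a] by (auto simp: Lam_def directed_def)
  fix x y :: "'a vN" assume "x \<in> Lam" "y \<in> Lam"
  then obtain a b where ab: "posA a" "posA b" "x = emb (apx a)" "y = emb (apx b)" by (auto simp: Lam_def)
  have p: "posA (a + b)" using ab by (simp add: posA_add)
  have "le x (emb (apx (a + b)))" "le y (emb (apx (a + b)))"
    using apx_mono[OF ab(1) p] apx_mono[OF ab(2) p] ab
    by (auto simp: le_def intro!: pos_emb simp flip: emb_simps)
  with p show "\<exists>z\<in>Lam. le x z \<and> le y z" unfolding Lam_def by blast
qed

text \<open>For the supremum x, norm convergence of b (apx a) to b gives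
  \<open>evf (arens1 \<psi> b) \<cdot> x = \<psi> \<cdot> b\<close> for all b, which says 1 x =
  1.\<close>

lemma Lam_sup: "is_sup Lam (1 :: 'a::cstar_algebra vN)"
proof -
  obtain x :: "'a vN" where x: "sa x" "is_sup Lam x"
    using sup_exists[OF Lam_directed, of 1] Lam_props(1,3) by blast
  have bx: "evf (arens1 \<psi> b) \<cdot> x = \<psi> \<cdot> b" for \<psi> :: "'a cdual" and b
  proof -
    have "cmod (evf (arens1 \<psi> b) \<cdot> x - \<psi> \<cdot> b) \<le> 0"
    proof (rule le_add_eps)
      fix e :: real assume e: "e > 0"
      obtain a1 where a1: "posA a1" "\<And>a. posA a \<Longrightarrow> posA (a - a1) \<Longrightarrow> norm (b * apx a - b) < e"
        using apx_unit[OF e, of b] by blast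
      obtain d where d: "d \<in> Lam" "\<And>d'. d' \<in> Lam \<Longrightarrow> le d d' \<Longrightarrow> cmod (evf (arens1 \<psi> b) \<cdot> (d' - x)) < e"
        using is_sup_tendsto[OF Lam_directed x(2) Lam_props(3) e] by blast
      obtain a2 where a2: "posA a2" "d = emb (apx a2)" using d(1) by (auto simp: Lam_def)
      have p: "posA (a1 + a2)" using a1 a2 by (simp add: posA_add)
      have "le d (emb (apx (a1 + a2)))"
        using apx_mono[OF a2(1) p] a1(1) a2 by (auto simp: le_def intro!: pos_emb simp flip: emb_simps)
      then have "cmod (evf (arens1 \<psi> b) \<cdot> (emb (apx (a1 + a2)) - x)) < e" using p by (intro d(2)) (auto simp: Lam_def)
      then have 1: "cmod (\<psi> \<cdot> (b * apx (a1 + a2)) - evf (arens1 \<psi> b) \<cdot> x) < e"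
        by (simp add: cdual_apply_diff evf_emb arens1.rep_eq)
      have "cmod (\<psi> \<cdot> (b * apx (a1 + a2) - b)) \<le> norm \<psi> * norm (b * apx (a1 + a2) - b)" by (rule norm_cdual_apply)
      also have "\<dots> \<le> norm \<psi> * e" using a1(2)[OF p] a2(1) by (intro mult_left_mono) auto
      finally have 2: "cmod (\<psi> \<cdot> (b * apx (a1 + a2)) - \<psi> \<cdot> b) \<le> norm \<psi> * e" by (simp add: cdual_apply_diff)
      show "cmod (evf (arens1 \<psi> b) \<cdot> x - \<psi> \<cdot> b) \<le> 0 + e * (norm \<psi> + 1)"
        using norm_triangle_ineq4[of "\<psi> \<cdot> (b * apx (a1 + a2)) - \<psi> \<cdot> b" "\<psi> \<cdot> (b * apx (a1 + a2)) - evf (arens1 \<psi> b) \<cdot> x"] 1 2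
        by (simp add: algebra_simps)
    qed simp
    then show ?thesis by simp
  qed
  have "1 * x = 1"
  proof (rule vN_eqI)
    fix \<psi> :: "'a cdual"
    have "arens2 (rep x) \<psi> = \<psi>"
      by (rule cdual_eqI) (use bx in \<open>simp add: arens2.rep_eq evf.rep_eq\<close>)
    then show "evf \<psi> \<cdot> (1 * x) = evf \<psi> \<cdot> 1" unfolding evf_mult by simp
  qed
  with x(2) show ?thesis by simp
qed

text \<open>Replaces a scalar by an element of the algebra. Take r the absolute value of a and e = n
  r (1 + n r)^-1. Multiplying a + 2 \<eta> e by 1 + n r gives (r + a) + n r (a + \<eta>) + (n \<eta>
  - 1) r, where each term is positive once n > 1/\<eta>; the factor 1 + n r is then divided out by
  commutation.\<close>

lemma Lam_compensates:
  assumes a: "sa a" and \<eta>: "\<eta> > 0" "pos (emb a + \<eta> *\<^sub>R 1)"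
  shows "\<exists>e\<in>Lam. pos (emb a + (2 * \<eta>) *\<^sub>R e)"
proof -
  obtain r where r: "posA r" "r * r = a * a" "posA (r + a)" "r * a = a * r" using abs_exA[OF a] by blast
  obtain n :: nat where n: "1 / \<eta> < real n" using reals_Archimedean2 by blast
  define s where "s = real n *\<^sub>R r"
  have s: "posA s" using r(1) by (simp add: s_def posA_scaleR)
  define R d e where "R = emb r" and "d = emb a" and "e = emb (apx s)"
  have e: "e \<in> Lam" using s by (simp add: Lam_def e_def)
  have "(1 + Uni s 0) * Uni (apx s) 0 = Uni s 0"
    using apx_minv(1,2)[OF s] by (simp add: right_diff_distrib)
  from arg_cong[OF this, of el] have "apx s + s * apx s = s" by (simp add: distrib_right scaleC_simps)
  then have "emb (apx s + s * apx s) = emb s" by simp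
  then have es: "e + real n *\<^sub>R (R * e) = real n *\<^sub>R R" by (simp add: s_def emb_simps e_def R_def)
  have Rd: "R * d = d * R" using arg_cong[OF r(4), of emb] by (simp add: emb_simps R_def d_def)
  have pR: "pos R" using r(1) by (simp add: R_def pos_emb)
  define T where "T = 1 + real n *\<^sub>R R"
  have T: "pos (T - 1 *\<^sub>R 1)" using pR by (simp add: T_def pos_scaleR)
  define S where "S = minv T"
  have S: "S * T = 1" "pos S" using minv[OF T] by (auto simp: S_def)
  define Y where "Y = d + real n *\<^sub>R (R * d) + (2 * \<eta> * real n) *\<^sub>R R"
  have TY: "T * (d + (2 * \<eta>) *\<^sub>R e) = Y"
  proof -
    have "T * (d + (2 * \<eta>) *\<^sub>R e) = d + real n *\<^sub>R (R * d) + (2 * \<eta>) *\<^sub>R (e + real n *\<^sub>R (R * e))"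
      by (simp add: T_def algebra_simps)
    then show ?thesis unfolding es by (simp add: Y_def)
  qed
  have "pos (R * (d + \<eta> *\<^sub>R 1))"
    using \<eta>(2) by (intro pos_mult pR) (simp_all add: d_def[symmetric] algebra_simps Rd)
  note p1 = this
  have p2: "pos (R + d)" using pos_emb[OF r(3)] by (simp add: emb_simps R_def d_def)
  have p3: "real n * \<eta> - 1 \<ge> 0" using n \<eta>(1) by (simp add: field_simps)
  have "pos ((R + d) + real n *\<^sub>R (R * (d + \<eta> *\<^sub>R 1)) + (real n * \<eta> - 1) *\<^sub>R R)"
    by (rule pos_add[OF pos_add[OF p2 pos_scaleR[OF p1]] pos_scaleR[OF pR p3]]) simp
  also have "(R + d) + real n *\<^sub>R (R * (d + \<eta> *\<^sub>R 1)) + (real n * \<eta> - 1) *\<^sub>R R = Y"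
  proof -
    have "(2 * \<eta> * real n) *\<^sub>R R = (real n * \<eta>) *\<^sub>R R + (real n * \<eta>) *\<^sub>R R"
      by (simp flip: scaleR_add_left)
    then show ?thesis by (simp add: Y_def algebra_simps)
  qed
  finally have pY: "pos Y" .
  have "Y * T = T * Y" by (simp add: Y_def T_def algebra_simps Rd) (simp add: Rd flip: mult.assoc)
  then have "Y * S = S * Y" unfolding S_def by (intro minv_comm[OF T]) auto
  then have "pos (S * Y)" by (intro pos_mult S pY) simp
  also have "S * Y = d + (2 * \<eta>) *\<^sub>R e" unfolding TY[symmetric] by (simp add: S(1) flip: mult.assoc)
  finally show ?thesis using e unfolding d_def by blast
qed

section \<open>A jointly operator monotone function\<close>

definition opZ :: "'b::ucstar \<Rightarrow> 'b \<Rightarrow> 'b"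
  where "opZ x y = x + \<i> *\<^sub>C y"

text \<open>The constant c bounds the inverses uniformly along nets and sequences.\<close>

definition admis :: "real \<Rightarrow> real \<Rightarrow> 'b::ucstar \<Rightarrow> 'b \<Rightarrow> bool"
  where "admis c t x y \<longleftrightarrow> c > 0 \<and> pos (1 + t *\<^sub>R (x + y) - c *\<^sub>R 1)"

definition opS :: "real \<Rightarrow> 'b::ucstar \<Rightarrow> 'b \<Rightarrow> 'b"
  where "opS t x y = minv (1 + t *\<^sub>R (x + y))"

definition opE :: "real \<Rightarrow> 'b::ucstar \<Rightarrow> 'b \<Rightarrow> 'b"
  where "opE t x y = x + y - t *\<^sub>R (opZ x y * opS t x y * adj (opZ x y))"

text \<open>\<open>opE t x y\<close> is the extremal value (minimal for \<open>t > 0\<close>, maximal for \<open>t < 0\<close>) over \<open>v\<close> of the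
  quadratic form \<open>opQ t x y v v\<close>, which is increasing in \<open>x\<close> and \<open>y\<close>; it is attained at \<open>opV t x y\<close>.\<close>

definition opV :: "real \<Rightarrow> 'b::ucstar \<Rightarrow> 'b \<Rightarrow> 'b"
  where "opV t x y = - (opS t x y * adj (opZ x y))"

text \<open>The shifts 1 and -i are chosen so that, for self-adjoint x and y, the part of
  \<open>opQ t x y v v\<close> linear in v is t (z v + adj (z v)) with z =
  \<open>opZ x y\<close>.\<close>

definition opA :: "real \<Rightarrow> 'b::ucstar \<Rightarrow> 'b" where "opA t v = 1 + t *\<^sub>R v"
definition opB :: "real \<Rightarrow> 'b::ucstar \<Rightarrow> 'b" where "opB t v = (- \<i>) *\<^sub>C 1 + t *\<^sub>R v"

definition opQ :: "real \<Rightarrow> 'b::ucstar \<Rightarrow> 'b \<Rightarrow> 'b \<Rightarrow> 'b \<Rightarrow> 'b"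
  where "opQ t x y v w = adj (opA t v) * x * opA t w + adj (opB t v) * y * opB t w + t *\<^sub>R (adj v * w)"

lemma opQ_expand:
  fixes x y v w :: "'b::ucstar"
  shows "opQ t x y v w = x + y + t *\<^sub>R (adj v * (x - \<i> *\<^sub>C y)) + t *\<^sub>R (opZ x y * w)
    + t *\<^sub>R (adj v * (1 + t *\<^sub>R (x + y)) * w)"
  by (simp add: opQ_def opA_def opB_def opZ_def adj_simps algebra_simps ii_mult scaleC_simps
      scaleC_scaleR scaleC_add_right)

lemma adj_opZ: "sa x \<Longrightarrow> sa y \<Longrightarrow> adj (opZ x y) = x - \<i> *\<^sub>C y"
  by (simp add: opZ_def adj_simps sa_def scaleC_simps)

lemma opS:
  assumes "admis c t x y"
  shows "(1 + t *\<^sub>R (x + y)) * opS t x y = 1" "opS t x y * (1 + t *\<^sub>R (x + y)) = 1"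
    "pos (opS t x y)" "sa (opS t x y)" "norm (opS t x y) \<le> 1 / c"
  using minv[of "1 + t *\<^sub>R (x + y)" c] assms by (auto simp: admis_def opS_def pos_sa)

lemma opE_sa: "admis c t x y \<Longrightarrow> sa x \<Longrightarrow> sa y \<Longrightarrow> sa (opE t x y)"
  unfolding opE_def using opS(4)[of c t x y] sa_conj[of "opS t x y" "adj (opZ x y)"]
  by (auto simp: adj_adj)

lemma opV_eq:
  assumes "admis c t x y" "sa x" "sa y"
  shows "(1 + t *\<^sub>R (x + y)) * opV t x y = - (x - \<i> *\<^sub>C y)"
    "adj (opV t x y) * (1 + t *\<^sub>R (x + y)) = - opZ x y"
proof -
  have "(1 + t *\<^sub>R (x + y)) * opV t x y = - (((1 + t *\<^sub>R (x + y)) * opS t x y) * adj (opZ x y))"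
    by (simp add: opV_def mult.assoc)
  then show "(1 + t *\<^sub>R (x + y)) * opV t x y = - (x - \<i> *\<^sub>C y)"
    by (simp add: opS(1)[OF assms(1)] adj_opZ[OF assms(2,3)])
  have "adj (opV t x y) * (1 + t *\<^sub>R (x + y)) = - (opZ x y * (opS t x y * (1 + t *\<^sub>R (x + y))))"
    using opS(4)[OF assms(1)] by (simp add: opV_def adj_simps sa_def mult.assoc)
  then show "adj (opV t x y) * (1 + t *\<^sub>R (x + y)) = - opZ x y"
    by (simp add: opS(2)[OF assms(1)])
qed

lemma opE_opZ_opV: "opE t x y = x + y + t *\<^sub>R (opZ x y * opV t x y)"
  by (simp add: opE_def opV_def mult.assoc)

text \<open>\<open>opV t x y\<close> is the critical point of the form: the terms containing w
  cancel.\<close>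

lemma opQ_left:
  assumes "admis c t x y" "sa x" "sa y"
  shows "opQ t x y (opV t x y) w = opE t x y"
proof -
  have "adj (opV t x y) = - (opZ x y * opS t x y)"
    using opS(4)[OF assms(1)] by (simp add: opV_def adj_minus adj_mult adj_adj sa_def)
  then have "adj (opV t x y) * (x - \<i> *\<^sub>C y) = opZ x y * opV t x y"
    by (simp add: opV_def mult.assoc adj_opZ[OF assms(2,3)])
  then show ?thesis
    unfolding opQ_expand opV_eq(2)[OF assms] opE_opZ_opV by simp
qed

lemma opQ_right:
  assumes "admis c t x y" "sa x" "sa y"
  shows "opQ t x y v (opV t x y) = opE t x y"
  unfolding opQ_expand mult.assoc opV_eq(1)[OF assms] opE_opZ_opV by (simp add: algebra_simps)

lemma opQ_diff:
  fixes x y :: "'b::ucstar"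
  shows "opQ t x' y' v w - opQ t x y v w
    = adj (opA t v) * (x' - x) * opA t w + adj (opB t v) * (y' - y) * opB t w"
  by (simp add: opQ_def left_diff_distrib right_diff_distrib)

text \<open>Both forms are evaluated with the critical point of (x, y) on the left and that of (x',
  y') on the right, where each takes its own extremal value. The exact mixed formula is ready for
  Cauchy-Schwarz.\<close>

lemma opE_diff:
  assumes "admis c t x y" "sa x" "sa y" "admis c' t x' y'" "sa x'" "sa y'"
  shows "opE t x' y' - opE t x y
    = adj (opA t (opV t x y)) * (x' - x) * opA t (opV t x' y')
      + adj (opB t (opV t x y)) * (y' - y) * opB t (opV t x' y')"
  using opQ_diff[of t x' y' "opV t x y" "opV t x' y'" x y]
  unfolding opQ_left[OF assms(1-3)] opQ_right[OF assms(4-6)] .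

lemma opQ_extremal:
  assumes "admis c t x y" "sa x" "sa y"
  defines "v \<equiv> opV t x y"
  shows "opQ t x y w w - opE t x y = t *\<^sub>R (adj (w - v) * (1 + t *\<^sub>R (x + y)) * (w - v))"
proof -
  define T where "T = 1 + t *\<^sub>R (x + y)"
  have a: "x - \<i> *\<^sub>C y = - (T * v)" and b: "opZ x y = - (adj v * T)"
    using opV_eq[OF assms(1-3)] by (auto simp: T_def v_def)
  have e: "opE t x y = x + y - t *\<^sub>R (adj v * T * v)"
    unfolding opE_opZ_opV by (simp add: b v_def[symmetric] mult.assoc)
  have q: "opQ t x y w w = x + y + t *\<^sub>R (adj w * (- (T * v))) + t *\<^sub>R (- (adj v * T) * w) + t *\<^sub>R (adj w * T * w)"
    unfolding opQ_expand a b T_def[symmetric] ..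
  show ?thesis unfolding q e T_def[symmetric] by (simp add: adj_simps algebra_simps)
qed

lemma opQ_mono:
  assumes "le x x'" "le y y'" shows "le (opQ t x y v v) (opQ t x' y' v v)"
  unfolding le_def opQ_diff using assms by (intro pos_add pos_conj) (auto simp: le_def)

lemma admis_pos: "admis c t x y \<Longrightarrow> pos (1 + t *\<^sub>R (x + y))"
  unfolding admis_def using pos_add[of "1 + t *\<^sub>R (x + y) - c *\<^sub>R 1" "c *\<^sub>R 1"] pos_scaleR_one[of c] by auto

lemma opE_le_opQ:
  assumes "admis c t x y" "sa x" "sa y" "t \<ge> 0"
  shows "le (opE t x y) (opQ t x y w w)"
  unfolding le_def opQ_extremal[OF assms(1-3)]
  by (intro pos_scaleR pos_conj admis_pos[OF assms(1)] assms)

lemma opQ_le_opE: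
  assumes "admis c t x y" "sa x" "sa y" "t \<le> 0"
  shows "le (opQ t x y w w) (opE t x y)"
proof -
  let ?v = "opV t x y"
  have "pos ((- t) *\<^sub>R (adj (w - ?v) * (1 + t *\<^sub>R (x + y)) * (w - ?v)))"
    by (intro pos_scaleR pos_conj admis_pos[OF assms(1)]) (use assms in simp)
  moreover have "opE t x y - opQ t x y w w = (- t) *\<^sub>R (adj (w - ?v) * (1 + t *\<^sub>R (x + y)) * (w - ?v))"
    using opQ_extremal[OF assms(1-3), of w] by (metis minus_diff_eq scaleR_minus_left)
  ultimately show ?thesis unfolding le_def by simp
qed

text \<open>For t \<ge> 0 the minimiser of the larger pair is tested in the smaller form; for t < 0
  the maximiser of the smaller pair is tested in the larger form.\<close>

lemma opE_mono:
  assumes "admis c t x y" "sa x" "sa y" "admis c' t x' y'" "sa x'" "sa y'" "le x x'" "le y y'"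
  shows "le (opE t x y) (opE t x' y')"
proof (cases "t \<ge> 0")
  case True
  let ?v = "opV t x' y'"
  have "le (opE t x y) (opQ t x y ?v ?v)" by (rule opE_le_opQ[OF assms(1-3) True])
  moreover have "le (opQ t x y ?v ?v) (opQ t x' y' ?v ?v)" by (rule opQ_mono) fact+
  ultimately show ?thesis unfolding opQ_left[OF assms(4-6)] by (rule le_trans)
next
  case False
  let ?v = "opV t x y"
  have "le (opQ t x y ?v ?v) (opQ t x' y' ?v ?v)" by (rule opQ_mono) fact+
  moreover have "le (opQ t x' y' ?v ?v) (opE t x' y')" by (rule opQ_le_opE[OF assms(4-6)]) (use False in simp)
  ultimately show ?thesis unfolding opQ_left[OF assms(1-3)] by (rule le_trans)
qed

text \<open>The vector v depends on (x, y) alone, so the bound carries no constant depending on the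
  norms of x' and y'.\<close>

lemma opE_diff_le:
  assumes "admis c t x y" "sa x" "sa y" "admis c' t x' y'" "sa x'" "sa y'" "t \<ge> 0"
  defines "v \<equiv> opV t x y"
  shows "le (opE t x' y' - opE t x y) (adj (opA t v) * (x' - x) * opA t v + adj (opB t v) * (y' - y) * opB t v)"
  using opE_le_opQ[OF assms(4-7), of v]
  unfolding opQ_diff[of t x' y' v v x y, symmetric] unfolding v_def opQ_left[OF assms(1-3)] by (simp add: le_def)

text \<open>Trades the sign of t for that of the arguments, so that results on suprema and upper
  approximation also serve for infima and lower approximation.\<close>

lemma opE_neg: "opE t (- x) (- y) = - opE (- t) x y"
  by (simp add: opE_def opS_def opZ_def adj_simps scaleC_simps algebra_simps)

lemma admis_mono:
  assumes "admis c t x y" "le x x'" "le y y'" "t \<ge> 0" shows "admis c t x' y'"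
proof -
  have "pos (1 + t *\<^sub>R (x + y) - c *\<^sub>R 1 + t *\<^sub>R ((x' - x) + (y' - y)))"
    using assms by (intro pos_add pos_scaleR) (auto simp: admis_def le_def intro: pos_add)
  then show ?thesis using assms by (simp add: admis_def algebra_simps)
qed

lemma admis_anti:
  assumes "admis c t x' y'" "le x x'" "le y y'" "t \<le> 0" shows "admis c t x y"
proof -
  have "pos (1 + t *\<^sub>R (x' + y') - c *\<^sub>R 1 + (- t) *\<^sub>R ((x' - x) + (y' - y)))"
    using assms by (intro pos_add pos_scaleR) (auto simp: admis_def le_def intro: pos_add)
  then show ?thesis using assms by (simp add: admis_def algebra_simps)
qed

lemma admis_norm:
  assumes "sa x" "sa y" "\<bar>t\<bar> * (norm x + norm y) \<le> 1 - c" "c > 0" shows "admis c t x y"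
proof -
  have "norm (t *\<^sub>R (x + y)) \<le> 1 - c"
    using assms(3) mult_left_mono[OF norm_triangle_ineq[of x y], of "\<bar>t\<bar>"] by simp
  then have "pos ((1 - c) *\<^sub>R 1 + t *\<^sub>R (x + y))" by (intro pos_norm_minus(2) sa_intros assms)
  then show ?thesis using assms(4) by (simp add: admis_def algebra_simps)
qed

lemma admis_weaken:
  assumes "admis c t x y" "0 < c'" "c' \<le> c" shows "admis c' t x y"
  using assms pos_add[of "1 + t *\<^sub>R (x + y) - c *\<^sub>R 1" "(c - c') *\<^sub>R 1"] pos_scaleR_one[of "c - c'"]
  by (simp add: admis_def algebra_simps)

lemma norm_opZ: "norm (opZ x y) \<le> norm x + norm y"
  unfolding opZ_def using norm_triangle_ineq[of x "\<i> *\<^sub>C y"] by (simp add: norm_scaleC)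

lemma norm_opV:
  assumes "admis c t x y" shows "norm (opV t x y) \<le> (norm x + norm y) / c"
proof -
  have c: "c > 0" using assms by (simp add: admis_def)
  have "norm (opV t x y) \<le> norm (opS t x y) * norm (adj (opZ x y))"
    unfolding opV_def norm_minus_cancel by (rule norm_mult_ineq)
  also have "\<dots> \<le> (1 / c) * (norm x + norm y)"
    unfolding norm_adj by (intro mult_mono opS(5)[OF assms] norm_opZ) (use c in auto)
  finally show ?thesis by simp
qed

lemma norm_opA_opB:
  assumes "norm v \<le> L" shows "norm (opA t v) \<le> 1 + \<bar>t\<bar> * L" "norm (opB t v) \<le> 1 + \<bar>t\<bar> * L"
proof -
  have 1: "norm (t *\<^sub>R v) \<le> \<bar>t\<bar> * L" using assms by (simp add: mult_left_mono)
  show "norm (opA t v) \<le> 1 + \<bar>t\<bar> * L"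
    unfolding opA_def by (rule order_trans[OF norm_triangle_ineq add_mono[OF norm_one_le 1]])
  have "norm ((- \<i>) *\<^sub>C (1::'a)) \<le> 1" using norm_one_le[where 'a='a] by (simp only: norm_scaleC) simp
  then show "norm (opB t v) \<le> 1 + \<bar>t\<bar> * L"
    unfolding opB_def by (rule order_trans[OF norm_triangle_ineq add_mono[OF _ 1]])
qed

lemma norm_opE:
  assumes "admis c t x y"
  shows "norm (opE t x y) \<le> (norm x + norm y) + \<bar>t\<bar> * ((norm x + norm y)\<^sup>2 / c)"
proof -
  have "norm (opZ x y * opV t x y) \<le> norm (opZ x y) * norm (opV t x y)" by (rule norm_mult_ineq)
  also have "\<dots> \<le> (norm x + norm y) * ((norm x + norm y) / c)"
    by (intro mult_mono norm_opZ norm_opV[OF assms]) auto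
  finally have "\<bar>t\<bar> * norm (opZ x y * opV t x y) \<le> \<bar>t\<bar> * ((norm x + norm y)\<^sup>2 / c)"
    by (intro mult_left_mono) (auto simp: power2_eq_square)
  then show ?thesis
    unfolding opE_opZ_opV
    using norm_triangle_ineq[of "x + y" "t *\<^sub>R (opZ x y * opV t x y)"] norm_triangle_ineq[of x y] by simp
qed

lemma opZ_tendsto:
  assumes "X \<longlonglongrightarrow> x" "Y \<longlonglongrightarrow> (y :: 'b::ucstar)" shows "(\<lambda>n. opZ (X n) (Y n)) \<longlonglongrightarrow> opZ x y"
  unfolding opZ_def by (intro tendsto_add assms(1) bounded_linear.tendsto[OF bounded_linear_scaleC assms(2)])

lemma opE_tendsto:
  assumes x: "x \<longlonglongrightarrow> x0" "y \<longlonglongrightarrow> y0" and ad: "admis c t x0 y0" "\<And>n. admis c t (x n) (y n)"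
  shows "(\<lambda>n. opE t (x n) (y n)) \<longlonglongrightarrow> opE t x0 (y0 :: 'b::ucstar)"
proof -
  let ?T = "\<lambda>n. 1 + t *\<^sub>R (x n + y n)" and ?U = "1 + t *\<^sub>R (x0 + y0)"
  have c: "c > 0" using ad by (simp add: admis_def)
  have T: "?T \<longlonglongrightarrow> ?U" by (intro tendsto_intros x)
  have "opS t (x n) (y n) - opS t x0 y0 = opS t (x n) (y n) * (?U - ?T n) * opS t x0 y0" for n
    using opS(1)[OF ad(1)] opS(2)[OF ad(2), of n] by (simp only: left_diff_distrib right_diff_distrib mult.assoc) (simp flip: mult.assoc)
  then have 1: "norm (opS t (x n) (y n) - opS t x0 y0) \<le> norm (?U - ?T n) / c\<^sup>2" for n
  proof -
    have "norm (opS t (x n) (y n) * (?U - ?T n) * opS t x0 y0)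
      \<le> norm (opS t (x n) (y n)) * norm (?U - ?T n) * norm (opS t x0 y0)"
      by (rule order_trans[OF norm_mult_ineq mult_right_mono[OF norm_mult_ineq]]) simp
    also have "\<dots> \<le> (1 / c) * norm (?U - ?T n) * (1 / c)"
      by (intro mult_mono opS(5) ad) (use c in auto)
    finally show ?thesis using \<open>\<And>n. opS t (x n) (y n) - opS t x0 y0 = _ n\<close>[of n] by (simp add: power2_eq_square)
  qed
  have "(\<lambda>n. norm (?U - ?T n) / c\<^sup>2) \<longlonglongrightarrow> norm (?U - ?U) / c\<^sup>2"
    using c by (intro tendsto_divide tendsto_norm tendsto_diff tendsto_const T) simp
  then have "(\<lambda>n. norm (?U - ?T n) / c\<^sup>2) \<longlonglongrightarrow> 0" by simp
  then have "(\<lambda>n. opS t (x n) (y n) - opS t x0 y0) \<longlonglongrightarrow> 0"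
    by (rule Lim_null_comparison[OF always_eventually, OF allI, rotated]) (rule 1)
  then have S: "(\<lambda>n. opS t (x n) (y n)) \<longlonglongrightarrow> opS t x0 y0" by (rule LIM_zero_cancel)
  have Z: "(\<lambda>n. opZ (x n) (y n)) \<longlonglongrightarrow> opZ x0 y0" by (rule opZ_tendsto[OF x])
  show ?thesis unfolding opE_def
    by (intro tendsto_diff tendsto_add tendsto_scaleR tendsto_const tendsto_mult x S Z tendsto_adj)
qed

section \<open>Estimates for differences of values of \<open>opE\<close>\<close>

lemma posf_CS_pos:
  fixes X :: "'b::ucstar"
  assumes "posf f" "pos X"
  shows "cmod (f \<cdot> (adj a * X * b)) \<le> sqrt (Re (f \<cdot> (adj a * X * a))) * sqrt (Re (f \<cdot> (adj b * X * b)))"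
proof -
  obtain w where w: "X = adj w * w" using assms(2) pos_iff by blast
  have "adj a * X * b = adj (w * a) * (w * b)" for a b by (simp add: w adj_simps mult.assoc)
  then show ?thesis using posf_CS[OF assms(1), of "w * a" "w * b"] by (simp add: N_def)
qed

lemma sqrt_conj_bound:
  fixes X :: "'b::ucstar"
  assumes "norm a \<le> L" "norm X \<le> K"
  shows "sqrt (Re (f \<cdot> (adj a * X * a))) \<le> sqrt (norm f * (L * K * L))"
proof -
  have L: "L \<ge> 0" using assms(1) norm_ge_zero order_trans by blast
  have K: "K \<ge> 0" using assms(2) norm_ge_zero order_trans by blast
  have "Re (f \<cdot> (adj a * X * a)) \<le> norm f * norm (adj a * X * a)"
    using norm_cdual_apply complex_Re_le_cmod order_trans by blast
  also have "norm (adj a * X * a) \<le> norm (adj a) * norm X * norm a"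
    by (rule order_trans[OF norm_mult_ineq mult_right_mono[OF norm_mult_ineq]]) simp
  also have "\<dots> \<le> L * K * L" unfolding norm_adj by (intro mult_mono assms) (use K L in auto)
  finally show ?thesis by (simp add: mult_left_mono)
qed

text \<open>Cauchy-Schwarz in \<open>opE_diff\<close>: one factor is kept and the other is absorbed
  into a constant depending on K. Either critical point may be kept; nets increasing to a limit use
  that of the larger pair, approximation from above that of the smaller one.\<close>

lemma opE_est:
  fixes x y :: "'b::ucstar"
  assumes f: "posf f" and ad: "admis c t x y" "sa x" "sa y" "admis c t x' y'" "sa x'" "sa y'"
    and le: "le x x'" "le y y'" and K: "norm x \<le> K" "norm y \<le> K" "norm x' \<le> K" "norm y' \<le> K"
    and v: "v = opV t x y \<or> v = opV t x' y'"
  defines "L \<equiv> 1 + \<bar>t\<bar> * (2 * K / c)"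
  shows "Re (f \<cdot> (opE t x' y' - opE t x y)) \<le> sqrt (norm f * (L * (2 * K) * L))
    * (sqrt (Re (f \<cdot> (adj (opA t v) * (x' - x) * opA t v))) + sqrt (Re (f \<cdot> (adj (opB t v) * (y' - y) * opB t v))))"
proof -
  have c: "c > 0" using ad(1) by (simp add: admis_def)
  define M where "M = sqrt (norm f * (L * (2 * K) * L))"
  have nV: "norm (opV t x y) \<le> 2 * K / c" "norm (opV t x' y') \<le> 2 * K / c"
    using norm_opV[OF ad(1)] norm_opV[OF ad(4)] K c
      divide_right_mono[of "norm x + norm y" "2 * K" c] divide_right_mono[of "norm x' + norm y'" "2 * K" c] by simp_all
  have nX: "norm (x' - x) \<le> 2 * K" "norm (y' - y) \<le> 2 * K"
    using norm_triangle_ineq4[of x' x] norm_triangle_ineq4[of y' y] K by simp_all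
  have pX: "pos (x' - x)" "pos (y' - y)" using le by (simp_all add: le_def)
  have b: "sqrt (Re (f \<cdot> (adj (opA t w) * (x' - x) * opA t w))) \<le> M"
    "sqrt (Re (f \<cdot> (adj (opB t w) * (y' - y) * opB t w))) \<le> M"
    if "w = opV t x y \<or> w = opV t x' y'" for w
  proof -
    have "norm w \<le> 2 * K / c" using that nV by auto
    note n = norm_opA_opB[OF this, of t, folded L_def]
    show "sqrt (Re (f \<cdot> (adj (opA t w) * (x' - x) * opA t w))) \<le> M"
      "sqrt (Re (f \<cdot> (adj (opB t w) * (y' - y) * opB t w))) \<le> M"
      unfolding M_def by (rule sqrt_conj_bound[OF n(1) nX(1)] sqrt_conj_bound[OF n(2) nX(2)])+
  qed
  have nn: "0 \<le> sqrt (Re (f \<cdot> (adj a * X * a)))" if "pos X" for a X :: 'b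
    using posf_pos(1)[OF f pos_conj[OF that]] by simp
  \<comment> \<open>Of two factors below M the one called r is kept and the other is replaced by
    M.\<close>
  have prod: "p * q \<le> M * r" if "p \<le> M" "q \<le> M" "p \<ge> 0" "q \<ge> 0" "r = p \<or> r = q" for p q r
    using that mult_left_mono[of q M p] mult_right_mono[of p M q] by (auto simp: mult.commute)
  let ?v = "opV t x y" and ?w = "opV t x' y'"
  have "Re (f \<cdot> (opE t x' y' - opE t x y)) \<le> cmod (f \<cdot> (adj (opA t ?v) * (x' - x) * opA t ?w))
    + cmod (f \<cdot> (adj (opB t ?v) * (y' - y) * opB t ?w))"
    unfolding opE_diff[OF ad] cdual_apply_add plus_complex.sel by (intro add_mono complex_Re_le_cmod)
  also have "cmod (f \<cdot> (adj (opA t ?v) * (x' - x) * opA t ?w)) \<le> M * sqrt (Re (f \<cdot> (adj (opA t v) * (x' - x) * opA t v)))"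
    by (rule order_trans[OF posf_CS_pos[OF f pX(1)] prod]) (use b nn pX v in auto)
  also have "cmod (f \<cdot> (adj (opB t ?v) * (y' - y) * opB t ?w)) \<le> M * sqrt (Re (f \<cdot> (adj (opB t v) * (y' - y) * opB t v)))"
    by (rule order_trans[OF posf_CS_pos[OF f pX(2)] prod]) (use b nn pX v in auto)
  finally show ?thesis by (simp add: M_def distrib_left)
qed

text \<open>\<open>minv (1 + q)\<close> involves the unit and need not lie in R, but flanked by
  elements of R it does. The iterates W n converge to it geometrically.\<close>

lemma mult_minv_mem:
  fixes R :: "'b::ucstar set"
  assumes R: "closed R" "\<And>a b. a \<in> R \<Longrightarrow> b \<in> R \<Longrightarrow> a + b \<in> R" "\<And>r a. a \<in> R \<Longrightarrow> r *\<^sub>R a \<in> R"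
    "\<And>a b. a \<in> R \<Longrightarrow> b \<in> R \<Longrightarrow> a * b \<in> R"
    and q: "q \<in> R" "pos (1 + q - c *\<^sub>R 1)" "c > 0" and ab: "a \<in> R" "b \<in> R"
  shows "a * minv (1 + q) * b \<in> R"
proof -
  define T where "T = 1 + q"
  have T: "pos (T - c *\<^sub>R 1)" using q by (simp add: T_def)
  note S = minv[OF T q(3)]
  have saT: "sa T" using pos_sa[OF T] by (simp add: sa_def adj_simps)
  define K where "K = norm T + c"
  have K: "K > 0" "K \<ge> c" using q(3) by (auto simp: K_def intro: add_nonneg_pos)
  define g where "g = 1 - (1 / K) *\<^sub>R T"
  have "pos (K *\<^sub>R 1 - T)" using pos_norm_minus(1)[OF saT, of K] q by (simp add: K_def)
  then have "norm (K *\<^sub>R 1 - T) \<le> norm ((K - c) *\<^sub>R (1::'b))"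
    by (rule norm_mono) (use T in \<open>simp add: algebra_simps\<close>)
  also have "\<dots> \<le> K - c" using norm_scaleR_one[of "K - c", where 'a='b] K by simp
  finally have "norm (K *\<^sub>R 1 - T) \<le> K - c" .
  moreover have "g = (1 / K) *\<^sub>R (K *\<^sub>R 1 - T)" using K by (simp add: g_def scaleR_diff_right)
  ultimately have ng: "norm g \<le> (K - c) / K" using K by (simp add: divide_right_mono)
  define r where "r = (K - c) / K"
  have r: "0 \<le> r" "r < 1" using K q(3) by (auto simp: r_def)
  define W where "W = rec_nat (0::'b) (\<lambda>n w. (1 / K) *\<^sub>R 1 + g * w)"
  have W: "W 0 = 0" "W (Suc n) = (1 / K) *\<^sub>R 1 + g * W n" for n by (auto simp: W_def)
  have fx: "minv T = (1 / K) *\<^sub>R 1 + g * minv T" using S(1) by (simp add: g_def algebra_simps)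
  have "norm (W n - minv T) \<le> r ^ n * norm (minv T)" for n
  proof (induction n)
    case (Suc n)
    have "W (Suc n) - minv T = g * (W n - minv T)"
      by (subst fx) (simp add: W right_diff_distrib)
    then have "norm (W (Suc n) - minv T) \<le> norm g * norm (W n - minv T)" using norm_mult_ineq by metis
    also have "\<dots> \<le> r * (r ^ n * norm (minv T))"
      by (intro mult_mono Suc) (use ng r in \<open>auto simp: r_def\<close>)
    finally show ?case by (simp add: mult.assoc)
  qed (simp add: W)
  moreover have "(\<lambda>n. r ^ n * norm (minv T)) \<longlonglongrightarrow> 0 * norm (minv T)"
    by (intro tendsto_mult tendsto_const LIMSEQ_realpow_zero r)
  then have "(\<lambda>n. r ^ n * norm (minv T)) \<longlonglongrightarrow> 0" by simp
  ultimately have "(\<lambda>n. W n - minv T) \<longlonglongrightarrow> 0"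
    by (rule Lim_null_comparison[OF always_eventually, OF allI])
  then have "W \<longlonglongrightarrow> minv T" by (rule LIM_zero_cancel)
  then have lim: "(\<lambda>n. a * W n * b) \<longlonglongrightarrow> a * minv T * b" by (intro tendsto_mult tendsto_const)
  have "0 \<in> R" using R(3)[OF ab(1), of 0] by simp
  \<comment> \<open>Generalised over the left factor, which absorbs g: the product a' g lies in R
    although g contains the unit.\<close>
  have "a' \<in> R \<Longrightarrow> a' * W n * b \<in> R" for n a'
  proof (induction n arbitrary: a')
    case (Suc n)
    have "a' * g = (1 - 1 / K) *\<^sub>R a' + (- (1 / K)) *\<^sub>R (a' * q)"
      by (simp add: g_def T_def algebra_simps)
    also have "\<dots> \<in> R" by (intro R Suc q)
    finally have 1: "a' * g * W n * b \<in> R" by (rule Suc.IH)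
    have "a' * W (Suc n) * b = (1 / K) *\<^sub>R (a' * b) + a' * g * W n * b"
      by (simp add: W algebra_simps)
    also have "\<dots> \<in> R" by (intro R(2) 1 R(3) R(4) Suc ab)
    finally show ?case .
  qed (use W \<open>0 \<in> R\<close> in simp)
  then show ?thesis using lim R(1) ab unfolding T_def[symmetric] by (metis closed_sequentially)
qed

section \<open>Strongly lower semicontinuous elements\<close>

text \<open>The sets \<open>Am\<close>, \<open>lscM\<close>, \<open>SbarM\<close>, \<open>Um\<close>, \<open>UbM\<close>, \<open>U0M\<close> in \<open>vN\<close> correspond to \<open>(A\<^sub>s\<^sub>a)\<^sup>m\<close>, its norm
  closure, \<open>S_bar\<close>, \<open>U_meas\<close>, \<open>U_b\<close> and \<open>U_0\<close> under \<open>rep\<close>.\<close>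

definition Am :: "'a::cstar_algebra vN set"
  where "Am = {h. \<exists>D. directed D le \<and> D \<subseteq> range emb \<and> (\<forall>d\<in>D. sa d) \<and> bounded D \<and> is_sup D h}"

lemma directed_ne: "directed D ord \<Longrightarrow> \<exists>d. d \<in> D"
  unfolding directed_def by blast

text \<open>Boundedness is free: beyond a member d0 the net lies between d0 and h.\<close>

lemma Am_I:
  assumes D: "directed D le" "D \<subseteq> range emb" "\<And>d. d \<in> D \<Longrightarrow> sa d" "is_sup D h"
  shows "h \<in> Am"
proof -
  obtain d0 where d0: "d0 \<in> D" using directed_ne[OF D(1)] by blast
  let ?D = "{d\<in>D. le d0 d}"
  have "norm d \<le> norm h + 2 * norm d0" if "d \<in> ?D" for d
    using that D(4) by (intro norm_between) (auto simp: is_sup_def le_def)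
  then have "bounded ?D" unfolding bounded_iff by blast
  moreover have "directed ?D le" "is_sup ?D h"
    using directed_tail[OF D(1) d0] is_sup_tail[OF D(1,4) d0] by auto
  ultimately show ?thesis unfolding Am_def using D(2,3) by blast
qed

lemma Am_E:
  assumes "h \<in> Am"
  obtains D K where "directed D le" "D \<subseteq> range emb" "\<And>d. d \<in> D \<Longrightarrow> sa d" "\<And>d. d \<in> D \<Longrightarrow> norm d \<le> K" "is_sup D h"
  using assms unfolding Am_def bounded_iff by blast

lemma Am_sa: "h \<in> Am \<Longrightarrow> sa h"
  unfolding Am_def directed_def using is_sup_sa by blast

lemma Am_emb: "sa d \<Longrightarrow> d \<in> range emb \<Longrightarrow> d \<in> Am"
  by (rule Am_I[of "{d}"]) (auto intro!: directedI simp: is_sup_def)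

lemma Am_one: "1 \<in> Am"
  by (rule Am_I[OF Lam_directed _ _ Lam_sup]) (use Lam_props in auto)

lemma directed_sum:
  assumes "directed D le" "directed E le" shows "directed {d + e | d e. d \<in> D \<and> e \<in> E} (le :: 'b::ucstar \<Rightarrow> _)"
proof (rule directedI)
  show "{d + e | d e. d \<in> D \<and> e \<in> E} \<noteq> {}" using directed_ne[OF assms(1)] directed_ne[OF assms(2)] by blast
  fix x y assume "x \<in> {d + e | d e. d \<in> D \<and> e \<in> E}" "y \<in> {d + e | d e. d \<in> D \<and> e \<in> E}"
  then obtain d e d' e' where *: "x = d + e" "y = d' + e'" "d \<in> D" "e \<in> E" "d' \<in> D" "e' \<in> E" by blast
  obtain d2 e2 where "d2 \<in> D" "le d d2" "le d' d2" "e2 \<in> E" "le e e2" "le e' e2"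
    using directedD[OF assms(1) *(3,5)] directedD[OF assms(2) *(4,6)] by blast
  then show "\<exists>z\<in>{d + e | d e. d \<in> D \<and> e \<in> E}. le x z \<and> le y z"
    using * by (intro bexI[of _ "d2 + e2"]) (auto intro: le_add)
qed

lemma is_sup_sum:
  assumes "is_sup D x" "is_sup E y" shows "is_sup {d + e | d e. d \<in> D \<and> e \<in> E} (x + y)"
  unfolding is_sup_def
proof (intro conjI ballI allI impI)
  fix f :: "'a vN cdual" and r :: real assume f: "f \<in> NF" "r > 0"
  then obtain d e where "d \<in> D" "Re (f \<cdot> (x - d)) < r / 2" "e \<in> E" "Re (f \<cdot> (y - e)) < r / 2"
    using assms unfolding is_sup_def by (meson half_gt_zero)
  then show "\<exists>z\<in>{d + e | d e. d \<in> D \<and> e \<in> E}. Re (f \<cdot> (x + y - z)) < r"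
    by (intro bexI[of _ "d + e"]) (auto simp: cdual_apply_diff cdual_apply_add)
qed (use assms in \<open>auto simp: is_sup_def intro: le_add\<close>)

lemma range_emb_simps:
  "x \<in> range emb \<Longrightarrow> y \<in> range emb \<Longrightarrow> x + y \<in> range emb"
  "x \<in> range emb \<Longrightarrow> y \<in> range emb \<Longrightarrow> x * y \<in> range emb"
  "x \<in> range emb \<Longrightarrow> r *\<^sub>R x \<in> range emb"
  "x \<in> range emb \<Longrightarrow> adj x \<in> range emb"
  "x \<in> range emb \<Longrightarrow> c *\<^sub>C x \<in> range emb"
  "x \<in> range emb \<Longrightarrow> y \<in> range emb \<Longrightarrow> x - y \<in> range emb"
proof -
  have C: "emb (c *\<^sub>C a) = c *\<^sub>C emb a" for c and a :: 'a
    by transfer (rule cdual_eqI, simp add: embed.rep_eq cdual_simps)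
  show "x \<in> range emb \<Longrightarrow> y \<in> range emb \<Longrightarrow> x + y \<in> range emb"
    "x \<in> range emb \<Longrightarrow> y \<in> range emb \<Longrightarrow> x * y \<in> range emb"
    "x \<in> range emb \<Longrightarrow> r *\<^sub>R x \<in> range emb"
    "x \<in> range emb \<Longrightarrow> adj x \<in> range emb"
    "x \<in> range emb \<Longrightarrow> c *\<^sub>C x \<in> range emb"
    "x \<in> range emb \<Longrightarrow> y \<in> range emb \<Longrightarrow> x - y \<in> range emb"
    by (auto simp flip: emb_simps C)
qed

lemma Am_add: "x \<in> Am \<Longrightarrow> y \<in> Am \<Longrightarrow> x + y \<in> Am"
proof -
  assume "x \<in> Am" "y \<in> Am"
  then obtain D E where *: "directed D le" "D \<subseteq> range emb" "\<And>d. d \<in> D \<Longrightarrow> sa d" "is_sup D x"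
    "directed E le" "E \<subseteq> range emb" "\<And>d. d \<in> E \<Longrightarrow> sa d" "is_sup E y" by (metis Am_E)
  show "x + y \<in> Am"
    by (rule Am_I[OF directed_sum[OF *(1,5)] _ _ is_sup_sum[OF *(4,8)]])
      (use * in \<open>auto intro!: range_emb_simps sa_intros\<close>)
qed

lemma Am_scaleR: "x \<in> Am \<Longrightarrow> r \<ge> 0 \<Longrightarrow> r *\<^sub>R x \<in> Am"
proof (cases "r = 0")
  case True
  have "(0 :: 'a vN) \<in> range emb" by (rule range_eqI[of _ _ 0]) (simp add: emb_simps)
  then have "(0 :: 'a vN) \<in> Am" by (intro Am_emb) simp
  with True show ?thesis by simp
next
  case False
  assume "x \<in> Am" "r \<ge> 0"
  with False have r: "r > 0" by simp
  obtain D where *: "directed D le" "D \<subseteq> range emb" "\<And>d. d \<in> D \<Longrightarrow> sa d" "is_sup D x"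
    using \<open>x \<in> Am\<close> by (rule Am_E) blast
  show ?thesis
  proof (rule Am_I)
    show "directed ((*\<^sub>R) r ` D) le"
    proof (rule directedI)
      show "(*\<^sub>R) r ` D \<noteq> {}" using directed_ne[OF *(1)] by blast
      fix u v assume "u \<in> (*\<^sub>R) r ` D" "v \<in> (*\<^sub>R) r ` D"
      then obtain d e where de: "u = r *\<^sub>R d" "v = r *\<^sub>R e" "d \<in> D" "e \<in> D" by blast
      obtain k where "k \<in> D" "le d k" "le e k" using directedD[OF *(1) de(3,4)] by blast
      then show "\<exists>z\<in>(*\<^sub>R) r ` D. le u z \<and> le v z" using de r le_scaleR by (metis imageI less_imp_le)
    qed
    show "is_sup ((*\<^sub>R) r ` D) (r *\<^sub>R x)"
      unfolding is_sup_def
    proof (intro conjI ballI allI impI)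
      fix f :: "'a vN cdual" and e :: real assume f: "f \<in> NF" "e > 0"
      then obtain d where "d \<in> D" "Re (f \<cdot> (x - d)) < e / r" using *(4) r unfolding is_sup_def by (meson divide_pos_pos)
      then show "\<exists>z\<in>(*\<^sub>R) r ` D. Re (f \<cdot> (r *\<^sub>R x - z)) < e"
        using r by (intro bexI[of _ "r *\<^sub>R d"]) (auto simp: field_simps cdual_apply_diff cdual_apply_scaleR)
    qed (use *(4) r in \<open>auto simp: is_sup_def intro: le_scaleR\<close>)
  qed (use * in \<open>auto intro!: range_emb_simps sa_intros\<close>)
qed

lemma sqrt_triple_nonneg:
  fixes a K L :: real
  assumes "a \<ge> 0" "K \<ge> 0" shows "0 \<le> sqrt (a * (L * (2 * K) * L))"
proof -
  have "L * (2 * K) * L = 2 * K * (L * L)" by simp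
  then show ?thesis using assms by simp
qed

text \<open>Conjugating f by \<open>opA t v\<close> and \<open>opB t v\<close> gives normal positive
  functionals. Members d and e are chosen close to x and y for these, and \<open>opE_est\<close>
  carries this over to f.\<close>

lemma is_sup_opE:
  fixes x y :: "'a::cstar_algebra vN"
  assumes D: "directed D le" "is_sup D x" "\<And>d. d \<in> D \<Longrightarrow> sa d \<and> norm d \<le> K"
    and E: "directed E le" "is_sup E y" "\<And>d. d \<in> E \<Longrightarrow> sa d \<and> norm d \<le> K"
    and xy: "norm x \<le> K" "norm y \<le> K" "admis c t x y"
    and ad: "\<And>d e. d \<in> D \<Longrightarrow> e \<in> E \<Longrightarrow> admis c t d e"
  shows "directed {opE t d e | d e. d \<in> D \<and> e \<in> E} le"
    and "is_sup {opE t d e | d e. d \<in> D \<and> e \<in> E} (opE t x y)"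
proof -
  obtain d0 e0 where d0: "d0 \<in> D" "e0 \<in> E" using directed_ne[OF D(1)] directed_ne[OF E(1)] by blast
  have sa: "sa x" "sa y" using is_sup_sa[OF D(2) d0(1)] is_sup_sa[OF E(2) d0(2)] D(3) E(3) d0 by auto
  show "directed {opE t d e | d e. d \<in> D \<and> e \<in> E} le"
  proof (rule directedI)
    show "{opE t d e | d e. d \<in> D \<and> e \<in> E} \<noteq> {}" using d0 by blast
    fix u v assume "u \<in> {opE t d e | d e. d \<in> D \<and> e \<in> E}" "v \<in> {opE t d e | d e. d \<in> D \<and> e \<in> E}"
    then obtain d e d' e' where *: "u = opE t d e" "v = opE t d' e'" "d \<in> D" "e \<in> E" "d' \<in> D" "e' \<in> E" by blast
    obtain d2 e2 where 2: "d2 \<in> D" "le d d2" "le d' d2" "e2 \<in> E" "le e e2" "le e' e2"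
      using directedD[OF D(1) *(3,5)] directedD[OF E(1) *(4,6)] by blast
    have "le u (opE t d2 e2)" "le v (opE t d2 e2)"
      unfolding * by (rule opE_mono; use ad D(3) E(3) * 2 in blast)+
    with 2 show "\<exists>z\<in>{opE t d e | d e. d \<in> D \<and> e \<in> E}. le u z \<and> le v z" by blast
  qed
  show "is_sup {opE t d e | d e. d \<in> D \<and> e \<in> E} (opE t x y)"
    unfolding is_sup_def
  proof (intro conjI ballI allI impI)
    fix z assume "z \<in> {opE t d e | d e. d \<in> D \<and> e \<in> E}"
    then obtain d e where z: "z = opE t d e" "d \<in> D" "e \<in> E" by blast
    then show "le z (opE t x y)"
      using ad D(2,3) E(2,3) xy(3) sa unfolding z(1) is_sup_def by (intro opE_mono) blast+
  next
    fix f :: "'a vN cdual" and r :: real assume f: "f \<in> NF" and r: "r > 0"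
    define v where "v = opV t x y"
    obtain g1 where g1: "g1 \<in> NF" "\<And>x. g1 \<cdot> x = f \<cdot> (adj (opA t v) * x * opA t v)" using NF_conj[OF f] by blast
    obtain g2 where g2: "g2 \<in> NF" "\<And>x. g2 \<cdot> x = f \<cdot> (adj (opB t v) * x * opB t v)" using NF_conj[OF f] by blast
    define L where "L = 1 + \<bar>t\<bar> * (2 * K / c)"
    define C where "C = sqrt (norm f * (L * (2 * K) * L))"
    have K: "K \<ge> 0" using xy(1) norm_ge_zero order_trans by blast
    then have C: "C \<ge> 0" unfolding C_def by (intro sqrt_triple_nonneg norm_ge_zero)
    \<comment> \<open>Two square roots of size s contribute at most 2 C s < r; the summand 1 covers
      C = 0.\<close>
    define s where "s = r / (2 * C + 1)"
    have s: "s > 0" using r C by (simp add: s_def)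
    obtain d where d: "d \<in> D" "Re (g1 \<cdot> (x - d)) < s\<^sup>2" using D(2) g1(1) s unfolding is_sup_def by (meson zero_less_power)
    obtain e where e: "e \<in> E" "Re (g2 \<cdot> (y - e)) < s\<^sup>2" using E(2) g2(1) s unfolding is_sup_def by (meson zero_less_power)
    have "le d x" "le e y" using D(2) E(2) d e by (auto simp: is_sup_def)
    then have "Re (f \<cdot> (opE t x y - opE t d e)) \<le> C * (sqrt (Re (g1 \<cdot> (x - d))) + sqrt (Re (g2 \<cdot> (y - e))))"
      unfolding g1(2) g2(2) C_def L_def
      by (intro opE_est[OF NF_posf[OF f]]) (use ad d e D(3) E(3) xy sa in \<open>auto simp: v_def\<close>)
    also have "\<dots> \<le> C * (s + s)"
      using d(2) e(2) s by (intro mult_left_mono C add_mono real_le_lsqrt) auto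
    also have "\<dots> = r * (2 * C / (2 * C + 1))" by (simp add: s_def)
    also have "\<dots> < r * 1" using r C by (intro mult_strict_left_mono) (auto simp: field_simps)
    finally show "\<exists>z\<in>{opE t d e | d e. d \<in> D \<and> e \<in> E}. Re (f \<cdot> (opE t x y - z)) < r"
      using d(1) e(1) by (intro bexI[of _ "opE t d e"]) auto
  qed
qed

lemma opE_emb:
  assumes "x \<in> range emb" "y \<in> range emb" "admis c t x y"
  shows "opE t x y \<in> range emb"
proof -
  have "opZ x y \<in> range emb" unfolding opZ_def by (intro range_emb_simps assms)
  then have "opZ x y * minv (1 + t *\<^sub>R (x + y)) * adj (opZ x y) \<in> range emb"
    using assms(3) by (intro mult_minv_mem[OF closed_range_emb range_emb_simps(1,3,2), of _ c] range_emb_simps assms)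
      (auto simp: admis_def)
  then show ?thesis unfolding opE_def opS_def
    by (rule range_emb_simps(6)[OF range_emb_simps(1)[OF assms(1,2)] range_emb_simps(3)])
qed

text \<open>For t \<le> 0 members of the nets are admissible because they lie below x and y. For t >
  0 this can fail at first, and \<open>dini\<close> finds members beyond which 1 + t (d + e) is
  bounded below.\<close>

lemma Am_opE:
  fixes x y :: "'a::cstar_algebra vN"
  assumes "x \<in> Am" "y \<in> Am" "admis c t x y"
  shows "opE t x y \<in> Am"
proof -
  obtain D K1 where D: "directed D le" "D \<subseteq> range emb" "\<And>d. d \<in> D \<Longrightarrow> sa d" "\<And>d. d \<in> D \<Longrightarrow> norm d \<le> K1" "is_sup D x"
    using assms(1) by (rule Am_E) blast
  obtain E K2 where E: "directed E le" "E \<subseteq> range emb" "\<And>d. d \<in> E \<Longrightarrow> sa d" "\<And>d. d \<in> E \<Longrightarrow> norm d \<le> K2" "is_sup E y"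
    using assms(2) by (rule Am_E) blast
  \<comment> \<open>Half of the margin 2 b is given up in the use of \<open>dini\<close>; 2 b \<le>
    1 keeps the estimate valid for functionals of norm below 1.\<close>
  define b where "b = min c 1 / 2"
  have b: "b > 0" "2 * b \<le> 1" "2 * b \<le> c" using assms(3) by (auto simp: b_def admis_def)
  have ad: "admis (2 * b) t x y" by (rule admis_weaken[OF assms(3)]) (use b in auto)
  obtain d0 e0 where de: "d0 \<in> D" "e0 \<in> E" "\<And>d e. d \<in> D \<Longrightarrow> e \<in> E \<Longrightarrow> le d0 d \<Longrightarrow> le e0 e \<Longrightarrow> admis b t d e"
  proof (cases "t \<le> 0")
    case True
    obtain d0 e0 where "d0 \<in> D" "e0 \<in> E" using directed_ne[OF D(1)] directed_ne[OF E(1)] by blast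
    moreover have "admis b t d e" if "d \<in> D" "e \<in> E" for d e
      by (rule admis_weaken[OF admis_anti[OF ad _ _ True]]) (use D(5) E(5) b that in \<open>auto simp: is_sup_def\<close>)
    ultimately show thesis using that by blast
  next
    case False
    then have t: "t > 0" by simp
    \<comment> \<open>The bound u \<ge> - \<gamma> says that 1 + t u \<ge> b.\<close>
    define \<gamma> where "\<gamma> = (1 - b) / t"
    have "\<exists>u\<in>{d + e | d e. d \<in> D \<and> e \<in> E}. pos (u + \<gamma> *\<^sub>R 1)"
    proof (rule dini)
      show "directed {d + e | d e. d \<in> D \<and> e \<in> E} le" by (rule directed_sum[OF D(1) E(1)])
      show "sa u" if "u \<in> {d + e | d e. d \<in> D \<and> e \<in> E}" for u using that D(3) E(3) by auto
      show "{d + e | d e. d \<in> D \<and> e \<in> E} \<subseteq> range emb" using D(2) E(2) by (auto intro!: range_emb_simps)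
      fix \<phi> :: "'a cdual" assume \<phi>: "posf \<phi>" "norm \<phi> \<le> 1"
      have f: "evf \<phi> \<in> NF" "posf (evf \<phi>)" using \<phi>(1) evf_NF NF_posf by blast+
      have "0 \<le> Re (evf \<phi> \<cdot> (1 + t *\<^sub>R (x + y) - (2 * b) *\<^sub>R 1))"
        using posf_pos(1)[OF f(2)] ad by (auto simp: admis_def)
      then have "- ((1 - 2 * b) * norm \<phi>) \<le> t * Re (evf \<phi> \<cdot> (x + y))"
        by (simp add: cdual_apply_diff cdual_apply_add cdual_apply_scaleR norm_posf[OF \<phi>(1)] algebra_simps)
      moreover have "(1 - 2 * b) * norm \<phi> \<le> (1 - 2 * b) * 1" using \<phi>(2) b by (intro mult_left_mono) auto
      ultimately have "- (1 - b) + b \<le> t * Re (evf \<phi> \<cdot> (x + y))" by simp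
      then have 1: "- \<gamma> + b / t \<le> Re (evf \<phi> \<cdot> (x + y))" using t by (simp add: \<gamma>_def field_simps)
      obtain u where "u \<in> {d + e | d e. d \<in> D \<and> e \<in> E}" "Re (evf \<phi> \<cdot> (x + y - u)) < b / t"
        using is_sup_sum[OF D(5) E(5)] f(1) b(1) t unfolding is_sup_def by (meson divide_pos_pos)
      with 1 show "\<exists>u\<in>{d + e | d e. d \<in> D \<and> e \<in> E}. - \<gamma> < Re (evf \<phi> \<cdot> u)"
        by (intro bexI[of _ u]) (auto simp: cdual_apply_diff)
    qed
    then obtain d0 e0 where d0: "d0 \<in> D" "e0 \<in> E" "pos (d0 + e0 + \<gamma> *\<^sub>R 1)" by blast
    have "pos (t *\<^sub>R (d0 + e0 + \<gamma> *\<^sub>R 1))" using d0(3) t by (intro pos_scaleR) auto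
    moreover have "t *\<^sub>R (d0 + e0 + \<gamma> *\<^sub>R 1) = t *\<^sub>R (d0 + e0) + (t * \<gamma>) *\<^sub>R 1" by (simp add: scaleR_add_right)
    moreover have "t * \<gamma> = 1 - b" using t by (simp add: \<gamma>_def)
    ultimately have "pos (t *\<^sub>R (d0 + e0) + (1 - b) *\<^sub>R 1)" by (simp only:)
    then have "admis b t d0 e0" using b by (simp add: admis_def algebra_simps)
    then show thesis using that[OF d0(1,2)] admis_mono t by (meson less_imp_le)
  qed
  let ?D = "{d\<in>D. le d0 d}" and ?E = "{e\<in>E. le e0 e}"
  define K where "K = Max {K1, K2, norm x, norm y}"
  have K: "K1 \<le> K" "K2 \<le> K" "norm x \<le> K" "norm y \<le> K" by (auto simp: K_def)
  note * = is_sup_opE[OF directed_tail[OF D(1) de(1)] is_sup_tail[OF D(1,5) de(1)] _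
      directed_tail[OF E(1) de(2)] is_sup_tail[OF E(1,5) de(2)] _ K(3,4) admis_weaken[OF assms(3), of b]]
  show ?thesis
  proof (rule Am_I)
    show "directed {opE t d e | d e. d \<in> ?D \<and> e \<in> ?E} le" "is_sup {opE t d e | d e. d \<in> ?D \<and> e \<in> ?E} (opE t x y)"
      using K D(3,4) E(3,4) b de(3) by (intro * ; fastforce intro: order_trans)+
    show "{opE t d e | d e. d \<in> ?D \<and> e \<in> ?E} \<subseteq> range emb"
      using D(2) E(2) de(3) by (auto intro!: opE_emb)
    show "sa u" if "u \<in> {opE t d e | d e. d \<in> ?D \<and> e \<in> ?E}" for u
      using that D(3) E(3) de(3) opE_sa by blast
  qed
qed

definition lscM :: "'a::cstar_algebra vN set"
  where "lscM = closure Am"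

lemma Am_lscM: "x \<in> Am \<Longrightarrow> x \<in> lscM"
  unfolding lscM_def using closure_subset by blast

lemma lscM_seq:
  assumes "x \<in> lscM" obtains X where "\<And>n. X n \<in> Am" "X \<longlonglongrightarrow> x"
  using assms unfolding lscM_def closure_sequential by blast

lemma lscM_lim:
  assumes "\<And>n. X n \<in> lscM" "X \<longlonglongrightarrow> x" shows "x \<in> lscM"
  using closed_sequentially[of lscM X x] assms by (simp add: lscM_def)

lemma sa_lim:
  fixes X :: "nat \<Rightarrow> 'b::cstar_algebra"
  assumes "\<And>n. sa (X n)" "X \<longlonglongrightarrow> x" shows "sa x"
  using LIMSEQ_unique[OF tendsto_adj[OF assms(2)], of x] assms by (simp add: sa_def)

lemma lscM_sa: "x \<in> lscM \<Longrightarrow> sa x"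
  by (rule lscM_seq) (auto intro: sa_lim Am_sa)

lemma lscM_add: "x \<in> lscM \<Longrightarrow> y \<in> lscM \<Longrightarrow> x + y \<in> lscM"
proof -
  assume "x \<in> lscM" "y \<in> lscM"
  then obtain X Y where *: "\<And>n. X n \<in> Am" "X \<longlonglongrightarrow> x" "\<And>n. Y n \<in> Am" "Y \<longlonglongrightarrow> y" by (metis lscM_seq)
  show ?thesis by (rule lscM_lim[OF _ tendsto_add[OF *(2,4)]]) (intro Am_lscM Am_add *)
qed

lemma lscM_scaleR: "x \<in> lscM \<Longrightarrow> r \<ge> 0 \<Longrightarrow> r *\<^sub>R x \<in> lscM"
proof -
  assume "x \<in> lscM" "r \<ge> 0"
  then obtain X where *: "\<And>n. X n \<in> Am" "X \<longlonglongrightarrow> x" by (metis lscM_seq)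
  show ?thesis by (rule lscM_lim[OF _ tendsto_scaleR[OF tendsto_const *(2)]]) (intro Am_lscM Am_scaleR * \<open>r \<ge> 0\<close>)
qed

lemma lscM_one: "r \<ge> 0 \<Longrightarrow> r *\<^sub>R 1 \<in> lscM"
  by (intro lscM_scaleR Am_lscM Am_one)

lemma lscM_0: "0 \<in> lscM"
  using lscM_one[of 0] by simp

lemma lscM_opE:
  fixes x y :: "'a::cstar_algebra vN"
  assumes "x \<in> lscM" "y \<in> lscM" and ad: "admis c t x y"
  shows "opE t x y \<in> lscM"
proof -
  obtain X Y where *: "\<And>n. X n \<in> Am" "X \<longlonglongrightarrow> x" "\<And>n. Y n \<in> Am" "Y \<longlonglongrightarrow> y"
    using assms(1,2) by (metis lscM_seq)
  have sa: "sa x" "sa y" "sa (X n)" "sa (Y n)" for n using assms(1,2) lscM_sa * Am_sa by auto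
  have c: "c > 0" using ad by (simp add: admis_def)
  have "(\<lambda>n. t *\<^sub>R (X n + Y n - (x + y))) \<longlonglongrightarrow> t *\<^sub>R (x + y - (x + y))" by (intro tendsto_intros *)
  from tendsto_norm[OF this] have "(\<lambda>n. norm (t *\<^sub>R (X n + Y n - (x + y)))) \<longlonglongrightarrow> 0" by simp
  then have "eventually (\<lambda>n. norm (t *\<^sub>R (X n + Y n - (x + y))) < c / 2) sequentially"
    using c by (intro order_tendstoD) auto
  then obtain n0 where n0: "\<And>n. n \<ge> n0 \<Longrightarrow> norm (t *\<^sub>R (X n + Y n - (x + y))) < c / 2"
    by (auto simp: eventually_sequentially)
  have adn: "admis (c / 2) t (X (n + n0)) (Y (n + n0))" for n
  proof -
    have p: "pos ((c / 2) *\<^sub>R 1 + t *\<^sub>R (X (n + n0) + Y (n + n0) - (x + y)))"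
      using n0[of "n + n0"] sa by (intro pos_norm_minus(2)) (auto intro!: sa_intros)
    then have "pos ((1 + t *\<^sub>R (x + y) - c *\<^sub>R 1) + ((c / 2) *\<^sub>R 1 + t *\<^sub>R (X (n + n0) + Y (n + n0) - (x + y))))"
      using ad by (intro pos_add[OF _ p]) (simp add: admis_def)
    moreover have "(1 + t *\<^sub>R (x + y) - c *\<^sub>R 1) + ((c / 2) *\<^sub>R 1 + t *\<^sub>R (X (n + n0) + Y (n + n0) - (x + y)))
      = 1 + t *\<^sub>R (X (n + n0) + Y (n + n0)) - (c / 2) *\<^sub>R 1"
      by (simp add: algebra_simps) (simp flip: scaleR_add_left)
    ultimately show ?thesis using c by (simp add: admis_def)
  qed
  show ?thesis
  proof (rule lscM_lim)
    show "opE t (X (n + n0)) (Y (n + n0)) \<in> lscM" for n by (intro Am_lscM Am_opE[OF _ _ adn] *)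
    show "(\<lambda>n. opE t (X (n + n0)) (Y (n + n0))) \<longlonglongrightarrow> opE t x y"
      by (rule opE_tendsto[OF LIMSEQ_ignore_initial_segment[OF *(2)] LIMSEQ_ignore_initial_segment[OF *(4)]
          admis_weaken[OF ad] adn]) (use c in auto)
  qed
qed

section \<open>Elements approximable from above\<close>

text \<open>The one-sided notion of which \<open>Um\<close> and \<open>UbM\<close> are the two-sided
  versions. \<open>B\<close> restricts the approximants: \<open>UNIV\<close>, or a ball carrying the
  uniform bound.\<close>

definition upper :: "'a::cstar_algebra vN set \<Rightarrow> 'a vN set"
  where "upper B = {x. sa x \<and> (\<forall>\<phi>. is_state \<phi> \<longrightarrow> (\<forall>e>0. \<exists>h\<in>lscM \<inter> B. le x h \<and> Re (evf \<phi> \<cdot> (h - x)) < e))}"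

lemma is_state_posf: "is_state \<phi> \<longleftrightarrow> posf \<phi> \<and> norm \<phi> = 1"
  by (simp add: is_state_def posf_def)

text \<open>Passes from states to all normal positive functionals, in particular to conjugated ones.
  The state \<open>\<phi>\<close> serves the case f = 0, where it supplies some majorant.\<close>

lemma upper_NF:
  fixes x :: "'a::cstar_algebra vN" and \<phi> :: "'a cdual"
  assumes x: "x \<in> upper B" and st: "is_state \<phi>" and f: "f \<in> NF" and e: "e > 0"
  shows "\<exists>h\<in>lscM \<inter> B. le x h \<and> Re (f \<cdot> (h - x)) < e"
proof -
  obtain \<omega> where \<omega>: "f = evf \<omega>" "posf \<omega>" using f by (auto simp: NF_def)
  show ?thesis
  proof (cases "\<omega> = 0")
    case True
    then have "f \<cdot> y = 0" for y using norm_evf[of \<omega> y] by (simp add: \<omega>)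
    moreover have "\<forall>e>0. \<exists>h\<in>lscM \<inter> B. le x h \<and> Re (evf \<phi> \<cdot> (h - x)) < e"
      using x st by (simp add: upper_def)
    then obtain h where "h \<in> lscM \<inter> B" "le x h" using zero_less_one by blast
    ultimately show ?thesis using e by auto
  next
    case False
    then have n: "norm \<omega> > 0" by simp
    define \<psi> where "\<psi> = (1 / norm \<omega>) *\<^sub>R \<omega>"
    have "is_state \<psi>" using \<omega>(2) n
      by (auto simp: is_state_posf posf_def \<psi>_def cdual_scaleR_apply complex_nonneg_Reals_iff)
    then obtain h where h: "h \<in> lscM \<inter> B" "le x h" "Re (evf \<psi> \<cdot> (h - x)) < e / norm \<omega>"
      using x e n unfolding upper_def by (blast intro: divide_pos_pos)
    have "evf \<psi> \<cdot> z = (1 / norm \<omega>) *\<^sub>R (f \<cdot> z)" for z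
      by (simp add: \<psi>_def \<omega> evf.rep_eq cdual_apply_scaleR)
    then have "Re (f \<cdot> (h - x)) < e" using h(3) n by (simp add: field_simps)
    with h show ?thesis by blast
  qed
qed

lemma upper_sa: "x \<in> upper B \<Longrightarrow> sa x" by (simp add: upper_def)

lemma upper_I:
  assumes "sa x" "\<And>\<phi> e. is_state \<phi> \<Longrightarrow> e > 0 \<Longrightarrow> \<exists>h\<in>lscM \<inter> B. le x h \<and> Re (evf \<phi> \<cdot> (h - x)) < e"
  shows "x \<in> upper B"
  using assms by (simp add: upper_def)

lemma upper_D:
  "x \<in> upper B \<Longrightarrow> is_state \<phi> \<Longrightarrow> e > 0 \<Longrightarrow> \<exists>h\<in>lscM \<inter> B. le x h \<and> Re (evf \<phi> \<cdot> (h - x)) < e"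
  by (simp add: upper_def)

lemma upper_lscM: "x \<in> lscM \<Longrightarrow> x \<in> B \<Longrightarrow> x \<in> upper B"
  by (rule upper_I) (auto simp: lscM_sa intro!: bexI[of _ x])

lemma upper_subset: "B \<subseteq> C \<Longrightarrow> upper B \<subseteq> upper C"
  unfolding upper_def by blast

lemma upper_add:
  assumes "x \<in> upper B" "y \<in> upper C" "\<And>a b. a \<in> B \<Longrightarrow> b \<in> C \<Longrightarrow> a + b \<in> F" shows "x + y \<in> upper F"
proof (rule upper_I)
  show "sa (x + y)" using assms upper_sa by blast
  fix \<phi> :: "'a cdual" and e :: real assume *: "is_state \<phi>" "e > 0"
  obtain h where h: "h \<in> lscM \<inter> B" "le x h" "Re (evf \<phi> \<cdot> (h - x)) < e / 2" using upper_D[OF assms(1) *(1), of "e/2"] *(2) by auto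
  obtain k where k: "k \<in> lscM \<inter> C" "le y k" "Re (evf \<phi> \<cdot> (k - y)) < e / 2" using upper_D[OF assms(2) *(1), of "e/2"] *(2) by auto
  show "\<exists>h\<in>lscM \<inter> F. le (x + y) h \<and> Re (evf \<phi> \<cdot> (h - (x + y))) < e"
    using h k assms(3) by (intro bexI[of _ "h + k"]) (auto intro: lscM_add le_add simp: cdual_apply_diff cdual_apply_add)
qed

lemma upper_scaleR:
  assumes "x \<in> upper B" "r \<ge> 0" "\<And>a. a \<in> B \<Longrightarrow> r *\<^sub>R a \<in> C" shows "r *\<^sub>R x \<in> upper C"
proof (rule upper_I)
  show "sa (r *\<^sub>R x)" using assms upper_sa by blast
  fix \<phi> :: "'a cdual" and e :: real assume *: "is_state \<phi>" "e > 0"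
  obtain h where h: "h \<in> lscM \<inter> B" "le x h" "Re (evf \<phi> \<cdot> (h - x)) < e / (r + 1)"
    using upper_D[OF assms(1) *(1), of "e/(r+1)"] *(2) assms(2) by auto
  have "0 \<le> Re (evf \<phi> \<cdot> (h - x))" using h(2) *(1) posf_pos(1)[OF NF_posf[OF evf_NF]] by (auto simp: le_def is_state_posf)
  then have "r * Re (evf \<phi> \<cdot> (h - x)) \<le> (r + 1) * Re (evf \<phi> \<cdot> (h - x))" by (intro mult_right_mono) auto
  also have "\<dots> < e" using h(3) assms(2) by (simp add: field_simps)
  finally show "\<exists>h\<in>lscM \<inter> C. le (r *\<^sub>R x) h \<and> Re (evf \<phi> \<cdot> (h - r *\<^sub>R x)) < e"
    using h assms(2,3) by (intro bexI[of _ "r *\<^sub>R h"])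
      (auto intro: lscM_scaleR le_scaleR simp: cdual_apply_diff cdual_apply_scaleR algebra_simps)
qed

text \<open>A norm error e/4 is absorbed by adding (e/4) 1, which is itself strongly lower
  semicontinuous.\<close>

lemma upper_lim:
  assumes X: "\<And>n. X n \<in> upper UNIV" "X \<longlonglongrightarrow> x" shows "x \<in> upper UNIV"
proof (rule upper_I)
  show "sa x" by (rule sa_lim[OF upper_sa X(2)]) (rule X)
  fix \<phi> :: "'a cdual" and e :: real assume *: "is_state \<phi>" "e > 0"
  have "(\<lambda>n. norm (X n - x)) \<longlonglongrightarrow> 0" using X(2) by (simp add: tendsto_norm_zero_iff LIM_zero_iff)
  then have "eventually (\<lambda>n. norm (X n - x) < e / 4) sequentially" using *(2) by (intro order_tendstoD) auto
  then obtain n where n: "norm (X n - x) < e / 4" by (auto simp: eventually_sequentially)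
  have p: "pos ((e / 4) *\<^sub>R 1 + (X n - x))"
    by (rule pos_norm_minus(2)) (use n upper_sa X(1) \<open>sa x\<close> in auto)
  obtain h where h: "h \<in> lscM" "le (X n) h" "Re (evf \<phi> \<cdot> (h - X n)) < e / 4" using upper_D[OF X(1) *(1), of "e/4"] *(2) by auto
  have "pos ((h - X n) + ((e / 4) *\<^sub>R 1 + (X n - x)))" using h(2) by (intro pos_add[OF _ p]) (simp add: le_def)
  then have "le x (h + (e / 4) *\<^sub>R 1)" by (simp add: le_def algebra_simps)
  moreover have "h + (e / 4) *\<^sub>R 1 \<in> lscM" using *(2) by (intro lscM_add lscM_one h) simp
  moreover have "Re (evf \<phi> \<cdot> (h + (e / 4) *\<^sub>R 1 - x)) < e"
  proof -
    have n1: "norm \<phi> = 1" "posf \<phi>" using *(1) by (auto simp: is_state_posf)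
    have "Re (evf \<phi> \<cdot> (X n - x)) \<le> norm (X n - x) * norm \<phi>" using norm_evf complex_Re_le_cmod order_trans by blast
    then have "Re (evf \<phi> \<cdot> (X n - x)) < e / 4" using n n1 by simp
    moreover have "Re (evf \<phi> \<cdot> ((e / 4) *\<^sub>R 1)) = e / 4" using norm_posf[OF n1(2)] n1(1) by (simp add: cdual_apply_scaleR)
    moreover have "h + (e / 4) *\<^sub>R 1 - x = (h - X n) + (e / 4) *\<^sub>R 1 + (X n - x)" by simp
    ultimately show ?thesis using h(3) *(2) by (simp only: cdual_apply_add plus_complex.sel)
  qed
  ultimately show "\<exists>h\<in>lscM \<inter> UNIV. le x h \<and> Re (evf \<phi> \<cdot> (h - x)) < e" by blast
qed

text \<open>Majorants of any size remain admissible because t \<ge> 0, and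
  \<open>opE_diff_le\<close> bounds the error through functionals fixed before the majorants are
  chosen.\<close>

lemma upper_opE_pos:
  assumes x: "x \<in> upper UNIV" "y \<in> upper UNIV" and ad: "admis c t x y" and t: "t \<ge> 0"
  shows "opE t x y \<in> upper UNIV"
proof (rule upper_I)
  have sa: "sa x" "sa y" using x upper_sa by auto
  show "sa (opE t x y)" by (rule opE_sa[OF ad sa])
  fix \<phi> :: "'a cdual" and e :: real assume *: "is_state \<phi>" "e > 0"
  have f: "evf \<phi> \<in> NF" "posf (evf \<phi>)" using *(1) evf_NF NF_posf by (auto simp: is_state_posf)
  define v where "v = opV t x y"
  obtain g1 where g1: "g1 \<in> NF" "\<And>x. g1 \<cdot> x = evf \<phi> \<cdot> (adj (opA t v) * x * opA t v)" using NF_conj[OF f(1)] by blast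
  obtain g2 where g2: "g2 \<in> NF" "\<And>x. g2 \<cdot> x = evf \<phi> \<cdot> (adj (opB t v) * x * opB t v)" using NF_conj[OF f(1)] by blast
  obtain h where h: "h \<in> lscM" "le x h" "Re (g1 \<cdot> (h - x)) < e / 2" using upper_NF[OF x(1) *(1) g1(1), of "e/2"] *(2) by auto
  obtain k where k: "k \<in> lscM" "le y k" "Re (g2 \<cdot> (k - y)) < e / 2" using upper_NF[OF x(2) *(1) g2(1), of "e/2"] *(2) by auto
  have ad': "admis c t h k" by (rule admis_mono[OF ad h(2) k(2) t])
  have sa': "sa h" "sa k" using h k lscM_sa by auto
  have "Re (evf \<phi> \<cdot> (opE t h k - opE t x y)) \<le> Re (g1 \<cdot> (h - x) + g2 \<cdot> (k - y))"
    using posf_mono[OF f(2)] opE_diff_le[OF ad sa ad' sa' t] unfolding g1(2) g2(2) v_def le_def cdual_apply_add[symmetric] by blast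
  then have "Re (evf \<phi> \<cdot> (opE t h k - opE t x y)) < e" using h k by simp
  moreover have "le (opE t x y) (opE t h k)" by (rule opE_mono[OF ad sa ad' sa' h(2) k(2)])
  moreover have "opE t h k \<in> lscM" by (rule lscM_opE[OF h(1) k(1) ad'])
  ultimately show "\<exists>h\<in>lscM \<inter> UNIV. le (opE t x y) h \<and> Re (evf \<phi> \<cdot> (h - opE t x y)) < e" by blast
qed

text \<open>Here t may have either sign: the bound \<gamma> on the majorants replaces the sign
  condition for admissibility and fixes the constant of \<open>opE_est\<close> in advance.\<close>

lemma upper_opE_bounded:
  assumes x: "x \<in> upper (cball 0 \<gamma>)" "y \<in> upper (cball 0 \<gamma>)" "norm x \<le> \<gamma>" "norm y \<le> \<gamma>"
    and t: "\<bar>t\<bar> * (2 * \<gamma>) \<le> 1 / 2"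
  shows "opE t x y \<in> upper (cball 0 (2 * \<gamma> + \<bar>t\<bar> * ((2 * \<gamma>)\<^sup>2 / (1 / 2))))"
proof (rule upper_I)
  have sa: "sa x" "sa y" using x upper_sa by auto
  have \<gamma>: "\<gamma> \<ge> 0" using x(3) norm_ge_zero order_trans by blast
  have adm: "admis (1 / 2) t a b" if "norm a \<le> \<gamma>" "norm b \<le> \<gamma>" "sa a" "sa b" for a b :: "'a vN"
  proof (rule admis_norm[OF that(3,4)])
    have "\<bar>t\<bar> * (norm a + norm b) \<le> \<bar>t\<bar> * (2 * \<gamma>)" using that by (intro mult_left_mono) auto
    with t show "\<bar>t\<bar> * (norm a + norm b) \<le> 1 - 1 / 2" by simp
  qed simp
  have ad: "admis (1 / 2) t x y" by (rule adm) (use x sa in auto)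
  show "sa (opE t x y)" by (rule opE_sa[OF ad sa])
  fix \<phi> :: "'a cdual" and e :: real assume *: "is_state \<phi>" "e > 0"
  have f: "evf \<phi> \<in> NF" "posf (evf \<phi>)" using *(1) evf_NF NF_posf by (auto simp: is_state_posf)
  define v where "v = opV t x y"
  obtain g1 where g1: "g1 \<in> NF" "\<And>x. g1 \<cdot> x = evf \<phi> \<cdot> (adj (opA t v) * x * opA t v)" using NF_conj[OF f(1)] by blast
  obtain g2 where g2: "g2 \<in> NF" "\<And>x. g2 \<cdot> x = evf \<phi> \<cdot> (adj (opB t v) * x * opB t v)" using NF_conj[OF f(1)] by blast
  define L where "L = 1 + \<bar>t\<bar> * (2 * \<gamma> / (1 / 2))"
  define C where "C = sqrt (norm (evf \<phi>) * (L * (2 * \<gamma>) * L))"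
  have C: "C \<ge> 0" unfolding C_def using \<gamma> by (intro sqrt_triple_nonneg norm_ge_zero)
  define s where "s = e / (2 * C + 1)"
  have s: "s > 0" using *(2) C by (simp add: s_def)
  obtain h where h: "h \<in> lscM" "norm h \<le> \<gamma>" "le x h" "Re (g1 \<cdot> (h - x)) < s\<^sup>2"
    using upper_NF[OF x(1) *(1) g1(1), of "s\<^sup>2"] s by auto
  obtain k where k: "k \<in> lscM" "norm k \<le> \<gamma>" "le y k" "Re (g2 \<cdot> (k - y)) < s\<^sup>2"
    using upper_NF[OF x(2) *(1) g2(1), of "s\<^sup>2"] s by auto
  have sa': "sa h" "sa k" using h k lscM_sa by auto
  have ad': "admis (1 / 2) t h k" by (rule adm) (use h k sa' in auto)
  have "Re (evf \<phi> \<cdot> (opE t h k - opE t x y)) \<le> C * (sqrt (Re (g1 \<cdot> (h - x))) + sqrt (Re (g2 \<cdot> (k - y))))"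
    unfolding g1(2) g2(2) C_def L_def
    by (rule opE_est[OF f(2) ad sa ad' sa']) (use h k x in \<open>auto simp: v_def\<close>)
  also have "\<dots> \<le> C * (s + s)"
    using h(4) k(4) s by (intro mult_left_mono C add_mono real_le_lsqrt) auto
  also have "\<dots> = e * (2 * C / (2 * C + 1))" by (simp add: s_def)
  also have "\<dots> < e * 1" using *(2) C by (intro mult_strict_left_mono) (auto simp: field_simps)
  finally have 1: "Re (evf \<phi> \<cdot> (opE t h k - opE t x y)) < e" by simp
  have "norm (opE t h k) \<le> (norm h + norm k) + \<bar>t\<bar> * ((norm h + norm k)\<^sup>2 / (1 / 2))" by (rule norm_opE[OF ad'])
  also have "\<dots> \<le> 2 * \<gamma> + \<bar>t\<bar> * ((2 * \<gamma>)\<^sup>2 / (1 / 2))"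
    using h(2) k(2) by (intro add_mono mult_left_mono divide_right_mono power_mono) auto
  finally have 2: "opE t h k \<in> cball 0 (2 * \<gamma> + \<bar>t\<bar> * ((2 * \<gamma>)\<^sup>2 / (1 / 2)))" by simp
  have 3: "le (opE t x y) (opE t h k)" by (rule opE_mono[OF ad sa ad' sa' h(3) k(3)])
  have 4: "opE t h k \<in> lscM" by (rule lscM_opE[OF h(1) k(1) ad'])
  from 1 2 3 4 show "\<exists>h\<in>lscM \<inter> cball 0 (2 * \<gamma> + \<bar>t\<bar> * ((2 * \<gamma>)\<^sup>2 / (1 / 2))). le (opE t x y) h \<and> Re (evf \<phi> \<cdot> (h - opE t x y)) < e" by blast
qed

section \<open>Real spaces closed under \<open>z z\<^sup>*\<close>\<close>

lemma zz_lim: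
  fixes x y :: "'b::ucstar"
  assumes sa: "sa x" "sa y" and t: "\<And>n. t n \<noteq> 0" "t \<longlonglongrightarrow> 0" "\<And>n. \<bar>t n\<bar> * (norm x + norm y) \<le> 1 / 2"
  shows "(\<lambda>n. (1 / t n) *\<^sub>R (x + y - opE (t n) x y)) \<longlonglongrightarrow> opZ x y * adj (opZ x y)"
proof -
  have ad: "admis (1 / 2) (t n) x y" for n by (rule admis_norm[OF sa]) (use t(3)[of n] in auto)
  have "norm (opS (t n) x y - 1) \<le> \<bar>t n\<bar> * (2 * norm (x + y))" for n
  proof -
    have "opS (t n) x y - 1 = - (t n *\<^sub>R ((x + y) * opS (t n) x y))"
      using opS(1)[OF ad[of n]] by (simp add: algebra_simps)
    then have eq: "norm (opS (t n) x y - 1) = \<bar>t n\<bar> * norm ((x + y) * opS (t n) x y)" by simp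
    have "norm ((x + y) * opS (t n) x y) \<le> norm (x + y) * norm (opS (t n) x y)" by (rule norm_mult_ineq)
    also have "\<dots> \<le> norm (x + y) * 2" using opS(5)[OF ad[of n]] by (intro mult_left_mono) auto
    finally have "\<bar>t n\<bar> * norm ((x + y) * opS (t n) x y) \<le> \<bar>t n\<bar> * (norm (x + y) * 2)"
      by (rule mult_left_mono) simp
    then show ?thesis unfolding eq by (simp add: mult.commute)
  qed
  moreover have "(\<lambda>n. \<bar>t n\<bar> * (2 * norm (x + y))) \<longlonglongrightarrow> \<bar>0\<bar> * (2 * norm (x + y))"
    by (intro tendsto_mult tendsto_rabs t tendsto_const)
  then have "(\<lambda>n. \<bar>t n\<bar> * (2 * norm (x + y))) \<longlonglongrightarrow> 0" by simp
  ultimately have "(\<lambda>n. opS (t n) x y - 1) \<longlonglongrightarrow> 0"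
    by (rule Lim_null_comparison[OF always_eventually, OF allI])
  then have "(\<lambda>n. opS (t n) x y) \<longlonglongrightarrow> 1" by (rule LIM_zero_cancel)
  then have "(\<lambda>n. opZ x y * opS (t n) x y * adj (opZ x y)) \<longlonglongrightarrow> opZ x y * 1 * adj (opZ x y)"
    by (intro tendsto_mult tendsto_const)
  moreover have "(1 / t n) *\<^sub>R (x + y - opE (t n) x y) = opZ x y * opS (t n) x y * adj (opZ x y)" for n
    using t(1)[of n] by (simp add: opE_def)
  ultimately show ?thesis by simp
qed

text \<open>A null sequence of positive numbers with t K \<le> 1/2, which keeps
  \<open>admis (1 / 2)\<close> when K bounds norm x + norm y. The summand 1 covers K = 0.\<close>

definition tseq :: "real \<Rightarrow> nat \<Rightarrow> real"
  where "tseq K n = 1 / (real (Suc n) * (2 * K + 1))"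

lemma tseq:
  assumes "K \<ge> 0"
  shows "tseq K n > 0" "tseq K \<longlonglongrightarrow> 0" "\<bar>tseq K n\<bar> * K \<le> 1 / 2"
proof -
  show 1: "tseq K n > 0" using assms by (simp add: tseq_def)
  have "tseq K = (\<lambda>n. inverse (real (Suc n)) * (1 / (2 * K + 1)))"
    by (rule ext) (simp add: tseq_def field_simps)
  moreover have "(\<lambda>n. inverse (real (Suc n)) * (1 / (2 * K + 1))) \<longlonglongrightarrow> 0 * (1 / (2 * K + 1))"
    by (intro tendsto_mult tendsto_const LIMSEQ_inverse_real_of_nat)
  ultimately show "tseq K \<longlonglongrightarrow> 0" by simp
  have "2 * K \<le> 1 * (2 * K + 1)" by simp
  also have "\<dots> \<le> real (Suc n) * (2 * K + 1)" using assms by (intro mult_right_mono) auto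
  finally have "2 * K \<le> real (Suc n) * (2 * K + 1)" .
  then have "K / (real (Suc n) * (2 * K + 1)) \<le> 1 / 2" using assms by (simp add: divide_simps)
  then show "\<bar>tseq K n\<bar> * K \<le> 1 / 2" using 1 by (simp add: tseq_def)
qed

definition real_space :: "'b::ucstar set \<Rightarrow> bool"
  where "real_space W \<longleftrightarrow> 0 \<in> W \<and> (\<forall>x\<in>W. \<forall>y\<in>W. x + y \<in> W) \<and> (\<forall>x\<in>W. \<forall>r. r *\<^sub>R x \<in> W) \<and> (\<forall>x\<in>W. sa x)"

lemma real_spaceD:
  assumes "real_space W"
  shows "0 \<in> W" "x \<in> W \<Longrightarrow> y \<in> W \<Longrightarrow> x + y \<in> W" "x \<in> W \<Longrightarrow> r *\<^sub>R x \<in> W" "x \<in> W \<Longrightarrow> sa x"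
    "x \<in> W \<Longrightarrow> - x \<in> W" "x \<in> W \<Longrightarrow> y \<in> W \<Longrightarrow> x - y \<in> W"
proof -
  show *: "0 \<in> W" "x \<in> W \<Longrightarrow> y \<in> W \<Longrightarrow> x + y \<in> W" "x \<in> W \<Longrightarrow> r *\<^sub>R x \<in> W" "x \<in> W \<Longrightarrow> sa x" for x y r
    using assms by (auto simp: real_space_def)
  show n: "x \<in> W \<Longrightarrow> - x \<in> W" for x using *(3)[of x "-1"] by simp
  show "x \<in> W \<Longrightarrow> y \<in> W \<Longrightarrow> x - y \<in> W" using *(2)[of x "-y"] n[of y] by simp
qed

lemma real_space_closure:
  fixes W :: "'b::ucstar set"
  assumes W: "real_space W" shows "real_space (closure W)"
  unfolding real_space_def
proof (intro conjI ballI allI)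
  show "0 \<in> closure W" using real_spaceD(1)[OF W] closure_subset by blast
next
  fix x y assume "x \<in> closure W" "y \<in> closure W"
  then obtain X Y where "\<And>n. X n \<in> W" "X \<longlonglongrightarrow> x" "\<And>n. Y n \<in> W" "Y \<longlonglongrightarrow> y"
    unfolding closure_sequential by blast
  then show "x + y \<in> closure W"
    unfolding closure_sequential using real_spaceD(2)[OF W]
    by (intro exI[of _ "\<lambda>n. X n + Y n"]) (auto intro: tendsto_add)
next
  fix x r assume "x \<in> closure W"
  then obtain X where X: "\<And>n. X n \<in> W" "X \<longlonglongrightarrow> x" unfolding closure_sequential by blast
  then show "r *\<^sub>R x \<in> closure W"
    unfolding closure_sequential using real_spaceD(3)[OF W]
    by (intro exI[of _ "\<lambda>n. r *\<^sub>R X n"]) (auto intro: tendsto_scaleR)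
  show "sa x" by (rule sa_lim[OF _ X(2)]) (rule real_spaceD(4)[OF W X(1)])
qed

lemma zz_closure:
  fixes W :: "'b::ucstar set"
  assumes zz: "\<And>x y. x \<in> W \<Longrightarrow> y \<in> W \<Longrightarrow> opZ x y * adj (opZ x y) \<in> closure W"
    and xy: "x \<in> closure W" "y \<in> closure W"
  shows "opZ x y * adj (opZ x y) \<in> closure W"
proof -
  obtain X Y where *: "\<And>n. X n \<in> W" "X \<longlonglongrightarrow> x" "\<And>n. Y n \<in> W" "Y \<longlonglongrightarrow> y"
    using xy unfolding closure_sequential by blast
  have lim: "(\<lambda>n. opZ (X n) (Y n) * adj (opZ (X n) (Y n))) \<longlonglongrightarrow> opZ x y * adj (opZ x y)"
    by (intro tendsto_mult tendsto_adj opZ_tendsto *)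
  show ?thesis by (rule closed_sequentially[OF closed_closure _ lim]) (rule zz[OF *(1,3)])
qed

definition cstar_real :: "'b::ucstar set \<Rightarrow> bool"
  where "cstar_real W \<longleftrightarrow> real_space W \<and> closed W \<and> (\<forall>x\<in>W. \<forall>y\<in>W. opZ x y * adj (opZ x y) \<in> W)"

section \<open>Complexification and polarization\<close>

definition reP :: "'b::ucstar \<Rightarrow> 'b" where "reP z = (1/2) *\<^sub>R (z + adj z)"
definition imP :: "'b::ucstar \<Rightarrow> 'b" where "imP z = (1/2) *\<^sub>R (- (\<i> *\<^sub>C (z - adj z)))"

lemma opZ_reP_imP: "opZ (reP z) (imP z) = z"
proof -
  have "opZ (reP z) (imP z) = (1/2) *\<^sub>R (z + z)"
    unfolding opZ_def reP_def imP_def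
    by (simp only: scaleC_scaleR scaleC_simps ii_mult minus_minus scaleR_add_right[symmetric]) simp
  then show ?thesis by (simp flip: scaleR_2)
qed

lemma reP_imP_opZ:
  assumes "sa x" "sa y" shows "reP (opZ x y) = x" "imP (opZ x y) = y"
proof -
  have "opZ x y + adj (opZ x y) = 2 *\<^sub>R x" unfolding adj_opZ[OF assms] by (simp add: opZ_def scaleR_2)
  then show "reP (opZ x y) = x" by (simp add: reP_def)
  have "opZ x y - adj (opZ x y) = 2 *\<^sub>R (\<i> *\<^sub>C y)" unfolding adj_opZ[OF assms] by (simp add: opZ_def scaleR_2)
  then show "imP (opZ x y) = y" by (simp add: imP_def scaleC_scaleR ii_mult)
qed

lemma opZ_complexify: "x \<in> W \<Longrightarrow> y \<in> W \<Longrightarrow> opZ x y \<in> complexify W"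
  by (auto simp: complexify_def opZ_def)

lemma complexify_iff:
  assumes "\<And>x. x \<in> W \<Longrightarrow> sa x" shows "z \<in> complexify W \<longleftrightarrow> reP z \<in> W \<and> imP z \<in> W"
proof
  assume "z \<in> complexify W"
  then obtain x y where "z = opZ x y" "x \<in> W" "y \<in> W" by (auto simp: complexify_def opZ_def)
  then show "reP z \<in> W \<and> imP z \<in> W" using reP_imP_opZ[of x y] assms by auto
next
  assume "reP z \<in> W \<and> imP z \<in> W"
  then show "z \<in> complexify W" using opZ_complexify[of "reP z" W "imP z"] by (simp add: opZ_reP_imP)
qed

lemma real_in_complexify: "real_space W \<Longrightarrow> x \<in> W \<Longrightarrow> x \<in> complexify W"
  using opZ_complexify[of x W 0] real_spaceD(1)[of W] by (simp add: opZ_def scaleC_simps)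

lemma complexify_space:
  assumes W: "real_space W"
  shows "0 \<in> complexify W" "u \<in> complexify W \<Longrightarrow> v \<in> complexify W \<Longrightarrow> u + v \<in> complexify W"
    "u \<in> complexify W \<Longrightarrow> c *\<^sub>C u \<in> complexify W" "u \<in> complexify W \<Longrightarrow> adj u \<in> complexify W"
proof -
  note D = real_spaceD[OF W]
  show "0 \<in> complexify W" by (intro real_in_complexify W D(1))
  assume "u \<in> complexify W"
  then obtain x y where u: "u = opZ x y" "x \<in> W" "y \<in> W" by (auto simp: complexify_def opZ_def)
  have "c *\<^sub>C u = opZ (Re c *\<^sub>R x - Im c *\<^sub>R y) (Im c *\<^sub>R x + Re c *\<^sub>R y)"
  proof -
    have e: "c *\<^sub>C z = Re c *\<^sub>R z + Im c *\<^sub>R (\<i> *\<^sub>C z)" for z :: 'a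
      by (subst complex_eq[of c]) (simp add: scaleC_add_left scaleC_of_real[symmetric] scaleC_scaleC mult.commute)
    show ?thesis unfolding e u(1) opZ_def
      by (simp add: scaleC_add_right scaleC_scaleR ii_mult algebra_simps)
  qed
  then show "c *\<^sub>C u \<in> complexify W" using u D by (simp add: opZ_complexify)
  have "adj u = opZ x (- y)" using adj_opZ[OF D(4)[OF u(2)] D(4)[OF u(3)]] by (simp add: u(1) opZ_def scaleC_simps)
  then show "adj u \<in> complexify W" using u D by (simp add: opZ_complexify)
  assume "v \<in> complexify W"
  then obtain x' y' where v: "v = opZ x' y'" "x' \<in> W" "y' \<in> W" by (auto simp: complexify_def opZ_def)
  have "u + v = opZ (x + x') (y + y')" by (simp add: u v opZ_def scaleC_add_right)
  then show "u + v \<in> complexify W" using u v D by (simp add: opZ_complexify)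
qed

lemma polarization:
  fixes z w :: "'b::ucstar"
  shows "4 *\<^sub>R (z * adj w) = (z + w) * adj (z + w) + (-1) *\<^sub>C ((z + (-1) *\<^sub>C w) * adj (z + (-1) *\<^sub>C w))
    + \<i> *\<^sub>C ((z + \<i> *\<^sub>C w) * adj (z + \<i> *\<^sub>C w)) + (- \<i>) *\<^sub>C ((z + (- \<i>) *\<^sub>C w) * adj (z + (- \<i>) *\<^sub>C w))"
proof -
  have "4 *\<^sub>R x = x + x + x + x" for x :: 'b
    using scaleR_add_left[of 2 2 x] by (simp add: scaleR_2)
  then show ?thesis
    by (simp add: adj_simps ii_mult scaleC_simps algebra_simps scaleC_add_right)
qed

lemma cstar_real_mult:
  assumes W: "cstar_real W" and uv: "u \<in> complexify W" "v \<in> complexify W"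
  shows "u * v \<in> complexify W"
proof -
  have R: "real_space W" using W by (simp add: cstar_real_def)
  note S = complexify_space[OF R]
  have zz: "z * adj z \<in> complexify W" if z: "z \<in> complexify W" for z
  proof -
    obtain x y where "z = opZ x y" "x \<in> W" "y \<in> W" using z by (auto simp: complexify_def opZ_def)
    then show ?thesis using W real_in_complexify[OF R] by (simp add: cstar_real_def)
  qed
  define w where "w = adj v"
  have w: "w \<in> complexify W" "v = adj w" using S(4) uv by (auto simp: w_def adj_adj)
  have "4 *\<^sub>R (u * adj w) \<in> complexify W"
    unfolding polarization by (intro S(2,3) zz uv w)
  then have "complex_of_real (1/4) *\<^sub>C (4 *\<^sub>R (u * adj w)) \<in> complexify W" by (rule S(3))
  then show ?thesis unfolding scaleC_of_real by (simp add: w(2))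
qed

lemma closed_complexify:
  assumes W: "real_space W" "closed W" shows "closed (complexify (W :: 'b::ucstar set))"
proof -
  have c: "z \<in> complexify W \<longleftrightarrow> reP z \<in> W \<and> imP z \<in> W" for z
    by (rule complexify_iff) (rule real_spaceD(4)[OF W(1)])
  show ?thesis
    unfolding closed_sequential_limits
  proof (intro allI impI, elim conjE)
    fix X z assume X: "\<forall>n. X n \<in> complexify W" "X \<longlonglongrightarrow> z"
    have "(\<lambda>n. reP (X n)) \<longlonglongrightarrow> reP z" unfolding reP_def
      by (intro tendsto_scaleR tendsto_const tendsto_add X tendsto_adj)
    moreover have "(\<lambda>n. imP (X n)) \<longlonglongrightarrow> imP z" unfolding imP_def
      by (intro tendsto_scaleR tendsto_const tendsto_minus bounded_linear.tendsto[OF bounded_linear_scaleC] tendsto_diff X tendsto_adj)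
    ultimately show "z \<in> complexify W"
      using X(1) unfolding c by (meson W(2) closed_sequentially)
  qed
qed

section \<open>The spaces generated by semicontinuous elements\<close>

definition SbarM :: "'a::cstar_algebra vN set" where "SbarM = closure (span lscM)"

lemma span_lscM: "span lscM = {h - k | h k. h \<in> lscM \<and> k \<in> (lscM :: 'a::cstar_algebra vN set)}" (is "_ = ?S")
proof
  have "subspace ?S"
    unfolding subspace_def
  proof (intro conjI ballI allI)
    show "0 \<in> ?S" using lscM_0 by force
    show "x + y \<in> ?S" if xy: "x \<in> ?S" "y \<in> ?S" for x y
    proof -
      obtain h k h' k' where *: "x = h - k" "y = h' - k'" "h \<in> lscM" "k \<in> lscM" "h' \<in> lscM" "k' \<in> lscM" using xy by blast
      have "x + y = (h + h') - (k + k')" by (simp add: *)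
      then show ?thesis using * lscM_add by blast
    qed
    show "r *\<^sub>R x \<in> ?S" if x: "x \<in> ?S" for r x
    proof -
      obtain h k where *: "x = h - k" "h \<in> lscM" "k \<in> lscM" using x by blast
      show ?thesis
      proof (cases "r \<ge> 0")
        case True
        have "r *\<^sub>R x = r *\<^sub>R h - r *\<^sub>R k" by (simp add: * scaleR_diff_right)
        then show ?thesis using * lscM_scaleR[OF _ True] by blast
      next
        case False
        have "r *\<^sub>R x = (- r) *\<^sub>R k - (- r) *\<^sub>R h" by (simp add: * scaleR_diff_right)
        moreover have "(- r) *\<^sub>R k \<in> lscM" "(- r) *\<^sub>R h \<in> lscM" using * False by (auto intro: lscM_scaleR simp del: scaleR_minus_left)
        ultimately show ?thesis by blast
      qed
    qed
  qed
  moreover have "lscM \<subseteq> ?S" using lscM_0 by force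
  ultimately show "span lscM \<subseteq> ?S" by (simp add: span_minimal)
  show "?S \<subseteq> span lscM" by (auto intro: span_diff span_base)
qed

lemma real_space_span_lscM: "real_space (span lscM)"
  unfolding real_space_def
proof (intro conjI ballI allI)
  show "sa x" if "x \<in> span lscM" for x :: "'a vN"
    using that unfolding span_lscM by (auto intro: lscM_sa)
qed (auto intro: span_add span_scale span_zero)

text \<open>\<open>opE\<close> reaches z z^* only for pairs from the cone \<open>lscM\<close>.
  Differences follow from (a - b) (a - b)^* = 2 a a^* + 2 b b^* - (a + b) (a + b)^*, whose right
  side involves pairs from the cone only.\<close>

lemma zz_span_lscM:
  fixes x y :: "'a::cstar_algebra vN"
  assumes "x \<in> span lscM" "y \<in> span lscM"
  shows "opZ x y * adj (opZ x y) \<in> closure (span lscM)"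
proof -
  note S = real_spaceD[OF real_space_closure[OF real_space_span_lscM]]
  have 1: "opZ h k * adj (opZ h k) \<in> closure (span lscM)" if hk: "h \<in> lscM" "k \<in> lscM" for h k :: "'a vN"
  proof -
    define K where "K = norm h + norm k"
    have K: "K \<ge> 0" by (simp add: K_def)
    have "(\<lambda>n. (1 / tseq K n) *\<^sub>R (h + k - opE (tseq K n) h k)) \<longlonglongrightarrow> opZ h k * adj (opZ h k)"
      using tseq[OF K] hk lscM_sa by (intro zz_lim) (auto simp: K_def less_imp_neq[THEN not_sym])
    moreover have "(1 / tseq K n) *\<^sub>R (h + k - opE (tseq K n) h k) \<in> span lscM" for n
    proof -
      have "admis (1 / 2) (tseq K n) h k"
        using tseq(3)[OF K, of n] hk lscM_sa by (intro admis_norm) (auto simp: K_def)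
      then have "opE (tseq K n) h k \<in> lscM" using hk by (rule lscM_opE[rotated 2])
      then show ?thesis using hk by (intro span_scale span_diff span_add span_base)
    qed
    ultimately show ?thesis unfolding closure_sequential
      by (intro exI[of _ "\<lambda>n. (1 / tseq K n) *\<^sub>R (h + k - opE (tseq K n) h k)"]) auto
  qed
  obtain h k where x: "x = h - k" "h \<in> lscM" "k \<in> lscM" using assms(1) unfolding span_lscM by blast
  obtain h' k' where y: "y = h' - k'" "h' \<in> lscM" "k' \<in> lscM" using assms(2) unfolding span_lscM by blast
  define a b where "a = opZ h h'" and "b = opZ k k'"
  have ab: "opZ x y = a - b" by (simp add: a_def b_def opZ_def x y scaleC_simps)
  have s: "a + b = opZ (h + k) (h' + k')" by (simp add: a_def b_def opZ_def scaleC_add_right)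
  have "(a - b) * adj (a - b) = 2 *\<^sub>R (a * adj a) + 2 *\<^sub>R (b * adj b) - (a + b) * adj (a + b)"
    by (simp add: adj_simps algebra_simps scaleR_2)
  also have "\<dots> \<in> closure (span lscM)"
    unfolding s unfolding a_def b_def by (intro S(6) S(2) S(3) 1 lscM_add x y)
  finally show ?thesis unfolding ab .
qed

lemma cstar_real_SbarM: "cstar_real SbarM"
  unfolding cstar_real_def SbarM_def
  by (intro conjI real_space_closure real_space_span_lscM closed_closure ballI zz_closure[OF zz_span_lscM])

section \<open>Two-sided approximability, with and without a norm bound\<close>

definition Um :: "'a::cstar_algebra vN set"
  where "Um = {x. x \<in> upper UNIV \<and> - x \<in> upper UNIV}"

definition UbM :: "'a::cstar_algebra vN set"
  where "UbM = {x. \<exists>\<gamma>. x \<in> upper (cball 0 \<gamma>) \<and> - x \<in> upper (cball 0 \<gamma>)}"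

lemma UbM_Um: "UbM \<subseteq> Um"
  unfolding UbM_def Um_def using upper_subset[of _ UNIV] by blast

lemma UbM_E:
  fixes x y :: "'a::cstar_algebra vN"
  assumes "x \<in> UbM" "y \<in> UbM"
  obtains \<gamma> where "x \<in> upper (cball 0 \<gamma>)" "- x \<in> upper (cball 0 \<gamma>)" "y \<in> upper (cball 0 \<gamma>)" "- y \<in> upper (cball 0 \<gamma>)"
    "norm x \<le> \<gamma>" "norm y \<le> \<gamma>" "\<gamma> \<ge> 0"
proof -
  obtain a b where ab: "x \<in> upper (cball 0 a)" "- x \<in> upper (cball 0 a)" "y \<in> upper (cball 0 b)" "- y \<in> upper (cball 0 b)"
    using assms unfolding UbM_def by blast
  define m where "m = max (max a b) (max (norm x) (norm y))"
  have m: "a \<le> m" "b \<le> m" "norm x \<le> m" "norm y \<le> m" by (auto simp: m_def)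
  have *: "upper (cball (0 :: 'a vN) a) \<subseteq> upper (cball 0 m)" "upper (cball (0 :: 'a vN) b) \<subseteq> upper (cball 0 m)"
    by (intro upper_subset subset_cball m)+
  show thesis
    using subsetD[OF *(1) ab(1)] subsetD[OF *(1) ab(2)] subsetD[OF *(2) ab(3)] subsetD[OF *(2) ab(4)]
      m(3,4) order_trans[OF norm_ge_zero m(3)] by (rule that)
qed

lemma upper_0: "0 \<in> upper (cball 0 0)"
  by (intro upper_lscM lscM_0) simp

lemma real_space_UbM: "real_space UbM"
  unfolding real_space_def
proof (intro conjI ballI allI)
  show "0 \<in> UbM" unfolding UbM_def using upper_0 by (auto intro!: exI[of _ 0])
next
  fix x y :: "'a vN" assume "x \<in> UbM" "y \<in> UbM"
  then obtain \<gamma> where g: "x \<in> upper (cball 0 \<gamma>)" "- x \<in> upper (cball 0 \<gamma>)" "y \<in> upper (cball 0 \<gamma>)" "- y \<in> upper (cball 0 \<gamma>)"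
    by (rule UbM_E)
  have *: "norm (a + b) \<le> \<gamma> + \<gamma>" if "norm a \<le> \<gamma>" "norm b \<le> \<gamma>" for a b :: "'a vN"
    using norm_triangle_ineq[of a b] that by simp
  have "x + y \<in> upper (cball 0 (\<gamma> + \<gamma>))" "- x + - y \<in> upper (cball 0 (\<gamma> + \<gamma>))"
    by (rule upper_add[OF g(1,3)] upper_add[OF g(2,4)]; use * in simp)+
  then show "x + y \<in> UbM" unfolding UbM_def by auto
next
  fix x :: "'a vN" and r assume x: "x \<in> UbM"
  then obtain \<gamma> where g: "x \<in> upper (cball 0 \<gamma>)" "- x \<in> upper (cball 0 \<gamma>)" unfolding UbM_def by blast
  show "sa x" using g(1) by (rule upper_sa)
  have *: "\<bar>r\<bar> *\<^sub>R y \<in> upper (cball 0 (\<bar>r\<bar> * \<gamma>))" if "y \<in> upper (cball 0 \<gamma>)" for y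
    by (rule upper_scaleR[OF that]) (auto intro: mult_left_mono)
  show "r *\<^sub>R x \<in> UbM"
  proof (cases "r \<ge> 0")
    case True
    then show ?thesis using *[OF g(1)] *[OF g(2)] unfolding UbM_def by auto
  next
    case False
    then show ?thesis using *[OF g(1)] *[OF g(2)] unfolding UbM_def by auto
  qed
qed

text \<open>By \<open>opE_neg\<close>, upper approximation for both signs of t is two-sided
  approximation. The choice \<delta> = 1/(4 \<gamma> + 1) makes 2 \<gamma> \<delta> \<le>
  1/2.\<close>

lemma UbM_opE:
  assumes "x \<in> UbM" "y \<in> UbM"
  obtains \<delta> where "\<delta> > 0" "\<And>t. \<bar>t\<bar> \<le> \<delta> \<Longrightarrow> opE t x y \<in> UbM"
proof -
  obtain \<gamma> where g: "x \<in> upper (cball 0 \<gamma>)" "- x \<in> upper (cball 0 \<gamma>)" "y \<in> upper (cball 0 \<gamma>)" "- y \<in> upper (cball 0 \<gamma>)"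
    "norm x \<le> \<gamma>" "norm y \<le> \<gamma>" "\<gamma> \<ge> 0" using assms by (rule UbM_E)
  define \<delta> where "\<delta> = 1 / (4 * \<gamma> + 1)"
  have "opE t x y \<in> UbM" if t: "\<bar>t\<bar> \<le> \<delta>" for t
  proof -
    have "\<bar>t\<bar> * (2 * \<gamma>) \<le> \<delta> * (2 * \<gamma>)" using t g(7) by (intro mult_right_mono) auto
    also have "\<dots> \<le> 1 / 2" using g(7) by (simp add: \<delta>_def field_simps)
    finally have t2: "\<bar>t\<bar> * (2 * \<gamma>) \<le> 1 / 2" .
    have "opE (- t) (- x) (- y) = - opE t x y" by (simp add: opE_neg)
    moreover have "\<bar>- t\<bar> * (2 * \<gamma>) \<le> 1 / 2" using t2 by simp
    ultimately show ?thesis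
      using upper_opE_bounded[OF g(1,3,5,6) t2] upper_opE_bounded[OF g(2,4), of "- t"] g(5,6)
      unfolding UbM_def by auto
  qed
  moreover have "\<delta> > 0" using g(7) by (simp add: \<delta>_def)
  ultimately show thesis using that by blast
qed

lemma zz_UbM:
  assumes xy: "x \<in> UbM" "y \<in> UbM" shows "opZ x y * adj (opZ x y) \<in> closure UbM"
proof -
  obtain \<delta> where d: "\<delta> > 0" "\<And>t. \<bar>t\<bar> \<le> \<delta> \<Longrightarrow> opE t x y \<in> UbM" using UbM_opE[OF xy] by blast
  note S = real_spaceD[OF real_space_UbM]
  \<comment> \<open>The summand 1/\<delta> forces tseq K n \<le> \<delta>.\<close>
  define K where "K = norm x + norm y + 1 / \<delta>"
  have K: "K \<ge> 0" "norm x + norm y \<le> K" "K \<ge> 1 / \<delta>" using d(1) by (auto simp: K_def)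
  have t: "\<bar>tseq K n\<bar> * (norm x + norm y) \<le> 1 / 2" "tseq K n \<le> \<delta>" for n
  proof -
    have "\<bar>tseq K n\<bar> * (norm x + norm y) \<le> \<bar>tseq K n\<bar> * K" using K by (intro mult_left_mono) auto
    then show "\<bar>tseq K n\<bar> * (norm x + norm y) \<le> 1 / 2" using tseq(3)[OF K(1), of n] by linarith
    have "tseq K n * (1 / \<delta>) \<le> tseq K n * K" using K tseq(1)[OF K(1), of n] by (intro mult_left_mono) auto
    also have "\<dots> \<le> 1" using tseq(3)[OF K(1), of n] tseq(1)[OF K(1), of n] by simp
    finally show "tseq K n \<le> \<delta>" using d(1) by (simp add: field_simps)
  qed
  have "(\<lambda>n. (1 / tseq K n) *\<^sub>R (x + y - opE (tseq K n) x y)) \<longlonglongrightarrow> opZ x y * adj (opZ x y)"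
    using tseq[OF K(1)] t S(4) xy by (intro zz_lim) (auto simp: less_imp_neq[THEN not_sym])
  moreover have "(1 / tseq K n) *\<^sub>R (x + y - opE (tseq K n) x y) \<in> UbM" for n
    using t(2)[of n] tseq(1)[OF K(1), of n] by (intro S(3) S(6) S(2) d(2) xy) auto
  ultimately show ?thesis unfolding closure_sequential
    by (intro exI[of _ "\<lambda>n. (1 / tseq K n) *\<^sub>R (x + y - opE (tseq K n) x y)"]) auto
qed

lemma cstar_real_UbM: "cstar_real (closure UbM)"
  unfolding cstar_real_def
  by (intro conjI real_space_closure real_space_UbM closed_closure ballI zz_closure[OF zz_UbM])

text \<open>The unit need not lie in the algebra, but the elements -e with e from the approximate
  unit do, and they decrease to -1.\<close>

lemma minus_one_upper: "- 1 \<in> upper (cball (0 :: 'a::cstar_algebra vN) 1)"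
proof (rule upper_I)
  show "sa (- 1 :: 'a vN)" by (rule sa_intros) simp
  fix \<phi> :: "'a cdual" and r :: real assume *: "is_state \<phi>" "r > 0"
  then obtain e where e: "e \<in> Lam" "Re (evf \<phi> \<cdot> (1 - e)) < r"
    using Lam_sup[where 'a='a] evf_NF[of \<phi>] unfolding is_sup_def is_state_posf by blast
  note p = Lam_props[OF e(1)]
  have "- e \<in> range emb" using range_emb_simps(3)[OF p(5), of "-1"] by simp
  then have "- e \<in> lscM" using p(1) by (intro Am_lscM Am_emb sa_intros)
  moreover have "le (- 1) (- e)" using p(4) by (simp add: le_minus)
  moreover have "Re (evf \<phi> \<cdot> (- e - (- 1))) < r" using e(2) by simp
  ultimately show "\<exists>h\<in>lscM \<inter> cball 0 1. le (- 1) h \<and> Re (evf \<phi> \<cdot> (h - (- 1))) < r"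
    using p(3) by (intro bexI[of _ "- e"]) auto
qed

lemma one_UbM: "1 \<in> UbM"
  unfolding UbM_def using minus_one_upper upper_lscM[of 1 "cball 0 1"] lscM_one[of 1] norm_one_le
  by (intro CollectI exI[of _ 1] conjI) auto

section \<open>Monotone sequential closure\<close>

definition mono_seq :: "(nat \<Rightarrow> 'a::cstar_algebra vN) \<Rightarrow> 'a vN \<Rightarrow> bool"
  where "mono_seq f x \<longleftrightarrow> bounded (range f) \<and> ((\<forall>n. le (f n) (f (Suc n))) \<or> (\<forall>n. le (f (Suc n)) (f n))) \<and>
    (\<forall>\<phi>. (\<lambda>n. evf \<phi> \<cdot> f n) \<longlonglongrightarrow> evf \<phi> \<cdot> x)"

definition mclosed :: "'a::cstar_algebra vN set \<Rightarrow> bool"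
  where "mclosed S \<longleftrightarrow> (\<forall>f x. (\<forall>n. f n \<in> S) \<longrightarrow> mono_seq f x \<longrightarrow> x \<in> S)"

definition U0M :: "'a::cstar_algebra vN set"
  where "U0M = \<Inter>{S. UbM \<subseteq> S \<and> S \<subseteq> {x. sa x} \<and> mclosed S}"

lemma evf_adj: "evf \<phi> \<cdot> adj x = cnj (evf (cdual_adj \<phi>) \<cdot> x)"
  by (simp add: evf.rep_eq adj_vN.rep_eq bidual_adj.rep_eq)

lemma mono_seq_sa:
  assumes "\<And>n. sa (f n)" "mono_seq f x" shows "sa x"
proof -
  have c: "(\<lambda>n. evf \<phi> \<cdot> f n) \<longlonglongrightarrow> evf \<phi> \<cdot> x" for \<phi> using assms(2) by (simp add: mono_seq_def)
  have "adj x = x"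
  proof (rule vN_eqI)
    fix \<phi> :: "'a cdual"
    have "(\<lambda>n. cnj (evf (cdual_adj \<phi>) \<cdot> f n)) \<longlonglongrightarrow> cnj (evf (cdual_adj \<phi>) \<cdot> x)" by (intro tendsto_cnj c)
    then have "(\<lambda>n. evf \<phi> \<cdot> f n) \<longlonglongrightarrow> evf \<phi> \<cdot> adj x"
      unfolding evf_adj[symmetric] using assms(1) by (simp add: sa_def)
    then show "evf \<phi> \<cdot> adj x = evf \<phi> \<cdot> x" using LIMSEQ_unique c by blast
  qed
  then show ?thesis by (simp add: sa_def)
qed

lemma mclosed_sa: "mclosed {x. sa x}"
  unfolding mclosed_def using mono_seq_sa by blast

lemma UbM_sa: "x \<in> UbM \<Longrightarrow> sa x"
  by (rule real_spaceD(4)[OF real_space_UbM])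

lemma U0M_sa: "x \<in> U0M \<Longrightarrow> sa x"
  unfolding U0M_def using mclosed_sa UbM_sa by blast

lemma UbM_U0M: "x \<in> UbM \<Longrightarrow> x \<in> U0M"
  unfolding U0M_def by blast

lemma U0M_mono_seq: "(\<And>n. f n \<in> U0M) \<Longrightarrow> mono_seq f x \<Longrightarrow> x \<in> U0M"
  unfolding U0M_def mclosed_def by blast

lemma U0M_least: "UbM \<subseteq> S \<Longrightarrow> S \<subseteq> {x. sa x} \<Longrightarrow> mclosed S \<Longrightarrow> U0M \<subseteq> S"
  unfolding U0M_def by blast

lemma U0M_induct [consumes 1, case_names base lim]:
  assumes x: "x \<in> U0M" and b: "\<And>x. x \<in> UbM \<Longrightarrow> P x"
    and l: "\<And>f x. (\<And>n. f n \<in> U0M) \<Longrightarrow> (\<And>n. P (f n)) \<Longrightarrow> mono_seq f x \<Longrightarrow> x \<in> U0M \<Longrightarrow> P x"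
  shows "P x"
proof -
  have "U0M \<subseteq> {x\<in>U0M. P x}"
  proof (rule U0M_least)
    show "UbM \<subseteq> {x\<in>U0M. P x}" using b UbM_U0M by blast
    show "{x\<in>U0M. P x} \<subseteq> {x. sa x}" using U0M_sa by blast
    show "mclosed {x\<in>U0M. P x}" unfolding mclosed_def
    proof (intro allI impI)
      fix f :: "nat \<Rightarrow> 'a vN" and x assume f: "\<forall>n. f n \<in> {x\<in>U0M. P x}" "mono_seq f x"
      have "x \<in> U0M" by (rule U0M_mono_seq[OF _ f(2)]) (use f(1) in blast)
      moreover have "P x" by (rule l[OF _ _ f(2) \<open>x \<in> U0M\<close>]) (use f(1) in blast)+
      ultimately show "x \<in> {x\<in>U0M. P x}" by blast
    qed
  qed
  with x show ?thesis by blast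
qed

lemma mono_seq_scaleR:
  assumes "mono_seq f x" shows "mono_seq (\<lambda>n. r *\<^sub>R f n) (r *\<^sub>R x)"
proof -
  have "bounded (range (\<lambda>n. r *\<^sub>R f n))"
    using bounded_scaling[of "range f" r] assms by (simp add: mono_seq_def image_image)
  moreover have "(\<forall>n. le (r *\<^sub>R f n) (r *\<^sub>R f (Suc n))) \<or> (\<forall>n. le (r *\<^sub>R f (Suc n)) (r *\<^sub>R f n))"
  proof (cases "r \<ge> 0")
    case True
    then show ?thesis using assms le_scaleR[OF _ True] unfolding mono_seq_def by blast
  next
    case False
    then have *: "le (r *\<^sub>R a) (r *\<^sub>R b) \<longleftrightarrow> le ((- r) *\<^sub>R b) ((- r) *\<^sub>R a)" for a b :: "'a vN"
      by (simp add: le_minus)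
    show ?thesis unfolding * using assms le_scaleR[of _ _ "- r"] False unfolding mono_seq_def by force
  qed
  ultimately show ?thesis using assms by (auto simp: mono_seq_def cdual_apply_scaleR intro!: tendsto_intros)
qed

lemma mono_seq_add:
  assumes "mono_seq f x" shows "mono_seq (\<lambda>n. f n + c) (x + c)"
proof -
  have "bounded (range (\<lambda>n. f n + c))"
    using bounded_translation[of "range f" c] assms by (simp add: mono_seq_def image_image add.commute)
  moreover have "le (a + c) (b + c) \<longleftrightarrow> le a b" for a b :: "'a vN" by (simp add: le_def)
  ultimately show ?thesis using assms by (auto simp: mono_seq_def cdual_apply_add intro!: tendsto_intros)
qed

lemma real_space_U0M: "real_space U0M"
  unfolding real_space_def
proof (intro conjI ballI allI)
  show "0 \<in> U0M" by (intro UbM_U0M real_spaceD(1)[OF real_space_UbM])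
  show "sa x" if "x \<in> U0M" for x :: "'a vN" using that by (rule U0M_sa)
  show "r *\<^sub>R x \<in> U0M" if "x \<in> U0M" for x :: "'a vN" and r
    using that
  proof (induction rule: U0M_induct)
    case (base x) then show ?case by (intro UbM_U0M real_spaceD(3)[OF real_space_UbM])
  next
    case (lim f x) then show ?case by (intro U0M_mono_seq[OF _ mono_seq_scaleR[OF lim(2)]])
  qed
  have 1: "x + y \<in> U0M" if "x \<in> U0M" "y \<in> UbM" for x y :: "'a vN"
    using that(1)
  proof (induction rule: U0M_induct)
    case (base x) then show ?case using that(2) by (intro UbM_U0M real_spaceD(2)[OF real_space_UbM])
  next
    case (lim f x) then show ?case by (intro U0M_mono_seq[OF _ mono_seq_add[OF lim(2)]])
  qed
  show "x + y \<in> U0M" if "x \<in> U0M" "y \<in> U0M" for x y :: "'a vN"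
    using that(2)
  proof (induction rule: U0M_induct)
    case (base y) then show ?case using that(1) 1 by blast
  next
    case (lim f y)
    have "mono_seq (\<lambda>n. x + f n) (x + y)" using mono_seq_add[OF lim(2), of x] by (simp add: add.commute)
    then show ?case by (rule U0M_mono_seq[OF lim.IH])
  qed
qed

text \<open>A fast convergent sequence becomes increasing after subtracting \<open>3 \<cdot> 2\<^sup>-\<^sup>n\<close>.\<close>

lemma U0M_lim:
  assumes X: "\<And>n. X n \<in> U0M" "X \<longlonglongrightarrow> x" shows "x \<in> U0M"
proof -
  note S = real_spaceD[OF real_space_U0M]
  have "\<exists>m. norm (X m - x) < (1/2) ^ n" for n
  proof -
    have "eventually (\<lambda>m. dist (X m) x < (1/2) ^ n) sequentially" using X(2) by (rule tendstoD) simp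
    then show ?thesis by (auto simp: eventually_sequentially dist_norm)
  qed
  then obtain m where m: "\<And>n. norm (X (m n) - x) < (1/2) ^ n" by metis
  \<comment> \<open>Consecutive terms differ by at most (1 + 1/2) 2^-n, and the correction drops by
    exactly 3/2 times 2^-n.\<close>
  define y where "y n = X (m n) - (3 * (1/2) ^ n) *\<^sub>R 1" for n
  have y: "y n \<in> U0M" for n unfolding y_def by (intro S(6) S(3) X UbM_U0M one_UbM)
  have pw: "(\<lambda>n. (1/2 :: real) ^ n) \<longlonglongrightarrow> 0" by (rule LIMSEQ_power_zero) simp
  have "(\<lambda>n. X (m n) - x) \<longlonglongrightarrow> 0"
    by (rule Lim_null_comparison[OF always_eventually pw]) (use m in \<open>auto intro: less_imp_le\<close>)
  then have lim1: "(\<lambda>n. X (m n)) \<longlonglongrightarrow> x" by (rule LIM_zero_cancel)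
  have "(\<lambda>n. X (m n) - (3 * (1/2) ^ n) *\<^sub>R 1) \<longlonglongrightarrow> x - (3 * 0) *\<^sub>R 1"
    by (intro tendsto_intros lim1 pw)
  then have lim: "y \<longlonglongrightarrow> x" by (simp add: y_def[abs_def])
  have inc: "le (y n) (y (Suc n))" for n
  proof -
    have "norm (X (m (Suc n)) - X (m n)) \<le> norm (X (m (Suc n)) - x) + norm (x - X (m n))"
      using norm_triangle_ineq[of "X (m (Suc n)) - x" "x - X (m n)"] by simp
    also have "\<dots> \<le> 3 / 2 * (1/2) ^ n" using m[of n] m[of "Suc n"] by (simp add: norm_minus_commute)
    finally have "pos ((3 / 2 * (1/2) ^ n) *\<^sub>R 1 + (X (m (Suc n)) - X (m n)))"
      by (intro pos_norm_minus(2) sa_intros U0M_sa X)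
    moreover have "y (Suc n) - y n = (3 / 2 * (1/2) ^ n) *\<^sub>R 1 + (X (m (Suc n)) - X (m n))"
      by (simp add: y_def algebra_simps) (simp flip: scaleR_add_left)
    ultimately show ?thesis by (simp add: le_def)
  qed
  have "mono_seq y x"
    unfolding mono_seq_def using inc lim
    by (auto intro: convergent_imp_bounded bounded_linear.tendsto[OF bounded_linear_cdual_apply])
  then show ?thesis using y U0M_mono_seq by blast
qed

lemma closed_U0M: "closed U0M"
  unfolding closed_sequential_limits using U0M_lim by blast

section \<open>Monotone sequences as directed suprema\<close>

lemma le_incseq:
  assumes "\<And>n. le (f n) (f (Suc n))" "m \<le> n" shows "le (f m) (f n)"
  using assms(2) by (induction rule: dec_induct) (auto intro: le_trans assms(1))

lemma directed_incseq:
  assumes "\<And>n. le (f n) (f (Suc n))" shows "directed (range f) le"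
proof (rule directedI)
  fix x y assume "x \<in> range f" "y \<in> range f"
  then obtain m n where "x = f m" "y = f n" by blast
  then show "\<exists>z\<in>range f. le x z \<and> le y z"
    using le_incseq[of f, OF assms] by (intro bexI[of _ "f (max m n)"]) auto
qed simp

lemma mono_seq_is_sup:
  assumes f: "\<And>n. le (f n) (f (Suc n))" "\<And>n. sa (f n)" and l: "mono_seq f x"
  shows "is_sup (range f) x"
  unfolding is_sup_def
proof (intro conjI ballI allI impI)
  have sa: "sa x" using mono_seq_sa f(2) l by blast
  have c: "(\<lambda>n. g \<cdot> f n) \<longlonglongrightarrow> g \<cdot> x" if "g \<in> NF" for g
    using l that by (auto simp: NF_def mono_seq_def)
  fix d assume "d \<in> range f"
  then obtain m where d: "d = f m" by blast
  show "le d x" unfolding le_def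
  proof (rule pos_of_NF)
    show "sa (x - d)" using sa f(2) d by (auto intro: sa_intros)
    fix g :: "'a vN cdual" assume g: "g \<in> NF"
    have "Re (g \<cdot> d) \<le> Re (g \<cdot> x)"
    proof (rule LIMSEQ_le_const[OF tendsto_Re[OF c[OF g]]], intro exI[of _ m] allI impI)
      fix n assume "m \<le> n"
      then show "Re (g \<cdot> d) \<le> Re (g \<cdot> f n)"
        using posf_mono[OF NF_posf[OF g]] le_incseq[of f, OF f(1)] unfolding d le_def by blast
    qed
    then show "0 \<le> Re (g \<cdot> (x - d))" by (simp add: cdual_apply_diff)
  qed
next
  fix g :: "'a vN cdual" and e :: real assume g: "g \<in> NF" "e > 0"
  have "(\<lambda>n. g \<cdot> f n) \<longlonglongrightarrow> g \<cdot> x" using l g(1) by (auto simp: NF_def mono_seq_def)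
  then obtain n where "dist (g \<cdot> f n) (g \<cdot> x) < e" using g(2) by (meson LIMSEQ_iff_nz lim_sequentially order_refl)
  then have "Re (g \<cdot> (x - f n)) < e"
    using complex_Re_le_cmod[of "g \<cdot> x - g \<cdot> f n"] by (simp add: dist_norm norm_minus_commute cdual_apply_diff)
  then show "\<exists>d\<in>range f. Re (g \<cdot> (x - d)) < e" by blast
qed

lemma is_sup_mono_seq:
  assumes f: "\<And>n. le (f n) (f (Suc n))" "\<And>n. norm (f n) \<le> K" and s: "is_sup (range f) x"
  shows "mono_seq f x"
proof -
  have "(\<lambda>n. evf \<phi> \<cdot> f n) \<longlonglongrightarrow> evf \<phi> \<cdot> x" for \<phi>
  proof (rule LIMSEQ_I)
    fix r :: real assume "r > 0"
    then obtain n where "\<forall>d'\<in>range f. le (f n) d' \<longrightarrow> cmod (evf \<phi> \<cdot> (d' - x)) < r"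
      using is_sup_tendsto[OF directed_incseq[of f, OF f(1)] s, of K r \<phi>] f(2) by blast
    then show "\<exists>n0. \<forall>n\<ge>n0. norm (evf \<phi> \<cdot> f n - evf \<phi> \<cdot> x) < r"
      using le_incseq[of f, OF f(1)] by (auto simp: cdual_apply_diff)
  qed
  then show ?thesis using f by (auto simp: mono_seq_def bounded_iff)
qed

lemma mono_seq_const: "mono_seq (\<lambda>n. x) x"
  by (simp add: mono_seq_def)

text \<open>The diagonal is cofinal in the product net of \<open>is_sup_opE\<close>.\<close>

lemma mono_seq_opE_inc:
  fixes f g :: "nat \<Rightarrow> 'a::cstar_algebra vN"
  assumes f: "\<And>n. le (f n) (f (Suc n))" "\<And>n. sa (f n)" "\<And>n. norm (f n) \<le> K" "norm x \<le> K" "mono_seq f x"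
    and g: "\<And>n. le (g n) (g (Suc n))" "\<And>n. sa (g n)" "\<And>n. norm (g n) \<le> K" "norm y \<le> K" "mono_seq g y"
    and t: "\<bar>t\<bar> * (2 * K) \<le> 1 / 2"
  shows "mono_seq (\<lambda>n. opE t (f n) (g n)) (opE t x y)"
proof -
  have adm: "admis (1 / 2) t a b" if "norm a \<le> K" "norm b \<le> K" "sa a" "sa b" for a b :: "'a vN"
  proof (rule admis_norm[OF that(3,4)])
    have "\<bar>t\<bar> * (norm a + norm b) \<le> \<bar>t\<bar> * (2 * K)" using that by (intro mult_left_mono) auto
    with t show "\<bar>t\<bar> * (norm a + norm b) \<le> 1 - 1 / 2" by simp
  qed simp
  have sa: "sa x" "sa y" using mono_seq_sa f g by blast+
  note sf = mono_seq_is_sup[of f, OF f(1,2,5)] and sg = mono_seq_is_sup[of g, OF g(1,2,5)]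
  have D: "directed (range f) le" "directed (range g) le"
    using directed_incseq[of f, OF f(1)] directed_incseq[of g, OF g(1)] by auto
  have ad: "admis (1 / 2) t (f m) (g n)" for m n by (intro adm f g)
  have s: "is_sup {opE t d e |d e. d \<in> range f \<and> e \<in> range g} (opE t x y)"
    by (rule is_sup_opE(2)[OF D(1) sf _ D(2) sg _ f(4) g(4) adm[OF f(4) g(4) sa]]) (use f g ad in auto)
  have mono: "le (opE t (f m) (g n)) (opE t (f m') (g n'))" if "m \<le> m'" "n \<le> n'" for m n m' n'
    using le_incseq[of f, OF f(1) that(1)] le_incseq[of g, OF g(1) that(2)]
    by (intro opE_mono[OF ad f(2) g(2) ad f(2) g(2)])
  show ?thesis
  proof (rule is_sup_mono_seq)
    show "le (opE t (f n) (g n)) (opE t (f (Suc n)) (g (Suc n)))" for n by (rule mono) auto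
    show "norm (opE t (f n) (g n)) \<le> 2 * K + \<bar>t\<bar> * ((2 * K)\<^sup>2 / (1 / 2))" for n
    proof -
      have K: "norm (f n) + norm (g n) \<le> 2 * K" using f(3)[of n] g(3)[of n] by simp
      have "norm (opE t (f n) (g n)) \<le> (norm (f n) + norm (g n)) + \<bar>t\<bar> * ((norm (f n) + norm (g n))\<^sup>2 / (1 / 2))"
        by (rule norm_opE[OF ad])
      also have "\<dots> \<le> 2 * K + \<bar>t\<bar> * ((2 * K)\<^sup>2 / (1 / 2))"
        using K by (intro add_mono mult_left_mono divide_right_mono power_mono) auto
      finally show ?thesis .
    qed
    show "is_sup (range (\<lambda>n. opE t (f n) (g n))) (opE t x y)"
      unfolding is_sup_def
    proof (intro conjI ballI allI impI)
      fix d assume "d \<in> range (\<lambda>n. opE t (f n) (g n))"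
      then show "le d (opE t x y)" using s unfolding is_sup_def by blast
    next
      fix h :: "'a vN cdual" and e :: real assume h: "h \<in> NF" "e > 0"
      then obtain m n where "Re (h \<cdot> (opE t x y - opE t (f m) (g n))) < e" using s unfolding is_sup_def by blast
      from le_small[OF h(1) mono this, of "max m n" "max m n"]
      show "\<exists>d\<in>range (\<lambda>n. opE t (f n) (g n)). Re (h \<cdot> (opE t x y - d)) < e" by auto
    qed
  qed
qed

text \<open>Decreasing sequences become increasing through \<open>opE_neg\<close>, which changes the
  sign of t; the condition on t is symmetric.\<close>

lemma mono_seq_opE:
  fixes f g :: "nat \<Rightarrow> 'a::cstar_algebra vN"
  assumes f: "\<And>n. sa (f n)" "\<And>n. norm (f n) \<le> K" "norm x \<le> K" "mono_seq f x"
    and y: "sa y" "norm y \<le> K"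
    and t: "\<bar>t\<bar> * (2 * K) \<le> 1 / 2"
  shows "mono_seq (\<lambda>n. opE t (f n) y) (opE t x y)" "mono_seq (\<lambda>n. opE t y (f n)) (opE t y x)"
proof -
  consider "\<And>n. le (f n) (f (Suc n))" | "\<And>n. le (f (Suc n)) (f n)" using f(4) unfolding mono_seq_def by blast
  then have "mono_seq (\<lambda>n. opE t (f n) y) (opE t x y) \<and> mono_seq (\<lambda>n. opE t y (f n)) (opE t y x)"
  proof cases
    case 1
    then show ?thesis
      using mono_seq_opE_inc[OF _ f le_refl y(1) y(2) y(2) mono_seq_const t]
        mono_seq_opE_inc[OF le_refl y(1) y(2) y(2) mono_seq_const _ f t] by blast
  next
    case 2
    have m: "mono_seq (\<lambda>n. - f n) (- x)" using mono_seq_scaleR[OF f(4), of "-1"] by simp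
    have "mono_seq (\<lambda>n. opE (- t) (- f n) (- y)) (opE (- t) (- x) (- y))"
      by (rule mono_seq_opE_inc[where K=K]) (use 2 f y t m mono_seq_const in \<open>auto simp: le_minus\<close>)
    moreover have "mono_seq (\<lambda>n. opE (- t) (- y) (- f n)) (opE (- t) (- y) (- x))"
      by (rule mono_seq_opE_inc[where K=K]) (use 2 f y t m mono_seq_const in \<open>auto simp: le_minus\<close>)
    ultimately show ?thesis
      using mono_seq_scaleR[of _ _ "-1"] by (fastforce simp: opE_neg)
  qed
  then show "mono_seq (\<lambda>n. opE t (f n) y) (opE t x y)" "mono_seq (\<lambda>n. opE t y (f n)) (opE t y x)" by auto
qed

text \<open>By the Neumann series of \<open>opS\<close>, membership of \<open>opE t x y\<close> for small \<open>t\<close> amounts to membership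
  of all coefficients \<open>z (x + y)\<^sup>n z\<^sup>*\<close>. The former passes to monotone limits in \<open>x\<close> or \<open>y\<close>, while
  the latter is available for \<open>x, y \<in> UbM\<close>.\<close>

definition opR :: "nat \<Rightarrow> real \<Rightarrow> 'b::ucstar \<Rightarrow> 'b \<Rightarrow> 'b"
  where "opR n t x y = opZ x y * (x + y) ^ n * opS t x y * adj (opZ x y)"

definition opC :: "nat \<Rightarrow> 'b::ucstar \<Rightarrow> 'b \<Rightarrow> 'b"
  where "opC n x y = opZ x y * (x + y) ^ n * adj (opZ x y)"

text \<open>One step S = 1 - t (x + y) S of the Neumann expansion, with the remainder kept.\<close>

lemma opR_step:
  assumes "admis c t x y" shows "opR n t x y = opC n x y - t *\<^sub>R opR (Suc n) t x y"
proof -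
  have S: "opS t x y = 1 - t *\<^sub>R ((x + y) * opS t x y)"
    using opS(1)[OF assms] by (simp add: algebra_simps)
  have "opR n t x y = opZ x y * (x + y) ^ n * (1 - t *\<^sub>R ((x + y) * opS t x y)) * adj (opZ x y)"
    unfolding opR_def using S by simp
  also have "\<dots> = opC n x y - t *\<^sub>R (opZ x y * ((x + y) ^ n * (x + y)) * opS t x y * adj (opZ x y))"
    unfolding opC_def by (simp only: right_diff_distrib left_diff_distrib mult_scaleR_right mult_scaleR_left mult_1_right mult.assoc)
  finally show ?thesis by (simp only: opR_def power_Suc2)
qed

lemma norm_pow_le: "norm (q ^ n) \<le> norm (q :: 'b::ucstar) ^ n"
proof (induction n)
  case (Suc n)
  have "norm (q * q ^ n) \<le> norm q * norm (q ^ n)" by (rule norm_mult_ineq)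
  also have "\<dots> \<le> norm q * norm q ^ n" by (intro mult_left_mono Suc) simp
  finally show ?case by simp
qed (simp add: norm_one_le)

lemma norm_opR:
  assumes "admis (1 / 2) t x y" "norm x + norm y \<le> L" shows "norm (opR n t x y) \<le> L * L ^ n * 2 * L"
proof -
  have L: "L \<ge> 0" using assms(2) norm_ge_zero[of x] norm_ge_zero[of y] by linarith
  have 1: "norm (opZ x y) \<le> L" using norm_opZ[of x y] assms(2) by linarith
  have "norm (x + y) \<le> L" using norm_triangle_ineq[of x y] assms(2) by linarith
  then have 2: "norm ((x + y) ^ n) \<le> L ^ n" using norm_pow_le[of "x + y" n] power_mono[of "norm (x + y)" L n] by simp
  have 3: "norm (opS t x y) \<le> 2" using opS(5)[OF assms(1)] by simp
  have m: "norm (a * b) \<le> A * B" if "norm a \<le> A" "norm b \<le> B" for a b :: 'a and A B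
    using norm_mult_ineq[of a b] mult_mono[of "norm a" A "norm b" B] that order_trans[OF norm_ge_zero that(1)]
    by (meson norm_ge_zero order_trans)
  show ?thesis unfolding opR_def by (intro m 1 2 3) (simp add: norm_adj 1)
qed

lemma opE_opR: "opE t x y = x + y - t *\<^sub>R opR 0 t x y"
  by (simp add: opE_def opR_def)

text \<open>The partial sums of the Neumann series lie in W, and the remainder after m terms is at
  most a constant times 2^-m.\<close>

lemma opE_of_opC:
  assumes W: "real_space W" "closed W" and xy: "x \<in> W" "y \<in> W" "\<And>n. opC n x y \<in> W"
    and L: "norm x + norm y \<le> L" "\<bar>t\<bar> * L \<le> 1 / 2"
  shows "opE t x y \<in> W"
proof -
  note S = real_spaceD[OF W(1)]
  have t: "\<bar>t\<bar> * (norm x + norm y) \<le> \<bar>t\<bar> * L" using L(1) by (intro mult_left_mono) auto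
  have ad: "admis (1 / 2) t x y" by (rule admis_norm) (use S(4) xy t L in auto)
  have L0: "L \<ge> 0" using L(1) norm_ge_zero[of x] norm_ge_zero[of y] by linarith
  define s where "s m = opR 0 t x y - (- t) ^ m *\<^sub>R opR m t x y" for m
  have s: "s m \<in> W" for m
  proof (induction m)
    case 0 then show ?case using S(1) by (simp add: s_def)
  next
    case (Suc m)
    have "s (Suc m) = s m + (- t) ^ m *\<^sub>R opC m x y"
      unfolding s_def opR_step[OF ad, of m] by (simp add: algebra_simps)
    then show ?case using Suc S xy by simp
  qed
  have "norm ((- t) ^ m *\<^sub>R opR m t x y) \<le> (1 / 2) ^ m * (L * 2 * L)" for m
  proof -
    have "norm ((- t) ^ m *\<^sub>R opR m t x y) \<le> \<bar>t\<bar> ^ m * (L * L ^ m * 2 * L)"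
      using norm_opR[OF ad L(1), of m] by (simp add: power_abs mult_left_mono)
    also have "\<dots> = (\<bar>t\<bar> * L) ^ m * (L * 2 * L)" by (simp add: power_mult_distrib)
    also have "\<dots> \<le> (1 / 2) ^ m * (L * 2 * L)" using L L0 by (intro mult_right_mono power_mono) auto
    finally show ?thesis .
  qed
  moreover have "(\<lambda>m. (1 / 2 :: real) ^ m * (L * 2 * L)) \<longlonglongrightarrow> 0 * (L * 2 * L)"
    by (intro tendsto_mult tendsto_const LIMSEQ_power_zero) simp
  then have "(\<lambda>m. (1 / 2 :: real) ^ m * (L * 2 * L)) \<longlonglongrightarrow> 0" by simp
  ultimately have "(\<lambda>m. (- t) ^ m *\<^sub>R opR m t x y) \<longlonglongrightarrow> 0"
    by (rule Lim_null_comparison[OF always_eventually, OF allI])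
  then have "s \<longlonglongrightarrow> opR 0 t x y - 0" unfolding s_def by (intro tendsto_diff tendsto_const)
  then have "opR 0 t x y \<in> W" by (intro closed_sequentially[OF W(2) s]) simp
  then show ?thesis unfolding opE_opR by (intro S xy)
qed

text \<open>Coefficients are read off one after the other: \<open>opC n\<close> is the limit of
  \<open>opR n t\<close> as t tends to 0, and \<open>opR (Suc n) t\<close> is the quotient of
  \<open>opC n\<close> - \<open>opR n t\<close> by t.\<close>

lemma opC_of_opE:
  assumes W: "real_space W" "closed W" and xy: "x \<in> W" "y \<in> W"
    and L: "norm x + norm y \<le> L" and E: "\<And>t. \<bar>t\<bar> * L \<le> 1 / 2 \<Longrightarrow> opE t x y \<in> W"
  shows "opC n x y \<in> W"
proof -
  note S = real_spaceD[OF W(1)]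
  have L0: "L \<ge> 0" using L(1) norm_ge_zero[of x] norm_ge_zero[of y] by linarith
  have ad: "admis (1 / 2) t x y" if "\<bar>t\<bar> * L \<le> 1 / 2" for t
  proof (rule admis_norm)
    show "\<bar>t\<bar> * (norm x + norm y) \<le> 1 - 1 / 2"
      using mult_left_mono[OF L, of "\<bar>t\<bar>"] that by simp
  qed (use S(4) xy in auto)
  have "(\<forall>t. t \<noteq> 0 \<longrightarrow> \<bar>t\<bar> * L \<le> 1 / 2 \<longrightarrow> opR n t x y \<in> W) \<and> opC n x y \<in> W" for n
  proof (induction n)
    have step: "opC n x y \<in> W" if R: "\<And>t. t \<noteq> 0 \<Longrightarrow> \<bar>t\<bar> * L \<le> 1 / 2 \<Longrightarrow> opR n t x y \<in> W" for n
    proof -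
      note tq = tseq[OF L0]
      have "opR n (tseq L k) x y \<in> W" for k using tq(1)[of k] by (intro R tq(3)) simp
      moreover have "(\<lambda>k. opR n (tseq L k) x y) \<longlonglongrightarrow> opC n x y"
      proof -
        have "norm (tseq L k *\<^sub>R opR (Suc n) (tseq L k) x y) \<le> \<bar>tseq L k\<bar> * (L * L ^ Suc n * 2 * L)" for k
          unfolding norm_scaleR by (intro mult_left_mono norm_opR[OF ad[OF tq(3)] L]) simp
        moreover have "(\<lambda>k. \<bar>tseq L k\<bar> * (L * L ^ Suc n * 2 * L)) \<longlonglongrightarrow> \<bar>0\<bar> * (L * L ^ Suc n * 2 * L)"
          by (intro tendsto_intros tq(2))
        then have "(\<lambda>k. \<bar>tseq L k\<bar> * (L * L ^ Suc n * 2 * L)) \<longlonglongrightarrow> 0" by simp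
        ultimately have "(\<lambda>k. tseq L k *\<^sub>R opR (Suc n) (tseq L k) x y) \<longlonglongrightarrow> 0"
          by (rule Lim_null_comparison[OF always_eventually, OF allI])
        then have "(\<lambda>k. opC n x y - tseq L k *\<^sub>R opR (Suc n) (tseq L k) x y) \<longlonglongrightarrow> opC n x y - 0"
          by (intro tendsto_diff tendsto_const)
        then show ?thesis unfolding opR_step[OF ad[OF tq(3)], of n] by simp
      qed
      ultimately show ?thesis by (rule closed_sequentially[OF W(2)])
    qed
    {
      case 0
      have "opR 0 t x y \<in> W" if "t \<noteq> 0" "\<bar>t\<bar> * L \<le> 1 / 2" for t
      proof -
        have "opR 0 t x y = (1 / t) *\<^sub>R (x + y - opE t x y)" using that(1) by (simp add: opE_opR)
        then show ?thesis using S(3) S(6) S(2) xy E that(2) by simp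
      qed
      then show ?case using step by blast
    next
      case (Suc n)
      have "opR (Suc n) t x y \<in> W" if "t \<noteq> 0" "\<bar>t\<bar> * L \<le> 1 / 2" for t
      proof -
        have "opR (Suc n) t x y = (1 / t) *\<^sub>R (opC n x y - opR n t x y)"
          using that(1) opR_step[OF ad[OF that(2)], of n] by simp
        then show ?thesis using S(3) S(6) Suc that by simp
      qed
      then show ?case using step by blast
    }
  qed
  then show ?thesis by blast
qed

text \<open>The complexified closure of \<open>UbM\<close> is an algebra containing 1, so it
  contains the coefficient; self-adjointness places it in the closure itself.\<close>

lemma opC_UbM:
  assumes "x \<in> UbM" "y \<in> UbM" shows "opC n x y \<in> U0M"
proof -
  let ?W = "closure UbM :: 'a vN set"
  have R: "real_space ?W" by (rule real_space_closure[OF real_space_UbM])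
  have xy: "x \<in> ?W" "y \<in> ?W" "1 \<in> ?W" using assms one_UbM closure_subset by blast+
  have q: "1 \<in> complexify ?W" "x + y \<in> complexify ?W" by (intro real_in_complexify[OF R] real_spaceD(2)[OF R] xy)+
  have p: "(x + y) ^ n \<in> complexify ?W" for n
  proof (induction n)
    case (Suc n) then show ?case using cstar_real_mult[OF cstar_real_UbM q(2)] by simp
  qed (simp add: q)
  have "opC n x y \<in> complexify ?W"
    unfolding opC_def by (intro cstar_real_mult[OF cstar_real_UbM] opZ_complexify complexify_space(4)[OF R] p xy)
  moreover have xy': "adj (x + y) = x + y" using UbM_sa[OF assms(1)] UbM_sa[OF assms(2)] by (auto simp: sa_def adj_simps)
  have "sa ((x + y) ^ n)"
  proof (induction n)
    case (Suc n) then show ?case by (simp add: sa_def adj_mult xy' power_commutes)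
  qed simp
  then have "sa (opC n x y)" unfolding opC_def using sa_conj[of "(x + y) ^ n" "adj (opZ x y)"] by (simp add: adj_adj)
  then have "reP (opC n x y) = opC n x y" by (simp add: reP_def sa_def flip: scaleR_2)
  ultimately have "opC n x y \<in> ?W" using complexify_iff[of ?W "opC n x y"] real_spaceD(4)[OF R] by simp
  moreover have "?W \<subseteq> U0M" using UbM_U0M closed_U0M by (intro closure_minimal) auto
  ultimately show ?thesis by blast
qed

text \<open>The coefficients do not mention t. Membership for every member of the sequence therefore
  gives \<open>opE t\<close> for t in a range common to the whole sequence; the monotone limit is
  taken there, and the coefficients are extracted again.\<close>

lemma opC_mono_seq:
  assumes f: "\<And>n. f n \<in> U0M" "mono_seq f x" and y: "y \<in> U0M"
  shows "(\<And>m n. opC m (f n) y \<in> U0M) \<Longrightarrow> opC n x y \<in> U0M"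
    "(\<And>m n. opC m y (f n) \<in> U0M) \<Longrightarrow> opC n y x \<in> U0M"
proof -
  have x: "x \<in> U0M" using U0M_mono_seq f by blast
  obtain K0 where K0: "\<And>n. norm (f n) \<le> K0" using f(2) by (auto simp: mono_seq_def bounded_iff)
  define K where "K = Max {K0, norm x, norm y}"
  have K: "norm (f n) \<le> K" "norm x \<le> K" "norm y \<le> K" for n
    using K0[of n] by (auto simp: K_def)
  have K2: "norm (f n) + norm y \<le> 2 * K" "norm y + norm (f n) \<le> 2 * K" "norm x + norm y \<le> 2 * K" "norm y + norm x \<le> 2 * K" for n
    using K(1)[of n] K(2,3) by auto
  note m = mono_seq_opE[of f K x y, OF U0M_sa[OF f(1)] K(1,2) f(2) U0M_sa[OF y] K(3)]
  show "opC n x y \<in> U0M" if "\<And>m n. opC m (f n) y \<in> U0M"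
    by (rule opC_of_opE[OF real_space_U0M closed_U0M x y K2(3)],
        rule U0M_mono_seq[OF opE_of_opC[OF real_space_U0M closed_U0M f(1) y that K2(1)] m(1)])
  show "opC n y x \<in> U0M" if "\<And>m n. opC m y (f n) \<in> U0M"
    by (rule opC_of_opE[OF real_space_U0M closed_U0M y x K2(4)],
        rule U0M_mono_seq[OF opE_of_opC[OF real_space_U0M closed_U0M y f(1) that K2(2)] m(2)])
qed

text \<open>One variable at a time: the second with the first in \<open>UbM\<close>, then the first
  with the second arbitrary.\<close>

lemma opC_U0M:
  assumes "x \<in> U0M" "y \<in> U0M" shows "opC n x y \<in> U0M"
proof -
  have 1: "opC n x y \<in> U0M" if x: "x \<in> UbM" and y: "y \<in> U0M" for n x and y :: "'a vN"
    using y
  proof (induction arbitrary: n rule: U0M_induct)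
    case (base y) with x show ?case by (rule opC_UbM)
  next
    case (lim f y) show ?case by (rule opC_mono_seq(2)[OF lim(1,2) UbM_U0M[OF x] lim.IH])
  qed
  show ?thesis using assms(1)
  proof (induction arbitrary: n rule: U0M_induct)
    case (base x) then show ?case using assms(2) by (rule 1)
  next
    case (lim f x) show ?case by (rule opC_mono_seq(1)[OF lim(1,2) assms(2) lim.IH])
  qed
qed

lemma cstar_real_U0M: "cstar_real U0M"
  unfolding cstar_real_def using opC_U0M[of _ _ 0] real_space_U0M closed_U0M by (auto simp: opC_def)

section \<open>Universally measurable elements\<close>

lemma Um_D: "x \<in> Um \<Longrightarrow> x \<in> upper UNIV" "x \<in> Um \<Longrightarrow> - x \<in> upper UNIV"
  by (auto simp: Um_def)

lemma real_space_Um: "real_space Um"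
  unfolding real_space_def
proof (intro conjI ballI allI)
  show "0 \<in> Um" using UbM_Um real_spaceD(1)[OF real_space_UbM] by blast
  show "sa x" if "x \<in> Um" for x :: "'a vN" by (rule upper_sa[OF Um_D(1)[OF that]])
  show "x + y \<in> Um" if xy: "x \<in> Um" "y \<in> Um" for x y :: "'a vN"
  proof -
    have "x + y \<in> upper UNIV" "- x + - y \<in> upper UNIV" by (rule upper_add; use xy in \<open>auto simp: Um_def\<close>)+
    then show ?thesis by (simp add: Um_def)
  qed
  show "r *\<^sub>R x \<in> Um" if x: "x \<in> Um" for x :: "'a vN" and r
  proof -
    have "\<bar>r\<bar> *\<^sub>R x \<in> upper UNIV" "\<bar>r\<bar> *\<^sub>R (- x) \<in> upper UNIV" by (rule upper_scaleR; use x in \<open>auto simp: Um_def\<close>)+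
    then show ?thesis by (cases "r \<ge> 0") (auto simp: Um_def)
  qed
qed

lemma upper_UNIV_add: "x \<in> upper UNIV \<Longrightarrow> y \<in> upper UNIV \<Longrightarrow> x + y \<in> upper UNIV"
  by (erule upper_add) auto

text \<open>For t > 0 the quotient of \<open>opE t x y\<close> - x - y by t is approximable from
  above with no norm bound. The opposite sign would call for \<open>opE\<close> at negative t, where
  large majorants may fail to be admissible.\<close>

lemma minus_zz_upper:
  assumes xy: "x \<in> Um" "y \<in> Um" shows "- (opZ x y * adj (opZ x y)) \<in> upper UNIV"
proof -
  define K where "K = norm x + norm y"
  have K: "K \<ge> 0" by (simp add: K_def)
  note S = real_spaceD[OF real_space_Um] and tq = tseq[OF K]
  have ad: "admis (1 / 2) (tseq K n) x y" for n
    by (rule admis_norm) (use tq(3)[of n] S(4) xy in \<open>auto simp: K_def\<close>)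
  have "(\<lambda>n. (1 / tseq K n) *\<^sub>R (x + y - opE (tseq K n) x y)) \<longlonglongrightarrow> opZ x y * adj (opZ x y)"
    using tq S(4) xy by (intro zz_lim) (auto simp: K_def less_imp_neq[THEN not_sym])
  from tendsto_minus[OF this]
  have lim: "(\<lambda>n. (1 / tseq K n) *\<^sub>R (opE (tseq K n) x y + (- x + - y))) \<longlonglongrightarrow> - (opZ x y * adj (opZ x y))"
    by (simp add: scaleR_minus_right[symmetric] algebra_simps del: scaleR_minus_right)
  show ?thesis
  proof (rule upper_lim[OF _ lim])
    fix n
    have "opE (tseq K n) x y \<in> upper UNIV" using tq(1)[of n] by (intro upper_opE_pos[OF _ _ ad] Um_D xy) simp
    then have "opE (tseq K n) x y + (- x + - y) \<in> upper UNIV"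
      by (rule upper_UNIV_add[OF _ upper_UNIV_add[OF Um_D(2)[OF xy(1)] Um_D(2)[OF xy(2)]]])
    then show "(1 / tseq K n) *\<^sub>R (opE (tseq K n) x y + (- x + - y)) \<in> upper UNIV"
      by (rule upper_scaleR) (use tq(1)[of n] in auto)
  qed
qed

text \<open>A net approximating g need not be positive. Moving up to h in \<open>Am\<close> with g
  \<le> h \<le> g + 2 \<eta>, \<open>dini\<close> finds a tail above - \<eta>, and
  \<open>Lam_compensates\<close> restores positivity by adding 2 \<eta> e. The total cost is 4
  \<eta>.\<close>

lemma lscM_pos_net:
  assumes g: "g \<in> lscM" "pos g" and \<eta>: "\<eta> > 0"
  obtains k D K where "directed D le" "D \<subseteq> range emb" "\<And>d. d \<in> D \<Longrightarrow> pos d" "\<And>d. d \<in> D \<Longrightarrow> norm d \<le> K"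
    "is_sup D k" "le g k" "le k (g + (4 * \<eta>) *\<^sub>R 1)"
proof -
  have "g + \<eta> *\<^sub>R 1 \<in> lscM" using \<eta> by (intro lscM_add lscM_one g) simp
  then obtain X where X: "\<And>n. X n \<in> Am" "X \<longlonglongrightarrow> g + \<eta> *\<^sub>R 1" by (rule lscM_seq) blast
  obtain n where n: "dist (X n) (g + \<eta> *\<^sub>R 1) < \<eta>"
    using tendstoD[OF X(2) \<eta>] by (auto simp: eventually_sequentially)
  define h where "h = X n"
  have h: "h \<in> Am" "sa (h - (g + \<eta> *\<^sub>R 1))" "norm (h - (g + \<eta> *\<^sub>R 1)) \<le> \<eta>"
    using X(1) n Am_sa[OF X(1)] pos_sa[OF g(2)] by (auto simp: h_def dist_norm intro!: sa_intros)
  have gh: "le g h" "le h (g + (2 * \<eta>) *\<^sub>R 1)"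
  proof -
    have "h - g = \<eta> *\<^sub>R 1 + (h - (g + \<eta> *\<^sub>R 1))" by simp
    then show "le g h" unfolding le_def using pos_norm_minus(2)[OF h(2,3)] by simp
    have "g + (2 * \<eta>) *\<^sub>R 1 - h = \<eta> *\<^sub>R 1 - (h - (g + \<eta> *\<^sub>R 1))" by (simp add: algebra_simps flip: scaleR_2)
    then show "le h (g + (2 * \<eta>) *\<^sub>R 1)" unfolding le_def using pos_norm_minus(1)[OF h(2,3)] by (simp only:)
  qed
  have ph: "pos h" using pos_add[OF g(2), of "h - g"] gh(1) by (simp add: le_def)
  obtain D K where D: "directed D le" "D \<subseteq> range emb" "\<And>d. d \<in> D \<Longrightarrow> sa d" "\<And>d. d \<in> D \<Longrightarrow> norm d \<le> K" "is_sup D h"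
    using h(1) by (rule Am_E) blast
  have "\<exists>d\<in>D. pos (d + \<eta> *\<^sub>R 1)"
  proof (rule dini[OF D(1,3,2)])
    fix \<phi> :: "'a cdual" assume \<phi>: "posf \<phi>"
    obtain d where "d \<in> D" "Re (evf \<phi> \<cdot> (h - d)) < \<eta>" using D(5) evf_NF[OF \<phi>] \<eta> unfolding is_sup_def by blast
    moreover have "Re (evf \<phi> \<cdot> h) \<ge> 0" by (rule posf_pos(1)[OF NF_posf[OF evf_NF[OF \<phi>]] ph])
    ultimately show "\<exists>d\<in>D. - \<eta> < Re (evf \<phi> \<cdot> d)" by (intro bexI[of _ d]) (auto simp: cdual_apply_diff)
  qed
  then obtain d0 where d0: "d0 \<in> D" "pos (d0 + \<eta> *\<^sub>R 1)" by blast
  obtain a where a: "d0 = emb a" using D(2) d0(1) by blast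
  obtain e where e: "e \<in> Lam" "pos (d0 + (2 * \<eta>) *\<^sub>R e)"
    using Lam_compensates[of a \<eta>] \<eta> d0(2) D(3)[OF d0(1)] unfolding a sa_emb by blast
  note Le = Lam_props[OF e(1)]
  let ?T = "{d \<in> D. le d0 d}" and ?E = "{(2 * \<eta>) *\<^sub>R e}"
  let ?F = "{d + c | d c. d \<in> ?T \<and> c \<in> ?E}"
  have E: "directed ?E le" "is_sup ?E ((2 * \<eta>) *\<^sub>R e)" by (auto intro: directedI simp: is_sup_def)
  show thesis
  proof (rule that[of ?F "K + norm ((2 * \<eta>) *\<^sub>R e)" "h + (2 * \<eta>) *\<^sub>R e"])
    show "directed ?F le" by (rule directed_sum[OF directed_tail[OF D(1) d0(1)] E(1)])
    show "is_sup ?F (h + (2 * \<eta>) *\<^sub>R e)" by (rule is_sup_sum[OF is_sup_tail[OF D(1,5) d0(1)] E(2)])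
    show "?F \<subseteq> range emb" using D(2) Le(5) by (auto intro!: range_emb_simps)
    show "norm d \<le> K + norm ((2 * \<eta>) *\<^sub>R e)" if "d \<in> ?F" for d
      using that D(4) norm_triangle_mono by blast
    show "pos d" if d: "d \<in> ?F" for d
    proof -
      obtain c where c: "d = c + (2 * \<eta>) *\<^sub>R e" "le d0 c" using d by blast
      then have "d = (c - d0) + (d0 + (2 * \<eta>) *\<^sub>R e)" by simp
      then show ?thesis using c(2) pos_add[OF _ e(2)] by (simp only: le_def)
    qed
    have "le (g + 0) (h + (2 * \<eta>) *\<^sub>R e)" using Le(2) \<eta> by (intro le_add gh) (simp add: le_def pos_scaleR)
    then show "le g (h + (2 * \<eta>) *\<^sub>R e)" by simp
    have "le (h + (2 * \<eta>) *\<^sub>R e) (g + (2 * \<eta>) *\<^sub>R 1 + (2 * \<eta>) *\<^sub>R 1)"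
      using \<eta> by (intro le_add gh le_scaleR Le) simp
    then show "le (h + (2 * \<eta>) *\<^sub>R e) (g + (4 * \<eta>) *\<^sub>R 1)" by (simp add: add.assoc flip: scaleR_add_left)
  qed
qed

text \<open>\<delta> times \<open>opE \<delta> a 0\<close> is 1 - (1 + \<delta> a)^-1, which lies
  between 0 and 1.\<close>

lemma opE_zero_le:
  assumes "pos a" "\<delta> \<ge> 0" shows "admis 1 \<delta> a 0" "pos (opE \<delta> a 0)" "le (opE \<delta> a 0) a" "\<delta> > 0 \<Longrightarrow> norm (opE \<delta> a 0) \<le> 1 / \<delta>"
proof -
  show ad: "admis 1 \<delta> a 0" using assms by (simp add: admis_def pos_scaleR)
  have sa: "sa a" "sa (0 :: 'a)" using assms(1) pos_sa by auto
  have z: "opZ a 0 = a" "adj a = a" using sa(1) by (simp_all add: opZ_def scaleC_simps sa_def)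
  have a0: "admis 1 \<delta> 0 (0 :: 'a)" by (simp add: admis_def)
  have "opE \<delta> 0 (0 :: 'a) = 0" by (simp add: opE_def opZ_def scaleC_simps)
  moreover have "le (opE \<delta> 0 0) (opE \<delta> a 0)"
    by (rule opE_mono[OF a0 _ _ ad sa]) (use assms in \<open>auto simp: le_def\<close>)
  ultimately show p: "pos (opE \<delta> a 0)" by (simp add: le_def)
  have "pos (\<delta> *\<^sub>R (adj a * opS \<delta> a 0 * a))" by (intro pos_scaleR pos_conj opS(3)[OF ad] assms)
  then show "le (opE \<delta> a 0) a" by (simp add: le_def opE_def z)
  have S: "(1 + \<delta> *\<^sub>R a) * opS \<delta> a 0 = 1" using opS(1)[OF ad] by simp
  then have S': "\<delta> *\<^sub>R (a * opS \<delta> a 0) = 1 - opS \<delta> a 0" by (simp add: algebra_simps)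
  have S2: "\<delta> *\<^sub>R (opS \<delta> a 0 * a) = 1 - opS \<delta> a 0" using opS(2)[OF ad] by (simp add: algebra_simps)
  have "\<delta> *\<^sub>R (\<delta> *\<^sub>R (a * opS \<delta> a 0 * a)) = \<delta> *\<^sub>R (\<delta> *\<^sub>R (a * opS \<delta> a 0)) * a" by simp
  also have "\<dots> = \<delta> *\<^sub>R a - \<delta> *\<^sub>R (opS \<delta> a 0 * a)" unfolding S' by (simp add: algebra_simps)
  also have "\<dots> = \<delta> *\<^sub>R a - (1 - opS \<delta> a 0)" unfolding S2 ..
  finally have eq: "\<delta> *\<^sub>R opE \<delta> a 0 = 1 - opS \<delta> a 0" by (simp add: opE_def z scaleR_diff_right)
  assume d: "\<delta> > 0"
  have "pos (1 - \<delta> *\<^sub>R opE \<delta> a 0)" unfolding eq using opS(3)[OF ad] by simp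
  moreover have "pos (\<delta> *\<^sub>R opE \<delta> a 0)" using p assms by (intro pos_scaleR)
  ultimately have "norm (\<delta> *\<^sub>R opE \<delta> a 0) \<le> norm (1 :: 'a)" by (rule norm_mono[rotated])
  then have "\<delta> * norm (opE \<delta> a 0) \<le> 1" using d norm_one_le[where 'a='a] by simp
  then show "norm (opE \<delta> a 0) \<le> 1 / \<delta>" using d by (simp add: field_simps)
qed

section \<open>Sums of countably many positive nets and monotone limits\<close>

fun psum :: "(nat \<Rightarrow> 'b::ucstar set) \<Rightarrow> nat \<Rightarrow> 'b set"
  where "psum D 0 = {0}" | "psum D (Suc m) = {d + e | d e. d \<in> psum D m \<and> e \<in> D m}"

lemma psum_directed:
  assumes "\<And>n. directed (D n) le" shows "directed (psum D m) le"
proof (induction m)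
  case 0 show ?case by (auto intro: directedI)
next
  case (Suc m) then show ?case using directed_sum[OF Suc assms] by simp
qed

lemma psum_props:
  assumes "\<And>n d. d \<in> D n \<Longrightarrow> pos d \<and> d \<in> range emb \<and> norm d \<le> K n" "d \<in> psum D m"
  shows "pos d \<and> d \<in> range emb \<and> norm d \<le> (\<Sum>i<m. K i)"
  using assms(2)
proof (induction m arbitrary: d)
  case 0 then show ?case using range_eqI[of 0 emb 0] by (simp add: emb_simps)
next
  case (Suc m)
  then obtain a b where ab: "d = a + b" "a \<in> psum D m" "b \<in> D m" by auto
  then show ?case using Suc.IH[OF ab(2)] assms(1)[OF ab(3)]
    by (auto intro: pos_add range_emb_simps norm_triangle_mono)
qed

text \<open>Positivity lets a finite sum be padded with further summands, which makes sums of
  different lengths comparable.\<close>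

lemma psum_lift:
  assumes D: "\<And>n. directed (D n) le" "\<And>n d. d \<in> D n \<Longrightarrow> pos d" and mn: "m \<le> n" and d: "d \<in> psum D m"
  shows "\<exists>e\<in>psum D n. le d e"
  using mn
proof (induction rule: dec_induct)
  case base then show ?case using d le_refl by blast
next
  case (step n)
  then obtain e where e: "e \<in> psum D n" "le d e" by blast
  obtain c where c: "c \<in> D n" using directed_ne[OF D(1)] by blast
  have "le (d + 0) (e + c)" using D(2)[OF c] by (intro le_add e) (simp add: le_def)
  then show ?case using e c by auto
qed

lemma psum_sup:
  assumes "\<And>n. is_sup (D n) (k n)" shows "is_sup (psum D m) (\<Sum>i<m. k i)"
proof (induction m)
  case 0 show ?case by (simp add: is_sup_def)
next
  case (Suc m) then show ?case using is_sup_sum[OF Suc assms] by simp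
qed

text \<open>The increments of \<open>f\<close> are dominated by suprema \<open>k n\<close> of nets of positive elements of the algebra.
  The partial sums of \<open>k\<close> may be unbounded, so they are cut off by \<open>a \<mapsto> opE \<delta> a 0 = a (1 + \<delta>a)\<^sup>-\<^sup>1\<close>,
  which costs at most \<open>\<delta> \<parallel>x\<parallel>\<^sup>2\<close> at \<open>x\<close>.\<close>

lemma upper_incseq0:
  fixes f :: "nat \<Rightarrow> 'a::cstar_algebra vN"
  assumes f: "\<And>n. f n \<in> Um" "\<And>n. le (f n) (f (Suc n))" "f 0 = 0" and l: "mono_seq f x"
  shows "x \<in> upper UNIV"
proof (rule upper_I)
  have saf: "sa (f n)" for n using real_spaceD(4)[OF real_space_Um] f(1) by blast
  then show sax: "sa x" using mono_seq_sa l by blast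
  note sf = mono_seq_is_sup[of f, OF f(2) saf l]
  fix \<phi> :: "'a cdual" and r :: real assume *: "is_state \<phi>" "r > 0"
  have \<phi>: "evf \<phi> \<in> NF" "posf (evf \<phi>)" "Re (evf \<phi> \<cdot> 1) = 1"
    using *(1) evf_NF[of \<phi>] NF_posf[of "evf \<phi>"] norm_posf[of \<phi>] by (auto simp: is_state_posf)
  \<comment> \<open>Each increment costs 5 \<eta> n, one from g and four from
    \<open>lscM_pos_net\<close>; the total is at most 10 r/32, below r/2.\<close>
  define \<eta> where "\<eta> n = r / 32 * (1/2) ^ n" for n :: nat
  have \<eta>: "\<eta> n > 0" for n using *(2) by (simp add: \<eta>_def)
  define u where "u n = f (Suc n) - f n" for n
  have u: "u n \<in> upper UNIV" "pos (u n)" for n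
    using real_spaceD(6)[OF real_space_Um f(1) f(1)] Um_D f(2) by (auto simp: u_def le_def)
  have "\<exists>D k K. directed D le \<and> (\<forall>d\<in>D. pos d \<and> d \<in> range emb \<and> norm d \<le> K) \<and> is_sup D k \<and> le (u n) k
      \<and> Re (evf \<phi> \<cdot> (k - u n)) \<le> 5 * \<eta> n" for n
  proof -
    obtain g where g: "g \<in> lscM" "le (u n) g" "Re (evf \<phi> \<cdot> (g - u n)) < \<eta> n"
      using upper_D[OF u(1) *(1) \<eta>] by blast
    have "pos g" using pos_add[OF u(2)[of n], of "g - u n"] g(2) by (simp add: le_def)
    then obtain k D K where k: "directed D le" "D \<subseteq> range emb" "\<And>d. d \<in> D \<Longrightarrow> pos d" "\<And>d. d \<in> D \<Longrightarrow> norm d \<le> K"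
      "is_sup D k" "le g k" "le k (g + (4 * \<eta> n) *\<^sub>R 1)" using lscM_pos_net[OF g(1) _ \<eta>] by metis
    have "Re (evf \<phi> \<cdot> k) \<le> Re (evf \<phi> \<cdot> (g + (4 * \<eta> n) *\<^sub>R 1))"
      using k(7) by (intro posf_mono[OF \<phi>(2)]) (simp add: le_def)
    then have "Re (evf \<phi> \<cdot> (k - u n)) \<le> 5 * \<eta> n"
      using g(3) \<phi>(3) by (simp add: cdual_apply_add cdual_apply_diff cdual_apply_scaleR)
    then show ?thesis using k le_trans[OF g(2) k(6)] by blast
  qed
  then obtain D k K where D: "\<And>n. directed (D n) le" "\<And>n d. d \<in> D n \<Longrightarrow> pos d \<and> d \<in> range emb \<and> norm d \<le> K n"
    "\<And>n. is_sup (D n) (k n)" "\<And>n. le (u n) (k n)" "\<And>n. Re (evf \<phi> \<cdot> (k n - u n)) \<le> 5 * \<eta> n"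
    by metis
  have pp: "pos d \<and> d \<in> range emb \<and> norm d \<le> (\<Sum>i<m. K i)" if "d \<in> psum D m" for d m
    using that by (rule psum_props[rotated]) (rule D(2))
  define s where "s m = (\<Sum>i<m. k i)" for m
  have fs: "le (f m) (s m)" for m
  proof (induction m)
    case (Suc m)
    have "le (f m + u m) (s m + k m)" by (rule le_add[OF Suc D(4)])
    then show ?case by (simp add: u_def s_def)
  qed (simp add: s_def f(3))
  have pf: "pos (f m)" for m using le_incseq[of f, OF f(2), of 0 m] f(3) by (simp add: le_def)
  then have ps: "pos (s m)" for m using fs[of m] pos_add[OF pf[of m], of "s m - f m"] by (simp add: le_def)
  have \<phi>s: "Re (evf \<phi> \<cdot> s m) \<le> Re (evf \<phi> \<cdot> f m) + r / 2" for m
  proof -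
    have "Re (evf \<phi> \<cdot> s m) \<le> Re (evf \<phi> \<cdot> f m) + (\<Sum>i<m. 5 * \<eta> i)"
    proof (induction m)
      case 0 show ?case by (simp add: s_def f(3))
    next
      case (Suc m)
      then show ?case using D(5)[of m] by (simp add: s_def u_def cdual_apply_add cdual_apply_diff)
    qed
    also have "(\<Sum>i<m. 5 * \<eta> i) = 5 * r / 32 * (\<Sum>i<m. (1/2) ^ i)"
      by (simp add: \<eta>_def sum_distrib_left mult.assoc)
    also have "(\<Sum>i<m. (1/2 :: real) ^ i) = 2 - 2 * (1/2) ^ m"
      by (induction m) auto
    also have "5 * r / 32 * (2 - 2 * (1/2) ^ m) \<le> 5 * r / 32 * 2" using *(2) by (intro mult_left_mono) auto
    also have "\<dots> \<le> r / 2" using *(2) by simp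
    finally show ?thesis by simp
  qed
  obtain B0 where B0: "\<And>n. norm (f n) \<le> B0" using l by (auto simp: mono_seq_def bounded_iff)
  define B where "B = max B0 (norm x)"
  have B: "norm (f n) \<le> B" "norm x \<le> B" "B \<ge> 0" for n
    using B0[of n] norm_ge_zero[of x] by (auto simp: B_def le_max_iff_disj)
  \<comment> \<open>The first entry keeps \<open>opE \<delta>\<close> admissible up to norm B, the
    second keeps the cost of the cut-off at x below r/4.\<close>
  define \<delta> where "\<delta> = min (1 / (4 * B + 1)) (r / (8 * B\<^sup>2 + 1))"
  have \<delta>: "\<delta> > 0" "\<bar>\<delta>\<bar> * (2 * B) \<le> 1 / 2" "2 * \<delta> * B\<^sup>2 \<le> r / 4"
  proof -
    have "8 * B\<^sup>2 + 1 > 0" using zero_le_power2[of B] by linarith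
    then show d: "\<delta> > 0" using B(3) *(2) by (auto simp: \<delta>_def)
    have "\<delta> * (2 * B) \<le> 1 / (4 * B + 1) * (2 * B)" using B(3) by (intro mult_right_mono) (auto simp: \<delta>_def)
    also have "\<dots> \<le> 1 / 2" using B(3) by (simp add: field_simps)
    finally show "\<bar>\<delta>\<bar> * (2 * B) \<le> 1 / 2" using d by simp
    have "\<delta> * (2 * B\<^sup>2) \<le> r / (8 * B\<^sup>2 + 1) * (2 * B\<^sup>2)" by (intro mult_right_mono) (auto simp: \<delta>_def)
    also have "\<dots> \<le> r / 4" using *(2) \<open>8 * B\<^sup>2 + 1 > 0\<close> by (simp add: field_simps)
    finally show "2 * \<delta> * B\<^sup>2 \<le> r / 4" by simp
  qed
  \<comment> \<open>Cut-off sums of all lengths form a single net in the algebra, bounded by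
    1/\<delta>. Its supremum w is the majorant sought, up to a small scalar.\<close>
  define \<E> where "\<E> = {opE \<delta> a 0 | a m. a \<in> psum D m}"
  have mono: "le (opE \<delta> a 0) (opE \<delta> b 0)" if "pos a" "pos b" "le a b" for a b :: "'a vN"
    using that \<delta>(1) opE_zero_le(1) pos_sa by (intro opE_mono[of 1 \<delta> a 0 1 b 0]) auto
  have dir: "directed \<E> le"
  proof (rule directedI)
    show "\<E> \<noteq> {}" unfolding \<E>_def using psum.simps(1)[of D] by blast
    fix v w assume "v \<in> \<E>" "w \<in> \<E>"
    then obtain a m b n where vw: "v = opE \<delta> a 0" "w = opE \<delta> b 0" "a \<in> psum D m" "b \<in> psum D n" unfolding \<E>_def by blast
    let ?p = "max m n"
    obtain a' b' where a': "a' \<in> psum D ?p" "le a a'" "b' \<in> psum D ?p" "le b b'"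
      using psum_lift[of D m ?p a] psum_lift[of D n ?p b] D(1,2) vw by (metis max.cobounded1 max.cobounded2)
    obtain c where c: "c \<in> psum D ?p" "le a' c" "le b' c"
      using directedD[OF psum_directed[of D, OF D(1)] a'(1,3)] by blast
    have "le v (opE \<delta> c 0)" "le w (opE \<delta> c 0)"
      unfolding vw(1,2) by (intro mono; use pp vw(3,4) c a' le_trans in blast)+
    then show "\<exists>z\<in>\<E>. le v z \<and> le w z" using c(1) unfolding \<E>_def by blast
  qed
  have \<E>: "d \<in> range emb \<and> pos d \<and> norm d \<le> 1 / \<delta> \<and> Re (evf \<phi> \<cdot> d) \<le> Re (evf \<phi> \<cdot> x) + r / 2" if d: "d \<in> \<E>" for d
  proof -
    obtain a m where a: "d = opE \<delta> a 0" "a \<in> psum D m" using d unfolding \<E>_def by blast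
    note pa = pp[OF a(2)]
    have o: "admis 1 \<delta> a 0" "pos d" "le d a" "norm d \<le> 1 / \<delta>"
      using opE_zero_le[of a \<delta>] pa \<delta>(1) unfolding a(1) by auto
    have 0: "(0 :: 'a vN) \<in> range emb" by (rule range_eqI[of _ _ 0]) (simp add: emb_simps)
    have "d \<in> range emb" unfolding a(1) using pa o(1) 0 by (intro opE_emb[of a 0 1 \<delta>]) auto
    have "le a (s m)" using psum_sup[of D k m] D(3) a(2) unfolding is_sup_def s_def by blast
    then have "Re (evf \<phi> \<cdot> d) \<le> Re (evf \<phi> \<cdot> s m)"
      using posf_mono[OF \<phi>(2)] le_trans[OF o(3)] unfolding le_def by blast
    moreover have "Re (evf \<phi> \<cdot> f m) \<le> Re (evf \<phi> \<cdot> x)"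
      using posf_mono[OF \<phi>(2)] sf unfolding is_sup_def le_def by blast
    ultimately show ?thesis using \<phi>s[of m] o \<open>d \<in> range emb\<close> by simp
  qed
  obtain w where w: "sa w" "is_sup \<E> w"
    using sup_exists[OF dir, of "1 / \<delta>"] \<E> pos_sa by (metis (no_types, lifting))
  have wA: "w \<in> Am" by (rule Am_I[OF dir _ _ w(2)]) (use \<E> pos_sa in blast)+
  have \<phi>w: "Re (evf \<phi> \<cdot> w) \<le> Re (evf \<phi> \<cdot> x) + r / 2"
  proof (rule field_le_epsilon)
    fix e :: real assume "e > 0"
    then obtain d where "d \<in> \<E>" "Re (evf \<phi> \<cdot> (w - d)) < e" using w(2) \<phi>(1) unfolding is_sup_def by blast
    then show "Re (evf \<phi> \<cdot> w) \<le> Re (evf \<phi> \<cdot> x) + r / 2 + e" using \<E>[of d] by (simp add: cdual_apply_diff)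
  qed
  \<comment> \<open>f m lies below s m, and the cut-off of s m is the supremum of the cut-offs of
    sums of length m, all of which belong to \<open>\<E>\<close>.\<close>
  have wf: "le (opE \<delta> (f m) 0) w" for m
  proof (rule le_trans[OF mono[OF pf ps fs]])
    define L where "L = max (\<Sum>i<m. K i) (norm (s m))"
    have L: "norm (s m) \<le> L" "L \<ge> 0" "\<And>d. d \<in> psum D m \<Longrightarrow> norm d \<le> L"
      using pp by (auto simp: L_def le_max_iff_disj)
    have d0: "directed {0 :: 'a vN} le" "is_sup {0 :: 'a vN} 0" by (auto intro: directedI simp: is_sup_def)
    have s1: "is_sup {opE \<delta> d e | d e. d \<in> psum D m \<and> e \<in> {0}} (opE \<delta> (s m) 0)"
      unfolding s_def
      by (rule is_sup_opE(2)[where c=1 and K=L, OF psum_directed[of D, OF D(1)] psum_sup[of D k, OF D(3)] _ d0])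
        (use pp L \<delta>(1) ps in \<open>auto simp: s_def intro!: opE_zero_le(1) pos_sa\<close>)
    have wle: "le d w" if "d \<in> \<E>" for d using w(2) that by (simp add: is_sup_def)
    have "le d w" if "d \<in> {opE \<delta> d e | d e. d \<in> psum D m \<and> e \<in> {0}}" for d
      by (rule wle) (use that in \<open>unfold \<E>_def, blast\<close>)
    moreover have "sa (opE \<delta> (s m) 0)" using \<delta>(1) by (intro pos_sa opE_zero_le(2) ps) simp
    ultimately show "le (opE \<delta> (s m) 0) w" by (intro is_sup_le[OF s1] w(1))
  qed
  have ox: "sa (opE \<delta> x 0)" "le x (opE \<delta> x 0 + (2 * \<delta> * B\<^sup>2) *\<^sub>R 1)"
  proof -
    have px: "pos x" using sf f(3) unfolding is_sup_def le_def by (metis diff_zero rangeI)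
    note ad = opE_zero_le(1)[OF px, of \<delta>]
    show sao: "sa (opE \<delta> x 0)" using \<delta>(1) opE_sa[OF ad sax] by simp
    have z: "opZ x 0 = x" "adj x = x" using sax by (simp_all add: opZ_def scaleC_simps sa_def)
    have "norm (x * opS \<delta> x 0) \<le> B * 1"
      using norm_mult_ineq[of x "opS \<delta> x 0"] opS(5)[OF ad] B \<delta>(1) mult_mono[of "norm x" B "norm (opS \<delta> x 0)" 1] by simp
    then have "norm (x * opS \<delta> x 0 * x) \<le> B * B"
      using norm_mult_ineq[of "x * opS \<delta> x 0" x] B mult_mono[of "norm (x * opS \<delta> x 0)" B "norm x" B] by simp
    then have "\<delta> * norm (x * opS \<delta> x 0 * x) \<le> \<delta> * (B * B)" using \<delta>(1) by (intro mult_left_mono) auto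
    also have "\<dots> \<le> 2 * \<delta> * B\<^sup>2" using \<delta>(1) by (simp add: power2_eq_square)
    finally have "norm (opE \<delta> x 0 - x) \<le> 2 * \<delta> * B\<^sup>2" using \<delta>(1) by (simp add: opE_def z)
    then have "pos ((2 * \<delta> * B\<^sup>2) *\<^sub>R 1 + (opE \<delta> x 0 - x))" using sao sax by (intro pos_norm_minus(2) sa_intros)
    then show "le x (opE \<delta> x 0 + (2 * \<delta> * B\<^sup>2) *\<^sub>R 1)" by (simp add: le_def algebra_simps)
  qed
  have sa0: "sa (opE \<delta> (f n) 0)" for n using opE_sa[OF opE_zero_le(1)[OF pf] saf] \<delta>(1) by simp
  have "mono_seq (\<lambda>n. opE \<delta> (f n) 0) (opE \<delta> x 0)"
    by (rule mono_seq_opE_inc[OF f(2) saf B(1,2) l le_refl _ _ _ mono_seq_const \<delta>(2)]) (use B in auto)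
  then have "is_sup (range (\<lambda>n. opE \<delta> (f n) 0)) (opE \<delta> x 0)"
    using mono f(2) pf by (intro mono_seq_is_sup sa0) auto
  then have "le (opE \<delta> x 0) w" by (rule is_sup_le) (use wf w ox in auto)
  then have "le (opE \<delta> x 0 + (2 * \<delta> * B\<^sup>2) *\<^sub>R 1) (w + (2 * \<delta> * B\<^sup>2) *\<^sub>R 1)" by (simp add: le_def)
  then have "le x (w + (2 * \<delta> * B\<^sup>2) *\<^sub>R 1)" using le_trans ox(2) by blast
  moreover have "w + (2 * \<delta> * B\<^sup>2) *\<^sub>R 1 \<in> lscM" using \<delta>(1) by (intro lscM_add lscM_one Am_lscM wA) simp
  moreover have "Re (evf \<phi> \<cdot> (w + (2 * \<delta> * B\<^sup>2) *\<^sub>R 1 - x)) < r"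
    using \<phi>w \<delta>(3) \<phi>(3) *(2) by (simp add: cdual_apply_add cdual_apply_diff cdual_apply_scaleR)
  ultimately show "\<exists>h\<in>lscM \<inter> UNIV. le x h \<and> Re (evf \<phi> \<cdot> (h - x)) < r" by blast
qed

text \<open>Approximating - x from above is the easy half: - x lies below every - f n, so a majorant
  of - f n for late n serves.\<close>

lemma Um_incseq:
  fixes f :: "nat \<Rightarrow> 'a::cstar_algebra vN"
  assumes f: "\<And>n. f n \<in> Um" "\<And>n. le (f n) (f (Suc n))" and l: "mono_seq f x"
  shows "x \<in> Um"
proof -
  note S = real_spaceD[OF real_space_Um]
  have saf: "sa (f n)" for n using S(4) f(1) by blast
  have sax: "sa x" using saf mono_seq_sa l by blast
  note sf = mono_seq_is_sup[of f, OF f(2) saf l]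
  have "- x \<in> upper UNIV"
  proof (rule upper_I)
    show "sa (- x)" using sax by (rule sa_intros)
    fix \<phi> :: "'a cdual" and r :: real assume *: "is_state \<phi>" "r > 0"
    obtain n where n: "Re (evf \<phi> \<cdot> (x - f n)) < r / 2"
      using sf *(2) evf_NF[of \<phi>] *(1) unfolding is_sup_def is_state_posf by (metis (no_types, lifting) half_gt_zero imageE)
    obtain h where h: "h \<in> lscM" "le (- f n) h" "Re (evf \<phi> \<cdot> (h - (- f n))) < r / 2"
      using upper_D[OF Um_D(2)[OF f(1)] *(1), of "r / 2"] *(2) by auto
    have "le (- x) (- f n)" using sf by (simp add: le_minus is_sup_def)
    then have "le (- x) h" using h(2) le_trans by blast
    moreover have "Re (evf \<phi> \<cdot> (h - (- x))) < r" using n h(3) by (simp add: cdual_apply_add cdual_apply_diff)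
    ultimately show "\<exists>h\<in>lscM \<inter> UNIV. le (- x) h \<and> Re (evf \<phi> \<cdot> (h - (- x))) < r" using h(1) by blast
  qed
  moreover have "x \<in> upper UNIV"
  proof -
    define c where "c = norm (f 0) *\<^sub>R (1 :: 'a vN)"
    have c: "c \<in> Um" unfolding c_def using S(3) one_UbM UbM_Um by blast
    \<comment> \<open>Adding c makes the first term positive, and prepending 0, a shift of the index
      by one, gives the start required by \<open>upper_incseq0\<close>.\<close>
    define g where "g = case_nat 0 (\<lambda>n. f n + c)"
    have "pos (f 0 + c)" using pos_norm_minus(2)[OF saf[of 0] order_refl] by (simp add: c_def add.commute)
    then have inc: "le (g n) (g (Suc n))" for n using f(2) by (cases n) (auto simp: g_def le_def)
    have m: "mono_seq (\<lambda>n. f n + c) (x + c)" by (rule mono_seq_add[OF l])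
    have gS: "(\<lambda>n. evf \<phi> \<cdot> g (Suc n)) \<longlonglongrightarrow> evf \<phi> \<cdot> (x + c)" for \<phi>
      using m by (simp add: mono_seq_def g_def)
    have "range g = insert 0 (range (\<lambda>n. f n + c))"
      by (auto simp: g_def image_iff split: nat.split nat.splits intro: exI[of _ "Suc _"])
    then have "bounded (range g)" using m by (simp add: mono_seq_def)
    then have "mono_seq g (x + c)"
      unfolding mono_seq_def using inc LIMSEQ_imp_Suc[OF gS] by blast
    moreover have "g n \<in> Um" for n using S(1) S(2)[OF f(1) c] by (cases n) (auto simp: g_def)
    ultimately have "x + c \<in> upper UNIV" using inc by (intro upper_incseq0[of g]) (auto simp: g_def)
    then have "x + c + - c \<in> upper UNIV" by (rule upper_UNIV_add[OF _ Um_D(2)[OF c]])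
    then show ?thesis by simp
  qed
  ultimately show ?thesis by (simp add: Um_def)
qed

lemma mclosed_Um: "mclosed Um"
  unfolding mclosed_def
proof (intro allI impI)
  fix f :: "nat \<Rightarrow> 'a vN" and x assume f: "\<forall>n. f n \<in> Um" "mono_seq f x"
  note S = real_spaceD[OF real_space_Um]
  consider "\<And>n. le (f n) (f (Suc n))" | "\<And>n. le (f (Suc n)) (f n)" using f(2) unfolding mono_seq_def by blast
  then show "x \<in> Um"
  proof cases
    case 1 then show ?thesis using f Um_incseq by blast
  next
    case 2
    have m: "mono_seq (\<lambda>n. - f n) (- x)" using mono_seq_scaleR[OF f(2), of "-1"] by simp
    have n: "- f n \<in> Um" for n using f(1) by (intro S(5)) blast
    have "le (- f n) (- f (Suc n))" for n using 2 by (simp only: le_minus)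
    from Um_incseq[of "\<lambda>n. - f n", OF n this m] have "- x \<in> Um" .
    from S(5)[OF this] show ?thesis by simp
  qed
qed

lemma U0M_Um: "U0M \<subseteq> Um"
  using real_spaceD(4)[OF real_space_Um] by (intro U0M_least UbM_Um mclosed_Um) blast

section \<open>The bimodule property\<close>

lemma bimodule_upper:
  assumes z: "z \<in> complexify U0M" and u: "u \<in> Um"
  shows "- (z * u + u * adj z) \<in> upper UNIV"
proof -
  obtain x y where xy: "z = opZ x y" "x \<in> U0M" "y \<in> U0M" using z by (auto simp: complexify_def opZ_def)
  have Uxy: "x \<in> Um" "y \<in> Um" using xy U0M_Um by auto
  note S = real_spaceD[OF real_space_Um]
  have au: "adj u = u" using S(4)[OF u] by (simp add: sa_def)
  have zz: "z * adj z \<in> Um" using cstar_real_U0M xy U0M_Um by (auto simp: cstar_real_def)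
  define t where "t = tseq 0"
  have t: "t n > 0" "t \<longlonglongrightarrow> 0" for n using tseq(1,2)[of 0] by (auto simp: t_def)
  have *: "- (z * u + u * adj z) + - (t n *\<^sub>R (u * u)) \<in> upper UNIV" for n
  proof -
    \<comment> \<open>A self-adjoint u perturbs the real part alone, so the new pair stays in
      \<open>Um\<close>.\<close>
    have o: "opZ (x + t n *\<^sub>R u) y = z + t n *\<^sub>R u" by (simp add: opZ_def xy(1))
    have "- ((z + t n *\<^sub>R u) * adj (z + t n *\<^sub>R u)) \<in> upper UNIV"
      using minus_zz_upper[of "x + t n *\<^sub>R u" y] Uxy S u unfolding o by blast
    then have "- ((z + t n *\<^sub>R u) * adj (z + t n *\<^sub>R u)) + z * adj z \<in> upper UNIV"
      by (rule upper_UNIV_add[OF _ Um_D(1)[OF zz]])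
    then have "(1 / t n) *\<^sub>R (- ((z + t n *\<^sub>R u) * adj (z + t n *\<^sub>R u)) + z * adj z) \<in> upper UNIV"
      by (rule upper_scaleR) (use t(1)[of n] in auto)
    moreover have "- ((z + t n *\<^sub>R u) * adj (z + t n *\<^sub>R u)) + z * adj z = t n *\<^sub>R (- (z * u + u * adj z) + - (t n *\<^sub>R (u * u)))"
      by (simp add: adj_simps au algebra_simps)
    ultimately show ?thesis using t(1)[of n] by simp
  qed
  have "(\<lambda>n. - (z * u + u * adj z) + - (t n *\<^sub>R (u * u))) \<longlonglongrightarrow> - (z * u + u * adj z) + - (0 *\<^sub>R (u * u))"
    by (intro tendsto_intros t(2))
  then show ?thesis using upper_lim[OF *] by simp
qed

lemma bimodule_herm:
  assumes z: "z \<in> complexify U0M" and u: "u \<in> Um"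
  shows "z * u + u * adj z \<in> Um"
proof -
  have "- z \<in> complexify U0M" using complexify_space(3)[OF real_space_U0M z, of "-1"] by (simp add: scaleC_simps)
  from bimodule_upper[OF this u] have "z * u + u * adj z \<in> upper UNIV" by (simp add: adj_simps add.commute)
  with bimodule_upper[OF assms] show ?thesis by (simp add: Um_def)
qed

text \<open>Twice z u is (z u + u adj z) + i (w u + u adj w) with w = - i z; both brackets are
  covered by \<open>bimodule_herm\<close>.\<close>

lemma bimodule_left:
  assumes z: "z \<in> complexify U0M" and u: "u \<in> complexify Um"
  shows "z * u \<in> complexify Um"
proof -
  note S = real_spaceD[OF real_space_Um]
  have 1: "z * u \<in> complexify Um" if u: "u \<in> Um" for u
  proof -
    have iz: "(- \<i>) *\<^sub>C z \<in> complexify U0M" by (rule complexify_space(3)[OF real_space_U0M z])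
    have "opZ ((1/2) *\<^sub>R (z * u + u * adj z)) ((1/2) *\<^sub>R ((- \<i>) *\<^sub>C z * u + u * adj ((- \<i>) *\<^sub>C z))) \<in> complexify Um"
      by (intro opZ_complexify S(3) bimodule_herm z u iz)
    moreover have "opZ ((1/2) *\<^sub>R (z * u + u * adj z)) ((1/2) *\<^sub>R ((- \<i>) *\<^sub>C z * u + u * adj ((- \<i>) *\<^sub>C z)))
      = (1/2) *\<^sub>R (z * u + z * u)"
      by (simp add: opZ_def adj_simps scaleC_simps scaleC_scaleR scaleC_add_right ii_mult algebra_simps)
    ultimately show ?thesis by (simp flip: scaleR_2)
  qed
  obtain a b where u: "u = opZ a b" "a \<in> Um" "b \<in> Um" using u by (auto simp: complexify_def opZ_def)
  have "z * u = z * a + \<i> *\<^sub>C (z * b)" by (simp add: u(1) opZ_def distrib_left mult_scaleC_right)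
  also have "\<dots> \<in> complexify Um" by (intro complexify_space(2,3)[OF real_space_Um] 1 u)
  finally show ?thesis .
qed

lemma bimodule_right:
  assumes z: "z \<in> complexify U0M" and u: "u \<in> complexify Um"
  shows "u * z \<in> complexify Um"
proof -
  have "adj z * adj u \<in> complexify Um"
    by (intro bimodule_left complexify_space(4) real_space_U0M real_space_Um assms)
  then have "adj (adj z * adj u) \<in> complexify Um" by (rule complexify_space(4)[OF real_space_Um])
  then show ?thesis by (simp add: adj_mult adj_adj)
qed

section \<open>Transfer to the bidual\<close>

lemma rep_simps:
  "rep (x + y) = rep x + rep y" "rep (x - y) = rep x - rep y" "rep (- x) = - rep x"
  "rep (r *\<^sub>R x) = r *\<^sub>R rep x" "rep (c *\<^sub>C x) = c *\<^sub>C rep x" "rep (0 :: 'a::cstar_algebra vN) = 0"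
  "rep (x * y) = rep x \<odot> rep y" "rep (adj x) = bidual_adj (rep x)" "norm (rep x) = norm x"
  for x y :: "'a::cstar_algebra vN"
  by (rule plus_vN.rep_eq minus_vN.rep_eq uminus_vN.rep_eq scaleR_vN.rep_eq scaleC_vN.rep_eq zero_vN.rep_eq
      times_vN.rep_eq adj_vN.rep_eq norm_vN.rep_eq[symmetric])+

lemma rep_surj: obtains y where "x = rep y"
  using Abs_vN_inverse[of x] by (metis UNIV_I)

lemma rep_le: "rep x \<preceq> rep y \<longleftrightarrow> le x y"
proof -
  have "rep x \<preceq> rep y \<longleftrightarrow> (\<exists>w. rep y - rep x = bidual_adj (rep w) \<odot> rep w)"
    unfolding bidual_le_def by (metis rep_surj)
  also have "\<dots> \<longleftrightarrow> le x y" by (simp add: le_def pos_iff rep_inject flip: rep_simps)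
  finally show ?thesis .
qed

lemma rep_sa: "bidual_adj (rep x) = rep x \<longleftrightarrow> sa x"
  by (simp add: sa_def rep_inject flip: rep_simps)

lemma rep_tendsto: "(\<lambda>n. rep (X n)) \<longlonglongrightarrow> rep x \<longleftrightarrow> X \<longlonglongrightarrow> x"
  by (simp add: LIMSEQ_def dist_norm rep_simps(9) flip: rep_simps(2))

lemma rep_closure: "rep ` closure S = closure (rep ` S)"
proof
  show "rep ` closure S \<subseteq> closure (rep ` S)"
  proof clarify
    fix x assume "x \<in> closure S"
    then obtain X where "\<And>n. X n \<in> S" "X \<longlonglongrightarrow> x" unfolding closure_sequential by blast
    then show "rep x \<in> closure (rep ` S)"
      unfolding closure_sequential by (intro exI[of _ "\<lambda>n. rep (X n)"]) (auto simp: rep_tendsto)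
  qed
  show "closure (rep ` S) \<subseteq> rep ` closure S"
  proof
    fix y assume "y \<in> closure (rep ` S)"
    then obtain Y where Y: "\<And>n. Y n \<in> rep ` S" "Y \<longlonglongrightarrow> y" unfolding closure_sequential by blast
    then have "\<forall>n. \<exists>x. Y n = rep x \<and> x \<in> S" by blast
    then obtain X where X: "\<And>n. Y n = rep (X n)" "\<And>n. X n \<in> S" by metis
    obtain x where y: "y = rep x" by (rule rep_surj)
    have "Y = (\<lambda>n. rep (X n))" by (rule ext) (rule X(1))
    then have "X \<longlonglongrightarrow> x" using Y(2) by (simp add: y rep_tendsto)
    then have "x \<in> closure S" unfolding closure_sequential using X(2) by blast
    then show "y \<in> rep ` closure S" by (simp add: y)
  qed
qed

lemma rep_span: "rep ` span S = span (rep ` S)"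
  by (rule linear_span_image[symmetric]) (simp add: linear_iff rep_simps)

lemma rep_complexify: "rep ` complexify W = complexify (rep ` W)"
  by (auto simp: complexify_def image_iff rep_simps) (metis rep_simps(1,5))+

lemma rep_range_emb: "rep d \<in> range embed \<longleftrightarrow> d \<in> range emb"
  by (simp add: image_iff rep_inject flip: emb.rep_eq)

text \<open>A directed set is a net indexed by itself. Conversely, an increasing net and the
  supremum of its range have the same limit, compared at an index beyond both tails.\<close>

lemma rep_Am: "increasing_net_limits (self_adjoint_part (range embed)) = rep ` (Am :: 'a::cstar_algebra vN set)"
proof (intro equalityI subsetI)
  fix y :: "'a bidual" assume "y \<in> rep ` Am"
  then obtain h where h: "y = rep h" "h \<in> Am" by blast
  obtain D K where D: "directed D le" "D \<subseteq> range emb" "\<And>d. d \<in> D \<Longrightarrow> sa d" "\<And>d. d \<in> D \<Longrightarrow> norm d \<le> K" "is_sup D h"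
    using h(2) by (rule Am_E) blast
  show "y \<in> increasing_net_limits (self_adjoint_part (range embed))"
    unfolding increasing_net_limits_def mem_Collect_eq
  proof (rule exI[of _ "rep ` D"], rule exI[of _ "(\<preceq>)"], rule exI[of _ "\<lambda>x. x"], intro conjI)
    show "rep ` D \<noteq> {}" using directed_ne[OF D(1)] by blast
    show "\<forall>i\<in>rep ` D. \<forall>j\<in>rep ` D. \<exists>k\<in>rep ` D. i \<preceq> k \<and> j \<preceq> k"
      using directedD[OF D(1)] by (simp add: rep_le)
    show "\<forall>i\<in>rep ` D. i \<in> self_adjoint_part (range embed)"
      using D(2,3) by (auto simp: self_adjoint_part_def rep_sa rep_range_emb)
    show "bounded ((\<lambda>x. x) ` rep ` D)" using D(4) by (auto simp: bounded_iff rep_simps(9))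
    show "\<forall>\<phi>. \<forall>\<epsilon>>0. \<exists>i\<in>rep ` D. \<forall>j\<in>rep ` D. i \<preceq> j \<longrightarrow> cmod (j \<cdot> \<phi> - y \<cdot> \<phi>) < \<epsilon>"
    proof (intro allI impI)
      fix \<phi> :: "'a cdual" and \<epsilon> :: real assume "\<epsilon> > 0"
      then obtain d where "d \<in> D" "\<forall>d'\<in>D. le d d' \<longrightarrow> cmod (evf \<phi> \<cdot> (d' - h)) < \<epsilon>"
        using is_sup_tendsto[OF D(1,5,4)] by blast
      then show "\<exists>i\<in>rep ` D. \<forall>j\<in>rep ` D. i \<preceq> j \<longrightarrow> cmod (j \<cdot> \<phi> - y \<cdot> \<phi>) < \<epsilon>"
        by (auto simp: rep_le h(1) evf.rep_eq rep_simps(2) cdual_diff_apply)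
    qed
  qed (auto simp: rep_le intro: le_trans)
next
  fix y :: "'a bidual" assume "y \<in> increasing_net_limits (self_adjoint_part (range embed))"
  then obtain I :: "'a bidual set" and ord and f :: "'a bidual \<Rightarrow> 'a bidual" where *: "I \<noteq> {}"
    "\<forall>i\<in>I. ord i i" "\<forall>i\<in>I. \<forall>j\<in>I. \<forall>k\<in>I. ord i j \<longrightarrow> ord j k \<longrightarrow> ord i k"
    "\<forall>i\<in>I. \<forall>j\<in>I. \<exists>k\<in>I. ord i k \<and> ord j k" "\<forall>i\<in>I. f i \<in> self_adjoint_part (range embed)"
    "bounded (f ` I)" "\<forall>i\<in>I. \<forall>j\<in>I. ord i j \<longrightarrow> f i \<preceq> f j"
    "\<forall>\<phi>. \<forall>\<epsilon>>0. \<exists>i\<in>I. \<forall>j\<in>I. ord i j \<longrightarrow> cmod (f j \<cdot> \<phi> - y \<cdot> \<phi>) < \<epsilon>"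
    unfolding increasing_net_limits_def mem_Collect_eq by (elim exE conjE) (rule that; assumption)
  obtain h where y: "y = rep h" by (rule rep_surj)
  define g where "g i = Abs_vN (f i)" for i
  have g: "f i = rep (g i)" for i by (simp add: g_def Abs_vN_inverse)
  let ?D = "g ` I"
  have D1: "directed ?D le"
  proof (rule directedI)
    fix u v assume "u \<in> ?D" "v \<in> ?D"
    then obtain i j where ij: "u = g i" "v = g j" "i \<in> I" "j \<in> I" by blast
    then obtain k where "k \<in> I" "ord i k" "ord j k" using *(4) by blast
    then show "\<exists>z\<in>?D. le u z \<and> le v z" using *(7) ij by (auto simp: g rep_le)
  qed (use *(1) in blast)
  have D2: "sa d" "d \<in> range emb" if d: "d \<in> ?D" for d
  proof -
    obtain i where i: "i \<in> I" "d = g i" using d by blast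
    have "f i \<in> self_adjoint_part (range embed)" using *(5) i(1) by blast
    then show "sa d" "d \<in> range emb" unfolding self_adjoint_part_def g i(2) by (simp_all add: rep_sa rep_range_emb)
  qed
  obtain K where "\<forall>x\<in>f ` I. norm x \<le> K" using *(6) by (auto simp: bounded_iff)
  then have D3: "norm d \<le> K" if "d \<in> ?D" for d using that by (auto simp: g rep_simps(9))
  obtain h' where h': "is_sup ?D h'" using sup_exists[OF D1 D2(1) D3] by blast
  have "h = h'"
  proof (rule vN_eqI)
    fix \<phi> :: "'a cdual"
    have "cmod (evf \<phi> \<cdot> h - evf \<phi> \<cdot> h') \<le> 0"
    proof (rule field_le_epsilon)
      fix e :: real assume e: "e > 0"
      obtain i where i: "i \<in> I" "\<forall>j\<in>I. ord i j \<longrightarrow> cmod (f j \<cdot> \<phi> - y \<cdot> \<phi>) < e / 2" using *(8) e half_gt_zero by blast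
      obtain d where d: "d \<in> ?D" "\<forall>d'\<in>?D. le d d' \<longrightarrow> cmod (evf \<phi> \<cdot> (d' - h')) < e / 2"
        using is_sup_tendsto[OF D1 h' D3, of "e / 2" \<phi>] e by auto
      obtain j where j: "d = g j" "j \<in> I" using d(1) by blast
      obtain k where k: "k \<in> I" "ord i k" "ord j k" using *(4) i(1) j(2) by blast
      have "le d (g k)" using *(7) k j by (auto simp: g rep_le)
      then have "cmod (evf \<phi> \<cdot> g k - evf \<phi> \<cdot> h') < e / 2" using d(2) k(1) by (simp add: cdual_apply_diff)
      moreover have "cmod (evf \<phi> \<cdot> g k - evf \<phi> \<cdot> h) < e / 2" using i(2) k by (simp add: g y evf.rep_eq)
      ultimately show "cmod (evf \<phi> \<cdot> h - evf \<phi> \<cdot> h') \<le> 0 + e"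
        using norm_triangle_ineq4[of "evf \<phi> \<cdot> g k - evf \<phi> \<cdot> h'" "evf \<phi> \<cdot> g k - evf \<phi> \<cdot> h"] by simp
    qed
    then show "evf \<phi> \<cdot> h = evf \<phi> \<cdot> h'" by simp
  qed
  then have "h \<in> Am" using D1 D2 h' by (intro Am_I[of ?D]) auto
  then show "y \<in> rep ` Am" by (simp add: y)
qed

lemma rep_lscM: "A_sa_m_closure = rep ` lscM"
  unfolding A_sa_m_closure_def lscM_def rep_closure rep_Am ..

lemma rep_strongly_lsc: "strongly_lsc (rep h) \<longleftrightarrow> h \<in> lscM"
  unfolding strongly_lsc_def rep_lscM by (auto simp: rep_sa rep_inject intro: lscM_sa)

lemma rep_SbarM: "S_bar = rep ` SbarM"
  unfolding S_bar_def SbarM_def rep_closure rep_span rep_lscM ..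

text \<open>A bracket k \<le> x \<le> h is a majorant h of x together with a majorant - k of - x.
  Both errors are nonnegative, so their sum can be made small exactly when each can.\<close>

lemma upper_both_iff:
  assumes "sa x"
  shows "(\<forall>\<epsilon>>0. \<forall>\<phi>. is_state \<phi> \<longrightarrow> (\<exists>h k. strongly_lsc h \<and> strongly_usc k \<and> k \<preceq> rep x \<and> rep x \<preceq> h \<and>
      Re ((h - k) \<cdot> \<phi>) < \<epsilon> \<and> h \<in> rep ` B \<and> - k \<in> rep ` B))
    \<longleftrightarrow> x \<in> upper B \<and> - x \<in> upper B" (is "?L \<longleftrightarrow> ?R")
proof
  assume L: ?L
  have *: "\<exists>h k. h \<in> lscM \<and> k \<in> lscM \<and> h \<in> B \<and> k \<in> B \<and> le x h \<and> le (- x) k \<and> Re (evf \<phi> \<cdot> (h - x)) < e \<and> Re (evf \<phi> \<cdot> (k - (- x))) < e"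
    if st: "is_state \<phi>" and e: "e > 0" for \<phi> and e :: real
  proof -
    obtain h k where hk: "strongly_lsc h" "strongly_usc k" "k \<preceq> rep x" "rep x \<preceq> h" "Re ((h - k) \<cdot> \<phi>) < e"
      "h \<in> rep ` B" "- k \<in> rep ` B" using L st e by meson
    obtain h' k' where *: "h = rep h'" "- k = rep k'" "h' \<in> B" "k' \<in> B" using hk(6,7) by blast
    have k: "k = rep (- k')" by (simp add: rep_simps(3) flip: *(2))
    have l: "le (- k') x" "le x h'" using hk(3,4) unfolding k *(1) rep_le .
    have l2: "le (- x) k'" using l(1) le_minus[of x "- k'"] by simp
    have p: "Re (evf \<phi> \<cdot> (h' - x)) \<ge> 0" "Re (evf \<phi> \<cdot> (k' - (- x))) \<ge> 0"
      using posf_pos(1)[OF NF_posf[OF evf_NF]] st l(2) l2 unfolding is_state_posf le_def by blast+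
    have "Re (evf \<phi> \<cdot> (h' + k')) < e" using hk(5) by (simp add: evf.rep_eq k *(1) flip: rep_simps)
    then have "Re (evf \<phi> \<cdot> (h' - x)) < e" "Re (evf \<phi> \<cdot> (k' - (- x))) < e"
      using p by (auto simp: cdual_apply_add cdual_apply_diff)
    moreover have "h' \<in> lscM" "k' \<in> lscM" using hk(1,2) *(1,2) by (auto simp: strongly_usc_def rep_strongly_lsc)
    ultimately show ?thesis using l l2 * by blast
  qed
  show ?R
  proof
    show "x \<in> upper B" by (rule upper_I[OF assms]) (use * in blast)
    have "sa (- x)" using assms by (rule sa_intros)
    then show "- x \<in> upper B" by (rule upper_I) (use * in blast)
  qed
next
  assume R: ?R
  show ?L
  proof (intro allI impI)
    fix \<epsilon> :: real and \<phi> :: "'a cdual" assume e: "\<epsilon> > 0" and st: "is_state \<phi>"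
    obtain h where h: "h \<in> lscM \<inter> B" "le x h" "Re (evf \<phi> \<cdot> (h - x)) < \<epsilon> / 2" using upper_D[OF conjunct1[OF R] st, of "\<epsilon> / 2"] e by auto
    obtain k where k: "k \<in> lscM \<inter> B" "le (- x) k" "Re (evf \<phi> \<cdot> (k - (- x))) < \<epsilon> / 2" using upper_D[OF conjunct2[OF R] st, of "\<epsilon> / 2"] e by auto
    have "le (- k) x" using k(2) le_minus[of k "- x"] by simp
    moreover have "Re (evf \<phi> \<cdot> (h + k)) < \<epsilon>" using h(3) k(3) by (simp add: cdual_apply_add cdual_apply_diff)
    then have "Re ((rep h - rep (- k)) \<cdot> \<phi>) < \<epsilon>" by (simp add: evf.rep_eq flip: rep_simps)
    moreover have "strongly_lsc (rep h)" "strongly_usc (rep (- k))" "- rep (- k) \<in> rep ` B" "rep h \<in> rep ` B"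
      using h(1) k(1) by (auto simp: strongly_usc_def rep_strongly_lsc simp flip: rep_simps)
    ultimately show "\<exists>h k. strongly_lsc h \<and> strongly_usc k \<and> k \<preceq> rep x \<and> rep x \<preceq> h \<and>
      Re ((h - k) \<cdot> \<phi>) < \<epsilon> \<and> h \<in> rep ` B \<and> - k \<in> rep ` B"
      using h(2) by (intro exI[of _ "rep h"] exI[of _ "rep (- k)"]) (simp add: rep_le)
  qed
qed

lemma rep_UNIV: "rep ` UNIV = UNIV"
  using rep_surj by (metis rangeI surj_def)

lemma rep_cball: "x \<in> rep ` cball 0 \<gamma> \<longleftrightarrow> norm x \<le> \<gamma>"
proof -
  obtain y where "x = rep y" by (rule rep_surj)
  then show ?thesis by (auto simp: image_iff rep_inject rep_simps)
qed

lemma rep_image_eqI: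
  fixes S :: "'a::cstar_algebra bidual set"
  assumes "\<And>x. rep x \<in> S \<longleftrightarrow> x \<in> T" shows "S = rep ` T"
proof (intro equalityI subsetI)
  fix y assume "y \<in> S"
  moreover obtain x where "y = rep x" by (rule rep_surj)
  ultimately show "y \<in> rep ` T" using assms by blast
qed (use assms in blast)

lemma rep_Um: "U_meas = rep ` Um"
proof (rule rep_image_eqI)
  fix x :: "'a vN"
  show "rep x \<in> U_meas \<longleftrightarrow> x \<in> Um"
    using upper_both_iff[of x UNIV] upper_sa[of x UNIV]
    by (auto simp: U_meas_def Um_def rep_sa rep_UNIV)
qed

lemma rep_UbM: "U_b = rep ` UbM"
proof (rule rep_image_eqI)
  fix x :: "'a vN"
  have "rep x \<in> U_b \<longleftrightarrow> x \<in> Um \<and> (\<exists>\<gamma>. x \<in> upper (cball 0 \<gamma>) \<and> - x \<in> upper (cball 0 \<gamma>))"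
    using upper_both_iff[of x "cball 0 _"] real_spaceD(4)[OF real_space_Um, of x]
    by (auto simp: U_b_def rep_Um rep_inject rep_cball)
  then show "rep x \<in> U_b \<longleftrightarrow> x \<in> UbM" using UbM_Um unfolding UbM_def by blast
qed

lemma mclosed_vimage:
  assumes "monotone_seq_closed S" shows "mclosed (rep -` S)"
  unfolding mclosed_def
proof (intro allI impI)
  fix f :: "nat \<Rightarrow> 'a vN" and x assume f: "\<forall>n. f n \<in> rep -` S" "mono_seq f x"
  have "bounded (range (\<lambda>n. rep (f n)))" using f(2) by (auto simp: mono_seq_def bounded_iff rep_simps)
  then have "rep x \<in> S"
    using assms[unfolded monotone_seq_closed_def, rule_format, of "\<lambda>n. rep (f n)" "rep x"] f
    by (simp add: mono_seq_def rep_le evf.rep_eq)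
  then show "x \<in> rep -` S" by simp
qed

lemma monotone_seq_closed_image:
  assumes "mclosed S" shows "monotone_seq_closed (rep ` S)"
  unfolding monotone_seq_closed_def
proof (intro allI impI, elim conjE)
  fix f :: "nat \<Rightarrow> 'a bidual" and x
  assume f: "\<forall>n. f n \<in> rep ` S" "bounded (range f)" "(\<forall>n. f n \<preceq> f (Suc n)) \<or> (\<forall>n. f (Suc n) \<preceq> f n)"
    "\<forall>\<phi>. (\<lambda>n. f n \<cdot> \<phi>) \<longlonglongrightarrow> x \<cdot> \<phi>"
  have "\<forall>n. \<exists>y. f n = rep y \<and> y \<in> S" using f(1) by blast
  then obtain g where g: "\<And>n. f n = rep (g n)" "\<And>n. g n \<in> S" by metis
  obtain y where y: "x = rep y" by (rule rep_surj)
  have "mono_seq g y"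
    using f(2-4) by (auto simp: mono_seq_def bounded_iff rep_simps g(1) y rep_le evf.rep_eq)
  then show "x \<in> rep ` S" using assms g(2) unfolding mclosed_def y by blast
qed

lemma mclosed_U0M: "mclosed U0M"
  unfolding mclosed_def using U0M_mono_seq by blast

lemma rep_U0M: "U_0 = rep ` (U0M :: 'a::cstar_algebra vN set)"
proof
  have "U_b \<subseteq> rep ` U0M" using UbM_U0M by (auto simp: rep_UbM)
  moreover have "rep ` U0M \<subseteq> self_adjoint_part UNIV" using U0M_sa by (auto simp: self_adjoint_part_def rep_sa)
  ultimately show "U_0 \<subseteq> rep ` U0M" unfolding U_0_def using monotone_seq_closed_image[OF mclosed_U0M] by blast
  have "rep ` U0M \<subseteq> S"
    if S: "U_b \<subseteq> S" "S \<subseteq> self_adjoint_part UNIV" "monotone_seq_closed S" for S :: "'a bidual set"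
  proof -
    have "U0M \<subseteq> rep -` S"
    proof (rule U0M_least)
      show "UbM \<subseteq> rep -` S" using S(1) by (auto simp: rep_UbM)
      show "rep -` S \<subseteq> {x. sa x}" using S(2) by (auto simp: self_adjoint_part_def simp flip: rep_sa)
      show "mclosed (rep -` S)" by (rule mclosed_vimage[OF S(3)])
    qed
    then show ?thesis by blast
  qed
  then show "rep ` U0M \<subseteq> (U_0 :: 'a bidual set)" unfolding U_0_def by (intro Inter_greatest) auto
qed

lemma complex_subspace_rep:
  assumes "real_space W" shows "complex_subspace (complexify (rep ` W))"
proof -
  note S = complexify_space[OF assms]
  show ?thesis
    unfolding complex_subspace_def rep_complexify[symmetric]
  proof (intro conjI ballI allI)
    show "0 \<in> rep ` complexify W" using S(1) by (metis imageI rep_simps(6))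
    show "x + y \<in> rep ` complexify W" if "x \<in> rep ` complexify W" "y \<in> rep ` complexify W" for x y
      using that S(2) by (auto simp flip: rep_simps)
    show "c *\<^sub>C x \<in> rep ` complexify W" if "x \<in> rep ` complexify W" for c x
      using that S(3) by (auto simp flip: rep_simps)
  qed
qed

lemma cstar_subalgebra_rep:
  assumes W: "cstar_real W" shows "cstar_subalgebra (complexify (rep ` W))"
proof -
  have R: "real_space W" "closed W" using W by (auto simp: cstar_real_def)
  have "closure (complexify W) = complexify W" using closed_complexify[OF R] by (rule closure_closed)
  then have "closed (complexify (rep ` W))" by (metis closed_closure rep_closure rep_complexify)
  moreover have "x \<odot> y \<in> complexify (rep ` W)" if "x \<in> complexify (rep ` W)" "y \<in> complexify (rep ` W)" for x y
    using that cstar_real_mult[OF W] unfolding rep_complexify[symmetric] by (auto simp flip: rep_simps)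
  moreover have "bidual_adj x \<in> complexify (rep ` W)" if "x \<in> complexify (rep ` W)" for x
    using that complexify_space(4)[OF R(1)] unfolding rep_complexify[symmetric] by (auto simp flip: rep_simps)
  ultimately show ?thesis
    unfolding cstar_subalgebra_def using complex_subspace_rep[OF R(1)] bidual_adj_mult bidual_cstar_identity by blast
qed

theorem theorem4:
  shows "cstar_subalgebra (complexify (S_bar :: 'a::cstar_algebra bidual set)) \<and>
    cstar_subalgebra (complexify (U_b_bar :: 'a bidual set)) \<and>
    cstar_subalgebra (complexify (U_0 :: 'a bidual set)) \<and>
    bimodule_over (complexify (U_0 :: 'a bidual set)) (complexify U_meas)"
proof (intro conjI)
  show "cstar_subalgebra (complexify (S_bar :: 'a bidual set))"
    unfolding rep_SbarM by (rule cstar_subalgebra_rep[OF cstar_real_SbarM])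
  show "cstar_subalgebra (complexify (U_b_bar :: 'a bidual set))"
    unfolding U_b_bar_def rep_UbM rep_closure[symmetric] by (rule cstar_subalgebra_rep[OF cstar_real_UbM])
  show "cstar_subalgebra (complexify (U_0 :: 'a bidual set))"
    unfolding rep_U0M by (rule cstar_subalgebra_rep[OF cstar_real_U0M])
  show "bimodule_over (complexify (U_0 :: 'a bidual set)) (complexify U_meas)"
    unfolding bimodule_over_def rep_U0M rep_Um
  proof (intro conjI complex_subspace_rep real_space_Um ballI)
    fix x u :: "'a bidual" assume "x \<in> complexify (rep ` U0M)" "u \<in> complexify (rep ` Um)"
    then obtain z v where *: "x = rep z" "z \<in> complexify U0M" "u = rep v" "v \<in> complexify Um"
      unfolding rep_complexify[symmetric] by blast
    show "x \<odot> u \<in> complexify (rep ` Um)" "u \<odot> x \<in> complexify (rep ` Um)"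
      unfolding rep_complexify[symmetric] *(1,3) rep_simps(7)[symmetric]
      by (intro imageI bimodule_left bimodule_right *)+
  qed
qed

end
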